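(* Let $0<q<1$ and let $N\in\frac12\mathbb Z$. Let $\mathcal A(S^2_q)$ be the algebra of the standard Podleś sphere, represented on $\mathcal H_{N,1}$ (the completion of $\mathcal V_N\oplus\mathcal V_{N+1}$) by $\pi=\pi_N\oplus\pi_{N+1}$, and let $\gamma$ be the grading equal to $+1$ on the first and $-1$ on the second summand. Write $|l,m,+\rangle$ for the basis vectors of $\mathcal V_N$ and $|l,m,-\rangle$ for those of $\mathcal V_{N+1}$. Then the densely defined operator $$D_N|l,m,\pm\rangle=\sqrt{[l-N]}\sqrt{[l+N+1]}\;|l,m,\mp\rangle$$ (the coefficient vanishes whenever the vector on the right does not exist) anticommutes with $\gamma$, has bounded commutators with $\pi(a)$ for every $a\in\mathcal A(S^2_q)$, and satisfies exactly the order-one condition (in the sense of real extensions, as defined in the context). The eigenvalues of $D_N$ are $$\lambda=\pm\sqrt{[l-N][l+N+1]},\qquad l=N,N+1,\dots\ \text{ if } N\ge 0,\qquad l=|N|-1,|N|,\dots\ \text{ if } N<0,$$ each with multiplicity $2l+1$ (the eigenvalue $0$, for which the two signs coincide, has multiplicity $2l+1$ in total; multiplicity $0$ means that the value does not occur).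
   Context: Notation: $[x]=\frac{q^x-q^{-x}}{q-q^{-1}}$. $\mathcal A(S^2_q)$ is the $*$-algebra generated by $B,B^*,A=A^*$ with relations $AB=q^2BA$, $AB^*=q^{-2}B^*A$, $BB^*=q^{-2}A(1-A)$, $B^*B=A(1-q^2A)$. For $N\in\frac12\mathbb Z$, $\mathcal V_N=\bigoplus_{l=|N|,|N|+1,\dots}V_l$, where $V_l$ has orthonormal basis $|l,m\rangle$, $m=-l,-l+1,\dots,l$. The $*$-representation $\pi_N$ of $\mathcal A(S^2_q)$ on (the completion of) $\mathcal V_N$ is $$\begin{aligned}\pi_N(B)|l,m\rangle=&\ q^m\sqrt{[l+m+1][l+m+2]}\,r^+(l)|l+1,m+1\rangle+q^m\sqrt{[l+m+1][l-m]}\,r^0(l)|l,m+1\rangle\\&+q^m\sqrt{[l-m][l-m-1]}\,r^-(l)|l-1,m+1\rangle,\\ \pi_N(B^* )|l,m\rangle=&\ q^{m-1}\sqrt{[l-m+2][l-m+1]}\,r^-(l+1)|l+1,m-1\rangle+q^{m-1}\sqrt{[l+m][l-m+1]}\,r^0(l)|l,m-1\rangle\\&+q^{m-1}\sqrt{[l+m][l+m-1]}\,r^+(l-1)|l-1,m-1\rangle,\\ \pi_N(A)|l,m\rangle=&-q^{m+l+\frac12}\sqrt{[l-m+1][l+m+1]}\,r^+(l)|l+1,m\rangle\\&+\tfrac{q^{-1/2}}{1+q^2}\Big(\big([l-m+1][l+m]-q^2[l-m][l+m+1]\big)r^0(l)+q^{\frac12}\Big)|l,m\rangle\\&+q^{m-l-\frac12}\sqrt{[l-m][l+m]}\,r^-(l)|l-1,m\rangle,\end{aligned}$$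 with $$r^0(l)=q^{-\frac12}\frac{(q-q^{-1})[l+|N|+1][l-|N|]\pm q^{\pm1}[2|N|]}{[2l][2l+2]},\quad r^+(l)=\frac{q^{-l-\frac32-N}}{[2l+2]}\frac{\sqrt{[l+N+1][l-N+1]}}{\sqrt{[2l+1][2l+3]}},\quad r^-(l)=-q^{2l}r^+(l-1),$$ where $\pm$ is the sign of $N$ (for $N=0$ that term is zero), and terms containing $r^0(0)$ are taken to be $0$. Commutators with $D_N$ are understood on the algebraic span of the basis vectors. Real extensions and the order-one condition. A real spectral triple is a spectral triple $(\mathcal A,\mathcal H,D)$ (with grading $\gamma$ in the even case) with an antiunitary $J$ on $\mathcal H$ such that $J^2=\pm1$, $JD=DJ$, $J\gamma=\pm\gamma J$, and $[J\pi(a)J^{-1},\pi(b)]=0$ for all $a,b\in\mathcal A$; its Dirac operator satisfies the order-one condition if $[J\pi(a)J^{-1},[D,\pi(b)]]=0$ for all $a,b\in\mathcal A$. A spectral triple $(\mathcal A,\mathcal H,D)$ extends to a real spectral triple if there are a spectral triple $(\mathcal A,\mathcal H',D')$ and an antiunitary $J$ on $\mathcal H\oplus\mathcal H'$ such that $(\mathcal A,\mathcal H\oplus\mathcal H',D\oplus D',J)$ is a real spectral triple. A Dirac operator $D$ (of a spectral triple not necessarily real) satisfies the order-one condition if there is such a real extension whose Dirac operator $D\oplus D'$ satisfies the order-one condition. *)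

theory Defs
  imports
    "HOL-Analysis.Analysis"
    "HOL-Algebra.QuotRing"
    "HOL-Algebra.Module"
    "HOL-Library.Poly_Mapping"
begin

section \<open>Star-algebras and Hilbert spaces\<close>

definition complex_ring :: "complex ring" where
  "complex_ring = \<lparr>carrier = UNIV, monoid.mult = (*), one = 1, zero = 0, add = (+)\<rparr>"

record 'a star_alg = "(complex, 'a) module" +
  star :: "'a \<Rightarrow> 'a"

locale star_algebra =
  Ring.ring A + Module.module complex_ring A for A :: "('a, 'z) star_alg_scheme" (structure) +
  assumes smult_mult_left:
      "\<lbrakk>a \<in> carrier A; b \<in> carrier A\<rbrakk> \<Longrightarrow> (c \<odot> a) \<otimes> b = c \<odot> (a \<otimes> b)"
    and smult_mult_right:
      "\<lbrakk>a \<in> carrier A; b \<in> carrier A\<rbrakk> \<Longrightarrow> a \<otimes> (c \<odot> b) = c \<odot> (a \<otimes> b)"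
    and star_closed: "a \<in> carrier A \<Longrightarrow> star A a \<in> carrier A"
    and star_star: "a \<in> carrier A \<Longrightarrow> star A (star A a) = a"
    and star_add:
      "\<lbrakk>a \<in> carrier A; b \<in> carrier A\<rbrakk> \<Longrightarrow> star A (a \<oplus> b) = star A a \<oplus> star A b"
    and star_smult: "a \<in> carrier A \<Longrightarrow> star A (c \<odot> a) = cnj c \<odot> star A a"
    and star_mult:
      "\<lbrakk>a \<in> carrier A; b \<in> carrier A\<rbrakk> \<Longrightarrow> star A (a \<otimes> b) = star A b \<otimes> star A a"

text \<open>
  As for the modules of HOL-Algebra, the inherited fields \<open>mult\<close> and \<open>one\<close> play no role for a
  Hilbert space. The inner product \<open>ip\<close> is linear in its second argument.
\<close>

record 'v hilb = "(complex, 'v) module" +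
  ip :: "'v \<Rightarrow> 'v \<Rightarrow> complex"

definition hnorm :: "('v, 'z) hilb_scheme \<Rightarrow> 'v \<Rightarrow> real" where
  "hnorm H x = sqrt (Re (ip H x x))"

definition hlim :: "('v, 'z) hilb_scheme \<Rightarrow> (nat \<Rightarrow> 'v) \<Rightarrow> 'v \<Rightarrow> bool" where
  "hlim H X x \<longleftrightarrow> (\<lambda>n. hnorm H (X n \<ominus>\<^bsub>H\<^esub> x)) \<longlonglongrightarrow> 0"

locale hilbert_space = Module.module complex_ring H for H :: "('v, 'z) hilb_scheme" (structure) +
  assumes ip_add_right:
      "\<lbrakk>x \<in> carrier H; y \<in> carrier H; z \<in> carrier H\<rbrakk> \<Longrightarrow> ip H x (y \<oplus> z) = ip H x y + ip H x z"
    and ip_smult_right: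
      "\<lbrakk>x \<in> carrier H; y \<in> carrier H\<rbrakk> \<Longrightarrow> ip H x (c \<odot> y) = c * ip H x y"
    and ip_cnj: "\<lbrakk>x \<in> carrier H; y \<in> carrier H\<rbrakk> \<Longrightarrow> ip H x y = cnj (ip H y x)"
    and ip_nonneg: "x \<in> carrier H \<Longrightarrow> 0 \<le> Re (ip H x x)"
    and ip_definite: "\<lbrakk>x \<in> carrier H; ip H x x = 0\<rbrakk> \<Longrightarrow> x = \<zero>"
    and complete:
      "\<lbrakk>\<forall>n. X n \<in> carrier H;
        \<forall>e>0. \<exists>M. \<forall>m\<ge>M. \<forall>n\<ge>M. hnorm H (X m \<ominus> X n) < e\<rbrakk>
       \<Longrightarrow> \<exists>x\<in>carrier H. hlim H X x"

definition ell2 :: "'i set \<Rightarrow> ('i \<Rightarrow> complex) hilb" where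
  "ell2 I = \<lparr>
     carrier = {f. (\<forall>i. i \<notin> I \<longrightarrow> f i = 0) \<and> (\<lambda>i. (cmod (f i))\<^sup>2) summable_on I},
     monoid.mult = undefined, one = undefined,
     zero = (\<lambda>i. 0), add = (\<lambda>f g i. f i + g i),
     smult = (\<lambda>c f i. c * f i),
     ip = (\<lambda>f g. \<Sum>\<^sub>\<infinity>i\<in>I. cnj (f i) * g i)\<rparr>"

definition hsum :: "'v hilb \<Rightarrow> 'w hilb \<Rightarrow> ('v \<times> 'w) hilb" where
  "hsum H K = \<lparr>
     carrier = carrier H \<times> carrier K,
     monoid.mult = undefined, one = undefined,
     zero = (\<zero>\<^bsub>H\<^esub>, \<zero>\<^bsub>K\<^esub>),
     add = (\<lambda>(x, y) (x', y'). (x \<oplus>\<^bsub>H\<^esub> x', y \<oplus>\<^bsub>K\<^esub> y')),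
     smult = (\<lambda>c (x, y). (c \<odot>\<^bsub>H\<^esub> x, c \<odot>\<^bsub>K\<^esub> y)),
     ip = (\<lambda>(x, y) (x', y'). ip H x x' + ip K y y')\<rparr>"

section \<open>Operators\<close>

text \<open>
  An everywhere defined operator is a function, whose values off the carrier are irrelevant.
  A possibly unbounded operator is given by its graph, a set of pairs; its domain is then the
  \<^const>\<open>Domain\<close> of that set.
\<close>

definition bounded_op :: "'v hilb \<Rightarrow> ('v \<Rightarrow> 'v) \<Rightarrow> bool" where
  "bounded_op H T \<longleftrightarrow>
     T \<in> carrier H \<rightarrow> carrier H \<and>
     (\<forall>x\<in>carrier H. \<forall>y\<in>carrier H. T (x \<oplus>\<^bsub>H\<^esub> y) = T x \<oplus>\<^bsub>H\<^esub> T y) \<and>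
     (\<forall>c. \<forall>x\<in>carrier H. T (c \<odot>\<^bsub>H\<^esub> x) = c \<odot>\<^bsub>H\<^esub> T x) \<and>
     (\<exists>C. \<forall>x\<in>carrier H. hnorm H (T x) \<le> C * hnorm H x)"

definition star_rep :: "'a star_alg \<Rightarrow> 'v hilb \<Rightarrow> ('a \<Rightarrow> 'v \<Rightarrow> 'v) \<Rightarrow> bool" where
  "star_rep A H \<pi> \<longleftrightarrow>
     (\<forall>a\<in>carrier A. bounded_op H (\<pi> a)) \<and>
     (\<forall>a\<in>carrier A. \<forall>b\<in>carrier A. \<forall>x\<in>carrier H. \<pi> (a \<oplus>\<^bsub>A\<^esub> b) x = \<pi> a x \<oplus>\<^bsub>H\<^esub> \<pi> b x) \<and>
     (\<forall>c. \<forall>a\<in>carrier A. \<forall>x\<in>carrier H. \<pi> (c \<odot>\<^bsub>A\<^esub> a) x = c \<odot>\<^bsub>H\<^esub> \<pi> a x) \<and>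
     (\<forall>a\<in>carrier A. \<forall>b\<in>carrier A. \<forall>x\<in>carrier H. \<pi> (a \<otimes>\<^bsub>A\<^esub> b) x = \<pi> a (\<pi> b x)) \<and>
     (\<forall>x\<in>carrier H. \<pi> \<one>\<^bsub>A\<^esub> x = x) \<and>
     (\<forall>a\<in>carrier A. \<forall>x\<in>carrier H. \<forall>y\<in>carrier H. ip H (\<pi> (star A a) x) y = ip H x (\<pi> a y))"

definition densely_defined :: "'v hilb \<Rightarrow> 'v rel \<Rightarrow> bool" where
  "densely_defined H D \<longleftrightarrow>
     (\<forall>x\<in>carrier H. \<forall>e>0. \<exists>y\<in>Domain D. hnorm H (x \<ominus>\<^bsub>H\<^esub> y) < e)"

definition op_closure :: "'v hilb \<Rightarrow> 'v rel \<Rightarrow> 'v rel" where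
  "op_closure H D =
     {(x, y). x \<in> carrier H \<and> y \<in> carrier H \<and>
        (\<exists>X Y. (\<forall>n. (X n, Y n) \<in> D) \<and> hlim H X x \<and> hlim H Y y)}"

definition op_adjoint :: "'v hilb \<Rightarrow> 'v rel \<Rightarrow> 'v rel" where
  "op_adjoint H D =
     {(y, z). y \<in> carrier H \<and> z \<in> carrier H \<and> (\<forall>(x, w)\<in>D. ip H w y = ip H x z)}"

definition self_adjoint :: "'v hilb \<Rightarrow> 'v rel \<Rightarrow> bool" where
  "self_adjoint H D \<longleftrightarrow> densely_defined H D \<and> op_adjoint H D = D"

text \<open>
  For some complex number \<open>z\<close>, the operator \<open>D - z\<close> maps the domain of \<open>D\<close> bijectively onto
  \<open>H\<close>, and its inverse is compact (which entails that it is bounded).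
\<close>

definition compact_resolvent :: "'v hilb \<Rightarrow> 'v rel \<Rightarrow> bool" where
  "compact_resolvent H D \<longleftrightarrow>
     (\<exists>z::complex.
        (\<forall>w\<in>carrier H. \<exists>!x. (x, w \<oplus>\<^bsub>H\<^esub> z \<odot>\<^bsub>H\<^esub> x) \<in> D) \<and>
        (\<forall>X Y. (\<forall>n. (X n, Y n) \<in> D) \<and> (\<exists>C. \<forall>n. hnorm H (Y n \<ominus>\<^bsub>H\<^esub> z \<odot>\<^bsub>H\<^esub> X n) \<le> C) \<longrightarrow>
           (\<exists>r x. strict_mono (r :: nat \<Rightarrow> nat) \<and> x \<in> carrier H \<and> hlim H (X \<circ> r) x)))"

definition bounded_commutator :: "'v hilb \<Rightarrow> 'v rel \<Rightarrow> ('v \<Rightarrow> 'v) \<Rightarrow> bool" where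
  "bounded_commutator H D T \<longleftrightarrow>
     (\<exists>C. \<forall>(x, y)\<in>D. \<exists>z. (T x, z) \<in> D \<and> hnorm H (z \<ominus>\<^bsub>H\<^esub> T y) \<le> C * hnorm H x)"

text \<open>\<open>K\<close> is the bounded operator on all of \<open>H\<close> that extends the commutator \<open>[D, T]\<close>.\<close>

definition is_commutator :: "'v hilb \<Rightarrow> 'v rel \<Rightarrow> ('v \<Rightarrow> 'v) \<Rightarrow> ('v \<Rightarrow> 'v) \<Rightarrow> bool" where
  "is_commutator H D T K \<longleftrightarrow>
     bounded_op H K \<and> (\<forall>(x, y)\<in>D. \<exists>z. (T x, z) \<in> D \<and> K x = z \<ominus>\<^bsub>H\<^esub> T y)"

definition anticommutes :: "'v hilb \<Rightarrow> 'v rel \<Rightarrow> ('v \<Rightarrow> 'v) \<Rightarrow> bool" where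
  "anticommutes H D \<gamma> \<longleftrightarrow> (\<forall>(x, y)\<in>D. (\<gamma> x, \<ominus>\<^bsub>H\<^esub> \<gamma> y) \<in> D)"

definition eigenspace :: "'v hilb \<Rightarrow> 'v rel \<Rightarrow> complex \<Rightarrow> 'v set" where
  "eigenspace H D \<mu> = {x \<in> carrier H. (x, \<mu> \<odot>\<^bsub>H\<^esub> x) \<in> D}"

definition eigenvalues :: "'v hilb \<Rightarrow> 'v rel \<Rightarrow> complex set" where
  "eigenvalues H D = {\<mu>. \<exists>x\<in>eigenspace H D \<mu>. x \<noteq> \<zero>\<^bsub>H\<^esub>}"

definition has_dim :: "'v hilb \<Rightarrow> 'v set \<Rightarrow> nat \<Rightarrow> bool" where
  "has_dim H S n \<longleftrightarrow>
     (\<exists>b. (\<forall>i<n. b i \<in> carrier H) \<and>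
          (\<forall>c. (\<Oplus>\<^bsub>H\<^esub>i\<in>{..<n}. c i \<odot>\<^bsub>H\<^esub> b i) \<in> S) \<and>
          (\<forall>x\<in>S. \<exists>!c. c \<in> {..<n} \<rightarrow>\<^sub>E UNIV \<and> x = (\<Oplus>\<^bsub>H\<^esub>i\<in>{..<n}. c i \<odot>\<^bsub>H\<^esub> b i)))"

definition op_sum :: "'v rel \<Rightarrow> 'w rel \<Rightarrow> ('v \<times> 'w) rel" where
  "op_sum D E = {((x, x'), (y, y')) | x x' y y'. (x, y) \<in> D \<and> (x', y') \<in> E}"

definition rep_sum :: "('a \<Rightarrow> 'v \<Rightarrow> 'v) \<Rightarrow> ('a \<Rightarrow> 'w \<Rightarrow> 'w) \<Rightarrow> 'a \<Rightarrow> 'v \<times> 'w \<Rightarrow> 'v \<times> 'w" where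
  "rep_sum \<pi> \<rho> a = map_prod (\<pi> a) (\<rho> a)"

section \<open>Spectral triples\<close>

definition spectral_triple ::
    "'a star_alg \<Rightarrow> 'v hilb \<Rightarrow> ('a \<Rightarrow> 'v \<Rightarrow> 'v) \<Rightarrow> 'v rel \<Rightarrow> bool" where
  "spectral_triple A H \<pi> D \<longleftrightarrow>
     star_algebra A \<and> hilbert_space H \<and> star_rep A H \<pi> \<and>
     self_adjoint H D \<and> compact_resolvent H D \<and>
     (\<forall>a\<in>carrier A. bounded_commutator H D (\<pi> a))"

definition even_spectral_triple ::
    "'a star_alg \<Rightarrow> 'v hilb \<Rightarrow> ('a \<Rightarrow> 'v \<Rightarrow> 'v) \<Rightarrow> 'v rel \<Rightarrow> ('v \<Rightarrow> 'v) \<Rightarrow> bool" where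
  "even_spectral_triple A H \<pi> D \<gamma> \<longleftrightarrow>
     spectral_triple A H \<pi> D \<and>
     bounded_op H \<gamma> \<and>
     (\<forall>x\<in>carrier H. \<gamma> (\<gamma> x) = x) \<and>
     (\<forall>x\<in>carrier H. \<forall>y\<in>carrier H. ip H (\<gamma> x) y = ip H x (\<gamma> y)) \<and>
     (\<forall>a\<in>carrier A. \<forall>x\<in>carrier H. \<gamma> (\<pi> a x) = \<pi> a (\<gamma> x)) \<and>
     anticommutes H D \<gamma>"

definition antiunitary :: "'v hilb \<Rightarrow> ('v \<Rightarrow> 'v) \<Rightarrow> bool" where
  "antiunitary H J \<longleftrightarrow>
     bij_betw J (carrier H) (carrier H) \<and>
     (\<forall>x\<in>carrier H. \<forall>y\<in>carrier H. J (x \<oplus>\<^bsub>H\<^esub> y) = J x \<oplus>\<^bsub>H\<^esub> J y) \<and>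
     (\<forall>c. \<forall>x\<in>carrier H. J (c \<odot>\<^bsub>H\<^esub> x) = cnj c \<odot>\<^bsub>H\<^esub> J x) \<and>
     (\<forall>x\<in>carrier H. \<forall>y\<in>carrier H. ip H (J x) (J y) = ip H y x)"

definition conj_by :: "'v hilb \<Rightarrow> ('v \<Rightarrow> 'v) \<Rightarrow> ('v \<Rightarrow> 'v) \<Rightarrow> 'v \<Rightarrow> 'v" where
  "conj_by H J T = J \<circ> T \<circ> inv_into (carrier H) J"

definition even_real_spectral_triple ::
    "'a star_alg \<Rightarrow> 'v hilb \<Rightarrow> ('a \<Rightarrow> 'v \<Rightarrow> 'v) \<Rightarrow> 'v rel \<Rightarrow> ('v \<Rightarrow> 'v) \<Rightarrow> ('v \<Rightarrow> 'v) \<Rightarrow> bool" where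
  "even_real_spectral_triple A H \<pi> D \<gamma> J \<longleftrightarrow>
     even_spectral_triple A H \<pi> D \<gamma> \<and>
     antiunitary H J \<and>
     (\<exists>\<epsilon>\<in>{1, -1}. \<forall>x\<in>carrier H. J (J x) = \<epsilon> \<odot>\<^bsub>H\<^esub> x) \<and>
     map_prod J J ` D = D \<and>
     (\<exists>\<epsilon>\<in>{1, -1}. \<forall>x\<in>carrier H. J (\<gamma> x) = \<epsilon> \<odot>\<^bsub>H\<^esub> \<gamma> (J x)) \<and>
     (\<forall>a\<in>carrier A. \<forall>b\<in>carrier A. \<forall>x\<in>carrier H.
        conj_by H J (\<pi> a) (\<pi> b x) = \<pi> b (conj_by H J (\<pi> a) x))"

definition order_one_real ::
    "'a star_alg \<Rightarrow> 'v hilb \<Rightarrow> ('a \<Rightarrow> 'v \<Rightarrow> 'v) \<Rightarrow> 'v rel \<Rightarrow> ('v \<Rightarrow> 'v) \<Rightarrow> bool" where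
  "order_one_real A H \<pi> D J \<longleftrightarrow>
     (\<forall>a\<in>carrier A. \<forall>b\<in>carrier A. \<exists>K. is_commutator H D (\<pi> b) K \<and>
        (\<forall>x\<in>carrier H. conj_by H J (\<pi> a) (K x) = K (conj_by H J (\<pi> a) x)))"

text \<open>
  The order-one condition for a not necessarily real even spectral triple, by way of a real
  extension. The additional Hilbert space \<open>H'\<close> has to be taken with carrier in some type, here
  the type of \<open>H\<close>. This is no restriction when that type has the cardinality of the continuum,
  since the Hilbert space of a spectral triple is separable (compact resolvent), so that it is
  isomorphic to one with carrier in that type.
\<close>

definition satisfies_order_one ::
    "'a star_alg \<Rightarrow> 'v hilb \<Rightarrow> ('a \<Rightarrow> 'v \<Rightarrow> 'v) \<Rightarrow> 'v rel \<Rightarrow> ('v \<Rightarrow> 'v) \<Rightarrow> bool" where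
  "satisfies_order_one A H \<pi> D \<gamma> \<longleftrightarrow>
     even_spectral_triple A H \<pi> D \<gamma> \<and>
     (\<exists>(H' :: 'v hilb) \<pi>' D' \<gamma>' J.
        even_spectral_triple A H' \<pi>' D' \<gamma>' \<and>
        even_real_spectral_triple A (hsum H H') (rep_sum \<pi> \<pi>') (op_sum D D') (map_prod \<gamma> \<gamma>') J \<and>
        order_one_real A (hsum H H') (rep_sum \<pi> \<pi>') (op_sum D D') J)"

section \<open>The algebra of the standard Podles sphere\<close>

text \<open>
  The free unital algebra on \<open>A\<close>, \<open>B\<close>, \<open>B\<^sup>*\<close> consists of the finitely supported functions on the
  words in these letters, and multiplication is convolution (the ring structure of
  \<^type>\<open>poly_mapping\<close>).
\<close>

datatype gen = GA | GB | GBstar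

datatype word = Word (letters: "gen list")

instantiation word :: monoid_add
begin

definition zero_word :: word where
  "zero_word = Word []"

definition plus_word :: "word \<Rightarrow> word \<Rightarrow> word" where
  "plus_word v w = Word (letters v @ letters w)"

instance
  by standard (simp_all add: zero_word_def plus_word_def)

end

type_synonym free_alg = "word \<Rightarrow>\<^sub>0 complex"

definition gelt :: "gen \<Rightarrow> free_alg" where
  "gelt g = Poly_Mapping.single (Word [g]) 1"

definition scal :: "complex \<Rightarrow> free_alg" where
  "scal c = Poly_Mapping.single 0 c"

fun gen_star :: "gen \<Rightarrow> gen" where
  "gen_star GA = GA"
| "gen_star GB = GBstar"
| "gen_star GBstar = GB"

definition free_star :: "free_alg \<Rightarrow> free_alg" where
  "free_star x = (\<Sum>w\<in>Poly_Mapping.keys x.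
     Poly_Mapping.single (Word (rev (map gen_star (letters w)))) (cnj (Poly_Mapping.lookup x w)))"

definition free_ring :: "free_alg ring" where
  "free_ring = \<lparr>carrier = UNIV, monoid.mult = (*), one = 1, zero = 0, add = (+)\<rparr>"

text \<open>Each element \<open>x - y\<close> of the following set stands for the defining relation \<open>x = y\<close>.\<close>

definition podles_relations :: "real \<Rightarrow> free_alg set" where
  "podles_relations q =
     (let A = gelt GA; B = gelt GB; Bs = gelt GBstar;
          s = scal (complex_of_real (q\<^sup>2)); t = scal (complex_of_real (1 / q\<^sup>2))
      in {A * B - s * (B * A),
          A * Bs - t * (Bs * A),
          B * Bs - t * (A * (1 - A)),
          Bs * B - A * (1 - s * A)})"

definition podles_ideal :: "real \<Rightarrow> free_alg set" where
  "podles_ideal q = genideal free_ring (podles_relations q)"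

text \<open>
  The elements of the algebra are cosets. The ideal is invariant under \<^const>\<open>free_star\<close>, so the
  image of a coset is a coset. Scalar multiplication by \<open>c\<close> is multiplication by the coset of the
  constant \<open>c\<close>.
\<close>

definition podles :: "real \<Rightarrow> free_alg set star_alg" where
  "podles q =
     (let I = podles_ideal q; Q = FactRing free_ring I
      in \<lparr>carrier = carrier Q, monoid.mult = mult Q, one = one Q, zero = zero Q, add = add Q,
          smult = (\<lambda>c X. mult Q (a_r_coset free_ring I (scal c)) X),
          star = (\<lambda>X. free_star ` X)\<rparr>)"

section \<open>The representations\<close>

definition qnum :: "real \<Rightarrow> real \<Rightarrow> real" where
  "qnum q x = (q powr x - q powr (-x)) / (q - 1 / q)"

text \<open>The index \<open>(l, m)\<close> stands for the basis vector \<open>|l, m\<rangle>\<close>.\<close>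

definition idx :: "real \<Rightarrow> (real \<times> real) set" where
  "idx N = {(l, m). (\<exists>k::nat. l = \<bar>N\<bar> + real k) \<and> (\<exists>j::nat. m = -l + real j) \<and> m \<le> l}"

type_synonym vec = "real \<times> real \<Rightarrow> complex"

text \<open>A vector is zero by convention if it does not belong to the basis.\<close>

definition ket :: "real \<Rightarrow> real \<times> real \<Rightarrow> vec" where
  "ket N j = (\<lambda>i. if i = j \<and> j \<in> idx N then 1 else 0)"

text \<open>The completion of \<open>\<V>\<^sub>N\<close> is the space of square-summable functions on the orthonormal basis.\<close>

definition hspace :: "real \<Rightarrow> vec hilb" where
  "hspace N = ell2 (idx N)"

definition algspan :: "real \<Rightarrow> vec set" where
  "algspan N = {f. finite {i. f i \<noteq> 0} \<and> {i. f i \<noteq> 0} \<subseteq> idx N}"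

text \<open>
  Linear extension of \<open>|j\<rangle> \<mapsto> T j\<close>, computed coordinatewise. For all \<open>T\<close> below, each coordinate is
  a sum with only finitely many nonzero terms.
\<close>

definition lin_ext :: "(real \<times> real \<Rightarrow> vec) \<Rightarrow> vec \<Rightarrow> vec" where
  "lin_ext T f = (\<lambda>i. \<Sum>\<^sub>\<infinity>j. f j * T j i)"

definition r_zero :: "real \<Rightarrow> real \<Rightarrow> real \<Rightarrow> real" where
  "r_zero q N l =
     (if l = 0 then 0
      else q powr (-1/2) *
        (((q - 1 / q) * qnum q (l + \<bar>N\<bar> + 1) * qnum q (l - \<bar>N\<bar>)
           + sgn N * q powr (sgn N) * qnum q (2 * \<bar>N\<bar>))
         / (qnum q (2*l) * qnum q (2*l + 2))))"

text \<open>
  For \<open>l = |N| - 1\<close> a denominator may vanish; the corresponding term of the representation is zero,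
  as its vector \<open>|l - 1, _\<rangle>\<close> does not exist.
\<close>

definition r_plus :: "real \<Rightarrow> real \<Rightarrow> real \<Rightarrow> real" where
  "r_plus q N l =
     q powr (-l - 3/2 - N) / qnum q (2*l + 2) *
     (sqrt (qnum q (l + N + 1) * qnum q (l - N + 1)) / sqrt (qnum q (2*l + 1) * qnum q (2*l + 3)))"

definition r_minus :: "real \<Rightarrow> real \<Rightarrow> real \<Rightarrow> real" where
  "r_minus q N l = - (q powr (2*l)) * r_plus q N (l - 1)"

definition B_ket :: "real \<Rightarrow> real \<Rightarrow> real \<times> real \<Rightarrow> vec" where
  "B_ket q N = (\<lambda>(l, m) i.
     complex_of_real (q powr m * sqrt (qnum q (l+m+1) * qnum q (l+m+2)) * r_plus q N l)
       * ket N (l+1, m+1) i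
     + complex_of_real (q powr m * sqrt (qnum q (l+m+1) * qnum q (l-m)) * r_zero q N l)
       * ket N (l, m+1) i
     + complex_of_real (q powr m * sqrt (qnum q (l-m) * qnum q (l-m-1)) * r_minus q N l)
       * ket N (l-1, m+1) i)"

definition Bstar_ket :: "real \<Rightarrow> real \<Rightarrow> real \<times> real \<Rightarrow> vec" where
  "Bstar_ket q N = (\<lambda>(l, m) i.
     complex_of_real (q powr (m-1) * sqrt (qnum q (l-m+2) * qnum q (l-m+1)) * r_minus q N (l+1))
       * ket N (l+1, m-1) i
     + complex_of_real (q powr (m-1) * sqrt (qnum q (l+m) * qnum q (l-m+1)) * r_zero q N l)
       * ket N (l, m-1) i
     + complex_of_real (q powr (m-1) * sqrt (qnum q (l+m) * qnum q (l+m-1)) * r_plus q N (l-1))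
       * ket N (l-1, m-1) i)"

definition A_ket :: "real \<Rightarrow> real \<Rightarrow> real \<times> real \<Rightarrow> vec" where
  "A_ket q N = (\<lambda>(l, m) i.
     complex_of_real (- (q powr (m+l+1/2)) * sqrt (qnum q (l-m+1) * qnum q (l+m+1)) * r_plus q N l)
       * ket N (l+1, m) i
     + complex_of_real (q powr (-1/2) / (1 + q\<^sup>2) *
         ((qnum q (l-m+1) * qnum q (l+m) - q\<^sup>2 * qnum q (l-m) * qnum q (l+m+1)) * r_zero q N l
          + q powr (1/2)))
       * ket N (l, m) i
     + complex_of_real (q powr (m-l-1/2) * sqrt (qnum q (l-m) * qnum q (l+m)) * r_minus q N l)
       * ket N (l-1, m) i)"

fun gen_op :: "real \<Rightarrow> real \<Rightarrow> gen \<Rightarrow> vec \<Rightarrow> vec" where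
  "gen_op q N GA = lin_ext (A_ket q N)"
| "gen_op q N GB = lin_ext (B_ket q N)"
| "gen_op q N GBstar = lin_ext (Bstar_ket q N)"

definition free_rep :: "real \<Rightarrow> real \<Rightarrow> free_alg \<Rightarrow> vec \<Rightarrow> vec" where
  "free_rep q N x f = (\<lambda>i. \<Sum>w\<in>Poly_Mapping.keys x.
     Poly_Mapping.lookup x w * foldr (gen_op q N) (letters w) f i)"

text \<open>
  On \<^term>\<open>hspace N\<close> the value does not depend on the chosen representative of the coset, as the
  operators satisfy the defining relations there.
\<close>

definition podles_rep :: "real \<Rightarrow> real \<Rightarrow> free_alg set \<Rightarrow> vec \<Rightarrow> vec" where
  "podles_rep q N X = free_rep q N (SOME x. x \<in> X)"

section \<open>The Dirac operator\<close>

definition hspace1 :: "real \<Rightarrow> (vec \<times> vec) hilb" where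
  "hspace1 N = hsum (hspace N) (hspace (N + 1))"

definition podles_rep1 :: "real \<Rightarrow> real \<Rightarrow> free_alg set \<Rightarrow> vec \<times> vec \<Rightarrow> vec \<times> vec" where
  "podles_rep1 q N = rep_sum (podles_rep q N) (podles_rep q (N + 1))"

definition grading1 :: "vec \<times> vec \<Rightarrow> vec \<times> vec" where
  "grading1 = (\<lambda>(f, g). (f, \<lambda>i. - g i))"

text \<open>The graph of the operator with domain the algebraic span of the basis vectors.\<close>

definition dirac :: "real \<Rightarrow> real \<Rightarrow> (vec \<times> vec) rel" where
  "dirac q N =
     (let c = (\<lambda>l. complex_of_real (sqrt (qnum q (l - N)) * sqrt (qnum q (l + N + 1))))
      in {((f, g), (lin_ext (\<lambda>(l, m) i. c l * ket N (l, m) i) g,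
                    lin_ext (\<lambda>(l, m) i. c l * ket (N + 1) (l, m) i) f)) | f g.
            f \<in> algspan N \<and> g \<in> algspan (N + 1)})"

definition dirac_levels :: "real \<Rightarrow> real set" where
  "dirac_levels N = {(if N \<ge> 0 then N else \<bar>N\<bar> - 1) + real k | k :: nat. True}"

end

theory Submission
  imports Defs "HOL-Complex_Analysis.Great_Picard"
begin

text \<open>
  Up to an additive constant, \<open>\<pi>\<^sub>N\<close> of each generator is a product of two operators \<open>spin 1 i j\<close>
  that change \<open>l\<close> and \<open>N\<close> by \<open>1/2\<close>: in the picture of \<open>V\<^sub>N\<close> as a space of matrix coefficients of
  quantum SU(2), these are the left multiplications by the generating matrix entries. The conjugation
  \<open>(jc f)(l,m) = cnj (f (l,-m))\<close> turns them into the right multiplications \<open>spin (-1) i j\<close>, which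
  commute with all left multiplications up to powers of \<open>q\<close> that cancel in the products. By a
  three-term relation for \<open>sqrt([l-N][l+N+1])\<close>, the commutator of the Dirac operator with a generator
  is again a product of two left multiplications, now shifting \<open>N\<close> by \<open>\<plusminus>1\<close>; so it is bounded and
  commutes with the right action. The real extension adds the triple for \<open>-N-1\<close>, which is spanned by
  \<open>V\<^bsub>-N-1\<^esub>\<close> and \<open>V\<^bsub>-N\<^esub>\<close> and has the same eigenvalues, and \<open>J\<close> is \<open>jc\<close> between opposite spaces.
  The Dirac operator is multiplication by a function of \<open>l\<close> composed with the flip of its two
  summands, and that function is finite-to-one and tends to infinity, whence the spectral statements.
\<close>

section \<open>Matrix coefficients of the spin-1/2 operators\<close>

text \<open>Coefficient by coefficient, the relations, the bounds and the order-one condition would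
  be identities between sums of products of the square roots in \<open>r_plus\<close>,
  \<open>r_zero\<close> and \<open>r_minus\<close>. Once the generators are factored, a product of
  two spin-1/2 operators has three coefficients. The two outer ones are single products, and
  exchanging the factors changes them by a power of q only. All content sits in the diagonal one,
  where the roots merge pairwise and a rational identity in q^l, q^m, q^N and q^(1/2) remains. The
  value l = 0 is treated apart, because [2l] is a denominator. The order-one condition needs no
  estimate: one bounded extension of [D, b] commutes with the whole right action. The partner of N
  is -N-1 because [l-N][l+N+1] is invariant under this substitution, so that J preserves D. A
  spectral triple needs a self-adjoint operator, whence the closure of the operator on the algebraic
  span. As multiplication by its coefficient leaves the square-summable functions, the algebraic
  identities are stated for all functions supported on the index set.\<close>

locale deformation =
  fixes q :: real
  assumes q_pos: "0 < q" and q_less_1: "q < 1"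
begin

abbreviation br :: "real \<Rightarrow> real" where
  "br \<equiv> qnum q"

text \<open>[2l+1] and [2l+2] are the quantum dimensions at l and at l + 1/2; the factor normalizes
  the Clebsch-Gordan coefficients for the step between these two levels, in either
  direction.\<close>

definition kap :: "real \<Rightarrow> real" where
  "kap l = 1 / (sqrt (br (2*l+1)) * sqrt (br (2*l+2)))"

text \<open>
  The operator with coefficients \<open>up s i j\<close> and \<open>dn s i j\<close>, where \<open>s, i, j = \<plusminus>1\<close>, maps \<open>|l,m\<rangle>\<close> in
  \<open>V\<^sub>N\<close> to a combination of \<open>|l \<plusminus> 1/2, m + i/2\<rangle>\<close> in \<open>V\<^bsub>N+j/2\<^esub>\<close>. It is left (for \<open>s = 1\<close>) or right
  (for \<open>s = -1\<close>) multiplication by an entry of the fundamental corepresentation of quantum SU(2).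
\<close>

definition up :: "real \<Rightarrow> real \<Rightarrow> real \<Rightarrow> real \<Rightarrow> real \<Rightarrow> real \<Rightarrow> real" where
  "up s i j N l m =
     q powr (s * ((m - N) / 2 + (j - i) / 2 * (l + 1/2)))
     * (sqrt (br (l+i*m+1)) * sqrt (br (l+j*N+1))) * kap l"

definition dn :: "real \<Rightarrow> real \<Rightarrow> real \<Rightarrow> real \<Rightarrow> real \<Rightarrow> real \<Rightarrow> real" where
  "dn s i j N l m =
     - (i * j) * q powr (s * ((m - N) / 2 - (j - i) / 2 * (l + 1/2)))
     * (sqrt (br (l-i*m)) * sqrt (br (l-j*N))) * kap (l - 1/2)"

lemma qd: "q - 1 / q < 0"
proof -
  have "q * q < 1 * 1" using q_pos q_less_1 by (intro mult_strict_mono) auto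
  thus ?thesis using q_pos by (simp add: field_simps)
qed

lemma br_0 [simp]: "br 0 = 0" by (simp add: qnum_def)
lemma br_minus: "br (- x) = - br x" by (simp add: qnum_def diff_divide_distrib)
lemma br_less_iff: "br x < br y \<longleftrightarrow> x < y"
proof -
  have "br x < br y \<longleftrightarrow> q powr x - q powr - x > q powr y - q powr - y"
    unfolding qnum_def using qd by (simp add: divide_less_cancel)
  also have "\<dots> \<longleftrightarrow> x < y"
  proof -
    have *: "q powr y < q powr x \<and> q powr (-x) < q powr (-y)" if "x < y" for x y
      using that q_pos q_less_1 by (auto intro!: powr_less_mono')
    show ?thesis using *[of x y] *[of y x] by (cases x y rule: linorder_cases) auto
  qed
  finally show ?thesis .
qed
lemma br_le_iff: "br x \<le> br y \<longleftrightarrow> x \<le> y" by (metis br_less_iff not_le)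
lemma br_nonneg [simp]: "0 \<le> br x \<longleftrightarrow> 0 \<le> x" using br_le_iff[of 0 x] by simp
lemma br_pos [simp]: "0 < br x \<longleftrightarrow> 0 < x" using br_less_iff[of 0 x] by simp
lemma br_eq_0 [simp]: "br x = 0 \<longleftrightarrow> x = 0" by (metis br_0 br_less_iff not_less_iff_gr_or_eq)

lemma kap_sq: "0 \<le> l \<Longrightarrow> kap l * kap l = 1 / (br (2*l+1) * br (2*l+2))"
  by (simp add: kap_def real_sqrt_mult[symmetric])
text \<open>For \<open>l = 0\<close> both sides are 0, since a bracket in the denominators vanishes.
  Hence the missing step down from \<open>l = 0\<close> needs no case distinction.\<close>

lemma kap_sq': "0 \<le> l \<Longrightarrow> kap (l - 1/2) * kap (l - 1/2) = 1 / (br (2*l) * br (2*l+1))"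
  by (simp add: kap_def real_sqrt_mult[symmetric] algebra_simps)
definition rt :: "real \<Rightarrow> real \<Rightarrow> real" where "rt l x = sqrt (br (l + x + 1)) * sqrt (br (l - x))"
text \<open>After a step of direction \<open>i\<close>, a step of direction \<open>i'\<close> meets
  the same square root again if \<open>i' = - i\<close>, and the product is a bracket. Equal
  directions leave the irrational factor \<open>rt\<close>.\<close>

definition prod_up :: "real \<Rightarrow> real \<Rightarrow> real \<Rightarrow> real \<Rightarrow> real" where
  "prod_up i i' l x = (if i = i' then rt l (i*x) else br (l + i*x + 1))"
definition prod_dn :: "real \<Rightarrow> real \<Rightarrow> real \<Rightarrow> real \<Rightarrow> real" where
  "prod_dn i i' l x = (if i = i' then rt l (i*x) else br (l - i*x))"

text \<open>The coefficient that preserves \<open>l\<close> in a product of two spin-1/2 operators: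
  one path goes up and comes back, the other goes down first. The primed data belong to the outer
  operator.\<close>

definition diag :: "real \<Rightarrow> real \<Rightarrow> real \<Rightarrow> real \<Rightarrow> real \<Rightarrow> real \<Rightarrow> real \<Rightarrow> real \<Rightarrow> real \<Rightarrow> real" where
  "diag s i j s' i' j' N l m =
     dn s' i' j' (N + j/2) (l + 1/2) (m + i/2) * up s i j N l m
     + up s' i' j' (N + j/2) (l - 1/2) (m + i/2) * dn s i j N l m"

lemma prod_up: assumes "i \<in> {1,-1}" "i' \<in> {1,-1}" "0 \<le> l+x" "0 \<le> l-x"
  shows "sqrt (br (l+i*x+1)) * sqrt (br (l+1/2-i'*(x+i/2))) = prod_up i i' l x"
  using assms unfolding prod_up_def rt_def by (auto simp: algebra_simps add_divide_distrib)
lemma prod_dn: assumes "i \<in> {1,-1}" "i' \<in> {1,-1}" "0 \<le> l+x" "0 \<le> l-x"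
  shows "sqrt (br (l-i*x)) * sqrt (br (l-1/2+i'*(x+i/2)+1)) = prod_dn i i' l x"
  using assms unfolding prod_dn_def rt_def by (auto simp: algebra_simps add_divide_distrib)

text \<open>Both paths share a power of q, which contains all of \<open>m - N\<close>, and the
  factor 1/[2l+1]. As \<open>kap\<close> enters squared, the only roots left are those inside
  \<open>prod_up\<close> and \<open>prod_dn\<close>.\<close>

lemma diag_eq:
  assumes "i \<in> {1,-1}" "i' \<in> {1,-1}" "j \<in> {1,-1}" "j' \<in> {1,-1}" "0 \<le> l+m" "0 \<le> l-m" "0 \<le> l+N" "0 \<le> l-N"
  shows "diag s i j s' i' j' N l m = 
    - (q powr ((s+s') * (m-N)/2 + s'*(i-j)/4)) / br (2*l+1) *
      (i'*j' * q powr (s*(j-i)/2*(l+1/2) - s'*(j'-i')/2*(l+1)) * (prod_up i i' l m * prod_up j j' l N) / br (2*l+2)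
      + i*j * q powr (- (s*(j-i)/2*(l+1/2)) + s'*(j'-i')/2*l) * (prod_dn i i' l m * prod_dn j j' l N) / br (2*l))"
proof -
  have l: "0 \<le> l" using assms by simp
  have 1: "dn s' i' j' (N + j/2) (l + 1/2) (m + i/2) * up s i j N l m =
     - (i'*j') * (q powr (s' * ((m +i/2- (N+j/2)) / 2 - (j' - i') / 2 * (l +1/2+ 1/2))) * q powr (s * ((m - N) / 2 + (j - i) / 2 * (l + 1/2))))
     * ((sqrt (br (l+i*m+1)) * sqrt (br (l+1/2-i'*(m+i/2)))) * (sqrt (br (l+j*N+1)) * sqrt (br (l+1/2-j'*(N+j/2))))) * (kap l * kap l)"
    unfolding up_def dn_def by simp
  have 2: "up s' i' j' (N + j/2) (l - 1/2) (m + i/2) * dn s i j N l m =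
     - (i*j) * (q powr (s' * ((m +i/2- (N+j/2)) / 2 + (j' - i') / 2 * (l -1/2+ 1/2))) * q powr (s * ((m - N) / 2 - (j - i) / 2 * (l + 1/2))))
     * ((sqrt (br (l-i*m)) * sqrt (br (l-1/2+i'*(m+i/2)+1))) * (sqrt (br (l-j*N)) * sqrt (br (l-1/2+j'*(N+j/2)+1)))) * (kap (l-1/2) * kap (l-1/2))"
    unfolding up_def dn_def by simp
  have e: "q powr (s' * ((m +i/2- (N+j/2)) / 2 - (j' - i') / 2 * (l +1/2+ 1/2))) * q powr (s * ((m - N) / 2 + (j - i) / 2 * (l + 1/2)))
     = q powr ((s+s') * (m-N)/2 + s'*(i-j)/4) * q powr (s*(j-i)/2*(l+1/2) - s'*(j'-i')/2*(l+1))"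
    unfolding powr_add[symmetric] by (rule arg_cong[where f="\<lambda>x. q powr x"]) (simp add: field_simps)
  have f: "q powr (s' * ((m +i/2- (N+j/2)) / 2 + (j' - i') / 2 * (l -1/2+ 1/2))) * q powr (s * ((m - N) / 2 - (j - i) / 2 * (l + 1/2)))
     = q powr ((s+s') * (m-N)/2 + s'*(i-j)/4) * q powr (- (s*(j-i)/2*(l+1/2)) + s'*(j'-i')/2*l)"
    unfolding powr_add[symmetric] by (rule arg_cong[where f="\<lambda>x. q powr x"]) (simp add: field_simps)
  show ?thesis
    unfolding diag_def 1 2 e f using assms l
    by (simp only: prod_up prod_dn kap_sq kap_sq') (simp add: algebra_simps add_divide_distrib)
qed
end

section \<open>Commutation and q-commutation of the diagonal coefficients\<close>

context deformation begin

lemma powr_split: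
  "q powr (x + y) = q powr x * q powr y" "q powr (x - y) = q powr x / q powr y"
  "q powr (- x) = 1 / q powr x" "q powr (2 * x) = (q powr x)^2"
  using q_pos by (simp_all add: powr_add powr_diff powr_minus_divide powr_power mult.commute)

lemma powr_num:
  "q powr 0 = 1" "q powr 1 = (q powr (1/2))^2" "q powr 2 = (q powr (1/2))^4"
  "q powr (3/2) = (q powr (1/2))^3"
  using q_pos by (simp_all add: powr_power mult.commute)

definition dq where "dq = q - 1/q"

lemma br_dq: "br x = (q powr x - q powr (-x)) / dq"
  by (simp add: qnum_def dq_def)

lemma dq_neq: "dq \<noteq> 0"
  using qd by (simp add: dq_def)

text \<open>Turns identities between brackets into rational identities in four independent
  variables. The numerators of [2l] and [2l+2] get the names \<open>w\<close> and \<open>v\<close>: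
  as nonzero atoms they are cleared as denominators first, and only then expanded.\<close>

lemma rational_parametrization:
  assumes "0 < l"
  obtains X Y Z h w v where
    "X \<noteq> 0" "Y \<noteq> 0" "Z \<noteq> 0" "h \<noteq> 0" "w \<noteq> 0" "v \<noteq> 0" "w = X^4 - 1" "v = X^4*h^8 - 1"
    "q powr l = X" "q powr m = Y" "q powr N = Z" "q powr (1/2) = h" "q = h^2" "dq = h^2 - 1/h^2"
    "br (2*l) = w / X^2 / dq" "br (2*l+2) = v / X^2 / h^4/ dq"
    "br (l+m+1) = (X*Y*h^2 - 1/(X*Y*h^2)) / dq" "br (l-m+1) = (X/Y*h^2 - 1/(X/Y*h^2)) / dq"
    "br (l+m) = (X*Y - 1/(X*Y)) / dq" "br (l-m) = (X/Y - 1/(X/Y)) / dq"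
    "br (l+N+1) = (X*Z*h^2 - 1/(X*Z*h^2)) / dq" "br (l-N+1) = (X/Z*h^2 - 1/(X/Z*h^2)) / dq"
    "br (l+N) = (X*Z - 1/(X*Z)) / dq" "br (l-N) = (X/Z - 1/(X/Z)) / dq"
    "br (2*l+1) = (X^2*h^2 - 1/(X^2*h^2)) / dq" "br (2*N) = (Z^2 - 1/Z^2) / dq"
proof -
  define X where "X = q powr l"
  define Y where "Y = q powr m"
  define Z where "Z = q powr N"
  define h where "h = q powr (1/2)"
  have g: "X \<noteq> 0" "h \<noteq> 0" "Y \<noteq> 0" "Z \<noteq> 0" using q_pos by (auto simp: X_def h_def Y_def Z_def)
  define w where "w = X^4 - 1" define v where "v = X^4*h^8 - 1"
  have bl: "br (2*l) = w / X^2 / dq" using g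
    unfolding br_dq powr_split powr_num X_def[symmetric] h_def[symmetric] w_def by (simp add: field_simps)
  have bl2: "br (2*l+2) = v / X^2 / h^4/ dq" using g
    unfolding br_dq powr_split powr_num X_def[symmetric] h_def[symmetric] v_def by (simp add: field_simps)
  have "br (2*l) \<noteq> 0" "br (2*l+2) \<noteq> 0" using assms by auto
  hence n: "w \<noteq> 0" "v \<noteq> 0" unfolding bl bl2 by auto
  have br: "br (l+m+1) = (X*Y*h^2 - 1/(X*Y*h^2)) / dq" "br (l-m+1) = (X/Y*h^2 - 1/(X/Y*h^2)) / dq"
     "br (l+m) = (X*Y - 1/(X*Y)) / dq" "br (l-m) = (X/Y - 1/(X/Y)) / dq"
     "br (l+N+1) = (X*Z*h^2 - 1/(X*Z*h^2)) / dq" "br (l-N+1) = (X/Z*h^2 - 1/(X/Z*h^2)) / dq"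
     "br (l+N) = (X*Z - 1/(X*Z)) / dq" "br (l-N) = (X/Z - 1/(X/Z)) / dq"
     "br (2*l+1) = (X^2*h^2 - 1/(X^2*h^2)) / dq" "br (2*N) = (Z^2 - 1/Z^2) / dq"
    unfolding br_dq powr_split powr_num X_def[symmetric] h_def[symmetric] Y_def[symmetric] Z_def[symmetric]
    using g by (simp_all add: field_simps power2_eq_square power3_eq_cube)
  have q: "q = h^2" using q_pos by (simp add: h_def powr_power)
  have "dq = h^2 - 1/h^2" by (simp add: dq_def q[symmetric])
  show ?thesis
    by (rule that[of X Y Z h w v])
      (rule g n bl bl2 br q \<open>dq = h^2 - 1/h^2\<close> w_def v_def X_def[symmetric] Y_def[symmetric]
        Z_def[symmetric] h_def[symmetric])+
qed

text \<open>Since the signs s = 1 and s' = -1 add up to 0, the dependence on \<open>m - N\<close>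
  drops out of the common power of q. A factor \<open>rt\<close>, if there is one, is common to all
  terms, so what remains for each choice of signs is a rational identity.\<close>

lemma diag_comm:
  assumes "i \<in> {1,-1}" "i' \<in> {1,-1}" "j \<in> {1,-1}" "j' \<in> {1,-1}"
    and "0 \<le> l+m" "0 \<le> l-m" "0 \<le> l+N" "0 \<le> l-N"
  shows "diag 1 i j (-1) i' j' N l m = diag (-1) i' j' 1 i j N l m"
\<comment> \<open>The parametrization needs [2l] to be nonzero; at \<open>l = 0\<close> also
  \<open>m\<close> and \<open>N\<close> vanish.\<close>
proof (cases "l = 0")
  case True
  hence "m = 0" "N = 0" using assms by auto
  thus ?thesis using assms(1-4) unfolding diag_eq[OF assms(1-8)] diag_eq[OF assms(2,1,4,3,5-8)]
    by (auto simp: True prod_up_def prod_dn_def rt_def)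
next
  case False
  hence l: "0 < l" using assms by simp
  from rational_parametrization[OF this, of m N] obtain X Y Z h w v where
    R: "X \<noteq> 0" "Y \<noteq> 0" "Z \<noteq> 0" "h \<noteq> 0" "w \<noteq> 0" "v \<noteq> 0" and wv: "w = X^4 - 1" "v = X^4*h^8 - 1"
    and P: "q powr l = X" "q powr m = Y" "q powr N = Z" "q powr (1/2) = h" and "q = h^2" "dq = h^2 - 1/h^2" and
    B: "br (2*l) = w / X^2 / dq" "br (2*l+2) = v / X^2 / h^4/ dq"
    "br (l+m+1) = (X*Y*h^2 - 1/(X*Y*h^2)) / dq" "br (l-m+1) = (X/Y*h^2 - 1/(X/Y*h^2)) / dq"
    "br (l+m) = (X*Y - 1/(X*Y)) / dq" "br (l-m) = (X/Y - 1/(X/Y)) / dq"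
    "br (l+N+1) = (X*Z*h^2 - 1/(X*Z*h^2)) / dq" "br (l-N+1) = (X/Z*h^2 - 1/(X/Z*h^2)) / dq"
    "br (l+N) = (X*Z - 1/(X*Z)) / dq" "br (l-N) = (X/Z - 1/(X/Z)) / dq" .
  show ?thesis using assms(1-4) unfolding diag_eq[OF assms(1-8)] diag_eq[OF assms(2,1,4,3,5-8)]
    apply (elim insertE emptyE; hypsubst)
    using l q_pos apply (simp_all add: prod_up_def prod_dn_def)
    apply (simp_all only: B)
    apply (simp_all only: powr_split powr_num P)
    using R dq_neq apply (simp_all add: field_simps)
    apply (simp_all only: wv)
    apply (simp_all add: algebra_simps eval_nat_numeral)
    done
qed

definition core :: "real \<Rightarrow> real \<Rightarrow> real \<Rightarrow> real \<Rightarrow> real \<Rightarrow> real \<Rightarrow> real \<Rightarrow> real" where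
  "core i j i' j' N l m = q powr ((i-j)/4) *
      (i'*j' * q powr ((j-i)/2*(l+1/2) - (j'-i')/2*(l+1)) * (prod_up i i' l m * prod_up j j' l N) / br (2*l+2)
      + i*j * q powr (- ((j-i)/2*(l+1/2)) + (j'-i')/2*l) * (prod_dn i i' l m * prod_dn j j' l N) / br (2*l))"

lemma diag_left:
  assumes "i \<in> {1,-1}" "i' \<in> {1,-1}" "j \<in> {1,-1}" "j' \<in> {1,-1}"
    and "0 \<le> l+m" "0 \<le> l-m" "0 \<le> l+N" "0 \<le> l-N"
  shows "diag 1 i j 1 i' j' N l m = - (q powr (m - N) / br (2*l+1)) * core i j i' j' N l m"
proof -
  have "q powr ((1+1) * (m-N)/2 + 1*(i-j)/4) = q powr (m-N) * q powr ((i-j)/4)"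
    unfolding powr_add[symmetric] by (rule arg_cong[where f="\<lambda>x. q powr x"]) (simp add: field_simps)
  thus ?thesis unfolding diag_eq[OF assms] core_def by simp
qed

text \<open>The commutation relations of the matrix entries of quantum SU(2): same row, same column,
  or the commuting pair (1,1), (-1,-1). The hypothesis leaves out exactly the pair (1,-1), (-1,1),
  whose two products are related by the determinant instead.\<close>

lemma core_q_comm:
  assumes "i \<in> {1,-1}" "i' \<in> {1,-1}" "j \<in> {1,-1}" "j' \<in> {1,-1}" "i = i' \<or> j = j' \<or> i = j"
    and "0 \<le> l+m" "0 \<le> l-m" "0 \<le> l+N" "0 \<le> l-N"
  shows "core i j i' j' N l m = q powr ((j'-i'-j+i)/2) * core i' j' i j N l m"
proof (cases "l = 0")
  case True
  hence "m = 0" "N = 0" using assms by auto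
  thus ?thesis using assms(1-5) q_pos unfolding core_def
    by (auto simp: True prod_up_def prod_dn_def rt_def powr_add[symmetric])
next
  case False
  hence l: "0 < l" using assms by simp
  from rational_parametrization[OF this, of m N] obtain X Y Z h w v where
    R: "X \<noteq> 0" "Y \<noteq> 0" "Z \<noteq> 0" "h \<noteq> 0" "w \<noteq> 0" "v \<noteq> 0" and wv: "w = X^4 - 1" "v = X^4*h^8 - 1"
    and P: "q powr l = X" "q powr m = Y" "q powr N = Z" "q powr (1/2) = h" and Q: "q = h^2" "dq = h^2 - 1/h^2" and
    B: "br (2*l) = w / X^2 / dq" "br (2*l+2) = v / X^2 / h^4/ dq"
    "br (l+m+1) = (X*Y*h^2 - 1/(X*Y*h^2)) / dq" "br (l-m+1) = (X/Y*h^2 - 1/(X/Y*h^2)) / dq"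
    "br (l+m) = (X*Y - 1/(X*Y)) / dq" "br (l-m) = (X/Y - 1/(X/Y)) / dq"
    "br (l+N+1) = (X*Z*h^2 - 1/(X*Z*h^2)) / dq" "br (l-N+1) = (X/Z*h^2 - 1/(X/Z*h^2)) / dq"
    "br (l+N) = (X*Z - 1/(X*Z)) / dq" "br (l-N) = (X/Z - 1/(X/Z)) / dq" .
  \<comment> \<open>As an opaque atom the irrational factor is cancelled and never expanded.\<close>
  define f where "f = rt l"
  define d where "d = dq"
  have f: "rt l x = f x" for x by (simp add: f_def)
  have d: "dq = d" "d \<noteq> 0" using dq_neq by (simp_all add: d_def)
  show ?thesis using assms(1-5) unfolding core_def
    apply (elim insertE emptyE; hypsubst)
    using l q_pos apply (simp_all add: prod_up_def prod_dn_def)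
    apply (simp_all only: B d(1) f)
    apply (simp_all only: powr_split powr_num P)
    apply (simp_all only: Q(1))
    using R d(2) apply (simp_all add: field_simps)
    apply (simp_all only: wv)
    apply (simp_all add: algebra_simps eval_nat_numeral)
    done
qed
end

section \<open>The quantum determinant, and \<open>r_zero\<close> without reference to the sign of
  \<open>N\<close>\<close>

context deformation begin

text \<open>With a, b, a', b' for the entries (1,-1), (1,1), (-1,1), (-1,-1), these are the two
  determinant relations a' a - q b' b = 1 and a a' - (1/q) b b' = 1, before the factor - q^(m-N) /
  [2l+1] is restored.\<close>

lemma core_unit:
  assumes "0 \<le> l+m" "0 \<le> l-m" "0 \<le> l+N" "0 \<le> l-N"
  shows "core 1 (-1) (-1) 1 N l m - q * core 1 1 (-1) (-1) N l m = - (q powr (N - m) * br (2*l+1))"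
    and "core (-1) 1 1 (-1) N l m - 1/q * core (-1) (-1) 1 1 N l m = - (q powr (N - m) * br (2*l+1))"
proof -
  have "core 1 (-1) (-1) 1 N l m - q * core 1 1 (-1) (-1) N l m = - (q powr (N - m) * br (2*l+1)) \<and>
    core (-1) 1 1 (-1) N l m - 1/q * core (-1) (-1) 1 1 N l m = - (q powr (N - m) * br (2*l+1))"
  proof (cases "l = 0")
    case True
    hence z: "m = 0" "N = 0" using assms by auto
    \<comment> \<open>At \<open>l = 0\<close> the only brackets that occur are [0] = 0, [1] and
      [2].\<close>
    have 1: "br 1 = 1" using q_pos dq_neq by (simp add: qnum_def powr_minus_divide dq_def)
    have "q powr 2 - q powr (-2) = dq * (q + 1/q)"
      using q_pos by (simp add: powr_minus_divide dq_def field_simps power2_eq_square)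
    hence 2: "br 2 = q + 1/q" using dq_neq by (simp add: br_dq)
    have 3: "q + 1/q \<noteq> 0" using q_pos by (metis add_pos_pos divide_pos_pos less_numeral_extra(1) less_irrefl)
    have 4: "q * q + 1 \<noteq> 0" using q_pos by (metis add_pos_pos mult_pos_pos less_numeral_extra(1) less_irrefl)
    have 5: "q powr (3/2) = q * q powr (1/2)" using powr_add[of q 1 "1/2"] q_pos by simp
    have 6: "q powr (1/2) + q * (q * q powr (1/2)) \<noteq> 0"
      using q_pos by (metis add_pos_pos mult_pos_pos powr_gt_zero less_irrefl)
    have "0 < 1 + (q * (q * (q * q)) + q * (q * 2))" using q_pos by (intro add_pos_pos mult_pos_pos) auto
    hence 7: "1 + (q * (q * (q * q)) + q * (q * 2)) \<noteq> 0" by simp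
    show ?thesis using q_pos 3 4 6 7 unfolding core_def
      by (auto simp: True z 1 2 5 prod_up_def prod_dn_def rt_def powr_minus powr_numeral field_simps power2_eq_square powr_add[symmetric])
  next
    case False
    hence l: "0 < l" using assms by simp
    from rational_parametrization[OF this, of m N] obtain X Y Z h w v where
      R: "X \<noteq> 0" "Y \<noteq> 0" "Z \<noteq> 0" "h \<noteq> 0" "w \<noteq> 0" "v \<noteq> 0" and wv: "w = X^4 - 1" "v = X^4*h^8 - 1"
      and P: "q powr l = X" "q powr m = Y" "q powr N = Z" "q powr (1/2) = h" and Q: "q = h^2" "dq = h^2 - 1/h^2" and
      B: "br (2*l) = w / X^2 / dq" "br (2*l+2) = v / X^2 / h^4/ dq"
      "br (l+m+1) = (X*Y*h^2 - 1/(X*Y*h^2)) / dq" "br (l-m+1) = (X/Y*h^2 - 1/(X/Y*h^2)) / dq"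
      "br (l+m) = (X*Y - 1/(X*Y)) / dq" "br (l-m) = (X/Y - 1/(X/Y)) / dq"
      "br (l+N+1) = (X*Z*h^2 - 1/(X*Z*h^2)) / dq" "br (l-N+1) = (X/Z*h^2 - 1/(X/Z*h^2)) / dq"
      "br (l+N) = (X*Z - 1/(X*Z)) / dq" "br (l-N) = (X/Z - 1/(X/Z)) / dq"
      "br (2*l+1) = (X^2*h^2 - 1/(X^2*h^2)) / dq"  .
    define d where "d = dq"
    have d: "dq = d" "d \<noteq> 0" using dq_neq by (simp_all add: d_def)
    show ?thesis unfolding core_def
      apply (intro conjI)
      using l q_pos apply (simp_all add: prod_up_def prod_dn_def)
      apply (simp_all only: B d(1))
      apply (simp_all only: powr_split powr_num P)
      apply (simp_all only: Q(1))
      using R d(2) apply (simp_all add: field_simps)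
      apply (simp_all only: wv)
      apply (simp_all add: algebra_simps eval_nat_numeral)
      done
  qed
  thus "core 1 (-1) (-1) 1 N l m - q * core 1 1 (-1) (-1) N l m = - (q powr (N - m) * br (2*l+1))"
    and "core (-1) 1 1 (-1) N l m - 1/q * core (-1) (-1) 1 1 N l m = - (q powr (N - m) * br (2*l+1))"
    by blast+
qed

lemma diag_unit:
  assumes "0 \<le> l+m" "0 \<le> l-m" "0 \<le> l+N" "0 \<le> l-N"
  shows "diag 1 1 (-1) 1 (-1) 1 N l m - q * diag 1 1 1 1 (-1) (-1) N l m = 1"
    and "diag 1 (-1) 1 1 1 (-1) N l m - 1/q * diag 1 (-1) (-1) 1 1 1 N l m = 1"
proof -
  have n: "br (2*l+1) \<noteq> 0" using assms by auto
  have e: "q powr (m - N) * q powr (N - m) = 1" using q_pos by (simp add: powr_add[symmetric])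
  have *: "- (q powr (m - N) / br (2*l+1)) * x - y * (- (q powr (m - N) / br (2*l+1)) * z) = 1"
    if "x - y * z = - (q powr (N - m) * br (2*l+1))" for x y z
  proof -
    have "- (q powr (m - N) / br (2*l+1)) * x - y * (- (q powr (m - N) / br (2*l+1)) * z) =
      - (q powr (m - N) / br (2*l+1)) * (x - y * z)"
      unfolding right_diff_distrib by (simp add: mult.commute mult.left_commute)
    also have "\<dots> = 1" unfolding that using n e by simp
    finally show ?thesis .
  qed
  show "diag 1 1 (-1) 1 (-1) 1 N l m - q * diag 1 1 1 1 (-1) (-1) N l m = 1"
    using *[OF core_unit(1)[OF assms]] by (subst (1 2) diag_left) (use assms in auto)
  show "diag 1 (-1) 1 1 1 (-1) N l m - 1/q * diag 1 (-1) (-1) 1 1 1 N l m = 1"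
    using *[OF core_unit(2)[OF assms]] by (subst (1 2) diag_left) (use assms in auto)
qed

lemma diag_q_comm:
  assumes "i \<in> {1,-1}" "i' \<in> {1,-1}" "j \<in> {1,-1}" "j' \<in> {1,-1}" "i = i' \<or> j = j' \<or> i = j"
    and "0 \<le> l+m" "0 \<le> l-m" "0 \<le> l+N" "0 \<le> l-N"
  shows "diag 1 i j 1 i' j' N l m = q powr ((j'-i'-j+i)/2) * diag 1 i' j' 1 i j N l m"
  unfolding diag_left[OF assms(1-4,6-9)] diag_left[OF assms(2,1,4,3,6-9)] core_q_comm[OF assms] by simp

text \<open>For negative \<open>N\<close> the defining formula has [l-N+1][l+N] and the summand
  (1/q)[2N]. Replacing these by [l+N+1][l-N] and q [2N] does not change the total, so one formula
  covers all signs of \<open>N\<close>.\<close>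

lemma r_zero_eq:
  assumes "0 < l"
  shows "r_zero q N l = q powr (-1/2) * ((dq * br (l+N+1) * br (l-N) + q * br (2*N)) / (br (2*l) * br (2*l+2)))"
proof -
  have q: "q powr (-1) = 1/q" using q_pos by (simp add: powr_minus_divide)
  have "(q - 1/q) * br (l+\<bar>N\<bar>+1) * br (l-\<bar>N\<bar>) + sgn N * q powr (sgn N) * br (2*\<bar>N\<bar>)
      = dq * br (l+N+1) * br (l-N) + q * br (2*N)"
  proof (cases "N < 0")
    case False
    thus ?thesis using q_pos by (cases "N = 0") (simp_all add: dq_def)
  next
    case True
    define x where "x = q powr l" define z where "z = q powr N"
    have xz: "x > 0" "z > 0" using q_pos by (auto simp: x_def z_def)
    have "dq * (br (l-N+1) * br (l+N)) + 1/q * br (2*N) = dq * (br (l+N+1) * br (l-N)) + q * br (2*N)"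
      unfolding br_dq powr_split powr_num x_def[symmetric] z_def[symmetric]
      using xz q_pos dq_neq apply (simp add: powr_half_sqrt field_simps)
      apply (simp add: dq_def field_simps) apply (simp add: algebra_simps eval_nat_numeral)
      done
    moreover have "br (2 * - N) = - br (2*N)" using br_minus[of "2*N"] by simp
    ultimately show ?thesis using True q by (simp add: dq_def mult.assoc)
  qed
  thus ?thesis using assms by (simp add: r_zero_def)
qed

end

section \<open>Closed forms for the diagonal coefficients of the generators\<close>

context deformation begin

lemma powr_1: "q powr 1 = q" "q powr 2 = q * q" using q_pos by (simp_all add: powr_numeral power2_eq_square)

definition r_zero_num where "r_zero_num l N = dq * br (l+N+1) * br (l-N) + q * br (2*N)"

text \<open>The identity behind the diagonal coefficients of B and B*: the terms over [2l] and
  [2l+2] combine to a multiple of [2l+1], which cancels the denominator of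
  \<open>diag\<close>.\<close>

lemma r_zero_num_br:
  "q powr (-N) * (q powr l * br (l+N) * br (2*l+2) - q powr (-l-1) * br (l-N+1) * br (2*l)) = br (2*l+1) * r_zero_num l N"
proof -
  \<comment> \<open>Here and in the next four proofs each power of q is paired with a name for its
    inverse. Products then cancel by rewriting, and an identity of Laurent polynomials is decided
    without clearing denominators.\<close>
  define x x' where "x = q powr l" and "x' = inverse (q powr l)"
  define y y' where "y = q powr m" and "y' = inverse (q powr m)"
  define z z' where "z = q powr N" and "z' = inverse (q powr N)"
  define p p' where "p = q" and "p' = inverse q"
  define d e where "d = inverse dq" and "e = dq"
  have i: "x * x' = 1" "y * y' = 1" "z * z' = 1" "p * p' = 1" "d * e = 1"
    using q_pos dq_neq by (auto simp: x_def x'_def y_def y'_def z_def z'_def p_def p'_def d_def e_def)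
  hence i': "x' * x = 1" "y' * y = 1" "z' * z = 1" "p' * p = 1" "e * d = 1" by (simp_all add: mult.commute)
  have j: "x * (x' * t) = t" "y * (y' * t) = t" "z * (z' * t) = t" "p * (p' * t) = t" "d * (e * t) = t" 
    "x' * (x * t) = t" "y' * (y * t) = t" "z' * (z * t) = t" "p' * (p * t) = t" "e * (d * t) = t" for t
    using i i' by (simp_all add: mult.assoc[symmetric])
  show ?thesis
    unfolding br_dq r_zero_num_def powr_split powr_1 divide_inverse inverse_mult_distrib power2_eq_square
      inverse_1 mult_1 inverse_inverse_eq
    unfolding x'_def[symmetric] y'_def[symmetric] z'_def[symmetric] p'_def[symmetric] d_def[symmetric]
    unfolding x_def[symmetric] y_def[symmetric] z_def[symmetric] e_def[symmetric] unfolding p_def[symmetric]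
    by (simp add: algebra_simps i i' j)
qed

text \<open>Up to normalization, the value of the Casimir element at spin \<open>l\<close>. Apart
  from a factor [2l+1], the numerators below are polynomials of degree at most 2 in it whose
  coefficients do not contain \<open>l\<close>.\<close>

definition qcosh where "qcosh l = q powr (2*l+1) + 1 / q powr (2*l+1)"

lemma r_zero_num_qcosh: "r_zero_num l N = (qcosh l - (q + 1/q) / (q powr N)^2) / dq"
proof -
  define x x' where "x = q powr l" and "x' = inverse (q powr l)"
  define y y' where "y = q powr m" and "y' = inverse (q powr m)"
  define z z' where "z = q powr N" and "z' = inverse (q powr N)"
  define p p' where "p = q" and "p' = inverse q"
  define d e where "d = inverse dq" and "e = dq"
  have i: "x * x' = 1" "y * y' = 1" "z * z' = 1" "p * p' = 1" "d * e = 1"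
    using q_pos dq_neq by (auto simp: x_def x'_def y_def y'_def z_def z'_def p_def p'_def d_def e_def)
  hence i': "x' * x = 1" "y' * y = 1" "z' * z = 1" "p' * p = 1" "e * d = 1" by (simp_all add: mult.commute)
  have j: "x * (x' * t) = t" "y * (y' * t) = t" "z * (z' * t) = t" "p * (p' * t) = t" "d * (e * t) = t" 
    "x' * (x * t) = t" "y' * (y * t) = t" "z' * (z * t) = t" "p' * (p * t) = t" "e * (d * t) = t" for t
    using i i' by (simp_all add: mult.assoc[symmetric])
  show ?thesis
    unfolding br_dq r_zero_num_def qcosh_def powr_split powr_1 divide_inverse inverse_mult_distrib power2_eq_square
      inverse_1 mult_1 inverse_inverse_eq
    unfolding x'_def[symmetric] y'_def[symmetric] z'_def[symmetric] p'_def[symmetric] d_def[symmetric]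
    unfolding x_def[symmetric] y_def[symmetric] z_def[symmetric] e_def[symmetric] unfolding p_def[symmetric]
    by (simp add: algebra_simps i i' j)
qed

lemma A_diag_qcosh: "br (l-m+1) * br (l+m) - q^2 * br (l-m) * br (l+m+1) = - q * (qcosh l - (q + 1/q) * (q powr m)^2) / dq"
proof -
  define x x' where "x = q powr l" and "x' = inverse (q powr l)"
  define y y' where "y = q powr m" and "y' = inverse (q powr m)"
  define z z' where "z = q powr N" and "z' = inverse (q powr N)"
  define p p' where "p = q" and "p' = inverse q"
  define d e where "d = inverse dq" and "e = dq"
  have i: "x * x' = 1" "y * y' = 1" "z * z' = 1" "p * p' = 1" "d * e = 1"
    using q_pos dq_neq by (auto simp: x_def x'_def y_def y'_def z_def z'_def p_def p'_def d_def e_def)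
  hence i': "x' * x = 1" "y' * y = 1" "z' * z = 1" "p' * p = 1" "e * d = 1" by (simp_all add: mult.commute)
  have j: "x * (x' * t) = t" "y * (y' * t) = t" "z * (z' * t) = t" "p * (p' * t) = t" "d * (e * t) = t" 
    "x' * (x * t) = t" "y' * (y * t) = t" "z' * (z * t) = t" "p' * (p * t) = t" "e * (d * t) = t" for t
    using i i' by (simp_all add: mult.assoc[symmetric])
  have "br (l-m+1) * br (l+m) - q^2 * br (l-m) * br (l+m+1) = - q * (qcosh l - (q + 1/q) * (q powr m)^2) / dq / dq * (q - 1/q)"
    unfolding br_dq qcosh_def powr_split powr_1 divide_inverse inverse_mult_distrib power2_eq_square
      inverse_1 mult_1 inverse_inverse_eq
    unfolding x'_def[symmetric] y'_def[symmetric] z'_def[symmetric] p'_def[symmetric] d_def[symmetric]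
    unfolding x_def[symmetric] y_def[symmetric] z_def[symmetric] e_def[symmetric] unfolding p_def[symmetric]
    by (simp add: algebra_simps i i' j)
  also have "q - 1/q = dq" by (simp add: dq_def)
  finally show ?thesis using dq_neq by simp
qed

lemma br_qcosh: "br (2*l) * br (2*l+2) = ((qcosh l)^2 - (q + 1/q)^2) / dq^2"
proof -
  define x x' where "x = q powr l" and "x' = inverse (q powr l)"
  define y y' where "y = q powr m" and "y' = inverse (q powr m)"
  define z z' where "z = q powr N" and "z' = inverse (q powr N)"
  define p p' where "p = q" and "p' = inverse q"
  define d e where "d = inverse dq" and "e = dq"
  have i: "x * x' = 1" "y * y' = 1" "z * z' = 1" "p * p' = 1" "d * e = 1"
    using q_pos dq_neq by (auto simp: x_def x'_def y_def y'_def z_def z'_def p_def p'_def d_def e_def)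
  hence i': "x' * x = 1" "y' * y = 1" "z' * z = 1" "p' * p = 1" "e * d = 1" by (simp_all add: mult.commute)
  have j: "x * (x' * t) = t" "y * (y' * t) = t" "z * (z' * t) = t" "p * (p' * t) = t" "d * (e * t) = t" 
    "x' * (x * t) = t" "y' * (y * t) = t" "z' * (z * t) = t" "p' * (p * t) = t" "e * (d * t) = t" for t
    using i i' by (simp_all add: mult.assoc[symmetric])
  show ?thesis
    unfolding br_dq qcosh_def powr_split powr_1 divide_inverse inverse_mult_distrib power2_eq_square
      inverse_1 mult_1 inverse_inverse_eq
    unfolding x'_def[symmetric] y'_def[symmetric] z'_def[symmetric] p'_def[symmetric] d_def[symmetric]
    unfolding x_def[symmetric] y_def[symmetric] z_def[symmetric] e_def[symmetric] unfolding p_def[symmetric]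
    by (simp add: algebra_simps i i' j)
qed

lemma A_qcosh:
  "q powr (m-N) * (br (l-m+1) * br (l-N+1) * br (2*l) + br (l+m) * br (l+N) * br (2*l+2))
    = br (2*l+1) * (qcosh l * ((q powr m)^2 + 1 / (q powr N)^2) - (q + 1/q) * ((q powr m)^2 / (q powr N)^2 + 1)) / dq^2"
proof -
  define x x' where "x = q powr l" and "x' = inverse (q powr l)"
  define y y' where "y = q powr m" and "y' = inverse (q powr m)"
  define z z' where "z = q powr N" and "z' = inverse (q powr N)"
  define p p' where "p = q" and "p' = inverse q"
  define d e where "d = inverse dq" and "e = dq"
  have i: "x * x' = 1" "y * y' = 1" "z * z' = 1" "p * p' = 1" "d * e = 1"
    using q_pos dq_neq by (auto simp: x_def x'_def y_def y'_def z_def z'_def p_def p'_def d_def e_def)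
  hence i': "x' * x = 1" "y' * y = 1" "z' * z = 1" "p' * p = 1" "e * d = 1" by (simp_all add: mult.commute)
  have j: "x * (x' * t) = t" "y * (y' * t) = t" "z * (z' * t) = t" "p * (p' * t) = t" "d * (e * t) = t" 
    "x' * (x * t) = t" "y' * (y * t) = t" "z' * (z * t) = t" "p' * (p * t) = t" "e * (d * t) = t" for t
    using i i' by (simp_all add: mult.assoc[symmetric])
  show ?thesis
    unfolding br_dq qcosh_def powr_split powr_1 divide_inverse inverse_mult_distrib power2_eq_square
      inverse_1 mult_1 inverse_inverse_eq
    unfolding x'_def[symmetric] y'_def[symmetric] z'_def[symmetric] p'_def[symmetric] d_def[symmetric]
    unfolding x_def[symmetric] y_def[symmetric] z_def[symmetric] e_def[symmetric] unfolding p_def[symmetric]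
    by (simp add: algebra_simps i i' j)
qed

text \<open>The given coefficient of A is a product in which \<open>m\<close> and \<open>N\<close>
  are separated, plus a constant, whereas \<open>core\<close> mixes them. The two become comparable
  once everything is expressed by \<open>qcosh l\<close>.\<close>

lemma core_A:
  assumes "0 < l"
  shows "1/q * (q powr (m - N) * core (-1) (-1) 1 1 N l m) / br (2*l+1)
      = q powr (-1/2) / (1 + q^2) *
        ((br (l-m+1) * br (l+m) - q^2 * br (l-m) * br (l+m+1)) * r_zero q N l + q powr (1/2))"
proof -
  define a b c where "a = br (2*l)" and "b = br (2*l+2)" and "c = br (2*l+1)"
  define C K M n where "C = qcosh l" and "K = q + 1/q" and "M = (q powr m)^2" and "n = 1 / (q powr N)^2"
  have abc: "a \<noteq> 0" "b \<noteq> 0" "c \<noteq> 0" using assms by (auto simp: a_def b_def c_def)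
  have "q * K = 1 + q^2" using q_pos by (simp add: K_def field_simps power2_eq_square)
  moreover have "1 + q^2 \<noteq> 0" by (metis add_pos_nonneg less_irrefl zero_le_power2 zero_less_one)
  ultimately have K: "q * K = 1 + q^2" "K \<noteq> 0" by auto
  define S where "S = br (l-m+1) * br (l+m) - q^2 * br (l-m) * br (l+m+1)"
  have S: "S = - q * (C - K * M) / dq" unfolding S_def A_diag_qcosh C_def K_def M_def by simp
  have T: "r_zero_num l N = (C - K * n) / dq" unfolding r_zero_num_qcosh C_def K_def n_def by simp
  have ab: "a * b = (C^2 - K^2) / dq^2" unfolding a_def b_def br_qcosh C_def K_def by simp
  have "S * r_zero_num l N + q * (a * b) = (- q * (C - K * M) * (C - K * n) + q * (C^2 - K^2)) / dq^2"
  proof -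
    have "- q * u / d * (v / d) + q * (w / d^2) = (- q * u * v + q * w) / d^2" for u v w d
      by (simp add: power2_eq_square diff_divide_distrib)
    thus ?thesis unfolding S T ab .
  qed
  \<comment> \<open>The squares of \<open>C\<close> cancel. The summand q [2l][2l+2] that makes this
    happen stems from the constant q^(1/2) in the coefficient of A.\<close>
  also have "\<dots> = q * K * (C * (M + n) - K * (M * n + 1)) / dq^2"
    by (simp add: algebra_simps power2_eq_square)
  finally have ST: "S * r_zero_num l N + q * (a * b) = q * K * (C * (M + n) - K * (M * n + 1)) / dq^2" .
  have "core (-1) (-1) 1 1 N l m = br (l-m+1) * br (l-N+1) / b + br (l+m) * br (l+N) / a"
    using q_pos by (simp add: core_def prod_up_def prod_dn_def a_def b_def)
  also have "\<dots> = (br (l-m+1) * br (l-N+1) * a + br (l+m) * br (l+N) * b) / (a * b)"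
    using abc by (simp add: field_simps)
  finally have "q powr (m - N) * core (-1) (-1) 1 1 N l m
      = c * ((C * (M + n) - K * (M * n + 1)) / dq^2) / (a * b)"
    using A_qcosh[of m N l] by (simp add: a_def b_def c_def C_def K_def M_def n_def)
  also have "(C * (M + n) - K * (M * n + 1)) / dq^2 = (S * r_zero_num l N + q * (a * b)) / (q * K)"
    unfolding ST using K(2) q_pos by simp
  finally have L: "q powr (m - N) * core (-1) (-1) 1 1 N l m
      = c * ((S * r_zero_num l N + q * (a * b)) / (1 + q^2)) / (a * b)"
    unfolding K(1) .
  have L: "1/q * (q powr (m - N) * core (-1) (-1) 1 1 N l m) / c
      = 1/q / (1 + q^2) * (S * r_zero_num l N / (a * b) + q)"
  proof -
    have *: "1/q * (c * ((x + q * y) / G) / y) / c = 1/q / G * (x / y + q)" if "y \<noteq> 0" "G \<noteq> 0" for x y G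
      using that abc q_pos by (simp add: field_simps)
    show ?thesis unfolding L by (rule *) (use abc K q_pos in auto)
  qed
  have r: "r_zero q N l = q powr (-1/2) * (r_zero_num l N / (a * b))"
    unfolding r_zero_eq[OF assms] r_zero_num_def a_def b_def by simp
  have h: "q powr (-1/2) * q powr (-1/2) = 1/q" "q powr (-1/2) * q powr (1/2) = 1"
    using q_pos by (simp_all add: powr_add[symmetric] powr_minus_divide)
  have "q powr (-1/2) / (1 + q^2) * (S * r_zero q N l + q powr (1/2))
     = ((q powr (-1/2) * q powr (-1/2)) * (S * r_zero_num l N / (a * b)) + q powr (-1/2) * q powr (1/2)) / (1 + q^2)"
    unfolding r by (simp add: field_simps)
  also have "\<dots> = 1/q / (1 + q^2) * (S * r_zero_num l N / (a * b) + q)"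
  proof -
    have "(1/q * t + 1) / G = 1/q / G * (t + q)" if "G \<noteq> 0" for t G
      using that q_pos by (simp add: field_simps)
    thus ?thesis unfolding h using K q_pos by (metis mult_eq_0_iff less_irrefl)
  qed
  finally show ?thesis using L unfolding S_def c_def by simp
qed

text \<open>Both coefficients are multiples of one combination \<open>W\<close> of the two paths,
  and \<open>r_zero_num_br\<close> evaluates \<open>W\<close>.\<close>

lemma core_BC:
  assumes "0 < l"
  shows "- (q powr (-3/2) * (q powr (m - N) * core 1 (-1) 1 1 N l m)) / br (2*l+1)
      = q powr m * (sqrt (br (l+m+1)) * sqrt (br (l-m))) * r_zero q N l" (is ?B)
    and "q powr (-3/2) * (q powr (m - N) * core (-1) (-1) (-1) 1 N l m) / br (2*l+1)
      = q powr (m-1) * (sqrt (br (l+m)) * sqrt (br (l-m+1))) * r_zero q N l" (is ?C)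
proof -
  define a b c where "a = br (2*l)" and "b = br (2*l+2)" and "c = br (2*l+1)"
  have abc: "a \<noteq> 0" "b \<noteq> 0" "c \<noteq> 0" using assms by (auto simp: a_def b_def c_def)
  define W where "W = q powr l * br (l+N) / a - q powr (-l-1) * br (l-N+1) / b"
  have "W = (q powr l * br (l+N) * b - q powr (-l-1) * br (l-N+1) * a) / (a * b)"
    using abc by (simp add: W_def field_simps)
  hence W: "q powr (-N) * W = c * (r_zero_num l N / (a * b))"
    using r_zero_num_br[of N l] by (simp add: a_def b_def c_def)
  have r: "r_zero q N l = q powr (-1/2) * (r_zero_num l N / (a * b))"
    unfolding r_zero_eq[OF assms] r_zero_num_def a_def b_def by simp
  have e: "q powr (-l - 1/2) = q powr (1/2) * q powr (-l-1)" "q powr (1/2+l) = q powr (1/2) * q powr l"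
    "q powr (1/2) * q powr (1/2) = q"
    using q_pos by (simp_all add: powr_add[symmetric] algebra_simps)
  have "core 1 (-1) 1 1 N l m = q powr (1/2) *
      (q powr (-l - 1/2) * (rt l m * br (l-N+1)) / b - q powr (1/2+l) * (rt l m * br (l+N)) / a)"
    by (simp add: core_def prod_up_def prod_dn_def a_def b_def add.commute)
  also have "\<dots> = - (q powr (1/2) * q powr (1/2)) * rt l m * W"
    unfolding e(1,2) W_def by (simp add: algebra_simps)
  finally have 1: "core 1 (-1) 1 1 N l m = - q * rt l m * W" unfolding e .
  have "q powr (- 1 - l) = q powr (- l - 1)" by (rule arg_cong[where f="\<lambda>x. q powr x"]) simp
  note E = this
  have 2: "core (-1) (-1) (-1) 1 N l m = rt l (-m) * W"
    by (simp add: core_def prod_up_def prod_dn_def a_def b_def W_def algebra_simps E)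
  have f: "q powr (-3/2) * q powr (m - N) * q = q powr m * q powr (-1/2) * q powr (-N)"
    "q powr (-3/2) * q powr (m - N) = q powr (m-1) * q powr (-1/2) * q powr (-N)"
  proof -
    have q1: "x * q = x * q powr 1" for x using q_pos by simp
    show "q powr (-3/2) * q powr (m - N) * q = q powr m * q powr (-1/2) * q powr (-N)"
      unfolding q1 powr_add[symmetric] by (rule arg_cong[where f="\<lambda>x. q powr x"]) simp
    show "q powr (-3/2) * q powr (m - N) = q powr (m-1) * q powr (-1/2) * q powr (-N)"
      unfolding powr_add[symmetric] by (rule arg_cong[where f="\<lambda>x. q powr x"]) simp
  qed
  have "- (q powr (-3/2) * (q powr (m - N) * core 1 (-1) 1 1 N l m)) / c
      = (q powr (-3/2) * q powr (m - N) * q) * rt l m * W / c" unfolding 1 by simp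
  also have "\<dots> = q powr m * rt l m * q powr (-1/2) * (q powr (-N) * W) / c" unfolding f(1) by simp
  finally show ?B unfolding W r rt_def using abc by (simp add: c_def mult.assoc)
  have "q powr (-3/2) * (q powr (m - N) * core (-1) (-1) (-1) 1 N l m) / c
      = (q powr (-3/2) * q powr (m - N)) * rt l (-m) * W / c" unfolding 2 by simp
  also have "\<dots> = q powr (m-1) * rt l (-m) * q powr (-1/2) * (q powr (-N) * W) / c" unfolding f(2) by simp
  finally show ?C unfolding W r rt_def using abc by (simp add: c_def mult.assoc mult.commute)
qed

end

section \<open>The spin-1/2 operators\<close>

text \<open>The index set in a form that is symmetric in \<open>m\<close> and \<open>N\<close> and
  under their changes of sign, so that a shift by 1/2 is checked condition by condition. By
  \<open>idx_eq\<close> it is \<open>idx N\<close> when 2N is an integer.\<close>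

definition gidx :: "real \<Rightarrow> (real \<times> real) set" where
  "gidx N = {(l, m). l + m \<in> \<nat> \<and> l - m \<in> \<nat> \<and> l + N \<in> \<nat> \<and> l - N \<in> \<nat>}"

definition supp :: "real \<Rightarrow> vec \<Rightarrow> bool" where
  "supp N f \<longleftrightarrow> (\<forall>x. x \<notin> gidx N \<longrightarrow> f x = 0)"

text \<open>The weights are read at the source vector. No truncation to existing basis vectors is
  built in; for the spin operators the weights vanish where a step would leave the index
  set.\<close>

definition hop :: "real \<Rightarrow> (real \<Rightarrow> real \<Rightarrow> real) \<Rightarrow> (real \<Rightarrow> real \<Rightarrow> real) \<Rightarrow> vec \<Rightarrow> vec" where
  "hop s u d f = (\<lambda>(l, m). complex_of_real (u (l-1/2) (m-s)) * f (l-1/2, m-s)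
     + complex_of_real (d (l+1/2) (m-s)) * f (l+1/2, m-s))"

definition band :: "real \<Rightarrow> (real \<Rightarrow> real \<Rightarrow> real) \<Rightarrow> (real \<Rightarrow> real \<Rightarrow> real) \<Rightarrow> (real \<Rightarrow> real \<Rightarrow> real) \<Rightarrow> vec \<Rightarrow> vec" where
  "band s u v w f = (\<lambda>(l, m). complex_of_real (u (l-1) (m-s)) * f (l-1, m-s)
     + complex_of_real (v l (m-s)) * f (l, m-s) + complex_of_real (w (l+1) (m-s)) * f (l+1, m-s))"

definition mulc :: "(real \<Rightarrow> real) \<Rightarrow> vec \<Rightarrow> vec" where
  "mulc c f = (\<lambda>(l, m). complex_of_real (c l) * f (l, m))"

lemma gidxD:
  assumes "(l, m) \<in> gidx N"
  shows "0 \<le> l+m" "0 \<le> l-m" "0 \<le> l+N" "0 \<le> l-N" "0 \<le> l"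
proof -
  have n: "0 \<le> x" if "x \<in> \<nat>" for x :: real using that by (auto elim: Nats_cases)
  have "l+m \<in> \<nat>" "l-m \<in> \<nat>" "l+N \<in> \<nat>" "l-N \<in> \<nat>" using assms by (auto simp: gidx_def)
  from this[THEN n] show "0 \<le> l+m" "0 \<le> l-m" "0 \<le> l+N" "0 \<le> l-N" "0 \<le> l" by auto
qed

lemma supp_not: "supp N f \<Longrightarrow> x \<notin> gidx N \<Longrightarrow> f x = 0"
  unfolding supp_def by blast

lemma hop_hop:
  "hop s' u' d' (hop s u d f) =
    band (s+s') (\<lambda>l m. u' (l+1/2) (m+s) * u l m)
      (\<lambda>l m. d' (l+1/2) (m+s) * u l m + u' (l-1/2) (m+s) * d l m)
      (\<lambda>l m. d' (l-1/2) (m+s) * d l m) f"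
proof -
  have 1: "l - 1/2 - 1/2 = l - 1" "l + 1/2 + 1/2 = l + 1" for l :: real by simp_all
  show ?thesis
    by (simp add: hop_def band_def fun_eq_iff algebra_simps 1 diff_diff_eq)
qed

lemma hop_cong:
  assumes "supp N f" "\<And>l m. (l, m) \<in> gidx N \<Longrightarrow> u l m = u' l m" "\<And>l m. (l, m) \<in> gidx N \<Longrightarrow> d l m = d' l m"
  shows "hop s u d f = hop s u' d' f"
proof -
  have *: "complex_of_real (u l m) * f (l, m) = u' l m * f (l, m)" "complex_of_real (d l m) * f (l, m) = d' l m * f (l, m)" for l m
    using assms by (cases "(l, m) \<in> gidx N"; simp add: supp_not)+
  show ?thesis unfolding hop_def * ..
qed

lemma band_cong:
  assumes "supp N f" "\<And>l m. (l, m) \<in> gidx N \<Longrightarrow> u l m = u' l m" "\<And>l m. (l, m) \<in> gidx N \<Longrightarrow> v l m = v' l m"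
    "\<And>l m. (l, m) \<in> gidx N \<Longrightarrow> w l m = w' l m"
  shows "band s u v w f = band s u' v' w' f"
proof -
  have *: "complex_of_real (u l m) * f (l, m) = u' l m * f (l, m)" "complex_of_real (v l m) * f (l, m) = v' l m * f (l, m)"
    "complex_of_real (w l m) * f (l, m) = w' l m * f (l, m)" for l m
    using assms by (cases "(l, m) \<in> gidx N"; simp add: supp_not)+
  show ?thesis unfolding band_def * ..
qed

lemma band_combine:
  "complex_of_real c * band s u v w f x + complex_of_real c' * band s u' v' w' f x =
    band s (\<lambda>l m. c * u l m + c' * u' l m) (\<lambda>l m. c * v l m + c' * v' l m) (\<lambda>l m. c * w l m + c' * w' l m) f x"
  by (cases x) (simp add: band_def algebra_simps)

lemma band_scale:
  "complex_of_real c * band s u v w f x =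
    band s (\<lambda>l m. c * u l m) (\<lambda>l m. c * v l m) (\<lambda>l m. c * w l m) f x"
  by (cases x) (simp add: band_def algebra_simps)

lemma band_id: "band 0 (\<lambda>l m. 0) (\<lambda>l m. 1) (\<lambda>l m. 0) f = f"
  by (auto simp: band_def)

lemma hop_mulc: "hop s u d (mulc c f) = hop s (\<lambda>l m. u l m * c l) (\<lambda>l m. d l m * c l) f"
  by (simp add: hop_def mulc_def fun_eq_iff)

lemma mulc_hop: "mulc c (hop s u d f) = hop s (\<lambda>l m. c (l+1/2) * u l m) (\<lambda>l m. c (l-1/2) * d l m) f"
  by (auto simp: hop_def mulc_def fun_eq_iff algebra_simps)

lemma hop_combine:
  "complex_of_real c * hop s u d f x + complex_of_real c' * hop s u' d' f x =
    hop s (\<lambda>l m. c * u l m + c' * u' l m) (\<lambda>l m. c * d l m + c' * d' l m) f x"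
  by (cases x) (simp add: hop_def algebra_simps)

lemma hop_scale:
  "complex_of_real c * hop s u d f x = hop s (\<lambda>l m. c * u l m) (\<lambda>l m. c * d l m) f x"
  by (cases x) (simp add: hop_def algebra_simps)

lemma Nats_pred: "x \<in> \<nat> \<Longrightarrow> x \<noteq> 0 \<Longrightarrow> x - 1 \<in> \<nat>" for x :: real
proof -
  assume "x \<in> \<nat>" "x \<noteq> 0"
  then obtain n where "x = of_nat n" "n \<noteq> 0" by (auto elim: Nats_cases)
  hence "x - 1 = of_nat (n - 1)" by (simp add: of_nat_diff)
  thus ?thesis by simp
qed

context deformation begin

definition spin :: "real \<Rightarrow> real \<Rightarrow> real \<Rightarrow> real \<Rightarrow> vec \<Rightarrow> vec" where
  "spin s i j N = hop (i/2) (up s i j N) (dn s i j N)"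

text \<open>A step up always stays in the index set. A step down leaves it only if
  \<open>l - i*m\<close> or \<open>l - j*N\<close> is 0 at the source, and then the weight contains
  the root of a vanishing bracket.\<close>

lemma supp_spin:
  assumes "i \<in> {1,-1}" "j \<in> {1,-1}" "supp N f"
  shows "supp (N + j/2) (spin s i j N f)"
  unfolding supp_def
proof (intro allI impI)
  fix x assume x: "x \<notin> gidx (N + j/2)"
  obtain l m where [simp]: "x = (l, m)" by (cases x)
  have 1: "up s i j N (l-1/2) (m-i/2) * f (l-1/2, m-i/2) = 0"
  proof (cases "(l-1/2, m-i/2) \<in> gidx N")
    case True
    hence "l-1/2 + (m-i/2) \<in> \<nat>" "l-1/2 - (m-i/2) \<in> \<nat>" "l-1/2+N \<in> \<nat>" "l-1/2-N \<in> \<nat>" by (auto simp: gidx_def)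
    note g = this
    have "l-1/2 + (m-i/2) + 1 \<in> \<nat>" "l-1/2 - (m-i/2) + 1 \<in> \<nat>" "l-1/2+N+1 \<in> \<nat>" "l-1/2-N+1 \<in> \<nat>"
      using g[THEN Nats_add[OF _ Nats_1]] by blast+
    with g have "(l, m) \<in> gidx (N + j/2)" using assms(1,2) by (auto simp: gidx_def algebra_simps)
    thus ?thesis using x by simp
  qed (use assms in \<open>simp add: supp_not\<close>)
  have 2: "dn s i j N (l+1/2) (m-i/2) * f (l+1/2, m-i/2) = 0"
  proof (cases "(l+1/2, m-i/2) \<in> gidx N \<and> l+1/2-i*(m-i/2) \<noteq> 0 \<and> l+1/2-j*N \<noteq> 0")
    case True
    have g: "l+1/2 + (m-i/2) \<in> \<nat>" "l+1/2 - (m-i/2) \<in> \<nat>" "l+1/2+N \<in> \<nat>" "l+1/2-N \<in> \<nat>" using True by (auto simp: gidx_def)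
    hence h: "l+1/2-i*(m-i/2) \<in> \<nat>" "l+1/2-j*N \<in> \<nat>" using assms(1,2) by auto
    have "l+1/2-i*(m-i/2) - 1 \<in> \<nat>" "l+1/2-j*N - 1 \<in> \<nat>" using h[THEN Nats_pred] True by blast+
    with g have "(l, m) \<in> gidx (N + j/2)" using assms(1,2) by (auto simp: gidx_def algebra_simps)
    thus ?thesis using x by simp
  next
    case False
    thus ?thesis using assms(3) by (auto simp: supp_not dn_def)
  qed
  show "spin s i j N f x = 0" using 1 2 by (auto simp: spin_def hop_def)
qed

text \<open>The power of q by which exchanging two spin operators changes the outer coefficients.
  Its exponent is proportional to \<open>s + s'\<close>, so that a left and a right multiplication
  exchange without any factor.\<close>

definition swap_factor :: "real \<Rightarrow> real \<Rightarrow> real \<Rightarrow> real \<Rightarrow> real \<Rightarrow> real \<Rightarrow> real" where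
  "swap_factor s i j s' i' j' = q powr ((s+s') * ((j'-i') - (j-i)) / 4)"

lemma up_up:
  assumes "i \<in> {1,-1}" "i' \<in> {1,-1}" "j \<in> {1,-1}" "j' \<in> {1,-1}"
  shows "up s' i' j' (N + j/2) (l+1/2) (m+i/2) * up s i j N l m
    = swap_factor s i j s' i' j' * (up s i j (N + j'/2) (l+1/2) (m+i'/2) * up s' i' j' N l m)"
proof -
  have e: "q powr (s' * ((m+i/2 - (N+j/2)) / 2 + (j' - i') / 2 * (l+1/2 + 1/2))) * q powr (s * ((m - N) / 2 + (j - i) / 2 * (l + 1/2)))
    = swap_factor s i j s' i' j' *
     (q powr (s * ((m+i'/2 - (N+j'/2)) / 2 + (j - i) / 2 * (l+1/2 + 1/2))) * q powr (s' * ((m - N) / 2 + (j' - i') / 2 * (l + 1/2))))"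
    unfolding swap_factor_def powr_add[symmetric] by (rule arg_cong[where f="\<lambda>x. q powr x"]) (simp add: field_simps)
  have r: "sqrt (br (l+1/2+i'*(x+i/2)+1)) * sqrt (br (l+i*x+1)) = sqrt (br (l+1/2+i*(x+i'/2)+1)) * sqrt (br (l+i'*x+1))"
    if "i \<in> {1,-1}" "i' \<in> {1,-1}" for x i i' using that by (auto simp: algebra_simps)
  have "up s' i' j' (N + j/2) (l+1/2) (m+i/2) * up s i j N l m =
    (q powr (s' * ((m+i/2 - (N+j/2)) / 2 + (j' - i') / 2 * (l+1/2 + 1/2))) * q powr (s * ((m - N) / 2 + (j - i) / 2 * (l + 1/2))))
    * (sqrt (br (l+1/2+i'*(m+i/2)+1)) * sqrt (br (l+i*m+1))) * (sqrt (br (l+1/2+j'*(N+j/2)+1)) * sqrt (br (l+j*N+1)))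
    * (kap l * kap (l+1/2))" by (simp add: up_def)
  also have "\<dots> = swap_factor s i j s' i' j' * (up s i j (N + j'/2) (l+1/2) (m+i'/2) * up s' i' j' N l m)"
    unfolding e r[OF assms(1,2)] r[OF assms(3,4)] by (simp add: up_def)
  finally show ?thesis .
qed

lemma dn_dn:
  assumes "i \<in> {1,-1}" "i' \<in> {1,-1}" "j \<in> {1,-1}" "j' \<in> {1,-1}"
  shows "dn s' i' j' (N + j/2) (l-1/2) (m+i/2) * dn s i j N l m
    = swap_factor s i j s' i' j' * (dn s i j (N + j'/2) (l-1/2) (m+i'/2) * dn s' i' j' N l m)"
proof -
  have e: "q powr (s' * ((m+i/2 - (N+j/2)) / 2 - (j' - i') / 2 * (l-1/2 + 1/2))) * q powr (s * ((m - N) / 2 - (j - i) / 2 * (l + 1/2)))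
    = swap_factor s i j s' i' j' *
     (q powr (s * ((m+i'/2 - (N+j'/2)) / 2 - (j - i) / 2 * (l-1/2 + 1/2))) * q powr (s' * ((m - N) / 2 - (j' - i') / 2 * (l + 1/2))))"
    unfolding swap_factor_def powr_add[symmetric] by (rule arg_cong[where f="\<lambda>x. q powr x"]) (simp add: field_simps)
  have r: "sqrt (br (l-1/2-i'*(x+i/2))) * sqrt (br (l-i*x)) = sqrt (br (l-1/2-i*(x+i'/2))) * sqrt (br (l-i'*x))"
    if "i \<in> {1,-1}" "i' \<in> {1,-1}" for x i i' using that by (auto simp: algebra_simps)
  have "dn s' i' j' (N + j/2) (l-1/2) (m+i/2) * dn s i j N l m = (i*j*(i'*j')) *
    (q powr (s' * ((m+i/2 - (N+j/2)) / 2 - (j' - i') / 2 * (l-1/2 + 1/2))) * q powr (s * ((m - N) / 2 - (j - i) / 2 * (l + 1/2))))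
    * (sqrt (br (l-1/2-i'*(m+i/2))) * sqrt (br (l-i*m))) * (sqrt (br (l-1/2-j'*(N+j/2))) * sqrt (br (l-j*N)))
    * (kap (l-1/2) * kap (l-1/2-1/2))" by (simp add: dn_def)
  also have "\<dots> = swap_factor s i j s' i' j' * (dn s i j (N + j'/2) (l-1/2) (m+i'/2) * dn s' i' j' N l m)"
    unfolding e r[OF assms(1,2)] r[OF assms(3,4)] by (simp add: dn_def)
  finally show ?thesis .
qed

lemma spin_spin:
  "spin s' i' j' (N + j/2) (spin s i j N f) = band (i/2 + i'/2)
     (\<lambda>l m. up s' i' j' (N + j/2) (l+1/2) (m+i/2) * up s i j N l m) (diag s i j s' i' j' N)
     (\<lambda>l m. dn s' i' j' (N + j/2) (l-1/2) (m+i/2) * dn s i j N l m) f"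
  unfolding spin_def hop_hop diag_def ..

text \<open>The outer coefficients exchange with \<open>swap_factor\<close> whatever the signs are;
  hence a commutation relation is decided by the diagonal coefficient alone.\<close>

lemma spin_swap:
  assumes ij: "i \<in> {1,-1}" "i' \<in> {1,-1}" "j \<in> {1,-1}" "j' \<in> {1,-1}" and f: "supp N f"
    and d: "\<And>l m. 0 \<le> l+m \<Longrightarrow> 0 \<le> l-m \<Longrightarrow> 0 \<le> l+N \<Longrightarrow> 0 \<le> l-N \<Longrightarrow>
      diag s i j s' i' j' N l m = swap_factor s i j s' i' j' * diag s' i' j' s i j N l m"
  shows "spin s' i' j' (N + j/2) (spin s i j N f) x
    = complex_of_real (swap_factor s i j s' i' j') * spin s i j (N + j'/2) (spin s' i' j' N f) x"
  unfolding spin_spin band_scale add.commute[of "i/2"]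
  by (rule fun_cong[where x=x], rule band_cong[OF f])
    (rule up_up[OF ij], use d gidxD in blast, rule dn_dn[OF ij])

lemma spin_comm:
  assumes "i \<in> {1,-1}" "i' \<in> {1,-1}" "j \<in> {1,-1}" "j' \<in> {1,-1}" "supp N f"
  shows "spin (-1) i' j' (N + j/2) (spin 1 i j N f) = spin 1 i j (N + j'/2) (spin (-1) i' j' N f)"
proof -
  have "swap_factor 1 i j (-1) i' j' = 1" using q_pos by (simp add: swap_factor_def)
  thus ?thesis using spin_swap[OF assms, of 1 "-1"] diag_comm[OF assms(1-4)] by (simp add: fun_eq_iff)
qed

lemma spin_q_comm:
  assumes "i \<in> {1,-1}" "i' \<in> {1,-1}" "j \<in> {1,-1}" "j' \<in> {1,-1}" "i = i' \<or> j = j' \<or> i = j" "supp N f"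
  shows "spin 1 i' j' (N + j/2) (spin 1 i j N f) x
    = complex_of_real (q powr ((j'-i'-j+i)/2)) * spin 1 i j (N + j'/2) (spin 1 i' j' N f) x"
proof -
  have s: "swap_factor 1 i j 1 i' j' = q powr ((j'-i'-j+i)/2)"
    unfolding swap_factor_def by (rule arg_cong[where f="\<lambda>x. q powr x"]) (simp add: field_simps)
  show ?thesis unfolding s[symmetric]
    by (rule spin_swap[OF assms(1-4,6)]) (simp add: s diag_q_comm[OF assms(1-5)])
qed

text \<open>The two products in a determinant relation reach an outer vector along paths with the
  same roots. So the outer coefficients cancel there, and the diagonal ones leave the
  identity.\<close>

lemma up_dn_unit:
  "up 1 (-1) 1 (N-1/2) (l+1/2) (m+1/2) * up 1 1 (-1) N l m = q * (up 1 (-1) (-1) (N+1/2) (l+1/2) (m+1/2) * up 1 1 1 N l m)"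
  "dn 1 (-1) 1 (N-1/2) (l-1/2) (m+1/2) * dn 1 1 (-1) N l m = q * (dn 1 (-1) (-1) (N+1/2) (l-1/2) (m+1/2) * dn 1 1 1 N l m)"
  "up 1 1 (-1) (N+1/2) (l+1/2) (m-1/2) * up 1 (-1) 1 N l m = 1/q * (up 1 1 1 (N-1/2) (l+1/2) (m-1/2) * up 1 (-1) (-1) N l m)"
  "dn 1 1 (-1) (N+1/2) (l-1/2) (m-1/2) * dn 1 (-1) 1 N l m = 1/q * (dn 1 1 1 (N-1/2) (l-1/2) (m-1/2) * dn 1 (-1) (-1) N l m)"
proof -
  have q: "q = q powr 1" "1/q = q powr (-1)" using q_pos by (simp_all add: powr_minus_divide)
  \<comment> \<open>It suffices that the exponents agree up to the shift \<open>c\<close> and that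
    the products of the roots agree; the normalizing factors are the same.\<close>
  have comb: "q powr x1 * (b1 * b2) * k1 * (q powr x2 * (b3 * b4) * k2) = e * (q powr y1 * (b1' * b2') * k1 * (q powr y2 * (b3' * b4') * k2))"
    if "x1 + x2 = c + (y1 + y2)" "e = q powr c" "b1 * b2 * (b3 * b4) = b1' * b2' * (b3' * b4')"
    for x1 x2 b1 b2 b3 b4 k1 k2 e y1 y2 b1' b2' b3' b4' c :: real
  proof -
    have "q powr x1 * (b1 * b2) * k1 * (q powr x2 * (b3 * b4) * k2) = q powr (x1 + x2) * (b1 * b2 * (b3 * b4)) * (k1 * k2)"
      by (simp add: powr_add mult_ac)
    also have "\<dots> = e * (q powr y1 * (b1' * b2') * k1 * (q powr y2 * (b3' * b4') * k2))"
      unfolding that by (simp add: powr_add mult_ac)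
    finally show ?thesis .
  qed
  have a: "l+1/2+ -1*(m+1/2)+1 = l-m+1" "l+1/2+1*(N-1/2)+1 = l+N+1" "l+1/2+ -1*(N+1/2)+1 = l-N+1"
    "l-1/2- -1*(m+1/2) = l+m" "l-1/2-1*(N-1/2) = l-N" "l-1/2- -1*(N+1/2) = l+N"
    "l+1/2+1*(m-1/2)+1 = l+m+1" "l+1/2+ -1*(N+1/2)+1 = l-N+1" "l-1/2-1*(m-1/2) = l-m" by simp_all
  show "up 1 (-1) 1 (N-1/2) (l+1/2) (m+1/2) * up 1 1 (-1) N l m = q * (up 1 (-1) (-1) (N+1/2) (l+1/2) (m+1/2) * up 1 1 1 N l m)"
    unfolding up_def a
    by (rule comb[where c=1]) (use q in \<open>simp_all add: field_simps\<close>)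
  show "up 1 1 (-1) (N+1/2) (l+1/2) (m-1/2) * up 1 (-1) 1 N l m = 1/q * (up 1 1 1 (N-1/2) (l+1/2) (m-1/2) * up 1 (-1) (-1) N l m)"
    unfolding up_def a q(2)
    by (rule comb[where c="-1"]) (simp_all add: field_simps)
  have neg: "- (i*j) * x * b * k * (- (i'*j') * x' * b' * k') = x * b * k * (x' * b' * k')" if "i*j*(i'*j') = 1" for i j i' j' x b k x' b' k' :: real
  proof -
    have "- (i*j) * x * b * k * (- (i'*j') * x' * b' * k') = (i*j*(i'*j')) * (x * b * k * (x' * b' * k'))" by (simp add: mult_ac)
    thus ?thesis using that by simp
  qed
  show "dn 1 (-1) 1 (N-1/2) (l-1/2) (m+1/2) * dn 1 1 (-1) N l m = q * (dn 1 (-1) (-1) (N+1/2) (l-1/2) (m+1/2) * dn 1 1 1 N l m)"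
    unfolding dn_def a apply (subst neg, simp, subst neg, simp)
    by (rule comb[where c=1]) (use q in \<open>simp_all add: field_simps\<close>)
  show "dn 1 1 (-1) (N+1/2) (l-1/2) (m-1/2) * dn 1 (-1) 1 N l m = 1/q * (dn 1 1 1 (N-1/2) (l-1/2) (m-1/2) * dn 1 (-1) (-1) N l m)"
    unfolding dn_def a q(2) apply (subst neg, simp, subst neg, simp)
    by (rule comb[where c="-1"]) (simp_all add: field_simps)
qed

lemma spin_unit:
  assumes f: "supp N f"
  shows "spin 1 (-1) 1 (N - 1/2) (spin 1 1 (-1) N f) x = complex_of_real q * spin 1 (-1) (-1) (N + 1/2) (spin 1 1 1 N f) x + f x"
    and "spin 1 1 (-1) (N + 1/2) (spin 1 (-1) 1 N f) x = complex_of_real (1/q) * spin 1 1 1 (N - 1/2) (spin 1 (-1) (-1) N f) x + f x"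
proof -
  have "complex_of_real 1 * spin 1 (-1) 1 (N + -1/2) (spin 1 1 (-1) N f) x + complex_of_real (-q) * spin 1 (-1) (-1) (N + 1/2) (spin 1 1 1 N f) x = band 0 (\<lambda>l m. 0) (\<lambda>l m. 1) (\<lambda>l m. 0) f x"
    unfolding spin_spin band_combine
    by (rule fun_cong[where x=x], simp, rule band_cong[OF f])
      (use up_dn_unit diag_unit gidxD in \<open>auto simp: algebra_simps\<close>)
  thus "spin 1 (-1) 1 (N - 1/2) (spin 1 1 (-1) N f) x = complex_of_real q * spin 1 (-1) (-1) (N + 1/2) (spin 1 1 1 N f) x + f x"
    by (simp add: band_id algebra_simps)
  have "complex_of_real 1 * spin 1 1 (-1) (N + 1/2) (spin 1 (-1) 1 N f) x + complex_of_real (-(1/q)) * spin 1 1 1 (N + -1/2) (spin 1 (-1) (-1) N f) x = band 0 (\<lambda>l m. 0) (\<lambda>l m. 1) (\<lambda>l m. 0) f x"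
    unfolding spin_spin band_combine
    by (rule fun_cong[where x=x], simp, rule band_cong[OF f])
      (use up_dn_unit diag_unit gidxD in \<open>auto simp: algebra_simps\<close>)
  thus "spin 1 1 (-1) (N + 1/2) (spin 1 (-1) 1 N f) x = complex_of_real (1/q) * spin 1 1 1 (N - 1/2) (spin 1 (-1) (-1) N f) x + f x"
    by (simp add: band_id algebra_simps)
qed
end

section \<open>Spin-1/2 operators and the Dirac coefficient; bounds on the weights\<close>

context deformation begin

definition cf :: "real \<Rightarrow> real \<Rightarrow> real" where
  "cf N l = sqrt (br (l - N)) * sqrt (br (l + N + 1))"

lemma br_succ: "br (x + 1) = 1/q * br x + q powr x" "br (x + 1) = q * br x + 1 / q powr x"
proof -
  have "br (x + 1) * dq = (1/q * br x + q powr x) * dq" "br (x + 1) * dq = (q * br x + 1 / q powr x) * dq"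
    using q_pos dq_neq unfolding br_dq powr_split powr_1 by (simp_all add: dq_def field_simps)
  thus "br (x + 1) = 1/q * br x + q powr x" "br (x + 1) = q * br x + 1 / q powr x" using dq_neq by simp_all
qed

text \<open>The scheme of the two exchanges that need a correction. The Dirac coefficient repeats
  the root \<open>r1\<close> of the spin weight; its square \<open>R1\<close> splits by
  \<open>br_succ\<close>, and the second part carries the root \<open>r2\<close>, that of the spin
  operator with the opposite \<open>j\<close>.\<close>

lemma three_term:
  fixes B :: real
  assumes "r1 * r1 = R1" "r3 * r3 = R3" "c1 * B1 = u * B" "c2 * B2 = v * B" "R1 = u * R3 + v" "C = r1 * r2" "C' = r3 * r2"
  shows "C * (B * (s * r1) * k) = c1 * (B1 * (s * r3) * k * C') + c2 * (B2 * (s * r2) * k)"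
proof -
  have "C * (B * (s * r1) * k) = B * (r1 * r1) * (s * r2 * k)" by (simp add: assms(6) mult_ac)
  also have "\<dots> = (u * B * (r3 * r3) + v * B) * (s * r2 * k)" by (simp add: assms(1,2,5) algebra_simps)
  also have "\<dots> = (u * B) * (r3 * r3) * (s * r2 * k) + (v * B) * (s * r2 * k)" by (simp add: distrib_right)
  also have "\<dots> = c1 * (B1 * (s * r3) * k * C') + c2 * (B2 * (s * r2) * k)"
    unfolding assms(3,4)[symmetric] by (simp add: assms(7) mult_ac)
  finally show ?thesis .
qed

lemma powr_eqI: "x = c + y \<Longrightarrow> e = q powr c \<Longrightarrow> q powr x = e * q powr y"
  by (simp add: powr_add)

lemma two_term:
  fixes B :: real
  assumes "B = c * B1" "C * r = r' * C'"
  shows "C * (B * (s * r) * k) = c * (B1 * (s * r') * k * C')"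
proof -
  have "C * (B * (s * r) * k) = B * s * k * (C * r)" by (simp add: mult_ac)
  thus ?thesis unfolding assms by (simp add: mult_ac)
qed

text \<open>The two Dirac coefficients differ in exactly the root by which the two spin weights
  differ, so the exchange is clean up to q^(1/2).\<close>

lemma cf_raise_outer:
  assumes "supp N f"
  shows "mulc (cf (N + 1/2)) (spin 1 i 1 N f) x = complex_of_real (q powr (1/2)) * spin 1 i 1 (N+1) (mulc (cf N) f) x"
proof -
  have "cf (N + 1/2) (l+1/2) * up 1 i 1 N l m = q powr (1/2) * (up 1 i 1 (N+1) l m * cf N l)" for l m
    unfolding up_def by (rule two_term, rule powr_eqI[where c="1/2"])
      (simp add: field_simps, simp, simp add: cf_def algebra_simps)
  moreover have "cf (N + 1/2) (l-1/2) * dn 1 i 1 N l m = q powr (1/2) * (dn 1 i 1 (N+1) l m * cf N l)" for l m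
  proof -
    have e: "q powr (1 * ((m - N) / 2 - (1 - i) / 2 * (l + 1/2))) = q powr (1/2) * q powr (1 * ((m - (N+1)) / 2 - (1 - i) / 2 * (l + 1/2)))"
      by (rule powr_eqI[OF _ refl]) (simp add: field_simps)
    show ?thesis unfolding dn_def by (rule two_term) (unfold e, simp_all add: cf_def algebra_simps)
  qed
  ultimately show ?thesis unfolding spin_def mulc_hop hop_mulc hop_scale by - (rule fun_cong[OF hop_cong[OF assms]], simp_all)
qed

lemma cf_lower_inner:
  assumes "supp N f"
  shows "mulc (cf (N - 3/2)) (spin 1 i (-1) N f) x = complex_of_real (q powr (-1/2)) * spin 1 i (-1) (N-1) (mulc (cf (N-1)) f) x"
proof -
  have "cf (N - 3/2) (l+1/2) * up 1 i (-1) N l m = q powr (-1/2) * (up 1 i (-1) (N-1) l m * cf (N-1) l)" for l m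
    unfolding up_def by (rule two_term, rule powr_eqI[where c="-1/2"])
      (simp add: field_simps, simp, simp add: cf_def algebra_simps)
  moreover have "cf (N - 3/2) (l-1/2) * dn 1 i (-1) N l m = q powr (-1/2) * (dn 1 i (-1) (N-1) l m * cf (N-1) l)" for l m
  proof -
    have e: "q powr (1 * ((m - N) / 2 - (-1 - i) / 2 * (l + 1/2))) = q powr (-1/2) * q powr (1 * ((m - (N-1)) / 2 - (-1 - i) / 2 * (l + 1/2)))"
      by (rule powr_eqI[OF _ refl]) (simp add: field_simps)
    show ?thesis unfolding dn_def by (rule two_term) (unfold e, simp_all add: cf_def algebra_simps)
  qed
  ultimately show ?thesis unfolding spin_def mulc_hop hop_mulc hop_scale by - (rule fun_cong[OF hop_cong[OF assms]], simp_all)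
qed

lemma q1: "q powr (-1) = 1/q" "q powr 1 = q" using q_pos by (simp_all add: powr_minus_divide)

text \<open>Here the exchange is not clean. The extra summand raises \<open>N\<close> instead of
  lowering it, and it is the source of the commutator of the Dirac operator with a generator on its
  way from V_N to V_(N+1).\<close>

lemma cf_raise_inner:
  assumes f: "supp N f"
  shows "mulc (cf (N - 1/2)) (spin 1 i (-1) N f) x =
    complex_of_real (q powr (-1/2)) * spin 1 i (-1) (N+1) (mulc (cf N) f) x + complex_of_real (q powr (-N-1/2)) * spin 1 i 1 N f x"
proof -
  have "cf (N - 1/2) (l+1/2) * up 1 i (-1) N l m =
     q powr (-1/2) * (up 1 i (-1) (N+1) l m * cf N l) + q powr (-N-1/2) * up 1 i 1 N l m"
    if "(l, m) \<in> gidx N" for l m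
    unfolding up_def
  proof (rule three_term)
    show "sqrt (br (l + -1*N + 1)) * sqrt (br (l + -1*N + 1)) = br (l - N + 1)" "sqrt (br (l + -1 * (N+1) + 1)) * sqrt (br (l + -1 * (N+1) + 1)) = br (l - N)"
      using gidxD[OF that] by simp_all
    show "q powr (-1/2) * q powr (1 * ((m-(N+1))/2 + (-1-i)/2 * (l+1/2))) = 1/q * q powr (1 * ((m-N)/2 + (-1-i)/2 * (l+1/2)))"
      "q powr (-N-1/2) * q powr (1 * ((m-N)/2 + (1-i)/2 * (l+1/2))) = q powr (l - N) * q powr (1 * ((m-N)/2 + (-1-i)/2 * (l+1/2)))"
      unfolding q1(1)[symmetric] powr_add[symmetric] by (rule arg_cong[where f="\<lambda>x. q powr x"], simp add: field_simps)+
    show "br (l - N + 1) = 1/q * br (l - N) + q powr (l - N)" by (rule br_succ)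
    show "cf (N - 1/2) (l+1/2) = sqrt (br (l + -1*N + 1)) * sqrt (br (l + 1*N + 1))"
      "cf N l = sqrt (br (l + -1*(N+1) + 1)) * sqrt (br (l + 1*N + 1))" by (simp_all add: cf_def add.commute)
  qed
  moreover have "cf (N - 1/2) (l-1/2) * dn 1 i (-1) N l m =
     q powr (-1/2) * (dn 1 i (-1) (N+1) l m * cf N l) + q powr (-N-1/2) * dn 1 i 1 N l m"
    if "(l, m) \<in> gidx N" for l m
    unfolding dn_def
  proof (rule three_term)
    have ll: "l - -1*N = l + N" "l - -1*(N+1) = l + N + 1" by simp_all
    show "sqrt (br (l - -1*N)) * sqrt (br (l - -1*N)) = br (l + N)" "sqrt (br (l - -1 * (N+1))) * sqrt (br (l - -1 * (N+1))) = br (l + N + 1)"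
      unfolding ll using gidxD[OF that] by simp_all
    have 1: "q powr (-1/2) * q powr (1 * ((m-(N+1))/2 - (-1-i)/2 * (l+1/2))) = 1/q * q powr (1 * ((m-N)/2 - (-1-i)/2 * (l+1/2)))"
      and 2: "q powr (-N-1/2) * q powr (1 * ((m-N)/2 - (1-i)/2 * (l+1/2))) = q powr (-(l + N + 1)) * q powr (1 * ((m-N)/2 - (-1-i)/2 * (l+1/2)))"
      unfolding q1(1)[symmetric] powr_add[symmetric] by (rule arg_cong[where f="\<lambda>x. q powr x"], simp add: field_simps)+
    show "q powr (-1/2) * (- (i * -1) * q powr (1 * ((m-(N+1))/2 - (-1-i)/2 * (l+1/2)))) = 1/q * (- (i * -1) * q powr (1 * ((m-N)/2 - (-1-i)/2 * (l+1/2))))"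
      using 1 by (simp add: mult_ac)
    show "q powr (-N-1/2) * (- (i * 1) * q powr (1 * ((m-N)/2 - (1-i)/2 * (l+1/2)))) = (- (q powr (-(l + N + 1)))) * (- (i * -1) * q powr (1 * ((m-N)/2 - (-1-i)/2 * (l+1/2))))"
      using 2 by (simp add: mult_ac)
    have p: "q powr (-(l+N+1)) = 1 / q powr (l+N) / q"
      using powr_minus_divide[of q "l+N+1"] powr_add[of q "l+N" 1] q_pos by simp
    have "1/q * br (l + N + 1) = br (l + N) + q powr (-(l+N+1))"
      unfolding p br_succ(2)[of "l+N"] using q_pos by (simp add: field_simps)
    thus "br (l + N) = 1/q * br (l + N + 1) + - (q powr (-(l + N + 1)))" by simp
    show "cf (N - 1/2) (l-1/2) = sqrt (br (l - -1*N)) * sqrt (br (l - 1*N))"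
      "cf N l = sqrt (br (l - -1*(N+1))) * sqrt (br (l - 1*N))" by (simp_all add: cf_def algebra_simps)
  qed
  ultimately show ?thesis
    unfolding spin_def mulc_hop hop_mulc hop_combine by - (rule fun_cong[OF hop_cong[OF f]], blast+)
qed

text \<open>On the way back from V_(N+1) to V_N the correction arises at the outer factor of a
  generator, while by \<open>cf_lower_inner\<close> the inner factor exchanges cleanly.\<close>

lemma cf_lower_outer:
  assumes f: "supp N f"
  shows "mulc (cf (N - 1/2)) (spin 1 i 1 N f) x =
    complex_of_real (q powr (1/2)) * spin 1 i 1 (N-1) (mulc (cf (N-1)) f) x + complex_of_real (q powr (1/2-N)) * spin 1 i (-1) N f x"
proof -
  have "cf (N - 1/2) (l+1/2) * up 1 i 1 N l m =
     q powr (1/2) * (up 1 i 1 (N-1) l m * cf (N-1) l) + q powr (1/2-N) * up 1 i (-1) N l m"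
    if "(l, m) \<in> gidx N" for l m
    unfolding up_def
  proof (rule three_term)
    show "sqrt (br (l + 1*N + 1)) * sqrt (br (l + 1*N + 1)) = br (l + N + 1)" "sqrt (br (l + 1 * (N-1) + 1)) * sqrt (br (l + 1 * (N-1) + 1)) = br (l + N)"
      using gidxD[OF that] by simp_all
    show "q powr (1/2) * q powr (1 * ((m-(N-1))/2 + (1-i)/2 * (l+1/2))) = q * q powr (1 * ((m-N)/2 + (1-i)/2 * (l+1/2)))"
      "q powr (1/2-N) * q powr (1 * ((m-N)/2 + (-1-i)/2 * (l+1/2))) = q powr (-(l + N)) * q powr (1 * ((m-N)/2 + (1-i)/2 * (l+1/2)))"
      by (simp_all only: powr_add[symmetric], rule powr_eqI[OF _ q1(2)[symmetric]], simp add: field_simps)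
        (rule arg_cong[where f="\<lambda>x. q powr x"], simp add: field_simps)
    show "br (l + N + 1) = q * br (l + N) + q powr (-(l + N))" using br_succ(2)[of "l+N"] powr_minus_divide[of q "l+N"] by simp
    show "cf (N - 1/2) (l+1/2) = sqrt (br (l + 1*N + 1)) * sqrt (br (l + -1*N + 1))"
      "cf (N-1) l = sqrt (br (l + 1*(N-1) + 1)) * sqrt (br (l + -1*N + 1))" by (simp_all add: cf_def algebra_simps)
  qed
  moreover have "cf (N - 1/2) (l-1/2) * dn 1 i 1 N l m =
     q powr (1/2) * (dn 1 i 1 (N-1) l m * cf (N-1) l) + q powr (1/2-N) * dn 1 i (-1) N l m"
    if "(l, m) \<in> gidx N" for l m
    unfolding dn_def
  proof (rule three_term)
    show "sqrt (br (l - 1*N)) * sqrt (br (l - 1*N)) = br (l - N)" "sqrt (br (l - 1 * (N-1))) * sqrt (br (l - 1 * (N-1))) = br (l - N + 1)"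
      using gidxD[OF that] by (simp_all add: algebra_simps)
    have 1: "q powr (1/2) * q powr (1 * ((m-(N-1))/2 - (1-i)/2 * (l+1/2))) = q * q powr (1 * ((m-N)/2 - (1-i)/2 * (l+1/2)))"
      by (simp only: powr_add[symmetric], rule powr_eqI[OF _ q1(2)[symmetric]], simp add: field_simps)
    have 2: "q powr (1/2-N) * q powr (1 * ((m-N)/2 - (-1-i)/2 * (l+1/2))) = q powr (l - N + 1) * q powr (1 * ((m-N)/2 - (1-i)/2 * (l+1/2)))"
      unfolding powr_add[symmetric] by (rule arg_cong[where f="\<lambda>x. q powr x"], simp add: field_simps)
    show "q powr (1/2) * (- (i * 1) * q powr (1 * ((m-(N-1))/2 - (1-i)/2 * (l+1/2)))) = q * (- (i * 1) * q powr (1 * ((m-N)/2 - (1-i)/2 * (l+1/2))))"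
      using 1 by (simp add: mult_ac)
    show "q powr (1/2-N) * (- (i * -1) * q powr (1 * ((m-N)/2 - (-1-i)/2 * (l+1/2)))) = (- (q powr (l - N + 1))) * (- (i * 1) * q powr (1 * ((m-N)/2 - (1-i)/2 * (l+1/2))))"
      using 2 by (simp add: mult_ac)
    have "q * br (l - N + 1) = br (l - N) + q powr (l-N+1)"
    proof -
      have "q powr (l-N+1) = q powr (l-N) * q" using powr_add[of q "l-N" 1] q_pos by simp
      thus ?thesis unfolding br_succ(1) using q_pos by (simp add: field_simps)
    qed
    thus "br (l - N) = q * br (l - N + 1) + - (q powr (l - N + 1))" by simp
    show "cf (N - 1/2) (l-1/2) = sqrt (br (l - 1*N)) * sqrt (br (l - -1*N))"
      "cf (N-1) l = sqrt (br (l - 1*(N-1))) * sqrt (br (l - -1*N))" by (simp_all add: cf_def algebra_simps)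
  qed
  ultimately show ?thesis
    unfolding spin_def mulc_hop hop_mulc hop_combine by - (rule fun_cong[OF hop_cong[OF f]], blast+)
qed

text \<open>The weights for (-i,-j) are those for (i,j) read along the reversed steps, up to the
  sign -ij. This is the star of the matrix entries.\<close>

lemma up_dn_adjoint:
  assumes "i \<in> {1,-1}" "j \<in> {1,-1}"
  shows "dn 1 (-i) (-j) (N + j/2) (l+1/2) (m+i/2) = - (i*j) * up 1 i j N l m"
    and "up 1 (-i) (-j) (N + j/2) (l-1/2) (m+i/2) = - (i*j) * dn 1 i j N l m"
proof -
  have e: "q powr (1 * ((m+i/2-(N+j/2))/2 - (-j - -i)/2 * (l+1/2+1/2))) = q powr (1 * ((m-N)/2 + (j-i)/2 * (l+1/2)))"
    "q powr (1 * ((m+i/2-(N+j/2))/2 + (-j - -i)/2 * (l-1/2+1/2))) = q powr (1 * ((m-N)/2 - (j-i)/2 * (l+1/2)))"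
    by (rule arg_cong[where f="\<lambda>x. q powr x"], simp add: field_simps)+
  have r: "l+1/2 - -x*(y+x/2) = l+x*y+1" "l-1/2+ -x*(y+x/2)+1 = l-x*y" if "x \<in> {1,-1}" for x y using that by auto
  show "dn 1 (-i) (-j) (N + j/2) (l+1/2) (m+i/2) = - (i*j) * up 1 i j N l m"
    unfolding dn_def up_def e r[OF assms(1)] r[OF assms(2)] by simp
  have "i*j*(i*j) = 1" using assms by auto
  thus "up 1 (-i) (-j) (N + j/2) (l-1/2) (m+i/2) = - (i*j) * dn 1 i j N l m"
    unfolding dn_def up_def e r[OF assms(1)] r[OF assms(2)] by (simp add: mult.assoc[symmetric])
qed

text \<open>By \<open>up_dn_adjoint\<close> the diagonal coefficient of a spin operator followed by
  its reversal is, up to sign, the sum of the squares of the two weights. The determinant relations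
  then say that such sums, weighted with 1 and q or with 1 and 1/q, add up to 1.\<close>

lemma up_dn_bound:
  assumes "i \<in> {1,-1}" "j \<in> {1,-1}" "(l, m) \<in> gidx N"
  shows "\<bar>up 1 i j N l m\<bar> \<le> 1/q" "\<bar>dn 1 i j N l m\<bar> \<le> 1/q"
proof -
  define S where "S i j = (up 1 i j N l m)^2 + (dn 1 i j N l m)^2" for i j
  have d: "diag 1 i j 1 (-i) (-j) N l m = - (i*j) * S i j" if "i \<in> {1,-1}" "j \<in> {1,-1}" for i j
    unfolding diag_def up_dn_adjoint[OF that] S_def by (simp add: power2_eq_square algebra_simps)
  have u: "S 1 (-1) + q * S 1 1 = 1" "S (-1) 1 + 1/q * S (-1) (-1) = 1"
    using diag_unit[OF gidxD(1-4)[OF assms(3)]] d[of 1 1] d[of 1 "-1"] d[of "-1" 1] d[of "-1" "-1"] by simp_all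
  have p: "0 \<le> S i j" for i j by (simp add: S_def)
  have q1: "1 \<le> 1/q" "q * q \<le> 1" using q_pos q_less_1 by (simp_all add: mult_le_one)
  have s1: "S 1 (-1) \<le> 1" "q * S 1 1 \<le> 1" using u(1) p[of 1 "-1"] mult_nonneg_nonneg[OF less_imp_le[OF q_pos] p[of 1 1]] by linarith+
  have s2: "S (-1) 1 \<le> 1" "S (-1) (-1) \<le> q"
  proof -
    have "0 \<le> 1/q * S (-1) (-1)" using p q_pos by simp
    thus "S (-1) 1 \<le> 1" using u(2) by linarith
    have "1/q * S (-1) (-1) \<le> 1" using u(2) p[of "-1" 1] by linarith
    thus "S (-1) (-1) \<le> q" using q_pos by (simp add: field_simps)
  qed
  have "S i j \<le> 1/q"
  proof -
    have "S 1 1 \<le> 1/q" using s1 q_pos by (simp add: field_simps)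
    thus ?thesis using s1 s2 q1 q_less_1 assms(1,2) by auto
  qed
  also have "1/q \<le> (1/q)^2"
  proof -
    have "1 * (1/q) \<le> (1/q) * (1/q)" using q1(1) q_pos by (intro mult_right_mono) auto
    thus ?thesis by (simp add: power2_eq_square)
  qed
  finally have S: "S i j \<le> (1/q)^2" .
  have "(up 1 i j N l m)^2 \<le> S i j" "(dn 1 i j N l m)^2 \<le> S i j" by (simp_all add: S_def)
  hence "(up 1 i j N l m)^2 \<le> (1/q)^2" "(dn 1 i j N l m)^2 \<le> (1/q)^2" using S by linarith+
  thus "\<bar>up 1 i j N l m\<bar> \<le> 1/q" "\<bar>dn 1 i j N l m\<bar> \<le> 1/q" using q_pos abs_le_square_iff[of _ "1/q"] by simp_all
qed
end

section \<open>The generators as products of spin-1/2 operators\<close>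

text \<open>Integrality of 2N turns the conditions on \<open>l + N\<close> and \<open>l - m\<close>
  into inequalities, which hold on \<open>idx N\<close>.\<close>

lemma idx_eq:
  assumes "2 * N \<in> \<int>"
  shows "idx N = gidx N"
proof (rule Set.set_eqI, rule iffI)
  fix x assume "x \<in> idx N"
  then obtain l m k j where x: "x = (l, m)" and l: "l = \<bar>N\<bar> + real k" and m: "m = - l + real j" "m \<le> l"
    by (auto simp: idx_def)
  have 1: "l + m \<in> \<nat>" using m by simp
  have "\<bar>2 * N\<bar> \<in> \<int>" using assms by simp
  hence n: "2 * \<bar>N\<bar> \<in> \<int>" by (simp add: abs_mult)
  hence "2 * \<bar>N\<bar> + 2 * real k - real j \<in> \<int>" by (intro Ints_diff Ints_add) auto
  moreover have "l - m = 2 * \<bar>N\<bar> + 2 * real k - real j" using l m by simp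
  ultimately have 2: "l - m \<in> \<nat>" using m by (simp add: Nats_altdef2)
  have 3: "l - \<bar>N\<bar> \<in> \<nat>" using l by simp
  have "2 * \<bar>N\<bar> + real k \<in> \<int>" using n by (intro Ints_add) auto
  hence 4: "l + \<bar>N\<bar> \<in> \<nat>" using l by (simp add: Nats_altdef2 algebra_simps)
  show "x \<in> gidx N" using 1 2 3 4 by (cases "N \<ge> 0") (auto simp: gidx_def x)
next
  fix x assume "x \<in> gidx N"
  then obtain l m where x: "x = (l, m)" and g: "l + m \<in> \<nat>" "l - m \<in> \<nat>" "l + N \<in> \<nat>" "l - N \<in> \<nat>"
    by (auto simp: gidx_def)
  have "l - \<bar>N\<bar> \<in> \<nat>" using g by (cases "N \<ge> 0") auto
  then obtain k where k: "l - \<bar>N\<bar> = real k" by (auto elim: Nats_cases)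
  obtain j where j: "l + m = real j" using g(1) by (auto elim: Nats_cases)
  have "0 \<le> l - m" using g(2) by (simp add: Nats_altdef2)
  moreover have "l = \<bar>N\<bar> + real k" "m = - l + real j" using k j by simp_all
  ultimately show "x \<in> idx N" unfolding idx_def x by auto
qed

text \<open>The common shape of \<open>A_ket\<close>, \<open>B_ket\<close> and
  \<open>Bstar_ket\<close>, with \<open>s\<close> the shift of \<open>m\<close>.\<close>

definition ket3 :: "real \<Rightarrow> real \<Rightarrow> (real \<Rightarrow> real \<Rightarrow> real) \<Rightarrow> (real \<Rightarrow> real \<Rightarrow> real) \<Rightarrow> (real \<Rightarrow> real \<Rightarrow> real)
    \<Rightarrow> real \<times> real \<Rightarrow> vec" where
  "ket3 N s u v w = (\<lambda>(l, m) i. complex_of_real (u l m) * ket N (l+1, m+s) i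
     + complex_of_real (v l m) * ket N (l, m+s) i + complex_of_real (w l m) * ket N (l-1, m+s) i)"

text \<open>A coordinate receives contributions from at most three sources, which makes the infinite
  sum a finite one. The truncation to \<open>idx N\<close> comes from \<open>ket\<close>, which is 0
  for vectors outside the basis.\<close>

lemma lin_ext_ket3: "lin_ext (ket3 N s u v w) f = (\<lambda>i. if i \<in> idx N then band s u v w f i else 0)"
proof
  fix i :: "real \<times> real"
  obtain l m where i: "i = (l, m)" by (cases i)
  show "lin_ext (ket3 N s u v w) f i = (if i \<in> idx N then band s u v w f i else 0)"
  proof (cases "i \<in> idx N")
    case False
    hence "ket N j i = 0" for j by (auto simp: ket_def)
    hence "ket3 N s u v w j i = 0" for j by (cases j) (simp add: ket3_def)
    thus ?thesis using False by (simp add: lin_ext_def)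
  next
    case True
    have k: "ket N j i = (if j = i then 1 else 0)" for j using True by (auto simp: ket_def)
    define P where "P = {(l-1, m-s), (l, m-s), (l+1, m-s)}"
    have "lin_ext (ket3 N s u v w) f i = (\<Sum>\<^sub>\<infinity>j\<in>P. f j * ket3 N s u v w j i)"
      unfolding lin_ext_def by (rule infsum_cong_neutral) (auto simp: P_def ket3_def k[unfolded i] i split: if_splits)
    also have "\<dots> = (\<Sum>j\<in>P. f j * ket3 N s u v w j i)" by (rule infsum_finite) (simp add: P_def)
    also have "\<dots> = band s u v w f i" by (simp add: P_def ket3_def k[unfolded i] i band_def)
    finally show ?thesis using True by simp
  qed
qed

context deformation begin

lemma r_plus_eq:
  "r_plus q N l = q powr (-l-3/2-N) * (sqrt (br (l-N+1)) * sqrt (br (l+N+1)))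
    / (br (2*l+2) * (sqrt (br (2*l+1)) * sqrt (br (2*l+3))))"
  by (simp add: r_plus_def real_sqrt_mult mult_ac)

lemma up_up_eq:
  assumes "0 \<le> l"
  shows "up 1 i 1 (N - 1/2) (l+1/2) (m+k/2) * up 1 k (-1) N l m =
    q powr ((m-N) + (k+1)/4 - (1+k)/2*(l+1/2) + (1-i)/2*(l+1))
    * ((sqrt (br (l+k*m+1)) * sqrt (br (l+1/2+i*(m+k/2)+1))) * (sqrt (br (l-N+1)) * sqrt (br (l+N+1))))
    / (br (2*l+2) * (sqrt (br (2*l+1)) * sqrt (br (2*l+3))))"
proof -
  have "sqrt (br (2*l+2)) * sqrt (br (2*l+2)) = br (2*l+2)" using assms by simp
  hence k: "kap (l+1/2) * kap l = 1 / (br (2*l+2) * (sqrt (br (2*l+1)) * sqrt (br (2*l+3))))"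
    unfolding kap_def by (simp add: algebra_simps)
  have e: "q powr (1*((m+k/2 - (N-1/2))/2 + (1-i)/2*(l+1/2+1/2))) * q powr (1*((m-N)/2 + (-1-k)/2*(l+1/2)))
      = q powr ((m-N) + (k+1)/4 - (1+k)/2*(l+1/2) + (1-i)/2*(l+1))"
    unfolding powr_add[symmetric] by (rule arg_cong[where f="\<lambda>x. q powr x"]) (simp add: field_simps)
  have n: "l+1/2+1*(N-1/2)+1 = l+N+1" "l + -1*N+1 = l-N+1" by simp_all
  have "up 1 i 1 (N - 1/2) (l+1/2) (m+k/2) * up 1 k (-1) N l m =
    (q powr (1*((m+k/2 - (N-1/2))/2 + (1-i)/2*(l+1/2+1/2))) * q powr (1*((m-N)/2 + (-1-k)/2*(l+1/2))))
    * ((sqrt (br (l+k*m+1)) * sqrt (br (l+1/2+i*(m+k/2)+1))) * (sqrt (br (l-N+1)) * sqrt (br (l+N+1))))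
    * (kap (l+1/2) * kap l)"
    unfolding up_def n by (simp only: mult_ac)
  thus ?thesis unfolding e k by simp
qed

lemma dn_dn_eq:
  assumes "0 \<le> l"
  shows "dn 1 i 1 (N - 1/2) (l-1/2) (m+k/2) * dn 1 k (-1) N l m =
    - (i*k) * q powr ((m-N) + (k+1)/4 + (1+k)/2*(l+1/2) - (1-i)/2*l)
    * ((sqrt (br (l-k*m)) * sqrt (br (l-1/2-i*(m+k/2)))) * (sqrt (br (l-N)) * sqrt (br (l+N))))
    / (br (2*l) * (sqrt (br (2*l-1)) * sqrt (br (2*l+1))))"
proof -
  have "sqrt (br (2*l)) * sqrt (br (2*l)) = br (2*l)" using assms by simp
  hence k: "kap (l-1/2-1/2) * kap (l-1/2) = 1 / (br (2*l) * (sqrt (br (2*l-1)) * sqrt (br (2*l+1))))"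
    unfolding kap_def by (simp add: algebra_simps)
  have e: "q powr (1*((m+k/2 - (N-1/2))/2 - (1-i)/2*(l-1/2+1/2))) * q powr (1*((m-N)/2 - (-1-k)/2*(l+1/2)))
      = q powr ((m-N) + (k+1)/4 + (1+k)/2*(l+1/2) - (1-i)/2*l)"
    unfolding powr_add[symmetric] by (rule arg_cong[where f="\<lambda>x. q powr x"]) (simp add: field_simps)
  have n: "l-1/2-1*(N-1/2) = l-N" "l - -1*N = l+N" by simp_all
  have "dn 1 i 1 (N - 1/2) (l-1/2) (m+k/2) * dn 1 k (-1) N l m =
    (- (i*1) * - (k * -1)) * (q powr (1*((m+k/2 - (N-1/2))/2 - (1-i)/2*(l-1/2+1/2))) * q powr (1*((m-N)/2 - (-1-k)/2*(l+1/2))))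
    * ((sqrt (br (l-k*m)) * sqrt (br (l-1/2-i*(m+k/2)))) * (sqrt (br (l-N)) * sqrt (br (l+N))))
    * (kap (l-1/2-1/2) * kap (l-1/2))"
    unfolding dn_def n by (simp only: mult_ac)
  thus ?thesis unfolding e k by simp
qed

text \<open>A generator is exactly \<open>gen_c\<close> times a product of two matrix entries, with
  no summand added. The inner factor has the signs (\<open>gen_k\<close>, -1) and lowers
  \<open>N\<close> by 1/2, the outer one has (\<open>gen_i\<close>, 1) and restores it. The
  constants are found by comparison with the given coefficients.\<close>

fun gen_c :: "gen \<Rightarrow> real" where
  "gen_c GA = - (1/q)" | "gen_c GB = q powr (-3/2)" | "gen_c GBstar = - (q powr (-3/2))"

fun gen_i :: "gen \<Rightarrow> real" where
  "gen_i GA = 1" | "gen_i GB = 1" | "gen_i GBstar = -1"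

fun gen_k :: "gen \<Rightarrow> real" where
  "gen_k GA = -1" | "gen_k GB = 1" | "gen_k GBstar = -1"

lemma quotient_match:
  fixes c :: real
  assumes "c * P1 = p * P2" "S = S'"
  shows "c * (P1 * (S * R) / E) = p * S' * (P2 * R / E)"
proof -
  have "c * (P1 * (S * R) / E) = (c * P1) * (S * R / E)" by simp
  thus ?thesis unfolding assms by simp
qed

lemma q_powr_half: "q * q powr x = q powr (1 + x)" "1/q * q powr x = q powr (x - 1)"
  using q_pos by (simp_all add: powr_add powr_diff)

lemma gen_up:
  assumes "0 \<le> l"
  shows "- (1/q) * (up 1 1 1 (N-1/2) (l+1/2) (m+ -1/2) * up 1 (-1) (-1) N l m) =
      - (q powr (m+l+1/2)) * sqrt (br (l-m+1) * br (l+m+1)) * r_plus q N l"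
    and "q powr (-3/2) * (up 1 1 1 (N-1/2) (l+1/2) (m+1/2) * up 1 1 (-1) N l m) =
      q powr m * sqrt (br (l+m+1) * br (l+m+2)) * r_plus q N l"
    and "- (q powr (-3/2)) * (up 1 (-1) 1 (N-1/2) (l+1/2) (m+ -1/2) * up 1 (-1) (-1) N l m) =
      q powr (m-1) * sqrt (br (l-m+2) * br (l-m+1)) * r_minus q N (l+1)"
proof -
  show "- (1/q) * (up 1 1 1 (N-1/2) (l+1/2) (m+ -1/2) * up 1 (-1) (-1) N l m) =
      - (q powr (m+l+1/2)) * sqrt (br (l-m+1) * br (l+m+1)) * r_plus q N l"
    unfolding up_up_eq[OF assms, of 1 N m "-1"] r_plus_eq
    by (rule quotient_match) (simp_all add: real_sqrt_mult powr_add[symmetric] q_powr_half[simplified] algebra_simps)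
  show "q powr (-3/2) * (up 1 1 1 (N-1/2) (l+1/2) (m+1/2) * up 1 1 (-1) N l m) =
      q powr m * sqrt (br (l+m+1) * br (l+m+2)) * r_plus q N l"
    unfolding up_up_eq[OF assms, of 1 N m 1] r_plus_eq
    by (rule quotient_match) (simp_all add: real_sqrt_mult powr_add[symmetric] algebra_simps)
  have r: "r_minus q N (l+1) = - (q powr (2*(l+1)) * q powr (-l-3/2-N)) * (sqrt (br (l-N+1)) * sqrt (br (l+N+1)))
    / (br (2*l+2) * (sqrt (br (2*l+1)) * sqrt (br (2*l+3))))"
    by (simp add: r_minus_def r_plus_eq)
  show "- (q powr (-3/2)) * (up 1 (-1) 1 (N-1/2) (l+1/2) (m+ -1/2) * up 1 (-1) (-1) N l m) =
      q powr (m-1) * sqrt (br (l-m+2) * br (l-m+1)) * r_minus q N (l+1)"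
    unfolding up_up_eq[OF assms, of "-1" N m "-1"] r
    by (rule quotient_match) (simp_all add: real_sqrt_mult powr_add[symmetric] algebra_simps)
qed

lemma gen_dn:
  assumes "0 \<le> l"
  shows "- (1/q) * (dn 1 1 1 (N-1/2) (l-1/2) (m+ -1/2) * dn 1 (-1) (-1) N l m) =
      q powr (m-l-1/2) * sqrt (br (l-m) * br (l+m)) * r_minus q N l"
    and "q powr (-3/2) * (dn 1 1 1 (N-1/2) (l-1/2) (m+1/2) * dn 1 1 (-1) N l m) =
      q powr m * sqrt (br (l-m) * br (l-m-1)) * r_minus q N l"
    and "- (q powr (-3/2)) * (dn 1 (-1) 1 (N-1/2) (l-1/2) (m+ -1/2) * dn 1 (-1) (-1) N l m) =
      q powr (m-1) * sqrt (br (l+m) * br (l+m-1)) * r_plus q N (l-1)"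
proof -
  have r0: "r_plus q N (l-1) = q powr (-l-1/2-N) * (sqrt (br (l-N)) * sqrt (br (l+N)))
    / (br (2*l) * (sqrt (br (2*l-1)) * sqrt (br (2*l+1))))"
    by (simp add: r_plus_eq algebra_simps)
  have r: "r_minus q N l = - (q powr (2*l) * q powr (-l-1/2-N)) * (sqrt (br (l-N)) * sqrt (br (l+N)))
    / (br (2*l) * (sqrt (br (2*l-1)) * sqrt (br (2*l+1))))"
    by (simp add: r_minus_def r0)
  show "- (1/q) * (dn 1 1 1 (N-1/2) (l-1/2) (m+ -1/2) * dn 1 (-1) (-1) N l m) =
      q powr (m-l-1/2) * sqrt (br (l-m) * br (l+m)) * r_minus q N l"
    unfolding dn_dn_eq[OF assms, of 1 N m "-1"] r
    by (rule quotient_match) (simp_all add: real_sqrt_mult powr_add[symmetric] q_powr_half[simplified] algebra_simps)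
  show "q powr (-3/2) * (dn 1 1 1 (N-1/2) (l-1/2) (m+1/2) * dn 1 1 (-1) N l m) =
      q powr m * sqrt (br (l-m) * br (l-m-1)) * r_minus q N l"
    unfolding dn_dn_eq[OF assms, of 1 N m 1] r
    by (rule quotient_match) (simp_all add: real_sqrt_mult powr_add[symmetric] algebra_simps)
  show "- (q powr (-3/2)) * (dn 1 (-1) 1 (N-1/2) (l-1/2) (m+ -1/2) * dn 1 (-1) (-1) N l m) =
      q powr (m-1) * sqrt (br (l+m) * br (l+m-1)) * r_plus q N (l-1)"
    unfolding dn_dn_eq[OF assms, of "-1" N m "-1"] r0
    by (rule quotient_match) (simp_all add: real_sqrt_mult powr_add[symmetric] algebra_simps)
qed

text \<open>At \<open>l = 0\<close> the convention that \<open>r_zero\<close> is 0 agrees with the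
  product: for B and B* a root vanishes, and for A the value 1/(1+q^2) is left on both
  sides.\<close>

lemma gen_diag:
  assumes "0 \<le> l+m" "0 \<le> l-m" "0 \<le> l+N" "0 \<le> l-N"
  shows "- (1/q) * diag 1 (-1) (-1) 1 1 1 N l m = q powr (-1/2) / (1 + q\<^sup>2) *
         ((br (l-m+1) * br (l+m) - q\<^sup>2 * br (l-m) * br (l+m+1)) * r_zero q N l + q powr (1/2))" (is ?A)
    and "q powr (-3/2) * diag 1 1 (-1) 1 1 1 N l m = q powr m * sqrt (br (l+m+1) * br (l-m)) * r_zero q N l" (is ?B)
    and "- (q powr (-3/2)) * diag 1 (-1) (-1) 1 (-1) 1 N l m =
      q powr (m-1) * sqrt (br (l+m) * br (l-m+1)) * r_zero q N l" (is ?C)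
proof -
  have d: "diag 1 i (-1) 1 k 1 N l m = - (q powr (m - N) / br (2*l+1)) * core i (-1) k 1 N l m"
    if "i \<in> {1,-1}" "k \<in> {1,-1}" for i k by (rule diag_left) (use assms that in auto)
  have "?A \<and> ?B \<and> ?C"
  proof (cases "l = 0")
    case False
    hence l: "0 < l" using assms by simp
    show ?thesis using core_A[OF l, of m N] core_BC[OF l, of m N]
      by (simp add: d real_sqrt_mult)
  next
    case True
    hence z: "m = 0" "N = 0" using assms by auto
    have 1: "br 1 = 1" using q_pos dq_neq by (simp add: qnum_def powr_minus_divide dq_def)
    have "q powr 2 - q powr (-2) = dq * (q + 1/q)"
      using q_pos by (simp add: powr_minus_divide dq_def field_simps power2_eq_square)
    hence "br 2 = q + 1/q" using dq_neq by (simp add: br_dq)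
    hence "1/q / br 2 = 1 / (1 + q^2)" using q_pos by (simp add: field_simps power2_eq_square)
    moreover have "q powr (-1/2) * q powr (1/2) = 1" using q_pos by (simp add: powr_add[symmetric])
    ultimately show ?thesis using q_pos
      by (simp add: d[unfolded True z] True z r_zero_def core_def prod_up_def prod_dn_def rt_def 1 field_simps)
  qed
  thus ?A ?B ?C by blast+
qed

text \<open>On the index set the three coefficients are matched. Off it both sides vanish,
  \<open>lin_ext\<close> by truncation and the product of the spin operators by
  \<open>supp_spin\<close>.\<close>

lemma gen_op_eq:
  assumes N: "2 * N \<in> \<int>" and f: "supp N f"
  shows "gen_op q N g f = (\<lambda>x. complex_of_real (gen_c g) * spin 1 (gen_i g) 1 (N - 1/2) (spin 1 (gen_k g) (-1) N f) x)"
proof -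
  have gi: "gen_i g \<in> {1,-1}" "gen_k g \<in> {1,-1}" for g by (cases g; simp)+
  have s: "supp N (spin 1 (gen_i g) 1 (N - 1/2) (spin 1 (gen_k g) (-1) N f))" for g
  proof -
    have "supp (N + -1/2) (spin 1 (gen_k g) (-1) N f)" by (rule supp_spin) (use gi f in auto)
    hence "supp (N - 1/2 + 1/2) (spin 1 (gen_i g) 1 (N - 1/2) (spin 1 (gen_k g) (-1) N f))"
      by (intro supp_spin) (use gi in auto)
    thus ?thesis by simp
  qed
  have T: "complex_of_real c * spin 1 i 1 (N - 1/2) (spin 1 k (-1) N f) x =
    band (k/2 + i/2) (\<lambda>l m. c * (up 1 i 1 (N-1/2) (l+1/2) (m+k/2) * up 1 k (-1) N l m))
      (\<lambda>l m. c * diag 1 k (-1) 1 i 1 N l m)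
      (\<lambda>l m. c * (dn 1 i 1 (N-1/2) (l-1/2) (m+k/2) * dn 1 k (-1) N l m)) f x" for c i k x
    using spin_spin[of 1 i 1 N "-1" 1 k f] by (simp add: band_scale)
  have K: "lin_ext (ket3 N s u v w) f = (\<lambda>x. complex_of_real (gen_c g) * spin 1 (gen_i g) 1 (N - 1/2) (spin 1 (gen_k g) (-1) N f) x)"
    if "s = gen_k g / 2 + gen_i g / 2"
      "\<And>l m. (l, m) \<in> gidx N \<Longrightarrow> gen_c g * (up 1 (gen_i g) 1 (N-1/2) (l+1/2) (m+gen_k g/2) * up 1 (gen_k g) (-1) N l m) = u l m"
      "\<And>l m. (l, m) \<in> gidx N \<Longrightarrow> gen_c g * diag 1 (gen_k g) (-1) 1 (gen_i g) 1 N l m = v l m"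
      "\<And>l m. (l, m) \<in> gidx N \<Longrightarrow> gen_c g * (dn 1 (gen_i g) 1 (N-1/2) (l-1/2) (m+gen_k g/2) * dn 1 (gen_k g) (-1) N l m) = w l m"
    for g s u v w
    unfolding lin_ext_ket3 idx_eq[OF N]
  proof
    fix x
    show "(if x \<in> gidx N then band s u v w f x else 0) = complex_of_real (gen_c g) * spin 1 (gen_i g) 1 (N - 1/2) (spin 1 (gen_k g) (-1) N f) x"
    proof (cases "x \<in> gidx N")
      case False thus ?thesis using supp_not[OF s] by simp
    next
      case True
      show ?thesis unfolding T that(1) using True
        by simp (rule fun_cong[OF band_cong[OF f]]; simp add: that)
    qed
  qed
  show ?thesis
  proof (cases g)
    case GA
    have e: "A_ket q N = ket3 N 0 (\<lambda>l m. - (q powr (m+l+1/2)) * sqrt (br (l-m+1) * br (l+m+1)) * r_plus q N l)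
      (\<lambda>l m. q powr (-1/2) / (1 + q\<^sup>2) * ((br (l-m+1) * br (l+m) - q\<^sup>2 * br (l-m) * br (l+m+1)) * r_zero q N l + q powr (1/2)))
      (\<lambda>l m. q powr (m-l-1/2) * sqrt (br (l-m) * br (l+m)) * r_minus q N l)"
      by (simp add: A_ket_def ket3_def)
    have "gen_op q N g f = lin_ext (A_ket q N) f" by (simp add: GA)
    also have "\<dots> = (\<lambda>x. complex_of_real (gen_c g) * spin 1 (gen_i g) 1 (N - 1/2) (spin 1 (gen_k g) (-1) N f) x)"
      unfolding e by (rule K) (use gen_up(1) gen_dn(1) gen_diag(1) gidxD in \<open>simp_all add: GA\<close>)
    finally show ?thesis .
  next
    case GB
    have e: "B_ket q N = ket3 N 1 (\<lambda>l m. q powr m * sqrt (br (l+m+1) * br (l+m+2)) * r_plus q N l)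
      (\<lambda>l m. q powr m * sqrt (br (l+m+1) * br (l-m)) * r_zero q N l)
      (\<lambda>l m. q powr m * sqrt (br (l-m) * br (l-m-1)) * r_minus q N l)"
      by (simp add: B_ket_def ket3_def)
    have "gen_op q N g f = lin_ext (B_ket q N) f" by (simp add: GB)
    also have "\<dots> = (\<lambda>x. complex_of_real (gen_c g) * spin 1 (gen_i g) 1 (N - 1/2) (spin 1 (gen_k g) (-1) N f) x)"
      unfolding e by (rule K) (use gen_up(2) gen_dn(2) gen_diag(2) gidxD in \<open>simp_all add: GB\<close>)
    finally show ?thesis .
  next
    case GBstar
    have e: "Bstar_ket q N = ket3 N (-1) (\<lambda>l m. q powr (m-1) * sqrt (br (l-m+2) * br (l-m+1)) * r_minus q N (l+1))
      (\<lambda>l m. q powr (m-1) * sqrt (br (l+m) * br (l-m+1)) * r_zero q N l)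
      (\<lambda>l m. q powr (m-1) * sqrt (br (l+m) * br (l+m-1)) * r_plus q N (l-1))"
      by (simp add: Bstar_ket_def ket3_def)
    have "gen_op q N g f = lin_ext (Bstar_ket q N) f" by (simp add: GBstar)
    also have "\<dots> = (\<lambda>x. complex_of_real (gen_c g) * spin 1 (gen_i g) 1 (N - 1/2) (spin 1 (gen_k g) (-1) N f) x)"
      unfolding e by (rule K) (use gen_up(3) gen_dn(3) gen_diag(3) gidxD in \<open>simp_all add: GBstar\<close>)
    finally show ?thesis .
  qed
qed
end

section \<open>Square-summable functions\<close>

text \<open>Summation is over the whole type. Index sets enter only through supports, so that
  functions from different spaces V_N can be shifted, added and paired without restriction
  maps.\<close>

definition l2 :: "('i \<Rightarrow> complex) \<Rightarrow> bool" where
  "l2 f \<longleftrightarrow> (\<lambda>x. (cmod (f x))\<^sup>2) summable_on UNIV"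

definition n2 :: "('i \<Rightarrow> complex) \<Rightarrow> real" where
  "n2 f = (\<Sum>\<^sub>\<infinity>x. (cmod (f x))\<^sup>2)"

definition ip2 :: "('i \<Rightarrow> complex) \<Rightarrow> ('i \<Rightarrow> complex) \<Rightarrow> complex" where
  "ip2 f g = (\<Sum>\<^sub>\<infinity>x. cnj (f x) * g x)"

lemma cmod_add_sq: "(cmod (a + b))\<^sup>2 \<le> 2 * (cmod a)\<^sup>2 + 2 * (cmod b)\<^sup>2"
proof -
  have "(cmod (a + b))\<^sup>2 \<le> (cmod a + cmod b)\<^sup>2" by (intro power_mono norm_triangle_ineq) simp
  also have "\<dots> \<le> 2 * (cmod a)\<^sup>2 + 2 * (cmod b)\<^sup>2"
    using sum_squares_bound[of "cmod a" "cmod b"] by (simp add: power2_sum)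
  finally show ?thesis .
qed

lemma n2_nonneg [simp]: "0 \<le> n2 f"
  unfolding n2_def by (rule infsum_nonneg) simp

lemma l2_dominated:
  assumes "l2 f" "\<And>x. cmod (g x) \<le> C * cmod (f x)"
  shows "l2 g" "n2 g \<le> C\<^sup>2 * n2 f"
proof -
  have *: "(cmod (g x))\<^sup>2 \<le> C\<^sup>2 * (cmod (f x))\<^sup>2" for x
    using power_mono[OF assms(2), of x 2] by (simp add: power_mult_distrib)
  have s: "(\<lambda>x. C\<^sup>2 * (cmod (f x))\<^sup>2) summable_on UNIV"
    using assms(1) unfolding l2_def by (rule summable_on_cmult_right)
  show g: "l2 g" unfolding l2_def by (rule summable_on_comparison_test[OF s]) (use * in auto)
  have "n2 g \<le> (\<Sum>\<^sub>\<infinity>x. C\<^sup>2 * (cmod (f x))\<^sup>2)"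
    unfolding n2_def by (rule infsum_mono[OF _ s]) (use * g in \<open>auto simp: l2_def\<close>)
  thus "n2 g \<le> C\<^sup>2 * n2 f" by (simp add: n2_def infsum_cmult_right')
qed

lemma l2_add:
  assumes "l2 f" "l2 g"
  shows "l2 (\<lambda>x. f x + g x)" "n2 (\<lambda>x. f x + g x) \<le> 2 * n2 f + 2 * n2 g"
proof -
  have s1: "(\<lambda>x. 2 * (cmod (f x))\<^sup>2) summable_on UNIV" "(\<lambda>x. 2 * (cmod (g x))\<^sup>2) summable_on UNIV"
    using assms unfolding l2_def by (simp_all add: summable_on_cmult_right)
  have s: "(\<lambda>x. 2 * (cmod (f x))\<^sup>2 + 2 * (cmod (g x))\<^sup>2) summable_on UNIV"
    by (rule summable_on_add[OF s1])
  show fg: "l2 (\<lambda>x. f x + g x)" unfolding l2_def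
    by (rule summable_on_comparison_test[OF s]) (auto intro: cmod_add_sq)
  have "n2 (\<lambda>x. f x + g x) \<le> (\<Sum>\<^sub>\<infinity>x. 2 * (cmod (f x))\<^sup>2 + 2 * (cmod (g x))\<^sup>2)"
    unfolding n2_def by (rule infsum_mono[OF _ s]) (use fg in \<open>auto simp: l2_def intro: cmod_add_sq\<close>)
  thus "n2 (\<lambda>x. f x + g x) \<le> 2 * n2 f + 2 * n2 g"
    by (simp add: n2_def infsum_add[OF s1] infsum_cmult_right')
qed

lemma l2_scale: "l2 f \<Longrightarrow> l2 (\<lambda>x. c * f x)"
  by (rule l2_dominated(1)[where C="cmod c"]) (auto simp: norm_mult)

lemma n2_scale: "n2 (\<lambda>x. c * f x) = (cmod c)\<^sup>2 * n2 f"
  unfolding n2_def by (simp add: norm_mult power_mult_distrib infsum_cmult_right')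

lemma l2_uminus: "l2 f \<Longrightarrow> l2 (\<lambda>x. - f x)"
  by (simp add: l2_def)

lemma l2_diff: "l2 f \<Longrightarrow> l2 g \<Longrightarrow> l2 (\<lambda>x. f x - g x)"
  using l2_add(1)[of f "\<lambda>x. - g x"] l2_uminus[of g] by simp

lemma l2_zero [simp]: "l2 (\<lambda>x. 0)" "n2 (\<lambda>x. 0) = 0"
  by (simp_all add: l2_def n2_def)

lemma l2_bij:
  assumes "bij \<tau>"
  shows "l2 (\<lambda>x. f (\<tau> x)) \<longleftrightarrow> l2 f" "n2 (\<lambda>x. f (\<tau> x)) = n2 f" "ip2 (\<lambda>x. f (\<tau> x)) (\<lambda>x. g (\<tau> x)) = ip2 f g"
  unfolding l2_def n2_def ip2_def using assms
  by (rule summable_on_reindex_bij_betw infsum_reindex_bij_betw)+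

lemma l2_prod_abs_summable:
  assumes "l2 f" "l2 g"
  shows "(\<lambda>x. cmod (f x * g x)) summable_on UNIV"
proof -
  have s: "(\<lambda>x. (cmod (f x))\<^sup>2 + (cmod (g x))\<^sup>2) summable_on UNIV"
    using assms unfolding l2_def by (rule summable_on_add)
  have "cmod (f x) * cmod (g x) \<le> (cmod (f x))\<^sup>2 + (cmod (g x))\<^sup>2" for x
    using sum_squares_bound[of "cmod (f x)" "cmod (g x)"] mult_nonneg_nonneg[OF norm_ge_zero norm_ge_zero, of "f x" "g x"]
    by linarith
  thus ?thesis by (intro summable_on_comparison_test[OF s]) (auto simp: norm_mult)
qed

lemma l2_ip_summable:
  assumes "l2 f" "l2 g"
  shows "(\<lambda>x. cnj (f x) * g x) summable_on UNIV"
  by (rule abs_summable_summable) (use l2_prod_abs_summable[OF assms] in \<open>simp add: norm_mult\<close>)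

lemma ip2_self: "l2 f \<Longrightarrow> ip2 f f = complex_of_real (n2 f)"
proof -
  assume f: "l2 f"
  have "cnj (f x) * f x = complex_of_real ((cmod (f x))\<^sup>2)" for x
    by (simp add: complex_norm_square mult.commute del: of_real_power)
  moreover have "((\<lambda>x. complex_of_real ((cmod (f x))\<^sup>2)) has_sum complex_of_real (n2 f)) UNIV"
    unfolding n2_def by (rule has_sum_of_real[OF has_sum_infsum]) (use f in \<open>simp add: l2_def\<close>)
  ultimately show ?thesis unfolding ip2_def by (simp add: infsumI del: of_real_power)
qed

lemma ip2_add_right: "l2 f \<Longrightarrow> l2 g \<Longrightarrow> l2 h \<Longrightarrow> ip2 f (\<lambda>x. g x + h x) = ip2 f g + ip2 f h"
  unfolding ip2_def by (simp add: distrib_left infsum_add l2_ip_summable)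

lemma ip2_scale_right: "ip2 f (\<lambda>x. c * g x) = c * ip2 f g"
proof -
  have "(\<lambda>x. cnj (f x) * (c * g x)) = (\<lambda>x. c * (cnj (f x) * g x))" by (simp add: fun_eq_iff)
  thus ?thesis unfolding ip2_def by (simp add: infsum_cmult_right')
qed

lemma ip2_cnj: "cnj (ip2 f g) = ip2 g f"
  unfolding ip2_def infsum_cnj[symmetric] by (simp add: mult.commute)

lemma ip2_add_left: "l2 f \<Longrightarrow> l2 g \<Longrightarrow> l2 h \<Longrightarrow> ip2 (\<lambda>x. g x + h x) f = ip2 g f + ip2 h f"
proof -
  assume *: "l2 f" "l2 g" "l2 h"
  have "ip2 (\<lambda>x. g x + h x) f = cnj (ip2 f (\<lambda>x. g x + h x))" by (simp only: ip2_cnj)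
  also have "\<dots> = cnj (ip2 f g) + cnj (ip2 f h)" by (simp only: ip2_add_right[OF *] complex_cnj_add)
  finally show ?thesis by (simp only: ip2_cnj)
qed

lemma ip2_scale_left: "ip2 (\<lambda>x. c * f x) g = cnj c * ip2 f g"
proof -
  have "ip2 (\<lambda>x. c * f x) g = cnj (ip2 g (\<lambda>x. c * f x))" by (simp only: ip2_cnj)
  also have "\<dots> = cnj c * cnj (ip2 g f)" by (simp only: ip2_scale_right complex_cnj_mult)
  finally show ?thesis by (simp only: ip2_cnj)
qed

lemma finite_sum_le_n2: "l2 f \<Longrightarrow> finite F \<Longrightarrow> (\<Sum>x\<in>F. (cmod (f x))\<^sup>2) \<le> n2 f"
  unfolding n2_def l2_def by (rule finite_sum_le_infsum) auto

lemma cmod_sq_le_n2: "l2 f \<Longrightarrow> (cmod (f x))\<^sup>2 \<le> n2 f"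
  using finite_sum_le_n2[of f "{x}"] by simp

lemma n2_0D: "l2 f \<Longrightarrow> n2 f = 0 \<Longrightarrow> f x = 0"
  using cmod_sq_le_n2[of f x] by simp

lemma l2I_finite_sums:
  assumes "\<And>F. finite F \<Longrightarrow> (\<Sum>x\<in>F. (cmod (f x))\<^sup>2) \<le> b"
  shows "l2 f" "n2 f \<le> b"
proof -
  show "l2 f" unfolding l2_def
    by (rule nonneg_bdd_above_summable_on) (use assms in \<open>auto intro!: bdd_aboveI[of _ b]\<close>)
  thus "n2 f \<le> b" unfolding n2_def l2_def by (rule infsum_le_finite_sums) (use assms in auto)
qed

lemma l2_finite_support: "finite {x. f x \<noteq> 0} \<Longrightarrow> l2 f"
  unfolding l2_def by (rule finite_nonzero_values_imp_summable_on) simp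

lemma bij_shift: "bij (\<lambda>(l, m). (l + a, m + b))" for a b :: real
  by (rule bij_betw_byWitness[where f'="\<lambda>(l, m). (l - a, m - b)"]) auto

lemma l2_shift:
  fixes f :: vec
  shows "l2 (\<lambda>(l, m). f (l + a, m + b)) \<longleftrightarrow> l2 f" "n2 (\<lambda>(l, m). f (l + a, m + b)) = n2 f"
  using l2_bij(1,2)[OF bij_shift[of a b], of f] by (simp_all only: case_prod_unfold)

lemma weighted_le:
  assumes "supp N f" "\<And>l m. (l, m) \<in> gidx N \<Longrightarrow> \<bar>u l m\<bar> \<le> C"
  shows "cmod (complex_of_real (u l m) * f (l, m)) \<le> C * cmod (f (l, m))"
proof (cases "(l, m) \<in> gidx N")
  case True
  have "\<bar>u l m\<bar> * cmod (f (l, m)) \<le> C * cmod (f (l, m))"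
    by (rule mult_right_mono[OF assms(2)[OF True]]) simp
  thus ?thesis by (simp add: norm_mult)
next
  case False
  thus ?thesis using supp_not[OF assms(1)] by simp
qed

lemma l2_hop:
  assumes f: "supp N f" "l2 f" and u: "\<And>l m. (l, m) \<in> gidx N \<Longrightarrow> \<bar>u l m\<bar> \<le> C"
    and d: "\<And>l m. (l, m) \<in> gidx N \<Longrightarrow> \<bar>d l m\<bar> \<le> C"
  shows "l2 (hop s u d f)" "n2 (hop s u d f) \<le> 4 * C\<^sup>2 * n2 f"
proof -
  define f1 where "f1 = (\<lambda>(l, m). complex_of_real (u l m) * f (l, m))"
  define f2 where "f2 = (\<lambda>(l, m). complex_of_real (d l m) * f (l, m))"
  have w: "cmod (f1 x) \<le> C * cmod (f x)" "cmod (f2 x) \<le> C * cmod (f x)" for x :: "real \<times> real"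
  proof -
    obtain l m where x: "x = (l, m)" by (cases x)
    show "cmod (f1 x) \<le> C * cmod (f x)" unfolding x f1_def prod.case by (rule weighted_le[OF f(1) u])
    show "cmod (f2 x) \<le> C * cmod (f x)" unfolding x f2_def prod.case by (rule weighted_le[OF f(1) d])
  qed
  note 1 = l2_dominated[OF f(2) w(1)] l2_dominated[OF f(2) w(2)]
  define F1 where "F1 = (\<lambda>(l, m). f1 (l + -1/2, m + -s))"
  define F2 where "F2 = (\<lambda>(l, m). f2 (l + 1/2, m + -s))"
  have F: "l2 F1" "l2 F2" "n2 F1 = n2 f1" "n2 F2 = n2 f2"
    unfolding F1_def F2_def l2_shift by (rule 1 refl)+
  have e: "hop s u d f = (\<lambda>x. F1 x + F2 x)"
    unfolding hop_def F1_def F2_def f1_def f2_def by (rule ext) (simp split: prod.split)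
  show "l2 (hop s u d f)" unfolding e by (rule l2_add(1)[OF F(1,2)])
  show "n2 (hop s u d f) \<le> 4 * C\<^sup>2 * n2 f" using l2_add(2)[OF F(1,2)] 1 F unfolding e by linarith
qed

text \<open>Undoing the shift by a substitution in the sum moves each weight to the other argument,
  where it belongs to the reversed step. The bound \<open>C\<close> ensures that all sums
  converge.\<close>

lemma ip2_hop:
  assumes f: "supp N f" "l2 f" and g: "l2 g"
    and u: "\<And>l m. (l, m) \<in> gidx N \<Longrightarrow> \<bar>u l m\<bar> \<le> C" and d: "\<And>l m. (l, m) \<in> gidx N \<Longrightarrow> \<bar>d l m\<bar> \<le> C"
    and u': "\<And>l m. (l, m) \<in> gidx N \<Longrightarrow> u' (l-1/2) (m+s) = d l m"
    and d': "\<And>l m. (l, m) \<in> gidx N \<Longrightarrow> d' (l+1/2) (m+s) = u l m"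
  shows "ip2 (hop s u d f) g = ip2 f (hop (-s) u' d' g)"
proof -
  define f1 where "f1 = (\<lambda>(l, m). complex_of_real (u l m) * f (l, m))"
  define f2 where "f2 = (\<lambda>(l, m). complex_of_real (d l m) * f (l, m))"
  have w: "cmod (f1 x) \<le> C * cmod (f x)" "cmod (f2 x) \<le> C * cmod (f x)" for x :: "real \<times> real"
  proof -
    obtain l m where x: "x = (l, m)" by (cases x)
    show "cmod (f1 x) \<le> C * cmod (f x)" unfolding x f1_def prod.case by (rule weighted_le[OF f(1) u])
    show "cmod (f2 x) \<le> C * cmod (f x)" unfolding x f2_def prod.case by (rule weighted_le[OF f(1) d])
  qed
  note 1 = l2_dominated(1)[OF f(2) w(1)] l2_dominated(1)[OF f(2) w(2)]
  define g1 where "g1 = (\<lambda>(l, m). g (l + 1/2, m + s))"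
  define g2 where "g2 = (\<lambda>(l, m). g (l + -1/2, m + s))"
  have 2: "l2 g1" "l2 g2" unfolding g1_def g2_def l2_shift by (rule g)+
  define F1 where "F1 = (\<lambda>(l, m). f1 (l + -1/2, m + -s))"
  define F2 where "F2 = (\<lambda>(l, m). f2 (l + 1/2, m + -s))"
  have 3: "l2 F1" "l2 F2" unfolding F1_def F2_def l2_shift by (rule 1)+
  have "hop s u d f = (\<lambda>x. F1 x + F2 x)" 
    unfolding hop_def F1_def F2_def f1_def f2_def by (rule ext) (simp split: prod.split)
  hence "ip2 (hop s u d f) g = ip2 F1 g + ip2 F2 g" using ip2_add_left[OF g 3] by simp
  also have "ip2 F1 g = ip2 f1 g1"
    using l2_bij(3)[OF bij_shift[of "1/2" s], of F1 g] by (simp add: F1_def g1_def case_prod_beta')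
  also have "ip2 F2 g = ip2 f2 g2"
    using l2_bij(3)[OF bij_shift[of "-1/2" s], of F2 g] by (simp add: F2_def g2_def case_prod_beta')
  also have "ip2 f1 g1 + ip2 f2 g2 = (\<Sum>\<^sub>\<infinity>x. cnj (f1 x) * g1 x + cnj (f2 x) * g2 x)"
    unfolding ip2_def by (rule infsum_add[symmetric]) (intro l2_ip_summable 1 2)+
  also have "\<dots> = ip2 f (hop (-s) u' d' g)"
    unfolding ip2_def
  proof (rule infsum_cong)
    fix x :: "real \<times> real"
    obtain l m where x: "x = (l, m)" by (cases x)
    show "cnj (f1 x) * g1 x + cnj (f2 x) * g2 x = cnj (f x) * hop (- s) u' d' g x"
    proof (cases "x \<in> gidx N")
      case True
      thus ?thesis using u'[of l m] d'[of l m] by (simp add: x f1_def f2_def g1_def g2_def hop_def algebra_simps)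
    next
      case False
      thus ?thesis using supp_not[OF f(1), of x] by (simp add: x f1_def f2_def)
    qed
  qed
  finally show ?thesis .
qed

section \<open>Boundedness and adjoints of the spin-1/2 operators\<close>

context deformation begin

lemma spin_l2:
  assumes "i \<in> {1,-1}" "j \<in> {1,-1}" "supp N f" "l2 f"
  shows "l2 (spin 1 i j N f)" "n2 (spin 1 i j N f) \<le> 4 / q\<^sup>2 * n2 f"
  using l2_hop[OF assms(3,4), of "up 1 i j N" "1/q" "dn 1 i j N" "i/2"] up_dn_bound[OF assms(1,2)]
  by (simp_all add: spin_def power_divide)

lemma spin_adjoint:
  assumes ij: "i \<in> {1,-1}" "j \<in> {1,-1}" and f: "supp N f" "l2 f" and g: "l2 g"
  shows "ip2 (spin 1 i j N f) g = - complex_of_real (i*j) * ip2 f (spin 1 (-i) (-j) (N + j/2) g)"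
proof -
  have s: "i * j * (i * j) = 1" using ij by auto
  have a: "dn 1 i j N l m = - (i*j) * up 1 (-i) (-j) (N + j/2) (l-1/2) (m+i/2)" for l m
    unfolding up_dn_adjoint[OF ij] using s by (simp add: mult.assoc[symmetric])
  have b: "up 1 i j N l m = - (i*j) * dn 1 (-i) (-j) (N + j/2) (l+1/2) (m+i/2)" for l m
    unfolding up_dn_adjoint[OF ij] using s by (simp add: mult.assoc[symmetric])
  have "ip2 (hop (i/2) (up 1 i j N) (dn 1 i j N) f) g
    = ip2 f (hop (-(i/2)) (\<lambda>l m. - (i*j) * up 1 (-i) (-j) (N + j/2) l m) (\<lambda>l m. - (i*j) * dn 1 (-i) (-j) (N + j/2) l m) g)"
    by (rule ip2_hop[OF f g, where C="1/q"]) (erule up_dn_bound[OF ij] | rule a[symmetric] b[symmetric])+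
  also have "hop (-(i/2)) (\<lambda>l m. - (i*j) * up 1 (-i) (-j) (N + j/2) l m) (\<lambda>l m. - (i*j) * dn 1 (-i) (-j) (N + j/2) l m) g
     = (\<lambda>x. complex_of_real (- (i*j)) * spin 1 (-i) (-j) (N + j/2) g x)"
    unfolding spin_def hop_scale by simp
  finally show ?thesis unfolding spin_def[symmetric] ip2_scale_right by simp
qed

end

section \<open>Hilbert spaces and their sums\<close>

lemma complex_ring_simps [simp]:
  "carrier complex_ring = UNIV" "mult complex_ring = (*)" "one complex_ring = 1"
  "zero complex_ring = 0" "add complex_ring = (+)"
  by (simp_all add: complex_ring_def)

lemma cring_complex_ring: "cring complex_ring"
proof (rule cringI)
  show "abelian_group complex_ring"
  proof (rule abelian_groupI)
    fix x assume "x \<in> carrier complex_ring"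
    show "\<exists>y\<in>carrier complex_ring. y \<oplus>\<^bsub>complex_ring\<^esub> x = \<zero>\<^bsub>complex_ring\<^esub>"
      by (rule bexI[of _ "- x"]) auto
  qed auto
  show "comm_monoid complex_ring" by (rule comm_monoidI) auto
qed (auto simp: distrib_right)

lemma ell2_simps:
  "carrier (ell2 I) = {f. (\<forall>i. i \<notin> I \<longrightarrow> f i = 0) \<and> l2 f}"
  "zero (ell2 I) = (\<lambda>i. 0)" "add (ell2 I) = (\<lambda>f g i. f i + g i)" "smult (ell2 I) = (\<lambda>c f i. c * f i)"
proof -
  have "(\<lambda>i. (cmod (f i))\<^sup>2) summable_on I \<longleftrightarrow> l2 f" if "\<forall>i. i \<notin> I \<longrightarrow> f i = 0" for f :: "'a \<Rightarrow> complex"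
    unfolding l2_def by (rule summable_on_cong_neutral) (use that in auto)
  thus "carrier (ell2 I) = {f. (\<forall>i. i \<notin> I \<longrightarrow> f i = 0) \<and> l2 f}" by (auto simp: ell2_def)
qed (simp_all add: ell2_def)

lemma ell2_ip: "f \<in> carrier (ell2 I) \<Longrightarrow> ip (ell2 I) f g = ip2 f g"
  unfolding ip2_def by (simp add: ell2_simps) (auto simp: ell2_def intro!: infsum_cong_neutral)

lemma ell2_hnorm: "f \<in> carrier (ell2 I) \<Longrightarrow> hnorm (ell2 I) f = sqrt (n2 f)"
  by (simp add: hnorm_def ell2_ip) (simp add: ell2_simps ip2_self)

lemma ell2_abelian_group: "abelian_group (ell2 I)"
proof (rule abelian_groupI)
  fix x assume x: "x \<in> carrier (ell2 I)"
  show "\<exists>y\<in>carrier (ell2 I). y \<oplus>\<^bsub>ell2 I\<^esub> x = \<zero>\<^bsub>ell2 I\<^esub>"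
    by (rule bexI[of _ "\<lambda>i. - x i"]) (use x in \<open>auto simp: ell2_simps l2_uminus\<close>)
qed (auto simp: ell2_simps l2_add add.assoc add.commute fun_eq_iff)

lemma ell2_minus:
  assumes "f \<in> carrier (ell2 I)"
  shows "\<ominus>\<^bsub>ell2 I\<^esub> f = (\<lambda>i. - f i)" "g \<ominus>\<^bsub>ell2 I\<^esub> f = (\<lambda>i. g i - f i)"
proof -
  show "\<ominus>\<^bsub>ell2 I\<^esub> f = (\<lambda>i. - f i)"
    by (rule abelian_group.minus_equality[OF ell2_abelian_group])
      (use assms in \<open>auto simp: ell2_simps l2_uminus\<close>)
  thus "g \<ominus>\<^bsub>ell2 I\<^esub> f = (\<lambda>i. g i - f i)" by (simp add: a_minus_def ell2_simps)
qed

text \<open>Fatou's lemma by finite partial sums: each of them converges and keeps the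
  bound.\<close>

lemma n2_pointwise_limit:
  assumes X: "\<And>n. l2 (X n)" and lim: "\<And>i. (\<lambda>n. X n i) \<longlonglongrightarrow> x i"
    and C: "eventually (\<lambda>n. n2 (\<lambda>i. X m i - X n i) \<le> C) sequentially"
  shows "l2 (\<lambda>i. X m i - x i)" "n2 (\<lambda>i. X m i - x i) \<le> C"
proof -
  have "(\<Sum>i\<in>F. (cmod (X m i - x i))\<^sup>2) \<le> C" if "finite F" for F
  proof (rule tendsto_upperbound)
    show "((\<lambda>n. \<Sum>i\<in>F. (cmod (X m i - X n i))\<^sup>2) \<longlongrightarrow> (\<Sum>i\<in>F. (cmod (X m i - x i))\<^sup>2)) sequentially"
      by (intro tendsto_intros lim)
    show "eventually (\<lambda>n. (\<Sum>i\<in>F. (cmod (X m i - X n i))\<^sup>2) \<le> C) sequentially"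
      using C by eventually_elim (rule order_trans[OF finite_sum_le_n2[OF l2_diff[OF X X] that]])
  qed simp
  from l2I_finite_sums[OF this] show "l2 (\<lambda>i. X m i - x i)" "n2 (\<lambda>i. X m i - x i) \<le> C" by blast+
qed

lemma ell2_complete:
  assumes X: "\<forall>n. X n \<in> carrier (ell2 I)"
    and cauchy: "\<forall>e>0. \<exists>M. \<forall>m\<ge>M. \<forall>n\<ge>M. hnorm (ell2 I) (X m \<ominus>\<^bsub>ell2 I\<^esub> X n) < e"
  shows "\<exists>x\<in>carrier (ell2 I). hlim (ell2 I) X x"
proof -
  have X': "l2 (X n)" for n using X by (simp add: ell2_simps)
  have d: "(\<lambda>i. f i - g i) \<in> carrier (ell2 I)" if "f \<in> carrier (ell2 I)" "g \<in> carrier (ell2 I)" for f g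
    using that by (auto simp: ell2_simps l2_diff)
  have hn: "hnorm (ell2 I) (X m \<ominus>\<^bsub>ell2 I\<^esub> X n) = sqrt (n2 (\<lambda>i. X m i - X n i))" for m n
    using X d by (simp add: ell2_minus ell2_hnorm)
  have c: "\<exists>M. \<forall>m\<ge>M. \<forall>n\<ge>M. n2 (\<lambda>i. X m i - X n i) < e\<^sup>2" if "e > 0" for e
  proof -
    have "n2 f < e\<^sup>2" if "sqrt (n2 f) < e" for f
      using that \<open>e > 0\<close> real_less_lsqrt real_sqrt_less_iff[of "n2 f" "e\<^sup>2"] by simp
    thus ?thesis using cauchy[rule_format, OF that] unfolding hn by meson
  qed
  have "Cauchy (\<lambda>n. X n i)" for i
  proof (rule metric_CauchyI)
    fix e :: real assume "0 < e"
    from c[OF this] obtain M where M: "\<And>m n. m \<ge> M \<Longrightarrow> n \<ge> M \<Longrightarrow> n2 (\<lambda>i. X m i - X n i) < e\<^sup>2" by blast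
    have "dist (X m i) (X n i) < e" if "m \<ge> M" "n \<ge> M" for m n
    proof -
      have "(cmod (X m i - X n i))\<^sup>2 < e\<^sup>2"
        using cmod_sq_le_n2[OF l2_diff[OF X'[of m] X'[of n]], of i] M[OF that] by linarith
      thus ?thesis using \<open>0 < e\<close> power2_less_imp_less[of "cmod (X m i - X n i)" e] by (simp add: dist_norm)
    qed
    thus "\<exists>M. \<forall>m\<ge>M. \<forall>n\<ge>M. dist (X m i) (X n i) < e" by blast
  qed
  hence "\<exists>l. (\<lambda>n. X n i) \<longlonglongrightarrow> l" for i using Cauchy_convergent convergent_def by blast
  then obtain x where lim: "\<And>i. (\<lambda>n. X n i) \<longlonglongrightarrow> x i" by metis
  have n: "\<exists>M. \<forall>m\<ge>M. l2 (\<lambda>i. X m i - x i) \<and> n2 (\<lambda>i. X m i - x i) \<le> e\<^sup>2" if e: "e > 0" for e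
  proof -
    from c[OF e] obtain M where M: "\<And>m n. m \<ge> M \<Longrightarrow> n \<ge> M \<Longrightarrow> n2 (\<lambda>i. X m i - X n i) < e\<^sup>2" by blast
    have "l2 (\<lambda>i. X m i - x i) \<and> n2 (\<lambda>i. X m i - x i) \<le> e\<^sup>2" if "m \<ge> M" for m
    proof -
      have ev: "eventually (\<lambda>n. n2 (\<lambda>i. X m i - X n i) \<le> e\<^sup>2) sequentially"
        using M[OF that] by (intro eventually_sequentiallyI[of M]) (simp add: less_imp_le)
      show ?thesis using n2_pointwise_limit[of X, OF X' lim ev] by simp
    qed
    thus ?thesis by blast
  qed
  have "l2 x"
  proof -
    obtain m where "l2 (\<lambda>i. X m i - x i)" using n[of 1] by auto
    from l2_diff[OF X' this, of m] show ?thesis by simp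
  qed
  moreover have "x i = 0" if "i \<notin> I" for i
    using lim[of i] X that LIMSEQ_unique[OF lim[of i], of 0] by (simp add: ell2_simps)
  ultimately have x: "x \<in> carrier (ell2 I)" by (simp add: ell2_simps)
  have "hlim (ell2 I) X x"
    unfolding hlim_def
  proof (rule LIMSEQ_I)
    fix r :: real assume r: "0 < r"
    obtain M where M: "\<And>m. m \<ge> M \<Longrightarrow> n2 (\<lambda>i. X m i - x i) \<le> (r/2)\<^sup>2" using n[of "r/2"] r by auto
    have "norm (hnorm (ell2 I) (X m \<ominus>\<^bsub>ell2 I\<^esub> x) - 0) < r" if "m \<ge> M" for m
    proof -
      have "hnorm (ell2 I) (X m \<ominus>\<^bsub>ell2 I\<^esub> x) = sqrt (n2 (\<lambda>i. X m i - x i))"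
        using X x d by (simp add: ell2_minus ell2_hnorm)
      also have "\<dots> \<le> sqrt ((r/2)\<^sup>2)" by (rule real_sqrt_le_mono[OF M[OF that]])
      finally have "hnorm (ell2 I) (X m \<ominus>\<^bsub>ell2 I\<^esub> x) \<le> r/2" using r by simp
      moreover have "0 \<le> hnorm (ell2 I) (X m \<ominus>\<^bsub>ell2 I\<^esub> x)" using X x d by (simp add: ell2_minus ell2_hnorm)
      ultimately show ?thesis using r by simp
    qed
    thus "\<exists>no. \<forall>n\<ge>no. norm (hnorm (ell2 I) (X n \<ominus>\<^bsub>ell2 I\<^esub> x) - 0) < r" by blast
  qed
  thus ?thesis using x by blast
qed

lemma hilbert_space_ell2: "hilbert_space (ell2 I)"
proof (intro hilbert_space.intro hilbert_space_axioms.intro)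
  show "Module.module complex_ring (ell2 I)"
    by (rule Module.moduleI[OF cring_complex_ring ell2_abelian_group])
      (auto simp: ell2_simps l2_scale algebra_simps fun_eq_iff)
next
  fix x y z assume "x \<in> carrier (ell2 I)" "y \<in> carrier (ell2 I)" "z \<in> carrier (ell2 I)"
  thus "ip (ell2 I) x (y \<oplus>\<^bsub>ell2 I\<^esub> z) = ip (ell2 I) x y + ip (ell2 I) x z"
    by (simp add: ell2_ip) (simp add: ell2_simps ip2_add_right)
next
  fix x y c assume "x \<in> carrier (ell2 I)" "y \<in> carrier (ell2 I)"
  thus "ip (ell2 I) x (c \<odot>\<^bsub>ell2 I\<^esub> y) = c * ip (ell2 I) x y"
    by (simp add: ell2_ip) (simp add: ell2_simps ip2_scale_right)
next
  fix x y assume "x \<in> carrier (ell2 I)" "y \<in> carrier (ell2 I)"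
  thus "ip (ell2 I) x y = cnj (ip (ell2 I) y x)" by (simp add: ell2_ip ip2_cnj)
next
  fix x assume x: "x \<in> carrier (ell2 I)"
  show "0 \<le> Re (ip (ell2 I) x x)" using x by (simp add: ell2_ip) (simp add: ell2_simps ip2_self)
  assume "ip (ell2 I) x x = 0"
  hence "n2 x = 0" using x by (simp add: ell2_ip) (simp add: ell2_simps ip2_self)
  thus "x = \<zero>\<^bsub>ell2 I\<^esub>" using x n2_0D[of x] by (auto simp: ell2_simps)
qed (rule ell2_complete)

context hilbert_space begin

lemma hnorm_sq: "x \<in> carrier H \<Longrightarrow> (hnorm H x)\<^sup>2 = Re (ip H x x)"
  by (simp add: hnorm_def ip_nonneg)

lemma hnorm_nonneg: "x \<in> carrier H \<Longrightarrow> 0 \<le> hnorm H x"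
  by (simp add: hnorm_def ip_nonneg)

lemma ip_zero_right: "x \<in> carrier H \<Longrightarrow> ip H x \<zero> = 0"
  using ip_smult_right[of x \<zero> 0] smult_l_null[of \<zero>] by simp

lemma ip_zero_left: "x \<in> carrier H \<Longrightarrow> ip H \<zero> x = 0"
  using ip_cnj[of \<zero> x] ip_zero_right[of x] by simp

end

section \<open>Direct sums of Hilbert spaces and of their operators\<close>

lemma hsum_simps:
  "carrier (hsum H K) = carrier H \<times> carrier K"
  "zero (hsum H K) = (zero H, zero K)"
  "add (hsum H K) (x, y) (x', y') = (add H x x', add K y y')"
  "smult (hsum H K) c (x, y) = (smult H c x, smult K c y)"
  "ip (hsum H K) (x, y) (x', y') = ip H x x' + ip K y y'"
  by (simp_all add: hsum_def)

lemma hsum_abelian_group: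
  assumes "abelian_group H" "abelian_group K"
  shows "abelian_group (hsum H K)"
proof -
  interpret H: abelian_group H by fact
  interpret K: abelian_group K by fact
  show ?thesis
  proof (rule abelian_groupI)
    fix x assume x: "x \<in> carrier (hsum H K)"
    show "\<exists>y\<in>carrier (hsum H K). y \<oplus>\<^bsub>hsum H K\<^esub> x = \<zero>\<^bsub>hsum H K\<^esub>"
      by (rule bexI[of _ "(\<ominus>\<^bsub>H\<^esub> fst x, \<ominus>\<^bsub>K\<^esub> snd x)"])
        (use x in \<open>auto simp: hsum_simps H.l_neg K.l_neg\<close>)
  qed (auto simp: hsum_simps intro: H.a_assoc K.a_assoc H.a_comm K.a_comm)
qed

lemma hsum_minus:
  assumes "abelian_group H" "abelian_group K" "x \<in> carrier H" "y \<in> carrier K"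
  shows "\<ominus>\<^bsub>hsum H K\<^esub> (x, y) = (\<ominus>\<^bsub>H\<^esub> x, \<ominus>\<^bsub>K\<^esub> y)"
    "(x', y') \<ominus>\<^bsub>hsum H K\<^esub> (x, y) = (x' \<ominus>\<^bsub>H\<^esub> x, y' \<ominus>\<^bsub>K\<^esub> y)"
proof -
  interpret H: abelian_group H by fact
  interpret K: abelian_group K by fact
  show "\<ominus>\<^bsub>hsum H K\<^esub> (x, y) = (\<ominus>\<^bsub>H\<^esub> x, \<ominus>\<^bsub>K\<^esub> y)"
    by (rule abelian_group.minus_equality[OF hsum_abelian_group[OF assms(1,2)]])
      (use assms in \<open>auto simp: hsum_simps H.l_neg K.l_neg\<close>)
  thus "(x', y') \<ominus>\<^bsub>hsum H K\<^esub> (x, y) = (x' \<ominus>\<^bsub>H\<^esub> x, y' \<ominus>\<^bsub>K\<^esub> y)"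
    by (simp add: a_minus_def hsum_simps)
qed

text \<open>Sums of spaces and the notions for operators are defined on records without extension
  fields; the locale fixes this type.\<close>

locale plain_hilbert_space = hilbert_space H for H :: "'v hilb" (structure)

locale two_hilbert_spaces = H: plain_hilbert_space H + K: plain_hilbert_space K
  for H :: "'v hilb" and K :: "'w hilb"
begin

lemma minus:
  assumes "x \<in> carrier H" "y \<in> carrier K"
  shows "\<ominus>\<^bsub>hsum H K\<^esub> (x, y) = (\<ominus>\<^bsub>H\<^esub> x, \<ominus>\<^bsub>K\<^esub> y)"
    "(x', y') \<ominus>\<^bsub>hsum H K\<^esub> (x, y) = (x' \<ominus>\<^bsub>H\<^esub> x, y' \<ominus>\<^bsub>K\<^esub> y)"
  using hsum_minus[OF H.abelian_group_axioms K.abelian_group_axioms assms] by blast+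

lemma hnorm_sum:
  assumes "x \<in> carrier H" "y \<in> carrier K"
  shows "hnorm (hsum H K) (x, y) = sqrt ((hnorm H x)\<^sup>2 + (hnorm K y)\<^sup>2)"
  using assms by (simp add: H.hnorm_sq K.hnorm_sq) (simp add: hnorm_def hsum_simps)

lemma hnorm_le:
  assumes "x \<in> carrier H" "y \<in> carrier K"
  shows "hnorm H x \<le> hnorm (hsum H K) (x, y)" "hnorm K y \<le> hnorm (hsum H K) (x, y)"
    "hnorm (hsum H K) (x, y) \<le> hnorm H x + hnorm K y"
  unfolding hnorm_sum[OF assms] using H.hnorm_nonneg[OF assms(1)] K.hnorm_nonneg[OF assms(2)]
  by (auto intro: real_le_rsqrt sqrt_sum_squares_le_sum)

lemma hlim_sum:
  assumes "\<And>n. X n \<in> carrier H" "\<And>n. Y n \<in> carrier K" "x \<in> carrier H" "y \<in> carrier K" "hlim H X x" "hlim K Y y"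
  shows "hlim (hsum H K) (\<lambda>n. (X n, Y n)) (x, y)"
proof -
  have "(\<lambda>n. sqrt ((hnorm H (X n \<ominus>\<^bsub>H\<^esub> x))\<^sup>2 + (hnorm K (Y n \<ominus>\<^bsub>K\<^esub> y))\<^sup>2)) \<longlonglongrightarrow> sqrt (0\<^sup>2 + 0\<^sup>2)"
    using assms(5,6) unfolding hlim_def by (intro tendsto_intros)
  thus ?thesis unfolding hlim_def using assms(1-4) by (simp add: minus hnorm_sum)
qed

lemma hilbert_space_sum: "hilbert_space (hsum H K)"
proof (intro hilbert_space.intro hilbert_space_axioms.intro)
  show "Module.module complex_ring (hsum H K)"
  proof (rule Module.moduleI[OF cring_complex_ring hsum_abelian_group[OF H.abelian_group_axioms K.abelian_group_axioms]])
  qed (auto simp: hsum_simps H.smult_l_distr K.smult_l_distr[simplified] H.smult_r_distr K.smult_r_distr H.smult_l_distr[simplified]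
       H.smult_assoc1[simplified] K.smult_assoc1[simplified] H.smult_one[simplified] K.smult_one[simplified])
next
  fix x y z assume "x \<in> carrier (hsum H K)" "y \<in> carrier (hsum H K)" "z \<in> carrier (hsum H K)"
  thus "ip (hsum H K) x (y \<oplus>\<^bsub>hsum H K\<^esub> z) = ip (hsum H K) x y + ip (hsum H K) x z"
    by (auto simp: hsum_simps H.ip_add_right K.ip_add_right)
next
  fix x y c assume "x \<in> carrier (hsum H K)" "y \<in> carrier (hsum H K)"
  thus "ip (hsum H K) x (c \<odot>\<^bsub>hsum H K\<^esub> y) = c * ip (hsum H K) x y"
    by (auto simp: hsum_simps H.ip_smult_right K.ip_smult_right distrib_left)
next
  fix x y assume "x \<in> carrier (hsum H K)" "y \<in> carrier (hsum H K)"
  thus "ip (hsum H K) x y = cnj (ip (hsum H K) y x)"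
    by (auto simp: hsum_simps intro!: arg_cong2[of _ _ _ _ "(+)"] H.ip_cnj K.ip_cnj)
next
  fix x assume "x \<in> carrier (hsum H K)"
  then obtain a b where x: "x = (a, b)" "a \<in> carrier H" "b \<in> carrier K" by (auto simp: hsum_simps)
  show "0 \<le> Re (ip (hsum H K) x x)" using x by (auto simp: hsum_simps H.ip_nonneg K.ip_nonneg)
  assume *: "ip (hsum H K) x x = 0"
  have im: "Im (ip H a a) = 0" "Im (ip K b b) = 0"
    using arg_cong[OF H.ip_cnj[OF x(2,2)], of Im] arg_cong[OF K.ip_cnj[OF x(3,3)], of Im] by simp_all
  have "Re (ip H a a) + Re (ip K b b) = 0" using arg_cong[OF *, of Re] by (simp add: x hsum_simps)
  hence "ip H a a = 0" "ip K b b = 0" using H.ip_nonneg[OF x(2)] K.ip_nonneg[OF x(3)] im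
    by (auto simp: complex_eq_iff)
  thus "x = \<zero>\<^bsub>hsum H K\<^esub>" using x H.ip_definite K.ip_definite by (simp add: hsum_simps)
next
  fix X :: "nat \<Rightarrow> 'v \<times> 'w" assume X: "\<forall>n. X n \<in> carrier (hsum H K)"
    and c: "\<forall>e>0. \<exists>M. \<forall>m\<ge>M. \<forall>n\<ge>M. hnorm (hsum H K) (X m \<ominus>\<^bsub>hsum H K\<^esub> X n) < e"
  define Y where "Y n = fst (X n)" for n
  define Z where "Z n = snd (X n)" for n
  have XYZ: "X n = (Y n, Z n)" for n by (simp add: Y_def Z_def)
  have YZ: "Y n \<in> carrier H" "Z n \<in> carrier K" for n using X by (simp_all add: XYZ hsum_simps)
  have le: "hnorm H (Y m \<ominus>\<^bsub>H\<^esub> Y n) \<le> hnorm (hsum H K) (X m \<ominus>\<^bsub>hsum H K\<^esub> X n)"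
    "hnorm K (Z m \<ominus>\<^bsub>K\<^esub> Z n) \<le> hnorm (hsum H K) (X m \<ominus>\<^bsub>hsum H K\<^esub> X n)" for m n
    unfolding XYZ minus[OF YZ] by (rule hnorm_le; simp add: YZ)+
  have "\<exists>y\<in>carrier H. hlim H Y y"
  proof (rule H.complete)
    show "\<forall>n. Y n \<in> carrier H" using YZ by blast
    show "\<forall>e>0. \<exists>M. \<forall>m\<ge>M. \<forall>n\<ge>M. hnorm H (Y m \<ominus>\<^bsub>H\<^esub> Y n) < e"
    proof (intro allI impI)
      fix e :: real assume "0 < e"
      with c obtain M where "\<And>m n. m \<ge> M \<Longrightarrow> n \<ge> M \<Longrightarrow> hnorm (hsum H K) (X m \<ominus>\<^bsub>hsum H K\<^esub> X n) < e" by blast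
      thus "\<exists>M. \<forall>m\<ge>M. \<forall>n\<ge>M. hnorm H (Y m \<ominus>\<^bsub>H\<^esub> Y n) < e"
        by (intro exI[of _ M] allI impI le_less_trans[OF le(1)])
    qed
  qed
  moreover have "\<exists>z\<in>carrier K. hlim K Z z"
  proof (rule K.complete)
    show "\<forall>n. Z n \<in> carrier K" using YZ by blast
    show "\<forall>e>0. \<exists>M. \<forall>m\<ge>M. \<forall>n\<ge>M. hnorm K (Z m \<ominus>\<^bsub>K\<^esub> Z n) < e"
    proof (intro allI impI)
      fix e :: real assume "0 < e"
      with c obtain M where "\<And>m n. m \<ge> M \<Longrightarrow> n \<ge> M \<Longrightarrow> hnorm (hsum H K) (X m \<ominus>\<^bsub>hsum H K\<^esub> X n) < e" by blast
      thus "\<exists>M. \<forall>m\<ge>M. \<forall>n\<ge>M. hnorm K (Z m \<ominus>\<^bsub>K\<^esub> Z n) < e"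
        by (intro exI[of _ M] allI impI le_less_trans[OF le(2)])
    qed
  qed
  ultimately obtain y z where yz: "y \<in> carrier H" "hlim H Y y" "z \<in> carrier K" "hlim K Z z" by blast
  have XE: "X = (\<lambda>n. (Y n, Z n))" using XYZ by (rule ext)
  show "\<exists>x\<in>carrier (hsum H K). hlim (hsum H K) X x"
    unfolding XE by (rule bexI[of _ "(y, z)"], rule hlim_sum[OF YZ yz(1,3,2,4)]) (use yz in \<open>simp add: hsum_simps\<close>)
qed

end

text \<open>The point \<open>z\<close> is a parameter, since a direct sum has a compact resolvent at
  \<open>z\<close> as soon as both summands have one at the same \<open>z\<close>. The existential
  form does not provide a common point.\<close>

definition compact_resolvent_at :: "'v hilb \<Rightarrow> 'v rel \<Rightarrow> complex \<Rightarrow> bool" where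
  "compact_resolvent_at H D z \<longleftrightarrow>
        (\<forall>w\<in>carrier H. \<exists>!x. (x, w \<oplus>\<^bsub>H\<^esub> z \<odot>\<^bsub>H\<^esub> x) \<in> D) \<and>
        (\<forall>X Y. (\<forall>n. (X n, Y n) \<in> D) \<and> (\<exists>C. \<forall>n. hnorm H (Y n \<ominus>\<^bsub>H\<^esub> z \<odot>\<^bsub>H\<^esub> X n) \<le> C) \<longrightarrow>
           (\<exists>r x. strict_mono (r :: nat \<Rightarrow> nat) \<and> x \<in> carrier H \<and> hlim H (X \<circ> r) x))"

lemma compact_resolventI: "compact_resolvent_at H D z \<Longrightarrow> compact_resolvent H D"
  unfolding compact_resolvent_def compact_resolvent_at_def by blast

lemma hlim_subseq: "hlim H X x \<Longrightarrow> strict_mono r \<Longrightarrow> hlim H (X \<circ> r) x"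
  unfolding hlim_def using LIMSEQ_subseq_LIMSEQ[of "\<lambda>n. hnorm H (X n \<ominus>\<^bsub>H\<^esub> x)" 0 r] by (simp add: o_def)

lemma bounded_commutatorI:
  assumes "is_commutator H D T K" "Domain D \<subseteq> carrier H"
  shows "bounded_commutator H D T"
proof -
  obtain C where C: "\<And>x. x \<in> carrier H \<Longrightarrow> hnorm H (K x) \<le> C * hnorm H x"
    using assms(1) unfolding is_commutator_def bounded_op_def by blast
  show ?thesis
    unfolding bounded_commutator_def
  proof (rule exI[of _ C], clarify)
    fix x y assume xy: "(x, y) \<in> D"
    then obtain z where z: "(T x, z) \<in> D" "K x = z \<ominus>\<^bsub>H\<^esub> T y"
      using assms(1) unfolding is_commutator_def by blast
    have "x \<in> carrier H" using xy assms(2) by blast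
    from C[OF this] z show "\<exists>z. (T x, z) \<in> D \<and> hnorm H (z \<ominus>\<^bsub>H\<^esub> T y) \<le> C * hnorm H x" by auto
  qed
qed

lemma self_adjoint_carrier:
  assumes "self_adjoint H D"
  shows "D \<subseteq> carrier H \<times> carrier H"
proof -
  have "D = op_adjoint H D" using assms by (simp add: self_adjoint_def)
  thus ?thesis by (auto simp: op_adjoint_def)
qed

context plain_hilbert_space begin

text \<open>A graph is not assumed to be a linear subspace, but an adjoint always contains the zero
  pair. In a direct sum this pair allows one component to be tested while the other contributes
  nothing.\<close>

lemma self_adjoint_zero:
  assumes "self_adjoint H D"
  shows "(\<zero>, \<zero>) \<in> D"
proof -
  have "(\<zero>, \<zero>) \<in> op_adjoint H D"
    using self_adjoint_carrier[OF assms] by (auto simp: op_adjoint_def ip_zero_right)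
  thus ?thesis using assms by (simp add: self_adjoint_def)
qed

lemma bounded_op_bound:
  assumes "bounded_op H T"
  obtains C where "0 \<le> C" "\<And>x. x \<in> carrier H \<Longrightarrow> hnorm H (T x) \<le> C * hnorm H x"
proof -
  obtain C where C: "\<And>x. x \<in> carrier H \<Longrightarrow> hnorm H (T x) \<le> C * hnorm H x"
    using assms unfolding bounded_op_def by blast
  show thesis
  proof (rule that[of "\<bar>C\<bar>"])
    fix x assume x: "x \<in> carrier H"
    have "C * hnorm H x \<le> \<bar>C\<bar> * hnorm H x" by (rule mult_right_mono[OF _ hnorm_nonneg[OF x]]) simp
    thus "hnorm H (T x) \<le> \<bar>C\<bar> * hnorm H x" using C[OF x] by linarith
  qed simp
qed

end

context two_hilbert_spaces begin

lemma bounded_op_sum: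
  assumes T: "bounded_op H T" and S: "bounded_op K S"
  shows "bounded_op (hsum H K) (map_prod T S)"
proof -
  obtain C1 where C1: "0 \<le> C1" "\<And>x. x \<in> carrier H \<Longrightarrow> hnorm H (T x) \<le> C1 * hnorm H x" using H.bounded_op_bound[OF T] by blast
  obtain C2 where C2: "0 \<le> C2" "\<And>x. x \<in> carrier K \<Longrightarrow> hnorm K (S x) \<le> C2 * hnorm K x" using K.bounded_op_bound[OF S] by blast
  have b: "hnorm (hsum H K) (map_prod T S p) \<le> (C1 + C2) * hnorm (hsum H K) p" if p: "p \<in> carrier (hsum H K)" for p
  proof -
    obtain x y where xy: "p = (x, y)" "x \<in> carrier H" "y \<in> carrier K" using p by (auto simp: hsum_simps)
    have c: "T x \<in> carrier H" "S y \<in> carrier K" using T S xy unfolding bounded_op_def by auto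
    have "hnorm (hsum H K) (T x, S y) \<le> hnorm H (T x) + hnorm K (S y)" by (rule hnorm_le(3)[OF c])
    also have "\<dots> \<le> C1 * hnorm H x + C2 * hnorm K y" by (intro add_mono C1 C2 xy)
    also have "\<dots> \<le> C1 * hnorm (hsum H K) (x, y) + C2 * hnorm (hsum H K) (x, y)"
      by (intro add_mono mult_left_mono hnorm_le xy C1 C2)
    finally show ?thesis by (simp add: xy distrib_right)
  qed
  from b have e: "\<exists>C. \<forall>x\<in>carrier (hsum H K). hnorm (hsum H K) (map_prod T S x) \<le> C * hnorm (hsum H K) x"
    by blast
  show ?thesis
    unfolding bounded_op_def using T[unfolded bounded_op_def] S[unfolded bounded_op_def]
    by (intro conjI e) (auto simp: hsum_simps Pi_iff)
qed

lemma star_rep_sum: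
  assumes "star_rep A H \<pi>" "star_rep A K \<rho>"
  shows "star_rep A (hsum H K) (rep_sum \<pi> \<rho>)"
  using assms bounded_op_sum unfolding star_rep_def rep_sum_def
  by (auto simp: hsum_simps)

lemma is_commutator_sum:
  assumes D: "is_commutator H D T P" "D \<subseteq> carrier H \<times> carrier H" "bounded_op H T"
    and E: "is_commutator K E S Q" "E \<subseteq> carrier K \<times> carrier K" "bounded_op K S"
  shows "is_commutator (hsum H K) (op_sum D E) (map_prod T S) (map_prod P Q)"
  unfolding is_commutator_def
proof (intro conjI)
  show "bounded_op (hsum H K) (map_prod P Q)"
    using D(1) E(1) bounded_op_sum unfolding is_commutator_def by blast
  show "\<forall>(x, y)\<in>op_sum D E. \<exists>z. (map_prod T S x, z) \<in> op_sum D E \<and> map_prod P Q x = z \<ominus>\<^bsub>hsum H K\<^esub> map_prod T S y"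
  proof clarify
    fix x x' y y' assume "((x, x'), (y, y')) \<in> op_sum D E"
    hence xy: "(x, y) \<in> D" "(x', y') \<in> E" by (auto simp: op_sum_def)
    obtain z where z: "(T x, z) \<in> D" "P x = z \<ominus>\<^bsub>H\<^esub> T y" using D(1) xy unfolding is_commutator_def by blast
    obtain z' where z': "(S x', z') \<in> E" "Q x' = z' \<ominus>\<^bsub>K\<^esub> S y'" using E(1) xy unfolding is_commutator_def by blast
    have c: "T y \<in> carrier H" "S y' \<in> carrier K" using D(2,3) E(2,3) xy unfolding bounded_op_def by auto
    show "\<exists>z. (map_prod T S (x, x'), z) \<in> op_sum D E \<and> map_prod P Q (x, x') = z \<ominus>\<^bsub>hsum H K\<^esub> map_prod T S (y, y')"
      by (rule exI[of _ "(z, z')"]) (use z z' minus[OF c] in \<open>auto simp: op_sum_def\<close>)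
  qed
qed

lemma anticommutes_sum:
  assumes D: "anticommutes H D \<gamma>" "D \<subseteq> carrier H \<times> carrier H" "bounded_op H \<gamma>"
    and E: "anticommutes K E \<delta>" "E \<subseteq> carrier K \<times> carrier K" "bounded_op K \<delta>"
  shows "anticommutes (hsum H K) (op_sum D E) (map_prod \<gamma> \<delta>)"
  unfolding anticommutes_def
proof clarify
  fix x x' y y' assume "((x, x'), (y, y')) \<in> op_sum D E"
  hence xy: "(x, y) \<in> D" "(x', y') \<in> E" by (auto simp: op_sum_def)
  have c: "\<gamma> y \<in> carrier H" "\<delta> y' \<in> carrier K" using D(2,3) E(2,3) xy unfolding bounded_op_def by auto
  show "(map_prod \<gamma> \<delta> (x, x'), \<ominus>\<^bsub>hsum H K\<^esub> map_prod \<gamma> \<delta> (y, y')) \<in> op_sum D E"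
    using D(1) E(1) xy by (auto simp: op_sum_def anticommutes_def minus[OF c])
qed

lemma self_adjoint_sum:
  assumes D: "self_adjoint H D" and E: "self_adjoint K E"
  shows "self_adjoint (hsum H K) (op_sum D E)"
  unfolding self_adjoint_def
proof (intro conjI)
  show "densely_defined (hsum H K) (op_sum D E)"
    unfolding densely_defined_def
  proof (intro ballI allI impI)
    fix p and e :: real assume p: "p \<in> carrier (hsum H K)" and e: "0 < e"
    obtain x y where xy: "p = (x, y)" "x \<in> carrier H" "y \<in> carrier K" using p by (auto simp: hsum_simps)
    obtain x' where x': "x' \<in> Domain D" "hnorm H (x \<ominus>\<^bsub>H\<^esub> x') < e/2"
      using D xy e unfolding self_adjoint_def densely_defined_def by (meson half_gt_zero)
    obtain y' where y': "y' \<in> Domain E" "hnorm K (y \<ominus>\<^bsub>K\<^esub> y') < e/2"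
      using E xy e unfolding self_adjoint_def densely_defined_def by (meson half_gt_zero)
    have c: "x' \<in> carrier H" "y' \<in> carrier K"
      using x' y' self_adjoint_carrier[OF D] self_adjoint_carrier[OF E] by auto
    have "hnorm (hsum H K) ((x, y) \<ominus>\<^bsub>hsum H K\<^esub> (x', y')) \<le> hnorm H (x \<ominus>\<^bsub>H\<^esub> x') + hnorm K (y \<ominus>\<^bsub>K\<^esub> y')"
      unfolding minus[OF c] by (rule hnorm_le(3)) (use xy c in simp_all)
    hence "hnorm (hsum H K) (p \<ominus>\<^bsub>hsum H K\<^esub> (x', y')) < e" using x' y' xy by simp
    moreover have "(x', y') \<in> Domain (op_sum D E)" using x' y' by (fastforce simp: op_sum_def)
    ultimately show "\<exists>y\<in>Domain (op_sum D E). hnorm (hsum H K) (p \<ominus>\<^bsub>hsum H K\<^esub> y) < e" by blast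
  qed
  have D': "op_adjoint H D = D" and E': "op_adjoint K E = E" using D E by (simp_all add: self_adjoint_def)
  note c = self_adjoint_carrier[OF D] self_adjoint_carrier[OF E]
  show "op_adjoint (hsum H K) (op_sum D E) = op_sum D E"
  proof (rule equalityI; clarify)
    fix y y' z z' assume *: "((y, y'), (z, z')) \<in> op_adjoint (hsum H K) (op_sum D E)"
    hence yz: "y \<in> carrier H" "z \<in> carrier H" "y' \<in> carrier K" "z' \<in> carrier K"
      by (auto simp: op_adjoint_def hsum_simps)
    have 1: "ip H w y + ip K w' y' = ip H x z + ip K x' z'" if "(x, w) \<in> D" "(x', w') \<in> E" for x w x' w'
      using * that by (fastforce simp: op_adjoint_def hsum_simps op_sum_def)
    have "(y, z) \<in> op_adjoint H D"
      using 1[OF _ K.self_adjoint_zero[OF E]] yz by (auto simp: op_adjoint_def K.ip_zero_left)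
    moreover have "(y', z') \<in> op_adjoint K E"
      using 1[OF H.self_adjoint_zero[OF D]] yz by (auto simp: op_adjoint_def H.ip_zero_left)
    ultimately show "((y, y'), (z, z')) \<in> op_sum D E" unfolding D' E' by (auto simp: op_sum_def)
  next
    fix y y' z z' assume "((y, y'), (z, z')) \<in> op_sum D E"
    hence yz: "(y, z) \<in> op_adjoint H D" "(y', z') \<in> op_adjoint K E" unfolding D' E' by (auto simp: op_sum_def)
    have "ip H w y + ip K w' y' = ip H x z + ip K x' z'" if "(x, w) \<in> D" "(x', w') \<in> E" for x w x' w'
    proof -
      have "ip H w y = ip H x z" "ip K w' y' = ip K x' z'" using yz that by (fastforce simp: op_adjoint_def)+
      thus ?thesis by simp
    qed
    thus "((y, y'), (z, z')) \<in> op_adjoint (hsum H K) (op_sum D E)"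
      using yz by (auto simp: op_adjoint_def hsum_simps op_sum_def)
  qed
qed

text \<open>With a common \<open>z\<close> the resolvent equation splits into its components. A
  convergent subsequence is extracted for the first component and thinned out for the
  second.\<close>

lemma compact_resolvent_at_sum:
  assumes D: "compact_resolvent_at H D z" "D \<subseteq> carrier H \<times> carrier H"
    and E: "compact_resolvent_at K E z" "E \<subseteq> carrier K \<times> carrier K"
  shows "compact_resolvent_at (hsum H K) (op_sum D E) z"
  unfolding compact_resolvent_at_def
proof (intro conjI ballI allI impI)
  fix w assume "w \<in> carrier (hsum H K)"
  then obtain a b where w: "w = (a, b)" "a \<in> carrier H" "b \<in> carrier K" by (auto simp: hsum_simps)
  have 1: "\<exists>!x. (x, a \<oplus>\<^bsub>H\<^esub> z \<odot>\<^bsub>H\<^esub> x) \<in> D" using D w unfolding compact_resolvent_at_def by blast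
  have 2: "\<exists>!x. (x, b \<oplus>\<^bsub>K\<^esub> z \<odot>\<^bsub>K\<^esub> x) \<in> E" using E w unfolding compact_resolvent_at_def by blast
  have "(p, w \<oplus>\<^bsub>hsum H K\<^esub> z \<odot>\<^bsub>hsum H K\<^esub> p) \<in> op_sum D E \<longleftrightarrow>
    (fst p, a \<oplus>\<^bsub>H\<^esub> z \<odot>\<^bsub>H\<^esub> fst p) \<in> D \<and> (snd p, b \<oplus>\<^bsub>K\<^esub> z \<odot>\<^bsub>K\<^esub> snd p) \<in> E" for p
    by (cases p) (auto simp: w hsum_simps op_sum_def)
  thus "\<exists>!x. (x, w \<oplus>\<^bsub>hsum H K\<^esub> z \<odot>\<^bsub>hsum H K\<^esub> x) \<in> op_sum D E"
    using 1 2 by (metis fst_conv snd_conv prod.collapse)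
next
  fix X Y :: "nat \<Rightarrow> 'v \<times> 'w"
  assume *: "(\<forall>n. (X n, Y n) \<in> op_sum D E) \<and> (\<exists>C. \<forall>n. hnorm (hsum H K) (Y n \<ominus>\<^bsub>hsum H K\<^esub> z \<odot>\<^bsub>hsum H K\<^esub> X n) \<le> C)"
  then obtain C where C: "\<And>n. hnorm (hsum H K) (Y n \<ominus>\<^bsub>hsum H K\<^esub> z \<odot>\<^bsub>hsum H K\<^esub> X n) \<le> C" by blast
  define x x' y y' where "x n = fst (X n)" and "x' n = snd (X n)" and "y n = fst (Y n)" and "y' n = snd (Y n)" for n
  have XY: "X n = (x n, x' n)" "Y n = (y n, y' n)" for n by (simp_all add: x_def x'_def y_def y'_def)
  have DE: "(x n, y n) \<in> D" "(x' n, y' n) \<in> E" for n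
    using * by (auto simp: op_sum_def XY)
  hence c: "x n \<in> carrier H" "y n \<in> carrier H" "x' n \<in> carrier K" "y' n \<in> carrier K" for n using D(2) E(2) by blast+
  have m: "z \<odot>\<^bsub>H\<^esub> x n \<in> carrier H" "z \<odot>\<^bsub>K\<^esub> x' n \<in> carrier K" for n using c by simp_all
  have "Y n \<ominus>\<^bsub>hsum H K\<^esub> z \<odot>\<^bsub>hsum H K\<^esub> X n = (y n \<ominus>\<^bsub>H\<^esub> z \<odot>\<^bsub>H\<^esub> x n, y' n \<ominus>\<^bsub>K\<^esub> z \<odot>\<^bsub>K\<^esub> x' n)" for n
    unfolding XY hsum_simps(4) by (rule minus[OF m])
  hence b: "hnorm H (y n \<ominus>\<^bsub>H\<^esub> z \<odot>\<^bsub>H\<^esub> x n) \<le> C" "hnorm K (y' n \<ominus>\<^bsub>K\<^esub> z \<odot>\<^bsub>K\<^esub> x' n) \<le> C" for n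
    using C[of n] hnorm_le(1,2)[of "y n \<ominus>\<^bsub>H\<^esub> z \<odot>\<^bsub>H\<^esub> x n" "y' n \<ominus>\<^bsub>K\<^esub> z \<odot>\<^bsub>K\<^esub> x' n"] c m by fastforce+
  obtain r u where r: "strict_mono r" "u \<in> carrier H" "hlim H (x \<circ> r) u"
    using D(1) DE(1) b(1) unfolding compact_resolvent_at_def by blast
  have "\<forall>n. ((x' \<circ> r) n, (y' \<circ> r) n) \<in> E" "\<exists>C. \<forall>n. hnorm K ((y' \<circ> r) n \<ominus>\<^bsub>K\<^esub> z \<odot>\<^bsub>K\<^esub> (x' \<circ> r) n) \<le> C"
    using DE(2) b(2) by auto
  then obtain r' u' where r': "strict_mono r'" "u' \<in> carrier K" "hlim K ((x' \<circ> r) \<circ> r') u'"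
    using E(1) unfolding compact_resolvent_at_def by blast
  have "hlim (hsum H K) (\<lambda>n. ((x \<circ> r \<circ> r') n, (x' \<circ> r \<circ> r') n)) (u, u')"
    by (rule hlim_sum[OF _ _ r(2) r'(2) hlim_subseq[OF r(3) r'(1)] r'(3)]) (simp_all add: c)
  moreover have "(\<lambda>n. ((x \<circ> r \<circ> r') n, (x' \<circ> r \<circ> r') n)) = X \<circ> (r \<circ> r')" by (auto simp: XY)
  ultimately show "\<exists>r x. strict_mono (r :: nat \<Rightarrow> nat) \<and> x \<in> carrier (hsum H K) \<and> hlim (hsum H K) (X \<circ> r) x"
    using r r' strict_mono_o[OF r(1) r'(1)] by (intro exI[of _ "r \<circ> r'"] exI[of _ "(u, u')"]) (auto simp: hsum_simps)
qed

end

section \<open>Bounded operators between the spaces \<open>V\<^sub>N\<close>, and right multiplications\<close>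

definition smul :: "complex \<Rightarrow> vec \<Rightarrow> vec" where
  "smul c f = (\<lambda>x. c * f x)"

definition vadd :: "vec \<Rightarrow> vec \<Rightarrow> vec" where
  "vadd f g = (\<lambda>x. f x + g x)"

lemma supp_smul: "supp N f \<Longrightarrow> supp N (smul c f)"
  by (simp add: supp_def smul_def)

lemma supp_vadd: "supp N f \<Longrightarrow> supp N g \<Longrightarrow> supp N (vadd f g)"
  by (simp add: supp_def vadd_def)

text \<open>Linearity is asked on all functions supported on the index set, square-summable or not,
  since multiplication by the Dirac coefficient may leave the Hilbert space. Preservation of finite
  support is included because the algebraic span has to be an invariant domain.\<close>

definition bop :: "real \<Rightarrow> real \<Rightarrow> (vec \<Rightarrow> vec) \<Rightarrow> bool" where
  "bop N M T \<longleftrightarrow> (\<forall>f. supp N f \<longrightarrow> supp M (T f)) \<and>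
     (\<forall>f g. supp N f \<longrightarrow> supp N g \<longrightarrow> T (vadd f g) = vadd (T f) (T g)) \<and>
     (\<forall>c f. supp N f \<longrightarrow> T (smul c f) = smul c (T f)) \<and>
     (\<forall>f. supp N f \<longrightarrow> finite {x. f x \<noteq> 0} \<longrightarrow> finite {x. T f x \<noteq> 0}) \<and>
     (\<exists>C. 0 \<le> C \<and> (\<forall>f. supp N f \<longrightarrow> l2 f \<longrightarrow> l2 (T f) \<and> n2 (T f) \<le> C * n2 f))"

lemma bopD:
  assumes "bop N M T" "supp N f"
  shows "supp M (T f)" "T (smul c f) = smul c (T f)" "supp N g \<Longrightarrow> T (vadd f g) = vadd (T f) (T g)"
    "finite {x. f x \<noteq> 0} \<Longrightarrow> finite {x. T f x \<noteq> 0}" "l2 f \<Longrightarrow> l2 (T f)"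
  using assms unfolding bop_def by blast+

lemma bop_bound:
  assumes "bop N M T"
  obtains C where "0 \<le> C" "\<And>f. supp N f \<Longrightarrow> l2 f \<Longrightarrow> n2 (T f) \<le> C * n2 f"
  using assms unfolding bop_def by blast

lemma bopI:
  assumes "\<And>f. supp N f \<Longrightarrow> supp M (T f)" "\<And>f g. supp N f \<Longrightarrow> supp N g \<Longrightarrow> T (vadd f g) = vadd (T f) (T g)"
    "\<And>c f. supp N f \<Longrightarrow> T (smul c f) = smul c (T f)"
    "\<And>f. supp N f \<Longrightarrow> finite {x. f x \<noteq> 0} \<Longrightarrow> finite {x. T f x \<noteq> 0}"
    "0 \<le> C" "\<And>f. supp N f \<Longrightarrow> l2 f \<Longrightarrow> l2 (T f)" "\<And>f. supp N f \<Longrightarrow> l2 f \<Longrightarrow> n2 (T f) \<le> C * n2 f"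
  shows "bop N M T"
  using assms unfolding bop_def by blast

lemma bop_id: "bop N N (\<lambda>f. f)"
  by (rule bopI[where C=1]) auto

lemma bop_comp:
  assumes T: "bop N M T" and S: "bop M L S"
  shows "bop N L (\<lambda>f. S (T f))"
proof -
  obtain C where C: "0 \<le> C" "\<And>f. supp N f \<Longrightarrow> l2 f \<Longrightarrow> n2 (T f) \<le> C * n2 f" using bop_bound[OF T] by blast
  obtain D where D: "0 \<le> D" "\<And>f. supp M f \<Longrightarrow> l2 f \<Longrightarrow> n2 (S f) \<le> D * n2 f" using bop_bound[OF S] by blast
  show ?thesis
  proof (rule bopI[where C="D * C"])
    fix f assume f: "supp N f" "l2 f"
    have "n2 (S (T f)) \<le> D * n2 (T f)" using D(2)[OF bopD(1)[OF T f(1)] bopD(5)[OF T f]] .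
    also have "\<dots> \<le> D * (C * n2 f)" by (rule mult_left_mono[OF C(2)[OF f] D(1)])
    finally show "n2 (S (T f)) \<le> D * C * n2 f" by (simp add: mult.assoc)
  qed (simp_all add: bopD[OF T] bopD[OF S] C D)
qed

lemma bop_vadd:
  assumes T: "bop N M T" and S: "bop N M S"
  shows "bop N M (\<lambda>f. vadd (T f) (S f))"
proof -
  obtain C where C: "0 \<le> C" "\<And>f. supp N f \<Longrightarrow> l2 f \<Longrightarrow> n2 (T f) \<le> C * n2 f" using bop_bound[OF T] by blast
  obtain D where D: "0 \<le> D" "\<And>f. supp N f \<Longrightarrow> l2 f \<Longrightarrow> n2 (S f) \<le> D * n2 f" using bop_bound[OF S] by blast
  show ?thesis
  proof (rule bopI[where C="2 * C + 2 * D"])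
    fix f assume f: "supp N f" "l2 f"
    note l = l2_add[OF bopD(5)[OF T f] bopD(5)[OF S f]]
    show "l2 (vadd (T f) (S f))" unfolding vadd_def by (rule l)
    have "n2 (vadd (T f) (S f)) \<le> 2 * n2 (T f) + 2 * n2 (S f)" unfolding vadd_def by (rule l)
    also have "\<dots> \<le> 2 * (C * n2 f) + 2 * (D * n2 f)" using C(2)[OF f] D(2)[OF f] by linarith
    finally show "n2 (vadd (T f) (S f)) \<le> (2 * C + 2 * D) * n2 f" by (simp add: algebra_simps)
  next
    fix f assume f: "supp N f" "finite {x. f x \<noteq> 0}"
    have "{x. vadd (T f) (S f) x \<noteq> 0} \<subseteq> {x. T f x \<noteq> 0} \<union> {x. S f x \<noteq> 0}" by (auto simp: vadd_def)
    thus "finite {x. vadd (T f) (S f) x \<noteq> 0}" using bopD(4)[OF T f] bopD(4)[OF S f] finite_subset by blast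
  next
    fix f g assume fg: "supp N f" "supp N g"
    show "vadd (T (vadd f g)) (S (vadd f g)) = vadd (vadd (T f) (S f)) (vadd (T g) (S g))"
      unfolding bopD(3)[OF T fg] bopD(3)[OF S fg] by (simp add: vadd_def algebra_simps)
  next
    fix f c assume f: "supp N f"
    show "vadd (T (smul c f)) (S (smul c f)) = smul c (vadd (T f) (S f))"
      unfolding bopD(2)[OF T f] bopD(2)[OF S f] by (simp add: vadd_def smul_def algebra_simps)
  next
    fix f assume f: "supp N f"
    show "supp M (vadd (T f) (S f))" by (rule supp_vadd[OF bopD(1)[OF T f] bopD(1)[OF S f]])
  qed (use C D in simp)
qed

lemma bop_scale: "bop N N (smul c)"
proof (rule bopI[where C="(cmod c)\<^sup>2"])
  fix f :: vec assume "finite {x. f x \<noteq> 0}"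
  thus "finite {x. smul c f x \<noteq> 0}" by (rule rev_finite_subset) (auto simp: smul_def)
qed (auto simp: supp_def smul_def vadd_def l2_scale n2_scale algebra_simps)

lemma bop_smul: "bop N M T \<Longrightarrow> bop N M (\<lambda>f. smul c (T f))"
  by (rule bop_comp[OF _ bop_scale])

lemma bop_zero: "bop N M (\<lambda>f x. 0)"
  by (rule bopI[where C=0]) (auto simp: supp_def vadd_def smul_def)

lemma bop_cong:
  assumes T: "bop N M T" and e: "\<And>f. supp N f \<Longrightarrow> T' f = T f"
  shows "bop N M T'"
proof -
  obtain C where C: "0 \<le> C" "\<And>f. supp N f \<Longrightarrow> l2 f \<Longrightarrow> n2 (T f) \<le> C * n2 f" using bop_bound[OF T] by blast
  show ?thesis
    by (rule bopI[where C=C]) (simp_all add: e supp_vadd supp_smul bopD[OF T] C)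
qed

section \<open>The conjugation and the right action\<close>

definition jc :: "vec \<Rightarrow> vec" where
  "jc f = (\<lambda>(l, m). cnj (f (l, - m)))"

lemma jc_jc [simp]: "jc (jc f) = f"
  by (auto simp: jc_def)

text \<open>The set \<open>gidx N\<close> is insensitive to the signs of \<open>m\<close> and
  \<open>N\<close>. The label -N records which representation acts on the reflected
  function.\<close>

lemma gidx_reflect: "(l, - m) \<in> gidx N \<longleftrightarrow> (l, m) \<in> gidx (- N)"
  by (auto simp: gidx_def)

lemma supp_jc: "supp N f \<Longrightarrow> supp (- N) (jc f)"
  by (auto simp: supp_def jc_def gidx_reflect)

lemma supp_jc': "supp (- N) f \<Longrightarrow> supp N (jc f)"
  using supp_jc[of "- N" f] by simp

lemma bij_reflect: "bij (\<lambda>(l :: real, m :: real). (l, - m))"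
  by (rule bij_betw_byWitness[where f'="\<lambda>(l, m). (l, - m)"]) auto

lemma l2_jc [simp]: "l2 (jc f) \<longleftrightarrow> l2 f"
  using l2_bij(1)[OF bij_reflect, of "\<lambda>x. cnj (f x)"] by (simp add: jc_def l2_def case_prod_unfold)

lemma ip2_jc: "ip2 (jc f) (jc g) = ip2 g f"
proof -
  have "ip2 (jc f) (jc g) = ip2 (\<lambda>x. cnj (f x)) (\<lambda>x. cnj (g x))"
    using l2_bij(3)[OF bij_reflect, of "\<lambda>x. cnj (f x)" "\<lambda>x. cnj (g x)"] by (simp add: jc_def case_prod_unfold)
  thus ?thesis by (simp add: ip2_def mult.commute)
qed

lemma jc_smul: "jc (smul c f) = smul (cnj c) (jc f)"
  by (auto simp: jc_def smul_def)

lemma jc_vadd: "jc (vadd f g) = vadd (jc f) (jc g)"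
  by (auto simp: jc_def vadd_def)

lemma supp_mulc_jc: "mulc c (jc f) = jc (mulc c f)"
  by (auto simp: mulc_def jc_def)

context deformation begin

lemma spin_vadd: "spin s i j N (vadd f g) = vadd (spin s i j N f) (spin s i j N g)"
  by (auto simp: spin_def hop_def vadd_def algebra_simps)

lemma spin_smul: "spin s i j N (smul c f) = smul c (spin s i j N f)"
  by (auto simp: spin_def hop_def smul_def algebra_simps)

lemma bop_spin:
  assumes "i \<in> {1,-1}" "j \<in> {1,-1}"
  shows "bop N (N + j/2) (spin 1 i j N)"
proof (rule bopI[where C="4 / q\<^sup>2"])
  fix f :: vec assume f: "finite {x. f x \<noteq> 0}"
  have "{x. spin 1 i j N f x \<noteq> 0} \<subseteq> (\<lambda>(l, m). (l+1/2, m+i/2)) ` {x. f x \<noteq> 0} \<union> (\<lambda>(l, m). (l-1/2, m+i/2)) ` {x. f x \<noteq> 0}"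
  proof
    fix x assume "x \<in> {x. spin 1 i j N f x \<noteq> 0}"
    moreover obtain l m where x: "x = (l, m)" by (cases x)
    ultimately have "f (l-1/2, m-i/2) \<noteq> 0 \<or> f (l+1/2, m-i/2) \<noteq> 0" by (auto simp: spin_def hop_def)
    moreover have "x = (\<lambda>(l, m). (l+1/2, m+i/2)) (l-1/2, m-i/2)" "x = (\<lambda>(l, m). (l-1/2, m+i/2)) (l+1/2, m-i/2)"
      by (simp_all add: x)
    ultimately show "x \<in> (\<lambda>(l, m). (l+1/2, m+i/2)) ` {x. f x \<noteq> 0} \<union> (\<lambda>(l, m). (l-1/2, m+i/2)) ` {x. f x \<noteq> 0}"
      by blast
  qed
  thus "finite {x. spin 1 i j N f x \<noteq> 0}" using f by (blast intro: finite_subset)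
qed (use supp_spin[OF assms] spin_l2[OF assms] in \<open>auto simp: spin_vadd spin_smul\<close>)

text \<open>Changing the signs of \<open>m\<close>, \<open>N\<close>, \<open>i\<close> and
  \<open>j\<close> together preserves the roots and reverses the exponent of q. That is the passage
  from s = 1 to s = -1.\<close>

lemma jc_spin: "jc (spin 1 i j (- N) (jc f)) = spin (-1) (-i) (-j) N f"
proof -
  have "up 1 i j (- N) l (- m) = up (-1) (-i) (-j) N l m" "dn 1 i j (- N) l (- m) = dn (-1) (-i) (-j) N l m" for l m
  proof -
    have e: "1 * ((- m - - N) / 2 + (j - i) / 2 * (l + 1/2)) = -1 * ((m - N) / 2 + (- j - - i) / 2 * (l + 1/2))"
      "1 * ((- m - - N) / 2 - (j - i) / 2 * (l + 1/2)) = -1 * ((m - N) / 2 - (- j - - i) / 2 * (l + 1/2))"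
      by (simp_all add: field_simps)
    show "up 1 i j (- N) l (- m) = up (-1) (-i) (-j) N l m" "dn 1 i j (- N) l (- m) = dn (-1) (-i) (-j) N l m"
      unfolding up_def dn_def e by simp_all
  qed
  note w = this
  have "jc (hop (i/2) u d (jc f)) = hop (-(i/2)) (\<lambda>l m. u l (- m)) (\<lambda>l m. d l (- m)) f" for u d
    by (simp add: jc_def hop_def fun_eq_iff algebra_simps)
  thus ?thesis by (simp add: spin_def w)
qed

text \<open>Conjugation by \<open>jc\<close> turns the left action on \<open>V\<^bsub>-M\<^esub>\<close> into a right action on \<open>V\<^sub>M\<close>.\<close>

definition rgen :: "real \<Rightarrow> gen \<Rightarrow> vec \<Rightarrow> vec" where
  "rgen M g f = jc (gen_op q (- M) g (jc f))"

lemma gen_ik: "gen_i g \<in> {1,-1}" "gen_k g \<in> {1,-1}"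
  by (cases g; simp)+

lemma gen_op_smul:
  assumes "2 * N \<in> \<int>" "supp N f"
  shows "gen_op q N g f = smul (complex_of_real (gen_c g)) (spin 1 (gen_i g) 1 (N - 1/2) (spin 1 (gen_k g) (-1) N f))"
  unfolding gen_op_eq[OF assms] smul_def ..

lemma bop_gen: "2 * N \<in> \<int> \<Longrightarrow> bop N N (gen_op q N g)"
proof -
  assume N: "2 * N \<in> \<int>"
  have 1: "bop N (N - 1/2) (spin 1 (gen_k g) (-1) N)" using bop_spin[OF gen_ik(2)[of g], of "-1" N] by simp
  have 2: "bop (N - 1/2) N (spin 1 (gen_i g) 1 (N - 1/2))" using bop_spin[OF gen_ik(1)[of g], of 1 "N - 1/2"] by simp
  show ?thesis by (rule bop_cong[OF bop_smul[OF bop_comp[OF 1 2]] gen_op_smul[OF N]])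
qed

text \<open>All signs flip under the conjugation, so a right generator raises \<open>N\<close> by
  1/2 first and then lowers it.\<close>

lemma rgen_eq:
  assumes N: "2 * N \<in> \<int>" and f: "supp N f"
  shows "rgen N g f = smul (complex_of_real (gen_c g)) (spin (-1) (- gen_i g) (-1) (N + 1/2) (spin (-1) (- gen_k g) 1 N f))"
proof -
  have "2 * (- N) \<in> \<int>" using N by simp
  note e = gen_op_smul[OF this supp_jc[OF f], of g]
  have 1: "spin 1 (gen_k g) (-1) (- N) (jc f) = jc (spin (-1) (- gen_k g) 1 N f)"
    using arg_cong[OF jc_spin[of "gen_k g" "-1" N f], of jc] by simp
  have 2: "jc (spin 1 (gen_i g) 1 (- N - 1/2) (jc h)) = spin (-1) (- gen_i g) (-1) (N + 1/2) h" for h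
    using jc_spin[of "gen_i g" 1 "N + 1/2" h] by simp
  show ?thesis unfolding rgen_def e jc_smul 1 2 by simp
qed

lemma half_Ints: "2 * N \<in> \<int> \<Longrightarrow> 2 * (N + 1/2) \<in> \<int>" "2 * N \<in> \<int> \<Longrightarrow> 2 * (N - 1/2) \<in> \<int>"
  "2 * N \<in> \<int> \<Longrightarrow> 2 * (N + 1) \<in> \<int>" "2 * N \<in> \<int> \<Longrightarrow> 2 * (N - 1) \<in> \<int>" for N :: real
  by (simp_all add: distrib_left right_diff_distrib)

text \<open>Only the right action of the generators is tested; \<open>inter_rop\<close> extends the
  property to the whole algebra.\<close>

definition intertwines :: "real \<Rightarrow> real \<Rightarrow> (vec \<Rightarrow> vec) \<Rightarrow> bool" where
  "intertwines N M T \<longleftrightarrow> (\<forall>g f. supp N f \<longrightarrow> T (rgen N g f) = rgen M g (T f))"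

text \<open>A right generator is a product of two right spin operators, and \<open>spin_comm\<close>
  moves the left one past each of them in turn.\<close>

lemma inter_spin:
  assumes ij: "i \<in> {1,-1}" "j \<in> {1,-1}" and N: "2 * N \<in> \<int>"
  shows "intertwines N (N + j/2) (spin 1 i j N)"
  unfolding intertwines_def
proof (intro allI impI)
  fix g f assume f: "supp N f"
  have M: "2 * (N + j/2) \<in> \<int>" using half_Ints[OF N] ij by auto
  have k: "- gen_k g \<in> {1,-1}" "- gen_i g \<in> {1,-1}" using gen_ik[of g] by auto
  have s: "supp (N + 1/2) (spin (-1) (- gen_k g) 1 N f)" by (rule supp_spin[OF k(1) _ f]) simp
  have "spin (-1) (- gen_i g) (-1) (N + j/2 + 1/2) (spin (-1) (- gen_k g) 1 (N + j/2) (spin 1 i j N f))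
    = spin (-1) (- gen_i g) (-1) (N + 1/2 + j/2) (spin 1 i j (N + 1/2) (spin (-1) (- gen_k g) 1 N f))"
    using spin_comm[OF ij(1) k(1) ij(2) _ f, of 1] by (simp add: algebra_simps)
  also have "\<dots> = spin 1 i j (N + 1/2 + -1/2) (spin (-1) (- gen_i g) (-1) (N + 1/2) (spin (-1) (- gen_k g) 1 N f))"
    by (rule spin_comm[OF ij(1) k(2) ij(2) _ s]) simp
  finally have "spin (-1) (- gen_i g) (-1) (N + j/2 + 1/2) (spin (-1) (- gen_k g) 1 (N + j/2) (spin 1 i j N f))
    = spin 1 i j N (spin (-1) (- gen_i g) (-1) (N + 1/2) (spin (-1) (- gen_k g) 1 N f))" by simp
  thus "spin 1 i j N (rgen N g f) = rgen (N + j/2) g (spin 1 i j N f)"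
    unfolding rgen_eq[OF N f] rgen_eq[OF M supp_spin[OF ij f]] spin_smul by simp
qed

lemma inter_comp: "intertwines N M T \<Longrightarrow> intertwines M L S \<Longrightarrow> bop N M T \<Longrightarrow> intertwines N L (\<lambda>f. S (T f))"
  unfolding intertwines_def by (simp add: bopD(1))

lemma rgen_smul:
  assumes N: "2 * N \<in> \<int>" and f: "supp N f"
  shows "rgen N a (smul c f) = smul c (rgen N a f)"
  unfolding rgen_eq[OF N f] rgen_eq[OF N supp_smul[OF f]]
  by (simp add: spin_smul) (simp add: smul_def fun_eq_iff algebra_simps)

lemma rgen_vadd:
  assumes N: "2 * N \<in> \<int>" and f: "supp N f" "supp N g"
  shows "rgen N a (vadd f g) = vadd (rgen N a f) (rgen N a g)"
  unfolding rgen_eq[OF N f(1)] rgen_eq[OF N f(2)] rgen_eq[OF N supp_vadd[OF f]]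
  by (simp add: spin_vadd) (simp add: smul_def vadd_def fun_eq_iff algebra_simps)

lemma inter_smul: "intertwines N M T \<Longrightarrow> bop N M T \<Longrightarrow> 2 * M \<in> \<int> \<Longrightarrow> intertwines N M (\<lambda>f. smul c (T f))"
  unfolding intertwines_def by (simp add: bopD(1) rgen_smul)

lemma inter_vadd:
  "intertwines N M T \<Longrightarrow> bop N M T \<Longrightarrow> intertwines N M S \<Longrightarrow> bop N M S \<Longrightarrow> 2 * M \<in> \<int> \<Longrightarrow> intertwines N M (\<lambda>f. vadd (T f) (S f))"
  unfolding intertwines_def by (simp add: bopD(1) rgen_vadd)

lemma inter_cong: "intertwines N M T \<Longrightarrow> (\<And>f. supp N f \<Longrightarrow> T' f = T f) \<Longrightarrow> (\<And>f g. supp N f \<Longrightarrow> supp N (rgen N g f)) \<Longrightarrow> intertwines N M T'"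
  unfolding intertwines_def by simp

lemma supp_rgen: "2 * N \<in> \<int> \<Longrightarrow> supp N f \<Longrightarrow> supp N (rgen N g f)"
  unfolding rgen_def by (rule supp_jc', rule bopD(1)[OF bop_gen], simp, rule supp_jc)

lemma inter_zero: "2 * M \<in> \<int> \<Longrightarrow> intertwines N M (\<lambda>f x. 0)"
proof -
  assume M: "2 * M \<in> \<int>"
  have z: "supp M (\<lambda>x. 0)" by (simp add: supp_def)
  have "rgen M g (\<lambda>x. 0) = (\<lambda>x. 0)" for g using rgen_smul[OF M z, of g 0] by (simp add: smul_def)
  thus ?thesis by (simp add: intertwines_def)
qed

lemma inter_gen: "2 * N \<in> \<int> \<Longrightarrow> intertwines N N (gen_op q N g)"
proof -
  assume N: "2 * N \<in> \<int>"
  have 1: "bop N (N - 1/2) (spin 1 (gen_k g) (-1) N)" using bop_spin[OF gen_ik(2)[of g], of "-1" N] by simp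
  have 2: "bop (N - 1/2) N (spin 1 (gen_i g) 1 (N - 1/2))" using bop_spin[OF gen_ik(1)[of g], of 1 "N - 1/2"] by simp
  have 3: "intertwines N (N - 1/2) (spin 1 (gen_k g) (-1) N)" using inter_spin[OF gen_ik(2)[of g], of "-1" N] N by simp
  have 4: "intertwines (N - 1/2) N (spin 1 (gen_i g) 1 (N - 1/2))" using inter_spin[OF gen_ik(1)[of g], of 1 "N - 1/2"] half_Ints[OF N] by simp
  show ?thesis
    by (rule inter_cong[OF inter_smul[OF inter_comp[OF 3 4 1] bop_comp[OF 1 2] N] gen_op_smul[OF N] supp_rgen[OF N]])
qed

text \<open>The first root vanishes at the level l = N, which V_(N+1) lacks, and the second at l =
  -N-1, which V_N lacks. So multiplication never produces a vector outside the target.\<close>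

lemma supp_mulc_cf:
  "supp N f \<Longrightarrow> supp (N + 1) (mulc (cf N) f)" "supp (N + 1) f \<Longrightarrow> supp N (mulc (cf N) f)"
proof -
  have n: "x - 1 \<in> \<nat>" if "x \<in> \<nat>" "x \<noteq> 0" for x :: real using Nats_pred that .
  have n': "x + 1 \<in> \<nat>" if "x \<in> \<nat>" for x :: real using that by simp
  { assume f: "supp N f"
    show "supp (N + 1) (mulc (cf N) f)"
      unfolding supp_def
    proof (intro allI impI)
      fix x assume x: "x \<notin> gidx (N + 1)"
      obtain l m where [simp]: "x = (l, m)" by (cases x)
      show "mulc (cf N) f x = 0"
      proof (cases "(l, m) \<in> gidx N \<and> l - N \<noteq> 0")
        case True
        hence "l + m \<in> \<nat>" "l - m \<in> \<nat>" "l + N + 1 \<in> \<nat>" "l - N - 1 \<in> \<nat>" using n[of "l - N"] n'[of "l + N"] by (auto simp: gidx_def)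
        hence "x \<in> gidx (N + 1)" by (simp add: gidx_def add.assoc diff_diff_eq)
        thus ?thesis using x by simp
      next
        case False
        thus ?thesis using supp_not[OF f, of x] by (auto simp: mulc_def cf_def)
      qed
    qed }
  { assume f: "supp (N + 1) f"
    show "supp N (mulc (cf N) f)"
      unfolding supp_def
    proof (intro allI impI)
      fix x assume x: "x \<notin> gidx N"
      obtain l m where [simp]: "x = (l, m)" by (cases x)
      show "mulc (cf N) f x = 0"
      proof (cases "(l, m) \<in> gidx (N + 1) \<and> l + N + 1 \<noteq> 0")
        case True
        hence "l + m \<in> \<nat>" "l - m \<in> \<nat>" "l + N + 1 - 1 \<in> \<nat>" "l - (N + 1) + 1 \<in> \<nat>"
          using n[of "l + N + 1"] n'[of "l - (N + 1)"] by (auto simp: gidx_def add.assoc)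
        hence "x \<in> gidx N" by (simp add: gidx_def)
        thus ?thesis using x by simp
      next
        case False
        thus ?thesis using supp_not[OF f, of x] by (auto simp: mulc_def cf_def)
      qed
    qed }
qed

end

section \<open>The relations and the free algebra\<close>

lemma free_alg_induct [case_names single add]:
  fixes x :: free_alg
  assumes "\<And>w c. P (Poly_Mapping.single w c)" "\<And>x y. P x \<Longrightarrow> P y \<Longrightarrow> P (x + y)"
  shows "P x"
proof -
  have s: "P (\<Sum>w\<in>S. Poly_Mapping.single w (f w))" if "finite S" for S f
    using that
  proof (induction S rule: finite_induct)
    case empty
    show ?case using assms(1)[of 0 0] by simp
  qed (simp add: assms)
  have "x = (\<Sum>w\<in>Poly_Mapping.keys x. Poly_Mapping.single w (Poly_Mapping.lookup x w))"
  proof (rule poly_mapping_eqI)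
    fix k
    show "Poly_Mapping.lookup x k = Poly_Mapping.lookup (\<Sum>w\<in>Poly_Mapping.keys x. Poly_Mapping.single w (Poly_Mapping.lookup x w)) k"
      by (simp add: lookup_sum lookup_single when_def sum.delta in_keys_iff)
  qed
  thus ?thesis using s[OF finite_keys] by metis
qed

lemma sum_superset:
  fixes h :: "word \<Rightarrow> complex \<Rightarrow> 'b :: comm_monoid_add"
  assumes "finite S" "Poly_Mapping.keys x \<subseteq> S" "\<And>w. h w 0 = 0"
  shows "(\<Sum>w\<in>Poly_Mapping.keys x. h w (Poly_Mapping.lookup x w)) = (\<Sum>w\<in>S. h w (Poly_Mapping.lookup x w))"
  by (rule sum.mono_neutral_left) (use assms in \<open>auto simp: in_keys_iff\<close>)

text \<open>Keys can cancel in a sum, so all three sums are first extended to the union of the two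
  key sets.\<close>

lemma sum_keys_add:
  fixes h :: "word \<Rightarrow> complex \<Rightarrow> 'b :: comm_monoid_add"
  assumes "\<And>w. h w 0 = 0" "\<And>w a b. h w (a + b) = h w a + h w b"
  shows "(\<Sum>w\<in>Poly_Mapping.keys (x + y). h w (Poly_Mapping.lookup (x + y) w))
    = (\<Sum>w\<in>Poly_Mapping.keys x. h w (Poly_Mapping.lookup x w)) + (\<Sum>w\<in>Poly_Mapping.keys y. h w (Poly_Mapping.lookup y w))"
proof -
  define S where "S = Poly_Mapping.keys x \<union> Poly_Mapping.keys y"
  have S: "finite S" "Poly_Mapping.keys x \<subseteq> S" "Poly_Mapping.keys y \<subseteq> S" "Poly_Mapping.keys (x + y) \<subseteq> S"
    using keys_add[of x y] by (auto simp: S_def)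
  show ?thesis
    unfolding sum_superset[where h=h, OF S(1,2) assms(1)] sum_superset[where h=h, OF S(1,3) assms(1)]
      sum_superset[where h=h, OF S(1,4) assms(1)]
    by (simp add: lookup_add assms(2) sum.distrib)
qed

lemma sum_keys_single:
  fixes h :: "word \<Rightarrow> complex \<Rightarrow> 'b :: comm_monoid_add"
  assumes "h w 0 = 0"
  shows "(\<Sum>v\<in>Poly_Mapping.keys (Poly_Mapping.single w c). h v (Poly_Mapping.lookup (Poly_Mapping.single w c) v)) = h w c"
  using assms by (cases "c = 0") auto

lemma free_star_add: "free_star (x + y) = free_star x + free_star y"
  unfolding free_star_def by (rule sum_keys_add) (simp_all add: single_add)

definition word_star :: "word \<Rightarrow> word" where
  "word_star w = Word (rev (map gen_star (letters w)))"

lemma free_star_single: "free_star (Poly_Mapping.single w c) = Poly_Mapping.single (word_star w) (cnj c)"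
  unfolding free_star_def word_star_def by (rule sum_keys_single) simp

lemma gen_star_gen_star [simp]: "gen_star (gen_star g) = g"
  by (cases g) auto

lemma word_star_word_star: "word_star (word_star w) = w"
  by (cases w) (simp add: word_star_def rev_map o_def)

lemma word_star_plus: "word_star (v + w) = word_star w + word_star v"
  by (simp add: word_star_def plus_word_def)

lemma word_star_zero: "word_star 0 = 0"
  by (simp add: word_star_def zero_word_def)

lemma free_star_star: "free_star (free_star x) = x"
  by (induction x rule: free_alg_induct) (simp_all add: free_star_single free_star_add word_star_word_star)

lemma free_star_mult: "free_star (x * y) = free_star y * free_star x"
proof (induction x rule: free_alg_induct)
  case (single w c)
  show ?case
    by (induction y rule: free_alg_induct)
      (simp_all add: free_star_single free_star_add mult_single word_star_plus distrib_left distrib_right mult.commute)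
qed (simp add: free_star_add distrib_left distrib_right)

lemma free_star_scal: "free_star (scal c) = scal (cnj c)"
  by (simp add: scal_def free_star_single word_star_zero)

lemma free_star_gelt: "free_star (gelt g) = gelt (gen_star g)"
  by (simp add: gelt_def free_star_single word_star_def)

lemma free_star_one: "free_star 1 = 1"
  using free_star_scal[of 1] by (simp add: scal_def)

lemma free_star_uminus: "free_star (- x) = - free_star x"
proof -
  have "free_star x + free_star (- x) = free_star 0" by (simp flip: free_star_add)
  also have "free_star 0 = 0" using free_star_single[of 0 0] by simp
  finally show ?thesis by (simp add: add_eq_0_iff)
qed

lemma free_star_diff: "free_star (x - y) = free_star x - free_star y"
  using free_star_add[of x "- y"] by (simp add: free_star_uminus)

lemma scal_simps: "scal c * scal d = scal (c * d)" "scal 1 = 1" "scal (c + d) = scal c + scal d" "scal c * x = x * scal c"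
proof -
  show "scal c * x = x * scal c"
    by (induction x rule: free_alg_induct) (simp_all add: scal_def mult_single distrib_left distrib_right mult.commute)
qed (simp_all add: scal_def mult_single single_add)

declare gen_op.simps [simp del]

section \<open>The defining relations for the operators, and the representation of the free
  algebra\<close>

context deformation begin

lemma spin_q_comm':
  assumes "i \<in> {1,-1}" "i' \<in> {1,-1}" "j \<in> {1,-1}" "j' \<in> {1,-1}" "i = i' \<or> j = j' \<or> i = j" "supp N f"
  shows "spin 1 i' j' (N + j/2) (spin 1 i j N f) = smul (complex_of_real (q powr ((j'-i'-j+i)/2))) (spin 1 i j (N + j'/2) (spin 1 i' j' N f))"
  by (rule ext) (simp add: smul_def spin_q_comm[OF assms])

text \<open>With a, b, a', b' for the entries (1,-1), (1,1), (-1,1), (-1,-1), these read b a = q a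
  b, b' a = q a b', b' b = b b', a' b = q b a' and a' b' = q b' a'.\<close>

lemma spin_rel:
  assumes f: "supp N f"
  shows "spin 1 1 1 (N-1/2) (spin 1 1 (-1) N f) = smul (complex_of_real q) (spin 1 1 (-1) (N+1/2) (spin 1 1 1 N f))"
    and "spin 1 (-1) (-1) (N-1/2) (spin 1 1 (-1) N f) = smul (complex_of_real q) (spin 1 1 (-1) (N-1/2) (spin 1 (-1) (-1) N f))"
    and "spin 1 (-1) (-1) (N+1/2) (spin 1 1 1 N f) = spin 1 1 1 (N-1/2) (spin 1 (-1) (-1) N f)"
    and "spin 1 (-1) 1 (N+1/2) (spin 1 1 1 N f) = smul (complex_of_real q) (spin 1 1 1 (N+1/2) (spin 1 (-1) 1 N f))"
    and "spin 1 (-1) 1 (N-1/2) (spin 1 (-1) (-1) N f) = smul (complex_of_real q) (spin 1 (-1) (-1) (N+1/2) (spin 1 (-1) 1 N f))"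
  using spin_q_comm'[OF _ _ _ _ _ f, of 1 1 "-1" 1] spin_q_comm'[OF _ _ _ _ _ f, of 1 "-1" "-1" "-1"]
    spin_q_comm'[OF _ _ _ _ _ f, of 1 "-1" 1 "-1"] spin_q_comm'[OF _ _ _ _ _ f, of 1 "-1" 1 1]
    spin_q_comm'[OF _ _ _ _ _ f, of "-1" "-1" "-1" 1] q_pos
  by (simp_all add: smul_def)

lemma spin_unit':
  assumes f: "supp N f"
  shows "spin 1 (-1) 1 (N - 1/2) (spin 1 1 (-1) N f) = vadd f (smul (complex_of_real q) (spin 1 (-1) (-1) (N + 1/2) (spin 1 1 1 N f)))"
    and "spin 1 1 (-1) (N + 1/2) (spin 1 (-1) 1 N f) = vadd f (smul (complex_of_real (1/q)) (spin 1 1 1 (N - 1/2) (spin 1 (-1) (-1) N f)))"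
  by (rule ext, simp add: vadd_def smul_def spin_unit[OF f])+

lemma supp_spin':
  assumes "supp N f"
  shows "supp (N - 1/2) (spin 1 1 (-1) N f)" "supp (N - 1/2) (spin 1 (-1) (-1) N f)"
    "supp (N + 1/2) (spin 1 1 1 N f)" "supp (N + 1/2) (spin 1 (-1) 1 N f)"
  using supp_spin[OF _ _ assms, of 1 "-1" 1] supp_spin[OF _ _ assms, of "-1" "-1" 1]
    supp_spin[OF _ _ assms, of 1 1 1] supp_spin[OF _ _ assms, of "-1" 1 1] by simp_all

lemma smul_smul: "smul c (smul d f) = smul (c * d) f"
  by (simp add: smul_def mult.assoc)

lemma smul_vadd: "smul c (vadd f g) = vadd (smul c f) (smul c g)"
  by (simp add: smul_def vadd_def distrib_left)

text \<open>In the letters a, b, a', b' of \<open>spin_rel\<close>, the generators are A = -(1/q) b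
  b', B = q^(-3/2) b a and B* = -q^(-3/2) a' b'. The first two relations need only the
  q-commutations. The last two also use the determinant relations, whose constant term produces the
  summand linear in A.\<close>

lemma gen_relations:
  assumes N: "2 * N \<in> \<int>" and f: "supp N f"
  shows "gen_op q N GA (gen_op q N GB f) = smul (complex_of_real (q\<^sup>2)) (gen_op q N GB (gen_op q N GA f))"
    and "gen_op q N GA (gen_op q N GBstar f) = smul (complex_of_real (1 / q\<^sup>2)) (gen_op q N GBstar (gen_op q N GA f))"
    and "gen_op q N GB (gen_op q N GBstar f) = smul (complex_of_real (1 / q\<^sup>2)) (vadd (gen_op q N GA f) (smul (-1) (gen_op q N GA (gen_op q N GA f))))"
    and "gen_op q N GBstar (gen_op q N GB f) = vadd (gen_op q N GA f) (smul (- complex_of_real (q\<^sup>2)) (gen_op q N GA (gen_op q N GA f)))"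
proof -
  have g: "supp N (gen_op q N g f)" for g by (rule bopD(1)[OF bop_gen[OF N] f])
  note e = gen_op_smul[OF N f]
  have ee: "gen_op q N g' (gen_op q N g f) = smul (complex_of_real (gen_c g') * complex_of_real (gen_c g))
      (spin 1 (gen_i g') 1 (N - 1/2) (spin 1 (gen_k g') (-1) N (spin 1 (gen_i g) 1 (N - 1/2) (spin 1 (gen_k g) (-1) N f))))" for g g'
    unfolding gen_op_smul[OF N g] unfolding e spin_smul smul_smul ..
  define u where "u = spin 1 1 (-1) N f"
  define v where "v = spin 1 (-1) (-1) N f"
  have uv: "supp (N - 1/2) u" "supp (N - 1/2) v" unfolding u_def v_def by (rule supp_spin'[OF f])+
  have w: "supp (N - 1) (spin 1 (-1) (-1) (N - 1/2) u)" "supp (N - 1) (spin 1 (-1) (-1) (N - 1/2) v)"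
    using supp_spin'(2)[OF uv(1)] supp_spin'(2)[OF uv(2)] by simp_all
  have bb: "spin 1 (-1) (-1) N (spin 1 1 1 (N - 1/2) h) = spin 1 1 1 (N - 1) (spin 1 (-1) (-1) (N - 1/2) h)" if "supp (N - 1/2) h" for h
    using spin_rel(3)[OF that] by simp
  have a'b: "spin 1 (-1) 1 (N - 1/2) (spin 1 1 1 (N - 1) h) = smul (complex_of_real q) (spin 1 1 1 (N - 1/2) (spin 1 (-1) 1 (N - 1) h))" if "supp (N - 1) h" for h
    using spin_rel(4)[OF that] by simp
  have a'b': "spin 1 (-1) 1 (N - 1) (spin 1 (-1) (-1) (N - 1/2) h) = smul (complex_of_real q) (spin 1 (-1) (-1) N (spin 1 (-1) 1 (N - 1/2) h))" if "supp (N - 1/2) h" for h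
    using spin_rel(5)[OF that] by simp
  have ba: "spin 1 1 1 (N - 1) (spin 1 1 (-1) (N - 1/2) h) = smul (complex_of_real q) (spin 1 1 (-1) N (spin 1 1 1 (N - 1/2) h))" if "supp (N - 1/2) h" for h
    using spin_rel(1)[OF that] by simp
  have "spin 1 (-1) (-1) N (spin 1 1 1 (N - 1/2) u) = smul (complex_of_real (q * q)) (spin 1 1 (-1) N (spin 1 1 1 (N - 1/2) v))"
    unfolding bb[OF uv(1)] unfolding u_def spin_rel(2)[OF f] spin_smul v_def[symmetric] ba[OF uv(2)] by (simp add: smul_smul)
  thus "gen_op q N GA (gen_op q N GB f) = smul (complex_of_real (q\<^sup>2)) (gen_op q N GB (gen_op q N GA f))"
    unfolding ee unfolding e by (simp add: spin_smul u_def v_def smul_smul power2_eq_square mult_ac)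
  have "spin 1 (-1) 1 (N - 1/2) (spin 1 (-1) (-1) N (spin 1 1 1 (N - 1/2) v)) = smul (complex_of_real (q * q)) (spin 1 1 1 (N - 1/2) (spin 1 (-1) (-1) N (spin 1 (-1) 1 (N - 1/2) v)))"
    unfolding bb[OF uv(2)] a'b[OF w(2)] a'b'[OF uv(2)] spin_smul by (simp add: smul_smul)
  thus "gen_op q N GA (gen_op q N GBstar f) = smul (complex_of_real (1 / q\<^sup>2)) (gen_op q N GBstar (gen_op q N GA f))"
    unfolding ee unfolding e using q_pos by (simp add: spin_smul u_def v_def smul_smul power2_eq_square field_simps)
  have "spin 1 1 (-1) N (spin 1 (-1) 1 (N - 1/2) v) = vadd v (smul (complex_of_real (1/q)) (spin 1 1 1 (N - 1) (spin 1 (-1) (-1) (N - 1/2) v)))"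
    using spin_unit'(2)[OF uv(2)] by simp
  also have "spin 1 1 1 (N - 1) (spin 1 (-1) (-1) (N - 1/2) v) = spin 1 (-1) (-1) N (spin 1 1 1 (N - 1/2) v)" by (rule bb[OF uv(2), symmetric])
  finally have 3: "spin 1 1 (-1) N (spin 1 (-1) 1 (N - 1/2) v) = vadd v (smul (complex_of_real (1/q)) (spin 1 (-1) (-1) N (spin 1 1 1 (N - 1/2) v)))" .
  have p3: "q powr (-3/2) * q powr (-3/2) = 1 / (q * (q * q))"
  proof -
    have "q powr (-3/2) * q powr (-3/2) = q powr (- 3)" by (simp add: powr_add[symmetric])
    thus ?thesis using q_pos by (simp add: powr_minus_divide powr_numeral power3_eq_cube)
  qed
  hence p3': "complex_of_real (q powr (-3/2)) * complex_of_real (q powr (-3/2)) = 1 / (complex_of_real q * (complex_of_real q * complex_of_real q))"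
    by (metis of_real_1 of_real_divide of_real_mult)
  have q0: "complex_of_real q \<noteq> 0" using q_pos by simp
  have "gen_op q N GB (gen_op q N GBstar f) = smul (- (complex_of_real (q powr (-3/2)) * complex_of_real (q powr (-3/2)))) (spin 1 1 1 (N - 1/2) (spin 1 1 (-1) N (spin 1 (-1) 1 (N - 1/2) v)))"
    unfolding ee unfolding e by (simp add: spin_smul v_def smul_smul)
  also have "\<dots> = smul (complex_of_real (1 / q\<^sup>2)) (vadd (gen_op q N GA f) (smul (-1) (gen_op q N GA (gen_op q N GA f))))"
    unfolding 3 p3' spin_vadd spin_smul ee unfolding e using q0
    by (simp add: spin_smul v_def smul_smul smul_vadd power2_eq_square field_simps)
  finally show "gen_op q N GB (gen_op q N GBstar f) = smul (complex_of_real (1 / q\<^sup>2)) (vadd (gen_op q N GA f) (smul (-1) (gen_op q N GA (gen_op q N GA f))))" .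
  have "spin 1 (-1) 1 (N - 1/2) u = vadd f (smul (complex_of_real q) (spin 1 1 1 (N - 1/2) v))"
    unfolding u_def spin_unit'(1)[OF f] spin_rel(3)[OF f] v_def ..
  hence 4: "spin 1 (-1) 1 (N - 1/2) (spin 1 (-1) (-1) N (spin 1 1 1 (N - 1/2) u)) =
      smul (complex_of_real (q * q)) (spin 1 1 1 (N - 1/2) (spin 1 (-1) (-1) N (vadd f (smul (complex_of_real q) (spin 1 1 1 (N - 1/2) v)))))"
    unfolding bb[OF uv(1)] a'b[OF w(1)] a'b'[OF uv(1)] spin_smul by (simp add: smul_smul spin_smul)
  have "gen_op q N GBstar (gen_op q N GB f) = smul (- (complex_of_real (q powr (-3/2)) * complex_of_real (q powr (-3/2)))) (spin 1 (-1) 1 (N - 1/2) (spin 1 (-1) (-1) N (spin 1 1 1 (N - 1/2) u)))"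
    unfolding ee unfolding e by (simp add: spin_smul u_def smul_smul)
  also have "\<dots> = vadd (gen_op q N GA f) (smul (- complex_of_real (q\<^sup>2)) (gen_op q N GA (gen_op q N GA f)))"
    unfolding 4 p3' spin_vadd spin_smul ee unfolding e using q0
    by (simp add: spin_smul v_def smul_smul smul_vadd power2_eq_square field_simps)
  finally show "gen_op q N GBstar (gen_op q N GB f) = vadd (gen_op q N GA f) (smul (- complex_of_real (q\<^sup>2)) (gen_op q N GA (gen_op q N GA f)))" .
qed

definition wop :: "real \<Rightarrow> word \<Rightarrow> vec \<Rightarrow> vec" where
  "wop N w f = foldr (gen_op q N) (letters w) f"

lemma wop_plus: "wop N (v + w) f = wop N v (wop N w f)"
  by (simp add: wop_def plus_word_def)

lemma word_induct [case_names zero cons]: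
  fixes w :: word
  assumes "P 0" "\<And>g w. P w \<Longrightarrow> P (Word [g] + w)"
  shows "P w"
proof (cases w)
  case (Word ls)
  have "P (Word ls)"
  proof (induction ls)
    case Nil thus ?case using assms(1) by (simp add: zero_word_def)
  next
    case (Cons g ls) thus ?case using assms(2)[of "Word ls" g] by (simp add: plus_word_def)
  qed
  thus ?thesis by (simp add: Word)
qed

lemma wop_simps: "wop N 0 f = f" "wop N (Word [g] + w) f = gen_op q N g (wop N w f)"
  by (simp_all add: wop_def zero_word_def plus_word_def)

lemma free_rep_add: "free_rep q N (x + y) f = vadd (free_rep q N x f) (free_rep q N y f)"
  unfolding free_rep_def vadd_def
  by (rule ext, rule sum_keys_add[where h="\<lambda>w c. c * foldr (gen_op q N) (letters w) f i" for i]) (simp_all add: distrib_right)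

lemma free_rep_single: "free_rep q N (Poly_Mapping.single w c) f = smul c (wop N w f)"
  unfolding free_rep_def smul_def wop_def
  by (rule ext, rule sum_keys_single[where h="\<lambda>w c. c * foldr (gen_op q N) (letters w) f i" for i]) simp

lemma bop_wop: "2 * N \<in> \<int> \<Longrightarrow> bop N N (wop N w)"
proof (induction w rule: word_induct)
  case zero
  show ?case by (rule bop_cong[OF bop_id]) (simp add: wop_simps)
next
  case (cons g w)
  show ?case by (rule bop_cong[OF bop_comp[OF cons.IH[OF cons.prems] bop_gen[OF cons.prems]] wop_simps(2)])
qed

lemma bop_free_rep: "2 * N \<in> \<int> \<Longrightarrow> bop N N (free_rep q N x)"
proof (induction x rule: free_alg_induct)
  case (single w c)
  show ?case by (rule bop_cong[OF bop_smul[OF bop_wop[OF single]] free_rep_single])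
next
  case (add x y)
  show ?case by (rule bop_cong[OF bop_vadd[OF add.IH(1)[OF add.prems] add.IH(2)[OF add.prems]] free_rep_add])
qed

lemma free_rep_mult:
  assumes N: "2 * N \<in> \<int>" and f: "supp N f"
  shows "free_rep q N (x * y) f = free_rep q N x (free_rep q N y f)"
proof (induction x rule: free_alg_induct)
  case (single v c)
  show ?case
  proof (induction y rule: free_alg_induct)
    case (single w d)
    show ?case
      by (simp add: mult_single free_rep_single wop_plus bopD(2)[OF bop_wop[OF N] bopD(1)[OF bop_wop[OF N] f]] smul_smul)
  next
    case (add x y)
    show ?case
      by (simp add: distrib_left free_rep_add add.IH bopD(3)[OF bop_free_rep[OF N] bopD(1)[OF bop_free_rep[OF N] f] bopD(1)[OF bop_free_rep[OF N] f]])
  qed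
next
  case (add x x')
  thus ?case by (simp add: distrib_right free_rep_add)
qed

lemma free_rep_one: "free_rep q N 1 f = f"
  using free_rep_single[of N 0 1 f] by (simp add: wop_simps smul_def)

lemma free_rep_scal: "free_rep q N (scal c) f = smul c f"
  by (simp add: scal_def free_rep_single wop_simps)

lemma free_rep_gelt: "free_rep q N (gelt g) f = gen_op q N g f"
  using wop_simps(2)[of N g 0 f] by (simp add: gelt_def free_rep_single smul_def wop_simps)

lemma free_rep_uminus: "free_rep q N (- x) f = smul (-1) (free_rep q N x f)"
proof -
  have "free_rep q N 0 f = (\<lambda>i. 0)" by (simp add: free_rep_def)
  hence e: "vadd (free_rep q N x f) (free_rep q N (- x) f) = (\<lambda>i. 0)" using free_rep_add[of N x "- x" f] by simp
  show ?thesis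
  proof
    fix i
    show "free_rep q N (- x) f i = smul (-1) (free_rep q N x f) i"
      using fun_cong[OF e, of i] by (simp add: vadd_def smul_def eq_neg_iff_add_eq_0 add.commute)
  qed
qed

lemma free_rep_diff: "free_rep q N (x - y) f = vadd (free_rep q N x f) (smul (-1) (free_rep q N y f))"
  using free_rep_add[of N x "- y" f] by (simp add: free_rep_uminus)

lemma free_rep_relation:
  assumes N: "2 * N \<in> \<int>" and f: "supp N f" and x: "x \<in> podles_relations q"
  shows "free_rep q N x f = (\<lambda>i. 0)"
proof -
  have g: "supp N (gen_op q N g f)" for g by (rule bopD(1)[OF bop_gen[OF N] f])
  have s: "supp N (smul c (gen_op q N g f))" for c g by (rule supp_smul[OF g])
  have gg: "gen_op q N g (smul c (gen_op q N g' f)) = smul c (gen_op q N g (gen_op q N g' f))" for c g g'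
    by (rule bopD(2)[OF bop_gen[OF N] g])
  have gv: "gen_op q N g (vadd f (smul c (gen_op q N g' f))) = vadd (gen_op q N g f) (smul c (gen_op q N g (gen_op q N g' f)))" for c g g'
    using bopD(3)[OF bop_gen[OF N] f s] gg by simp
  have z: "vadd h (smul (-1) h) = (\<lambda>i. 0)" "vadd (smul c h) (smul (- c) h) = (\<lambda>i. 0)" for c h
    by (simp_all add: vadd_def smul_def)
  note m = free_rep_mult[OF N f] free_rep_diff free_rep_gelt free_rep_scal free_rep_one
  show ?thesis using x unfolding podles_relations_def Let_def
    by (elim insertE emptyE; hypsubst)
      (simp_all only: m gen_relations[OF N f] gg gv smul_smul z, simp_all add: z smul_smul gv)
qed

end

section \<open>The Podles sphere as a star-algebra\<close>

lemma free_ring_simps [simp]: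
  "carrier free_ring = UNIV" "mult free_ring = (*)" "one free_ring = 1" "zero free_ring = 0" "add free_ring = (+)"
  by (simp_all add: free_ring_def)

lemma ring_free_ring: "Ring.ring free_ring"
proof (rule ringI)
  show "abelian_group free_ring"
  proof (rule abelian_groupI)
    fix x assume "x \<in> carrier free_ring"
    show "\<exists>y\<in>carrier free_ring. y \<oplus>\<^bsub>free_ring\<^esub> x = \<zero>\<^bsub>free_ring\<^esub>" by (rule bexI[of _ "- x"]) auto
  qed (auto simp: algebra_simps)
  show "Group.monoid free_ring" by (rule monoidI) (auto simp: algebra_simps)
qed (auto simp: distrib_left distrib_right)

lemma ideal_podles: "ideal (podles_ideal q) free_ring"
  unfolding podles_ideal_def by (rule ring.genideal_ideal[OF ring_free_ring]) simp

lemma podles_ideal_closed: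
  "0 \<in> podles_ideal q" "x \<in> podles_ideal q \<Longrightarrow> y \<in> podles_ideal q \<Longrightarrow> x + y \<in> podles_ideal q"
  "x \<in> podles_ideal q \<Longrightarrow> y * x \<in> podles_ideal q" "x \<in> podles_ideal q \<Longrightarrow> x * y \<in> podles_ideal q"
  "x \<in> podles_ideal q \<Longrightarrow> - x \<in> podles_ideal q" "x \<in> podles_ideal q \<Longrightarrow> y \<in> podles_ideal q \<Longrightarrow> x - y \<in> podles_ideal q"
  "podles_relations q \<subseteq> podles_ideal q"
proof -
  interpret I: ideal "podles_ideal q" free_ring by (rule ideal_podles)
  show 1: "0 \<in> podles_ideal q" using additive_subgroup.zero_closed[OF I.additive_subgroup_axioms] by simp
  show 2: "x + y \<in> podles_ideal q" if "x \<in> podles_ideal q" "y \<in> podles_ideal q" for x y using additive_subgroup.a_closed[OF I.additive_subgroup_axioms that] by simp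
  show 3: "y * x \<in> podles_ideal q" if "x \<in> podles_ideal q" for x y using I.I_l_closed[OF that, of y] by simp
  show "x * y \<in> podles_ideal q" if "x \<in> podles_ideal q" for x y using I.I_r_closed[OF that, of y] by simp
  show 4: "- x \<in> podles_ideal q" if "x \<in> podles_ideal q" for x using 3[OF that, of "-1"] by simp
  show "x - y \<in> podles_ideal q" if "x \<in> podles_ideal q" "y \<in> podles_ideal q" for x y
    using 2[OF that(1) 4[OF that(2)]] by simp
  show "podles_relations q \<subseteq> podles_ideal q"
    unfolding podles_ideal_def by (rule ring.genideal_self[OF ring_free_ring]) simp
qed

text \<open>The elements with property \<open>P\<close> form an ideal containing the relations, so
  they include the generated ideal. Closure under negation comes from multiplication by -1.\<close>

lemma podles_ideal_induct:
  assumes x: "x \<in> podles_ideal q" and rel: "\<And>x. x \<in> podles_relations q \<Longrightarrow> P x"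
    and zero: "P 0" and add: "\<And>x y. P x \<Longrightarrow> P y \<Longrightarrow> P (x + y)" and l: "\<And>x y. P x \<Longrightarrow> P (y * x)" and r: "\<And>x y. P x \<Longrightarrow> P (x * y)"
  shows "P x"
proof -
  have "ideal {x. P x} free_ring"
  proof (rule idealI[OF ring_free_ring])
    show "subgroup {x. P x} (add_monoid free_ring)"
    proof (rule group.subgroupI[OF abelian_group.a_group[OF ring.is_abelian_group[OF ring_free_ring]]])
      show "{x. P x} \<noteq> {}" using zero by blast
      fix a assume a: "a \<in> {x. P x}"
      have "\<ominus>\<^bsub>free_ring\<^esub> a = - a"
        by (rule abelian_group.minus_equality[OF ring.is_abelian_group[OF ring_free_ring]]) auto
      hence "inv\<^bsub>add_monoid free_ring\<^esub> a = - a" by (simp add: a_inv_def)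
      thus "inv\<^bsub>add_monoid free_ring\<^esub> a \<in> {x. P x}" using l[of a "-1"] a by simp
    qed (use add in auto)
  qed (use l r in auto)
  hence "podles_ideal q \<subseteq> {x. P x}"
    unfolding podles_ideal_def by (rule ring.genideal_minimal[OF ring_free_ring]) (use rel in auto)
  thus ?thesis using x by blast
qed

text \<open>The star exchanges the first two relations up to the factors \<open>- s\<close> and
  \<open>- t\<close>, and it fixes the other two.\<close>

lemma podles_ideal_star: 
  assumes q: "q \<noteq> 0" and x: "x \<in> podles_ideal q"
  shows "free_star x \<in> podles_ideal q"
  using x
proof (rule podles_ideal_induct)
  fix x assume "x \<in> podles_relations q"
  define A B Bs s t where "A = gelt GA" and "B = gelt GB" and "Bs = gelt GBstar"
    and "s = scal (complex_of_real (q\<^sup>2))" and "t = scal (complex_of_real (1 / q\<^sup>2))"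
  have st: "s * t = 1" "t * s = 1" using q by (simp_all add: s_def t_def scal_simps(1,2))
  have c: "s * y = y * s" "t * y = y * t" for y by (simp_all only: s_def t_def scal_simps(4))
  have star: "free_star A = A" "free_star B = Bs" "free_star Bs = B" "free_star s = s" "free_star t = t"
    by (simp_all add: A_def B_def Bs_def s_def t_def free_star_gelt free_star_scal)
  have R: "podles_relations q = {A * B - s * (B * A), A * Bs - t * (Bs * A), B * Bs - t * (A * (1 - A)), Bs * B - A * (1 - s * A)}"
    by (simp add: podles_relations_def Let_def A_def B_def Bs_def s_def t_def)
  have stt: "s * (t * y) = y" "t * (s * y) = y" for y by (simp_all add: mult.assoc[symmetric] st)
  have 1: "free_star (A * B - s * (B * A)) = - s * (A * Bs - t * (Bs * A))"
    using c(1)[of "A * Bs"] by (simp add: free_star_diff free_star_mult star right_diff_distrib stt)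
  have "x \<in> {A * B - s * (B * A), A * Bs - t * (Bs * A), B * Bs - t * (A * (1 - A)), Bs * B - A * (1 - s * A)}"
    using \<open>x \<in> podles_relations q\<close> R by simp
  moreover have 2: "free_star (A * Bs - t * (Bs * A)) = - t * (A * B - s * (B * A))"
    using c(2)[of "A * B"] by (simp add: free_star_diff free_star_mult star right_diff_distrib stt)
  moreover have 3: "free_star (B * Bs - t * (A * (1 - A))) = B * Bs - t * (A * (1 - A))"
    using c(2)[of "A * (1 - A)"] by (simp add: free_star_diff free_star_mult free_star_one star left_diff_distrib right_diff_distrib)
  moreover have 4: "free_star (Bs * B - A * (1 - s * A)) = Bs * B - A * (1 - s * A)"
    by (simp add: free_star_diff free_star_mult free_star_one star left_diff_distrib right_diff_distrib mult.assoc)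
  moreover have "{A * B - s * (B * A), A * Bs - t * (Bs * A), B * Bs - t * (A * (1 - A)), Bs * B - A * (1 - s * A)} \<subseteq> podles_ideal q"
    using podles_ideal_closed(7)[of q] unfolding R .
  ultimately show "free_star x \<in> podles_ideal q" using 1 podles_ideal_closed(3,5)[of _ q] by auto
qed (use podles_ideal_closed free_star_single[of 0 0] in \<open>auto simp: free_star_add free_star_mult\<close>)

definition coset :: "real \<Rightarrow> free_alg \<Rightarrow> free_alg set" where
  "coset q x = a_r_coset free_ring (podles_ideal q) x"

lemma coset_eq: "coset q x = (\<lambda>i. i + x) ` podles_ideal q"
  by (auto simp: coset_def a_r_coset_def r_coset_def)

lemma podles_simps:
  "carrier (podles q) = range (coset q)" "mult (podles q) (coset q x) (coset q y) = coset q (x * y)"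
  "one (podles q) = coset q 1" "zero (podles q) = coset q 0" "add (podles q) (coset q x) (coset q y) = coset q (x + y)"
  "smult (podles q) c (coset q x) = coset q (scal c * x)"
proof -
  interpret I: ideal "podles_ideal q" free_ring by (rule ideal_podles)
  have m: "rcoset_mult free_ring (podles_ideal q) (coset q x) (coset q y) = coset q (x * y)" for x y
    using I.rcoset_mult_add[of x y] by (simp add: coset_def)
  show "carrier (podles q) = range (coset q)"
    by (auto simp: podles_def Let_def FactRing_def A_RCOSETS_def RCOSETS_def coset_def a_r_coset_def)
  show "mult (podles q) (coset q x) (coset q y) = coset q (x * y)"
    using m by (simp add: podles_def Let_def FactRing_def)
  show "one (podles q) = coset q 1" by (simp add: podles_def Let_def FactRing_def coset_def)
  have "podles_ideal q = coset q 0" by (auto simp: coset_eq)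
  thus "zero (podles q) = coset q 0" by (simp add: podles_def Let_def FactRing_def)
  show "add (podles q) (coset q x) (coset q y) = coset q (x + y)"
    using I.a_rcos_sum[of x y] by (simp add: podles_def Let_def FactRing_def coset_def)
  show "smult (podles q) c (coset q x) = coset q (scal c * x)"
    using m[of "scal c" x] by (simp add: podles_def Let_def FactRing_def coset_def)
qed

text \<open>The image of a coset is a full coset because the star maps the ideal onto itself, which
  holds since the star is an involution.\<close>

lemma podles_star:
  assumes "q \<noteq> 0"
  shows "star (podles q) (coset q x) = coset q (free_star x)"
proof -
  have e: "free_star ` podles_ideal q = podles_ideal q"
  proof
    show "free_star ` podles_ideal q \<subseteq> podles_ideal q" using podles_ideal_star[OF assms] by blast
    show "podles_ideal q \<subseteq> free_star ` podles_ideal q"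
    proof
      fix x assume "x \<in> podles_ideal q"
      thus "x \<in> free_star ` podles_ideal q"
        using podles_ideal_star[OF assms] free_star_star[of x] by (intro image_eqI[of _ _ "free_star x"]) auto
    qed
  qed
  have "free_star ` (\<lambda>i. i + x) ` podles_ideal q = (\<lambda>i. i + free_star x) ` (free_star ` podles_ideal q)"
    by (simp only: image_image free_star_add)
  thus ?thesis unfolding e by (simp add: podles_def Let_def coset_eq)
qed

lemma scal_left_commute: "x * (scal c * y) = scal c * (x * y)"
  by (simp only: mult.assoc[symmetric] scal_simps(4)[of c x])

lemma free_star_scal_mult: "free_star (scal c * x) = scal (cnj c) * free_star x"
  by (simp only: free_star_mult free_star_scal scal_simps(4))

lemma star_algebra_podles:
  assumes "q \<noteq> 0"
  shows "star_algebra (podles q)"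
proof (intro star_algebra.intro star_algebra_axioms.intro)
  note s = podles_simps podles_star[OF assms]
  have ab: "abelian_group (podles q)"
  proof (rule abelian_groupI)
    fix x assume "x \<in> carrier (podles q)"
    then obtain y where "x = coset q y" by (auto simp: s)
    thus "\<exists>y\<in>carrier (podles q). y \<oplus>\<^bsub>podles q\<^esub> x = \<zero>\<^bsub>podles q\<^esub>"
      by (intro bexI[of _ "coset q (- y)"]) (auto simp: s)
  qed (auto simp: s add.assoc add.commute add.left_commute)
  show "Ring.ring (podles q)"
  proof (rule ringI[OF ab])
    show "Group.monoid (podles q)" by (rule monoidI) (auto simp: s mult.assoc)
  qed (auto simp: s distrib_left distrib_right)
  show "Module.module complex_ring (podles q)"
    by (rule Module.moduleI[OF cring_complex_ring ab])
      (auto simp: s scal_simps(2,3) distrib_left distrib_right scal_simps(1)[symmetric] mult.assoc)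
next
  fix a c assume "a \<in> carrier (podles q)"
  thus "star (podles q) (c \<odot>\<^bsub>podles q\<^esub> a) = cnj c \<odot>\<^bsub>podles q\<^esub> star (podles q) a"
    by (auto simp: podles_simps podles_star[OF assms] free_star_scal_mult)
qed (auto simp: podles_simps podles_star[OF assms] mult.assoc free_star_star free_star_add free_star_mult scal_left_commute)

section \<open>The representations of the quotient algebra on the Hilbert spaces\<close>

context deformation begin

lemma free_rep_ideal:
  assumes N: "2 * N \<in> \<int>" and x: "x \<in> podles_ideal q"
    and f: "supp N f"
  shows "free_rep q N x f = (\<lambda>i. 0)"
proof -
  have "\<forall>f. supp N f \<longrightarrow> free_rep q N x f = (\<lambda>i. 0)"
    using x
  proof (rule podles_ideal_induct)
    fix x assume "x \<in> podles_relations q"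
    thus "\<forall>f. supp N f \<longrightarrow> free_rep q N x f = (\<lambda>i. 0)" using free_rep_relation[OF N] by blast
  next
    fix x y assume 1: "\<forall>f. supp N f \<longrightarrow> free_rep q N x f = (\<lambda>i. 0)"
    show "\<forall>f. supp N f \<longrightarrow> free_rep q N (x * y) f = (\<lambda>i. 0)"
      using 1 bopD(1)[OF bop_free_rep[OF N]] by (simp add: free_rep_mult[OF N])
  next
    fix x y assume 1: "\<forall>f. supp N f \<longrightarrow> free_rep q N x f = (\<lambda>i. 0)"
    show "\<forall>f. supp N f \<longrightarrow> free_rep q N (y * x) f = (\<lambda>i. 0)"
    proof (intro allI impI)
      fix f assume f: "supp N f"
      \<comment> \<open>The zero function is written as \<open>smul 0 f\<close>, so that linearity
        yields the value 0.\<close>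
      have "free_rep q N y (smul 0 f) = smul 0 (free_rep q N y f)" by (rule bopD(2)[OF bop_free_rep[OF N] f])
      moreover have "free_rep q N x f = smul 0 f" using 1 f by (simp add: smul_def)
      ultimately show "free_rep q N (y * x) f = (\<lambda>i. 0)"
        unfolding free_rep_mult[OF N f] by (simp add: smul_def)
    qed
  next
    show "\<forall>f. supp N f \<longrightarrow> free_rep q N 0 f = (\<lambda>i. 0)" by (simp add: free_rep_def)
  qed (simp add: free_rep_add vadd_def)
  thus ?thesis using f by blast
qed

text \<open>The representative picked by \<open>SOME\<close> differs from \<open>x\<close> by an
  element of the ideal, which acts by 0 on supported functions.\<close>

lemma podles_rep_coset:
  assumes N: "2 * N \<in> \<int>" and f: "supp N f"
  shows "podles_rep q N (coset q x) f = free_rep q N x f"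
proof -
  define y where "y = (SOME y. y \<in> coset q x)"
  have "x \<in> coset q x" using podles_ideal_closed(1)[of q] by (force simp: coset_eq)
  hence "y \<in> coset q x" unfolding y_def by (rule someI)
  then obtain i where i: "i \<in> podles_ideal q" "y = i + x" by (auto simp: coset_eq)
  have "free_rep q N y f = free_rep q N x f"
    unfolding i(2) free_rep_add free_rep_ideal[OF N i(1) f] by (simp add: vadd_def)
  thus ?thesis by (simp add: podles_rep_def y_def)
qed

lemma hspace_carrier: "2 * N \<in> \<int> \<Longrightarrow> carrier (hspace N) = {f. supp N f \<and> l2 f}"
  by (auto simp: hspace_def ell2_simps idx_eq supp_def)

lemma hspace_simps:
  "zero (hspace N) = (\<lambda>i. 0)" "add (hspace N) = vadd" "smult (hspace N) = smul"
  by (simp_all add: hspace_def ell2_simps vadd_def[abs_def] smul_def[abs_def])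

lemma hspace_ip: "f \<in> carrier (hspace N) \<Longrightarrow> ip (hspace N) f g = ip2 f g"
  unfolding hspace_def by (rule ell2_ip)

lemma hspace_hnorm: "f \<in> carrier (hspace N) \<Longrightarrow> hnorm (hspace N) f = sqrt (n2 f)"
  unfolding hspace_def by (rule ell2_hnorm)

lemma plain_hilbert_space_hspace: "plain_hilbert_space (hspace N)"
  unfolding hspace_def plain_hilbert_space_def by (rule hilbert_space_ell2)

lemma bounded_op_bop:
  assumes N: "2 * N \<in> \<int>" and T: "bop N N T"
  shows "bounded_op (hspace N) T"
proof -
  obtain C where C: "0 \<le> C" "\<And>f. supp N f \<Longrightarrow> l2 f \<Longrightarrow> n2 (T f) \<le> C * n2 f" using bop_bound[OF T] by blast
  have "hnorm (hspace N) (T f) \<le> sqrt C * hnorm (hspace N) f" if f: "f \<in> carrier (hspace N)" for f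
  proof -
    have f': "supp N f" "l2 f" using f by (simp_all add: hspace_carrier[OF N])
    have "T f \<in> carrier (hspace N)" using bopD[OF T] f' by (simp add: hspace_carrier[OF N])
    thus ?thesis using real_sqrt_le_mono[OF C(2)[OF f']] f by (simp add: hspace_hnorm real_sqrt_mult)
  qed
  thus ?thesis unfolding bounded_op_def hspace_simps
    by (auto simp: hspace_carrier[OF N] bopD[OF T])
qed

text \<open>The adjoint reverses the order of the two spin factors and flips their signs, so
  \<open>gen_i\<close> and \<open>gen_k\<close> trade places. The two signs from
  \<open>spin_adjoint\<close> combine with the one relating \<open>gen_c (gen_star g)\<close> to
  \<open>gen_c g\<close>, and they cancel.\<close>

lemma gen_adjoint:
  assumes N: "2 * N \<in> \<int>" and f: "supp N f" "l2 f" and h: "supp N h" "l2 h"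
  shows "ip2 (gen_op q N (gen_star g) f) h = ip2 f (gen_op q N g h)"
proof -
  have s: "gen_i (gen_star g) = - gen_k g" "gen_k (gen_star g) = - gen_i g"
    "gen_c (gen_star g) = - (gen_i g * gen_k g) * gen_c g" by (cases g; simp)+
  define u where "u = spin 1 (- gen_i g) (-1) N f"
  define v where "v = spin 1 (gen_k g) (-1) N h"
  have i: "- gen_i g \<in> {1,-1}" "- gen_k g \<in> {1,-1}" "gen_i g \<in> {1,-1}" "gen_k g \<in> {1,-1}" using gen_ik[of g] by auto
  have u: "supp (N - 1/2) u" "l2 u" unfolding u_def using supp_spin[OF i(1) _ f(1), of "-1" 1] spin_l2(1)[OF i(1) _ f, of "-1"] by simp_all
  have v: "l2 v" unfolding v_def using spin_l2(1)[OF i(4) _ h, of "-1"] by simp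
  have "ip2 (spin 1 (- gen_k g) 1 (N - 1/2) u) h = complex_of_real (gen_k g) * ip2 u v"
    using spin_adjoint[OF i(2) _ u h(2), of 1] by (simp add: v_def)
  also have "ip2 u v = - complex_of_real (gen_i g) * ip2 f (spin 1 (gen_i g) 1 (N - 1/2) v)"
    unfolding u_def using spin_adjoint[OF i(1) _ f v, of "-1"] by simp
  finally have 1: "ip2 (spin 1 (- gen_k g) 1 (N - 1/2) u) h
    = complex_of_real (gen_k g) * (- complex_of_real (gen_i g) * ip2 f (spin 1 (gen_i g) 1 (N - 1/2) v))" .
  show ?thesis
    unfolding gen_op_smul[OF N f(1)] gen_op_smul[OF N h(1)] s smul_def ip2_scale_left ip2_scale_right
      u_def[symmetric] v_def[symmetric] 1 by (cases g) simp_all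
qed

lemma wop_adjoint:
  assumes N: "2 * N \<in> \<int>" and h: "supp N h" "l2 h"
  shows "supp N f \<Longrightarrow> l2 f \<Longrightarrow> ip2 (wop N (word_star w) f) h = ip2 f (wop N w h)"
proof (induction w arbitrary: f rule: word_induct)
  case zero thus ?case by (simp add: word_star_zero wop_simps)
next
  case (cons g w)
  have e: "wop N (word_star (Word [g] + w)) f = wop N (word_star w) (gen_op q N (gen_star g) f)"
    unfolding word_star_plus wop_plus using wop_simps(2)[of N "gen_star g" 0 f]
    by (simp add: word_star_def wop_simps)
  show ?case unfolding e
    using cons.IH[OF bopD(1)[OF bop_gen[OF N] cons.prems(1)] bopD(5)[OF bop_gen[OF N] cons.prems]]
      gen_adjoint[OF N cons.prems bopD(1)[OF bop_wop[OF N] h(1)] bopD(5)[OF bop_wop[OF N] h]]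
    by (simp add: wop_simps)
qed

lemma free_rep_adjoint:
  assumes N: "2 * N \<in> \<int>" and f: "supp N f" "l2 f" and h: "supp N h" "l2 h"
  shows "ip2 (free_rep q N (free_star x) f) h = ip2 f (free_rep q N x h)"
proof (induction x rule: free_alg_induct)
  case (single w c)
  show ?case unfolding free_star_single free_rep_single smul_def ip2_scale_left ip2_scale_right
    by (simp add: wop_adjoint[OF N h f])
next
  case (add x y)
  note l = bopD(5)[OF bop_free_rep[OF N] f] bopD(5)[OF bop_free_rep[OF N] h]
  show ?case
    using add unfolding free_star_add free_rep_add vadd_def by (simp add: ip2_add_left ip2_add_right l f h)
qed

lemma star_rep_hspace:
  assumes N: "2 * N \<in> \<int>"
  shows "star_rep (podles q) (hspace N) (podles_rep q N)"
  unfolding star_rep_def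
proof (intro conjI ballI allI)
  note s = podles_simps podles_star[OF less_imp_neq[OF q_pos, symmetric]]
  have F: "f \<in> carrier (hspace N) \<Longrightarrow> supp N f" "f \<in> carrier (hspace N) \<Longrightarrow> l2 f" for f
    by (simp_all add: hspace_carrier[OF N])
  have P: "podles_rep q N (coset q x) f = free_rep q N x f" if "f \<in> carrier (hspace N)" for x f
    by (rule podles_rep_coset[OF N F(1)[OF that]])
  have c: "free_rep q N x f \<in> carrier (hspace N)" if "f \<in> carrier (hspace N)" for x f
    using bopD(1)[OF bop_free_rep[OF N] F(1)[OF that]] bopD(5)[OF bop_free_rep[OF N] F(1)[OF that] F(2)[OF that]]
    by (simp add: hspace_carrier[OF N])
  fix a assume "a \<in> carrier (podles q)"
  then obtain x where a: "a = coset q x" by (auto simp: s)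
  show "bounded_op (hspace N) (podles_rep q N a)"
    unfolding a by (rule bounded_op_bop[OF N bop_cong[OF bop_free_rep[OF N] podles_rep_coset[OF N]]])
  { fix f assume f: "f \<in> carrier (hspace N)"
    fix b assume "b \<in> carrier (podles q)"
    then obtain y where b: "b = coset q y" by (auto simp: s)
    show "podles_rep q N (a \<oplus>\<^bsub>podles q\<^esub> b) f = podles_rep q N a f \<oplus>\<^bsub>hspace N\<^esub> podles_rep q N b f"
      by (simp add: a b s P f free_rep_add hspace_simps)
    show "podles_rep q N (a \<otimes>\<^bsub>podles q\<^esub> b) f = podles_rep q N a (podles_rep q N b f)"
      by (simp add: a b s P f c free_rep_mult[OF N F(1)[OF f]]) }
  { fix f d assume f: "f \<in> carrier (hspace N)"
    show "podles_rep q N (d \<odot>\<^bsub>podles q\<^esub> a) f = d \<odot>\<^bsub>hspace N\<^esub> podles_rep q N a f"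
      by (simp add: a s P f free_rep_mult[OF N F(1)[OF f]] free_rep_scal hspace_simps) }
  { fix f h assume f: "f \<in> carrier (hspace N)" and h: "h \<in> carrier (hspace N)"
    show "ip (hspace N) (podles_rep q N (star (podles q) a) f) h = ip (hspace N) f (podles_rep q N a h)"
      by (simp add: a s P f h c hspace_ip free_rep_adjoint[OF N F(1)[OF f] F(2)[OF f] F(1)[OF h] F(2)[OF h]]) }
next
  fix f assume "f \<in> carrier (hspace N)"
  thus "podles_rep q N \<one>\<^bsub>podles q\<^esub> f = f"
    using podles_rep_coset[OF N, of f 1] by (simp add: podles_simps free_rep_one hspace_carrier[OF N])
qed

end

section \<open>Commutators with the Dirac operator\<close>

context deformation begin

text \<open>The right action on V_M of the whole free algebra: linear in the function,
  conjugate-linear in \<open>x\<close>.\<close>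

definition rop :: "real \<Rightarrow> free_alg \<Rightarrow> vec \<Rightarrow> vec" where
  "rop M x f = jc (free_rep q (- M) x (jc f))"

text \<open>For words by induction on the letters, with preservation of the support carried along so
  that the hypothesis on \<open>T\<close> applies at every letter; then for sums by linearity of
  \<open>T\<close>.\<close>

lemma inter_rop:
  assumes N: "2 * N \<in> \<int>" and T: "bop N M T" "intertwines N M T" and f: "supp N f"
  shows "T (rop N x f) = rop M x (T f)"
proof -
  have N': "2 * (- N) \<in> \<int>" using N by simp
  have w: "supp N (jc (wop (- N) w (jc f))) \<and> T (jc (wop (- N) w (jc f))) = jc (wop (- M) w (jc (T f)))" for w
  proof (induction w rule: word_induct)
    case zero
    show ?case using f by (simp add: wop_simps)
  next
    case (cons g w)
    define h where "h = jc (wop (- N) w (jc f))"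
    have e: "jc (wop (- N) (Word [g] + w) (jc f)) = rgen N g h" by (simp add: wop_simps rgen_def h_def)
    have h: "supp N h" "T h = jc (wop (- M) w (jc (T f)))" using cons by (simp_all add: h_def)
    have "T (rgen N g h) = rgen M g (T h)" using T(2) h(1) unfolding intertwines_def by blast
    thus ?case unfolding e h(2) using supp_rgen[OF N h(1)] by (simp add: rgen_def wop_simps)
  qed
  have "supp N (rop N x f) \<and> T (rop N x f) = rop M x (T f)"
  proof (induction x rule: free_alg_induct)
    case (single w c)
    show ?case unfolding rop_def free_rep_single jc_smul using w[of w] bopD(2)[OF T(1)] by (simp add: supp_smul)
  next
    case (add x y)
    thus ?case using bopD(3)[OF T(1)] unfolding rop_def free_rep_add jc_vadd by (simp add: supp_vadd)
  qed
  thus ?thesis by blast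
qed

lemma inter_id: "intertwines N N (\<lambda>f. f)"
  by (simp add: intertwines_def)

lemma inter_wop: "2 * N \<in> \<int> \<Longrightarrow> intertwines N N (wop N w)"
proof (induction w rule: word_induct)
  case zero
  show ?case by (rule inter_cong[OF inter_id wop_simps(1) supp_rgen[OF zero]])
next
  case (cons g w)
  show ?case
    by (rule inter_cong[OF inter_comp[OF cons.IH[OF cons.prems] inter_gen[OF cons.prems] bop_wop[OF cons.prems]] wop_simps(2) supp_rgen[OF cons.prems]])
qed

lemma inter_free_rep: "2 * N \<in> \<int> \<Longrightarrow> intertwines N N (free_rep q N x)"
proof (induction x rule: free_alg_induct)
  case (single w c)
  show ?case
    by (rule inter_cong[OF inter_smul[OF inter_wop[OF single] bop_wop[OF single] single] free_rep_single supp_rgen[OF single]])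
next
  case (add x y)
  show ?case
    by (rule inter_cong[OF inter_vadd[OF add.IH(1)[OF add.prems] bop_free_rep[OF add.prems] add.IH(2)[OF add.prems] bop_free_rep[OF add.prems] add.prems]
      free_rep_add supp_rgen[OF add.prems]])
qed

text \<open>\<open>K\<close> is the commutator of multiplication by \<open>c\<close> with the action
  of \<open>x\<close>. Written as a sum, the identity makes sense even where \<open>mulc c f\<close>
  is not square-summable.\<close>

definition dcomm :: "(real \<Rightarrow> real) \<Rightarrow> real \<Rightarrow> real \<Rightarrow> free_alg \<Rightarrow> (vec \<Rightarrow> vec) \<Rightarrow> bool" where
  "dcomm c N M x K \<longleftrightarrow> bop N M K \<and> intertwines N M K \<and>
     (\<forall>f. supp N f \<longrightarrow> mulc c (free_rep q N x f) = vadd (free_rep q M x (mulc c f)) (K f))"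

lemma mulc_vadd: "mulc c (vadd f g) = vadd (mulc c f) (mulc c g)"
  by (auto simp: mulc_def vadd_def algebra_simps)

lemma mulc_smul: "mulc c (smul d f) = smul d (mulc c f)"
  by (auto simp: mulc_def smul_def algebra_simps)

text \<open>The Leibniz rule: if \<open>L\<close> and \<open>K\<close> are the commutators for a
  letter g and a word w, then g K + L w is the commutator for the word g w. Boundedness and the
  intertwining property pass to such combinations.\<close>

lemma dcomm_exists:
  assumes N: "2 * N \<in> \<int>" and M: "2 * M \<in> \<int>" and c: "\<And>f. supp N f \<Longrightarrow> supp M (mulc c f)"
    and gen: "\<And>g. \<exists>K. bop N M K \<and> intertwines N M K \<and>
      (\<forall>f. supp N f \<longrightarrow> mulc c (gen_op q N g f) = vadd (gen_op q M g (mulc c f)) (K f))"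
  shows "\<exists>K. dcomm c N M x K"
proof -
  have w: "\<exists>K. bop N M K \<and> intertwines N M K \<and> (\<forall>f. supp N f \<longrightarrow> mulc c (wop N w f) = vadd (wop M w (mulc c f)) (K f))" for w
  proof (induction w rule: word_induct)
    case zero
    show ?case
      by (rule exI[of _ "\<lambda>f x. 0"]) (simp add: bop_zero inter_zero[OF M] wop_simps vadd_def)
  next
    case (cons g w)
    then obtain K where K: "bop N M K" "intertwines N M K"
      "\<And>f. supp N f \<Longrightarrow> mulc c (wop N w f) = vadd (wop M w (mulc c f)) (K f)" by blast
    obtain L where L: "bop N M L" "intertwines N M L"
      "\<And>f. supp N f \<Longrightarrow> mulc c (gen_op q N g f) = vadd (gen_op q M g (mulc c f)) (L f)" using gen by blast
    note b1 = bop_comp[OF K(1) bop_gen[OF M, of g]] and b2 = bop_comp[OF bop_wop[OF N, of w] L(1)]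
    show ?case
    proof (intro exI conjI allI impI)
      show "bop N M (\<lambda>f. vadd (gen_op q M g (K f)) (L (wop N w f)))" by (rule bop_vadd[OF b1 b2])
      show "intertwines N M (\<lambda>f. vadd (gen_op q M g (K f)) (L (wop N w f)))"
        by (rule inter_vadd[OF inter_comp[OF K(2) inter_gen[OF M] K(1)] b1 inter_comp[OF inter_wop[OF N] L(2) bop_wop[OF N]] b2 M])
      fix f assume f: "supp N f"
      have "mulc c (wop N (Word [g] + w) f) = vadd (gen_op q M g (vadd (wop M w (mulc c f)) (K f))) (L (wop N w f))"
        unfolding wop_simps L(3)[OF bopD(1)[OF bop_wop[OF N] f]] K(3)[OF f] ..
      also have "gen_op q M g (vadd (wop M w (mulc c f)) (K f)) = vadd (gen_op q M g (wop M w (mulc c f))) (gen_op q M g (K f))"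
        by (rule bopD(3)[OF bop_gen[OF M] bopD(1)[OF bop_wop[OF M] c[OF f]] bopD(1)[OF K(1) f]])
      finally show "mulc c (wop N (Word [g] + w) f) = vadd (wop M (Word [g] + w) (mulc c f)) (vadd (gen_op q M g (K f)) (L (wop N w f)))"
        unfolding wop_simps by (simp add: vadd_def add.assoc)
    qed
  qed
  show ?thesis
  proof (induction x rule: free_alg_induct)
    case (single v d)
    obtain K where K: "bop N M K" "intertwines N M K"
      "\<And>f. supp N f \<Longrightarrow> mulc c (wop N v f) = vadd (wop M v (mulc c f)) (K f)" using w by blast
    show ?case
      by (rule exI[of _ "\<lambda>f. smul d (K f)"])
        (simp add: dcomm_def bop_smul[OF K(1)] inter_smul[OF K(2,1) M] free_rep_single mulc_smul K(3) smul_vadd)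
  next
    case (add x y)
    then obtain K L where K: "dcomm c N M x K" and L: "dcomm c N M y L" by blast
    have "bop N M (\<lambda>f. vadd (K f) (L f))" "intertwines N M (\<lambda>f. vadd (K f) (L f))"
      using K L unfolding dcomm_def by (blast intro: bop_vadd inter_vadd[OF _ _ _ _ M])+
    moreover have "mulc c (free_rep q N (x + y) f) = vadd (free_rep q M (x + y) (mulc c f)) (vadd (K f) (L f))" if "supp N f" for f
    proof -
      have 1: "mulc c (free_rep q N x f) = vadd (free_rep q M x (mulc c f)) (K f)"
        and 2: "mulc c (free_rep q N y f) = vadd (free_rep q M y (mulc c f)) (L f)" using K L that unfolding dcomm_def by blast+
      show ?thesis unfolding free_rep_add mulc_vadd 1 2 by (simp add: vadd_def algebra_simps)
    qed
    ultimately show ?case unfolding dcomm_def by blast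
  qed
qed

lemma bop_inter_spin_spin:
  assumes "i \<in> {1,-1}" "i' \<in> {1,-1}" "j \<in> {1,-1}" "j' \<in> {1,-1}" "2 * N \<in> \<int>" "M = N + j/2" "L = M + j'/2"
  shows "bop N L (\<lambda>f. spin 1 i' j' M (spin 1 i j N f))" "intertwines N L (\<lambda>f. spin 1 i' j' M (spin 1 i j N f))"
proof -
  have M: "2 * M \<in> \<int>" using assms(3,5,6) half_Ints[OF assms(5)] by auto
  have 1: "bop N M (spin 1 i j N)" "bop M L (spin 1 i' j' M)" using bop_spin[OF assms(1,3), of N] bop_spin[OF assms(2,4), of M] assms by simp_all
  have 2: "intertwines N M (spin 1 i j N)" "intertwines M L (spin 1 i' j' M)" using inter_spin[OF assms(1,3,5)] inter_spin[OF assms(2,4) M] assms by simp_all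
  show "bop N L (\<lambda>f. spin 1 i' j' M (spin 1 i j N f))" by (rule bop_comp[OF 1])
  show "intertwines N L (\<lambda>f. spin 1 i' j' M (spin 1 i j N f))" by (rule inter_comp[OF 2 1(1)])
qed

text \<open>The coefficient passes the outer spin factor cleanly and the inner one with a
  correction. In the main term q^(1/2) and q^(-1/2) cancel, which restores the generator on V_(N+1).
  In the correction both spin factors raise \<open>N\<close>.\<close>

lemma dcomm_raise:
  assumes N: "2 * N \<in> \<int>"
  shows "\<exists>K. dcomm (cf N) N (N + 1) x K"
proof (rule dcomm_exists[OF N half_Ints(3)[OF N] supp_mulc_cf(1)])
  fix g
  define i k where "i = gen_i g" and "k = gen_k g"
  have ik: "i \<in> {1,-1}" "k \<in> {1,-1}" using gen_ik[of g] by (simp_all add: i_def k_def)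
  \<comment> \<open>The factor q^(1/2) is that of the outer exchange, and q^(-N-1/2) that of the
    correction at the inner one.\<close>
  define d where "d = complex_of_real (gen_c g) * (complex_of_real (q powr (1/2)) * complex_of_real (q powr (-N-1/2)))"
  define K where "K = (\<lambda>f. smul d (spin 1 i 1 (N + 1/2) (spin 1 k 1 N f)))"
  have bi: "bop N (N + 1) (\<lambda>f. spin 1 i 1 (N + 1/2) (spin 1 k 1 N f))" "intertwines N (N + 1) (\<lambda>f. spin 1 i 1 (N + 1/2) (spin 1 k 1 N f))"
    using bop_inter_spin_spin[OF ik(2,1) _ _ N, of 1 1 "N + 1/2" "N + 1"] by simp_all
  have "mulc (cf N) (gen_op q N g f) = vadd (gen_op q (N + 1) g (mulc (cf N) f)) (K f)" if f: "supp N f" for f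
  proof -
    have u: "supp (N - 1/2) (spin 1 k (-1) N f)" using supp_spin[OF ik(2) _ f, of "-1" 1] by simp
    have 1: "mulc (cf N) (spin 1 i 1 (N - 1/2) h) = smul (complex_of_real (q powr (1/2))) (spin 1 i 1 (N + 1/2) (mulc (cf (N - 1/2)) h))" if "supp (N - 1/2) h" for h
      using cf_raise_outer[OF that, of i] by (simp add: fun_eq_iff smul_def add.commute)
    have 2: "mulc (cf (N - 1/2)) (spin 1 k (-1) N f) = vadd (smul (complex_of_real (q powr (-1/2))) (spin 1 k (-1) (N + 1) (mulc (cf N) f)))
        (smul (complex_of_real (q powr (-N-1/2))) (spin 1 k 1 N f))"
      using cf_raise_inner[OF f, of k] by (simp add: fun_eq_iff smul_def vadd_def)
    have q: "complex_of_real (q powr (1/2)) * complex_of_real (q powr (-1/2)) = 1"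
      using q_pos by (simp add: powr_add[symmetric] flip: of_real_mult)
    have 3: "gen_op q (N + 1) g (mulc (cf N) f) = smul (complex_of_real (gen_c g)) (spin 1 i 1 (N + 1/2) (spin 1 k (-1) (N + 1) (mulc (cf N) f)))"
      using gen_op_smul[OF half_Ints(3)[OF N] supp_mulc_cf(1)[OF f], of g] by (simp add: i_def k_def add.commute)
    have "mulc (cf N) (gen_op q N g f) = vadd (smul (complex_of_real (gen_c g) * (complex_of_real (q powr (1/2)) * complex_of_real (q powr (-1/2)))) (spin 1 i 1 (N + 1/2) (spin 1 k (-1) (N + 1) (mulc (cf N) f)))) (K f)"
      unfolding gen_op_smul[OF N f] i_def[symmetric] k_def[symmetric] mulc_smul 1[OF u] 2 spin_vadd spin_smul smul_vadd smul_smul K_def d_def ..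
    thus ?thesis unfolding 3 q by simp
  qed
  thus "\<exists>K. bop N (N + 1) K \<and> intertwines N (N + 1) K \<and> (\<forall>f. supp N f \<longrightarrow> mulc (cf N) (gen_op q N g f) = vadd (gen_op q (N + 1) g (mulc (cf N) f)) (K f))"
    using bop_smul[OF bi(1)] inter_smul[OF bi(2,1) half_Ints(3)[OF N]] unfolding K_def by blast
qed

text \<open>The mirror image of the raising case: the correction arises at the outer spin factor,
  and both factors of the commutator lower \<open>N\<close>.\<close>

lemma dcomm_lower:
  assumes N: "2 * N \<in> \<int>"
  shows "\<exists>K. dcomm (cf N) (N + 1) N x K"
proof (rule dcomm_exists[OF half_Ints(3)[OF N] N supp_mulc_cf(2)])
  fix g
  define i k where "i = gen_i g" and "k = gen_k g"
  have ik: "i \<in> {1,-1}" "k \<in> {1,-1}" using gen_ik[of g] by (simp_all add: i_def k_def)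
  \<comment> \<open>q^(-N) is the constant of the correction in \<open>cf_lower_outer\<close>, taken
    at N + 1/2.\<close>
  define d where "d = complex_of_real (gen_c g) * complex_of_real (q powr (-N))"
  define K where "K = (\<lambda>f. smul d (spin 1 i (-1) (N + 1/2) (spin 1 k (-1) (N + 1) f)))"
  have bi: "bop (N + 1) N (\<lambda>f. spin 1 i (-1) (N + 1/2) (spin 1 k (-1) (N + 1) f))" "intertwines (N + 1) N (\<lambda>f. spin 1 i (-1) (N + 1/2) (spin 1 k (-1) (N + 1) f))"
    using bop_inter_spin_spin[OF ik(2,1) _ _ half_Ints(3)[OF N], of "-1" "-1" "N + 1/2" N] by simp_all
  have "mulc (cf N) (gen_op q (N + 1) g f) = vadd (gen_op q N g (mulc (cf N) f)) (K f)" if f: "supp (N + 1) f" for f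
  proof -
    have u: "supp (N + 1/2) (spin 1 k (-1) (N + 1) f)" using supp_spin[OF ik(2) _ f, of "-1" 1] by (simp add: add.commute)
    have 1: "mulc (cf N) (spin 1 i 1 (N + 1/2) h) = vadd (smul (complex_of_real (q powr (1/2))) (spin 1 i 1 (N - 1/2) (mulc (cf (N - 1/2)) h)))
        (smul (complex_of_real (q powr (-N))) (spin 1 i (-1) (N + 1/2) h))" if "supp (N + 1/2) h" for h
      using cf_lower_outer[OF that, of i] by (simp add: fun_eq_iff smul_def vadd_def)
    have 2: "mulc (cf (N - 1/2)) (spin 1 k (-1) (N + 1) f) = smul (complex_of_real (q powr (-1/2))) (spin 1 k (-1) N (mulc (cf N) f))"
      using cf_lower_inner[OF f, of k] by (simp add: fun_eq_iff smul_def)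
    have q: "complex_of_real (q powr (1/2)) * complex_of_real (q powr (-1/2)) = 1"
      using q_pos by (simp add: powr_add[symmetric] flip: of_real_mult)
    have 3: "gen_op q N g (mulc (cf N) f) = smul (complex_of_real (gen_c g)) (spin 1 i 1 (N - 1/2) (spin 1 k (-1) N (mulc (cf N) f)))"
      using gen_op_smul[OF N supp_mulc_cf(2)[OF f], of g] by (simp add: i_def k_def)
    have 4: "gen_op q (N + 1) g f = smul (complex_of_real (gen_c g)) (spin 1 i 1 (N + 1/2) (spin 1 k (-1) (N + 1) f))"
      using gen_op_smul[OF half_Ints(3)[OF N] f, of g] by (simp add: i_def k_def add.commute)
    have "mulc (cf N) (gen_op q (N + 1) g f) = vadd (smul (complex_of_real (gen_c g) * (complex_of_real (q powr (1/2)) * complex_of_real (q powr (-1/2)))) (spin 1 i 1 (N - 1/2) (spin 1 k (-1) N (mulc (cf N) f)))) (K f)"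
      unfolding 4 mulc_smul 1[OF u] 2 spin_vadd spin_smul smul_vadd smul_smul K_def d_def ..
    thus ?thesis unfolding 3 q by simp
  qed
  thus "\<exists>K. bop (N + 1) N K \<and> intertwines (N + 1) N K \<and> (\<forall>f. supp (N + 1) f \<longrightarrow> mulc (cf N) (gen_op q (N + 1) g f) = vadd (gen_op q N g (mulc (cf N) f)) (K f))"
    using bop_smul[OF bi(1)] inter_smul[OF bi(2,1) N] unfolding K_def by blast
qed

end

section \<open>Off-diagonal multiplication operators\<close>

text \<open>Outside a suitable finite set the squares of |f| sum to at most \<open>e\<close>. The
  same set serves for every \<open>g\<close> dominated by \<open>f\<close>.\<close>

lemma n2_tail:
  assumes "l2 f" "0 < e"
  shows "\<exists>F. finite F \<and> (\<forall>g. (\<forall>i\<in>F. g i = 0) \<and> (\<forall>i. cmod (g i) \<le> cmod (f i)) \<longrightarrow> n2 g \<le> e)"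
proof -
  have "((\<lambda>i. (cmod (f i))\<^sup>2) has_sum n2 f) UNIV" using assms by (simp add: l2_def n2_def has_sum_infsum)
  then obtain F where F: "finite F" "dist (\<Sum>i\<in>F. (cmod (f i))\<^sup>2) (n2 f) \<le> e"
    using has_sum_finite_approximation assms(2) by blast
  have main: "n2 g \<le> e" if g: "\<And>i. i \<in> F \<Longrightarrow> g i = 0" "\<And>i. cmod (g i) \<le> cmod (f i)" for g
  proof (rule l2I_finite_sums(2))
    fix G :: "'a set" assume G: "finite G"
    have "(\<Sum>i\<in>G. (cmod (g i))\<^sup>2) = (\<Sum>i\<in>G - F. (cmod (g i))\<^sup>2)"
      by (rule sum.mono_neutral_right) (use G g in auto)
    also have "\<dots> \<le> (\<Sum>i\<in>G - F. (cmod (f i))\<^sup>2)" by (intro sum_mono power_mono g) simp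
    also have "\<dots> = (\<Sum>i\<in>(G - F) \<union> F. (cmod (f i))\<^sup>2) - (\<Sum>i\<in>F. (cmod (f i))\<^sup>2)"
      using G F by (subst sum.union_disjoint) auto
    also have "\<dots> \<le> e"
      using finite_sum_le_n2[OF assms(1), of "(G - F) \<union> F"] G F unfolding dist_real_def by force
    finally show "(\<Sum>i\<in>G. (cmod (g i))\<^sup>2) \<le> e" .
  qed
  show ?thesis
  proof (intro exI[of _ F] conjI allI impI)
    fix g assume g: "(\<forall>i\<in>F. g i = 0) \<and> (\<forall>i. cmod (g i) \<le> cmod (f i))"
    show "n2 g \<le> e" by (rule main) (simp_all add: g)
  qed (rule F(1))
qed

lemma ell2_diff_carrier: "f \<in> carrier (ell2 I) \<Longrightarrow> g \<in> carrier (ell2 I) \<Longrightarrow> (\<lambda>i. f i - g i) \<in> carrier (ell2 I)"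
  by (auto simp: ell2_simps l2_diff)

lemma ell2_hnorm_diff:
  assumes "f \<in> carrier (ell2 I)" "g \<in> carrier (ell2 I)"
  shows "hnorm (ell2 I) (f \<ominus>\<^bsub>ell2 I\<^esub> g) = sqrt (n2 (\<lambda>i. f i - g i))"
  using assms by (simp add: ell2_minus ell2_hnorm ell2_diff_carrier)

lemma hlim_ell2_coord:
  assumes X: "\<And>n. X n \<in> carrier (ell2 I)" "x \<in> carrier (ell2 I)" "hlim (ell2 I) X x"
  shows "(\<lambda>n. X n i) \<longlonglongrightarrow> x i"
proof -
  have b: "cmod (X n i - x i) \<le> hnorm (ell2 I) (X n \<ominus>\<^bsub>ell2 I\<^esub> x)" for n
  proof -
    have "l2 (\<lambda>i. X n i - x i)" using ell2_diff_carrier[OF X(1)[of n] X(2)] by (simp add: ell2_simps)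
    from cmod_sq_le_n2[OF this, of i] show ?thesis unfolding ell2_hnorm_diff[OF X(1,2)] by (rule real_le_rsqrt)
  qed
  hence "(\<lambda>n. X n i - x i) \<longlonglongrightarrow> 0"
    by (rule Lim_null_comparison[OF always_eventually[OF allI] X(3)[unfolded hlim_def]])
  thus ?thesis by (simp add: LIM_zero_iff)
qed

lemma plain_hilbert_space_ell2: "plain_hilbert_space (ell2 I)"
  by (rule plain_hilbert_space.intro[OF hilbert_space_ell2])

lemma (in two_hilbert_spaces) hlim_components:
  assumes "\<And>n. X n \<in> carrier H" "\<And>n. Y n \<in> carrier K" "x \<in> carrier H" "y \<in> carrier K"
    and "hlim (hsum H K) (\<lambda>n. (X n, Y n)) (x, y)"
  shows "hlim H X x" "hlim K Y y"
proof -
  have c: "X n \<ominus>\<^bsub>H\<^esub> x \<in> carrier H" "Y n \<ominus>\<^bsub>K\<^esub> y \<in> carrier K" for n using assms by auto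
  have l: "(\<lambda>n. hnorm (hsum H K) (X n \<ominus>\<^bsub>H\<^esub> x, Y n \<ominus>\<^bsub>K\<^esub> y)) \<longlonglongrightarrow> 0"
    using assms(5) unfolding hlim_def minus(2)[OF assms(3,4)] .
  show "hlim H X x" "hlim K Y y" unfolding hlim_def
    by (rule Lim_null_comparison[OF _ l], simp add: hnorm_le[OF c] H.hnorm_nonneg[OF c(1)] K.hnorm_nonneg[OF c(2)])+
qed

text \<open>The abstract model of the Dirac operator: multiplication by \<open>c\<close>, exchanging
  two spaces whose index sets differ only where \<open>c\<close> vanishes. Finiteness of the
  sublevel sets is behind both the compact resolvent and the finite multiplicities.\<close>

locale offdiagonal =
  fixes I J :: "'i set" and c :: "'i \<Rightarrow> real"
  assumes c_I: "i \<in> I \<Longrightarrow> i \<notin> J \<Longrightarrow> c i = 0" and c_J: "i \<in> J \<Longrightarrow> i \<notin> I \<Longrightarrow> c i = 0"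
    and c_nonneg: "i \<in> I \<union> J \<Longrightarrow> 0 \<le> c i"
    and finite_sublevel: "finite {i \<in> I \<union> J. c i \<le> R}"
begin

sublocale two_hilbert_spaces "ell2 I" "ell2 J"
  by (intro two_hilbert_spaces.intro plain_hilbert_space_ell2)

definition wmul :: "('i \<Rightarrow> complex) \<Rightarrow> 'i \<Rightarrow> complex" where
  "wmul f = (\<lambda>i. of_real (c i) * f i)"

abbreviation "H1 \<equiv> hsum (ell2 I) (ell2 J)"

definition fin_op :: "('i \<Rightarrow> complex) \<times> ('i \<Rightarrow> complex) \<Rightarrow> ('i \<Rightarrow> complex) \<times> ('i \<Rightarrow> complex) \<Rightarrow> bool" where
  "fin_op x y \<longleftrightarrow> x \<in> carrier H1 \<and> y = (wmul (snd x), wmul (fst x)) \<and> finite {i. fst x i \<noteq> 0} \<and> finite {i. snd x i \<noteq> 0}"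

definition max_op :: "('i \<Rightarrow> complex) \<times> ('i \<Rightarrow> complex) \<Rightarrow> ('i \<Rightarrow> complex) \<times> ('i \<Rightarrow> complex) \<Rightarrow> bool" where
  "max_op x y \<longleftrightarrow> x \<in> carrier H1 \<and> y = (wmul (snd x), wmul (fst x)) \<and> y \<in> carrier H1"

definition "Dfin = {(x, y). fin_op x y}"
definition "Dmax = {(x, y). max_op x y}"

lemma carrier_pair: "(f, g) \<in> carrier H1 \<longleftrightarrow> (\<forall>i. i \<notin> I \<longrightarrow> f i = 0) \<and> l2 f \<and> (\<forall>i. i \<notin> J \<longrightarrow> g i = 0) \<and> l2 g"
  by (auto simp: hsum_simps ell2_simps)

lemma wmul_zero: "(\<And>i. i \<notin> I \<Longrightarrow> f i = 0) \<Longrightarrow> i \<notin> J \<Longrightarrow> wmul f i = 0" "(\<And>i. i \<notin> J \<Longrightarrow> f i = 0) \<Longrightarrow> i \<notin> I \<Longrightarrow> wmul f i = 0"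
  using c_I[of i] c_J[of i] by (auto simp: wmul_def)

lemma Dmax_iff: "((f, g), (u, v)) \<in> Dmax \<longleftrightarrow> (f, g) \<in> carrier H1 \<and> u = wmul g \<and> v = wmul f \<and> l2 u \<and> l2 v"
  by (auto simp: Dmax_def max_op_def carrier_pair wmul_zero)

lemma Dfin_iff: "((f, g), (u, v)) \<in> Dfin \<longleftrightarrow> (f, g) \<in> carrier H1 \<and> u = wmul g \<and> v = wmul f \<and> finite {i. f i \<noteq> 0} \<and> finite {i. g i \<noteq> 0}"
  by (auto simp: Dfin_def fin_op_def)

lemma finite_wmul: "finite {i. f i \<noteq> 0} \<Longrightarrow> finite {i. wmul f i \<noteq> 0}"
  by (erule rev_finite_subset) (auto simp: wmul_def)

lemma Dfin_subset: "Dfin \<subseteq> Dmax"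
  by (auto simp: Dmax_iff Dfin_iff intro!: l2_finite_support finite_wmul)

lemma Dmax_carrier: "Dmax \<subseteq> carrier H1 \<times> carrier H1"
  by (auto simp: Dmax_def max_op_def)

text \<open>Truncation to a finite sublevel set of \<open>c\<close>. It commutes with
  \<open>wmul\<close>, so that a vector and its image are approximated simultaneously.\<close>

definition cut :: "nat \<Rightarrow> ('i \<Rightarrow> complex) \<Rightarrow> 'i \<Rightarrow> complex" where
  "cut n f = (\<lambda>i. if i \<in> I \<union> J \<and> c i \<le> real n then f i else 0)"

lemma cut_finite: "finite {i. cut n f i \<noteq> 0}"
  by (rule finite_subset[OF _ finite_sublevel[of "real n"]]) (auto simp: cut_def split: if_splits)

lemma wmul_cut: "wmul (cut n f) = cut n (wmul f)"
  by (auto simp: wmul_def cut_def)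

lemma cut_carrier: "f \<in> carrier (ell2 L) \<Longrightarrow> cut n f \<in> carrier (ell2 L)"
  using l2_finite_support[OF cut_finite[of n f]] by (simp add: ell2_simps) (simp add: cut_def)

lemma hlim_cut:
  assumes f: "f \<in> carrier (ell2 L)" and L: "L \<subseteq> I \<union> J"
  shows "hlim (ell2 L) (\<lambda>n. cut n f) f"
proof -
  have f2: "l2 f" "\<And>i. i \<notin> L \<Longrightarrow> f i = 0" using f by (simp_all add: ell2_simps)
  have "(\<lambda>n. n2 (\<lambda>i. cut n f i - f i)) \<longlonglongrightarrow> 0"
  proof (rule LIMSEQ_I)
    fix r :: real assume r: "0 < r"
    hence r2: "0 < r/2" by simp
    obtain F where F: "finite F" "\<And>g. (\<forall>i\<in>F. g i = 0) \<and> (\<forall>i. cmod (g i) \<le> cmod (f i)) \<Longrightarrow> n2 g \<le> r/2"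
      using n2_tail[OF f2(1) r2] by blast
    obtain M where M: "\<And>i. i \<in> F \<Longrightarrow> c i \<le> real M"
    proof -
      have "bdd_above (c ` F)" using F(1) by simp
      then obtain b where "\<forall>i\<in>F. c i \<le> b" unfolding bdd_above_def by blast
      moreover obtain M :: nat where "b \<le> real M" using real_arch_simple by blast
      ultimately have "c i \<le> real M" if "i \<in> F" for i using that by fastforce
      thus thesis by (rule that)
    qed
    have "n2 (\<lambda>i. cut n f i - f i) < r" if "n \<ge> M" for n
    proof -
      have "n2 (\<lambda>i. cut n f i - f i) \<le> r/2"
      proof (rule F(2), intro conjI ballI allI)
        fix i assume "i \<in> F"
        hence "c i \<le> real n" using M[of i] that by simp
        thus "cut n f i - f i = 0" using f2(2)[of i] L by (auto simp: cut_def)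
      next
        fix i show "cmod (cut n f i - f i) \<le> cmod (f i)" by (simp add: cut_def)
      qed
      thus ?thesis using r by simp
    qed
    thus "\<exists>no. \<forall>n\<ge>no. norm (n2 (\<lambda>i. cut n f i - f i) - 0) < r" by auto
  qed
  from tendsto_real_sqrt[OF this] show ?thesis
    by (simp only: hlim_def ell2_hnorm_diff[OF cut_carrier[OF f] f] real_sqrt_zero)
qed

text \<open>Norm limits converge in each coordinate, which confines the closure to
  \<open>Dmax\<close>; truncation by \<open>cut\<close> approximates every element of
  \<open>Dmax\<close>.\<close>

lemma op_closure_Dfin: "op_closure H1 Dfin = Dmax"
proof (rule equalityI; clarify)
  fix f g u v assume "((f, g), (u, v)) \<in> op_closure H1 Dfin"
  then obtain X Y where fu: "(f, g) \<in> carrier H1" "(u, v) \<in> carrier H1" and D: "\<And>n. (X n, Y n) \<in> Dfin"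
    and lim: "hlim H1 X (f, g)" "hlim H1 Y (u, v)" unfolding op_closure_def by blast
  define F G where "F n = fst (X n)" and "G n = snd (X n)" for n
  have XE: "X n = (F n, G n)" for n by (simp add: F_def G_def)
  have YE: "Y n = (wmul (G n), wmul (F n))" for n using D[of n] unfolding XE by (cases "Y n") (auto simp: Dfin_iff)
  have D': "X n \<in> carrier H1 \<and> Y n \<in> carrier H1" for n using D Dfin_subset Dmax_carrier by blast
  have ca: "F n \<in> carrier (ell2 I)" "G n \<in> carrier (ell2 J)" "wmul (G n) \<in> carrier (ell2 I)" "wmul (F n) \<in> carrier (ell2 J)" for n
    using D'[of n] unfolding XE YE by (simp_all add: hsum_simps)
  have cb: "f \<in> carrier (ell2 I)" "g \<in> carrier (ell2 J)" "u \<in> carrier (ell2 I)" "v \<in> carrier (ell2 J)"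
    using fu by (simp_all add: hsum_simps)
  have lX: "hlim H1 (\<lambda>n. (F n, G n)) (f, g)" using lim(1) unfolding XE[symmetric] by simp
  have lY: "hlim H1 (\<lambda>n. (wmul (G n), wmul (F n))) (u, v)" using lim(2) unfolding YE[symmetric] by simp
  have 1: "(\<lambda>n. F n i) \<longlonglongrightarrow> f i" "(\<lambda>n. G n i) \<longlonglongrightarrow> g i" for i
    using hlim_ell2_coord[OF ca(1) cb(1) hlim_components(1)[OF ca(1,2) cb(1,2) lX]]
      hlim_ell2_coord[OF ca(2) cb(2) hlim_components(2)[OF ca(1,2) cb(1,2) lX]] .
  have 2: "(\<lambda>n. wmul (G n) i) \<longlonglongrightarrow> u i" "(\<lambda>n. wmul (F n) i) \<longlonglongrightarrow> v i" for i
    using hlim_ell2_coord[OF ca(3) cb(3) hlim_components(1)[OF ca(3,4) cb(3,4) lY]]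
      hlim_ell2_coord[OF ca(4) cb(4) hlim_components(2)[OF ca(3,4) cb(3,4) lY]] .
  have "u i = wmul g i" for i
    by (rule LIMSEQ_unique[OF 2(1)]) (unfold wmul_def, rule tendsto_mult_left[OF 1(2)])
  moreover have "v i = wmul f i" for i
    by (rule LIMSEQ_unique[OF 2(2)]) (unfold wmul_def, rule tendsto_mult_left[OF 1(1)])
  ultimately show "((f, g), (u, v)) \<in> Dmax" using fu by (auto simp: Dmax_iff carrier_pair)
next
  fix f g u v assume D: "((f, g), (u, v)) \<in> Dmax"
  hence cc: "(f, g) \<in> carrier H1" "(u, v) \<in> carrier H1" using Dmax_carrier by auto
  hence c4: "f \<in> carrier (ell2 I)" "g \<in> carrier (ell2 J)" "u \<in> carrier (ell2 I)" "v \<in> carrier (ell2 J)"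
    by (simp_all add: hsum_simps)
  have uv: "u = wmul g" "v = wmul f" using D by (simp_all add: Dmax_iff)
  have "((cut n f, cut n g), (cut n u, cut n v)) \<in> Dfin" for n
    using cut_carrier[OF c4(1), of n] cut_carrier[OF c4(2), of n] by (simp add: Dfin_iff uv wmul_cut cut_finite hsum_simps)
  moreover have "hlim H1 (\<lambda>n. (cut n f, cut n g)) (f, g)" "hlim H1 (\<lambda>n. (cut n u, cut n v)) (u, v)"
    by (intro hlim_sum cut_carrier c4 hlim_cut; blast)+
  ultimately show "((f, g), (u, v)) \<in> op_closure H1 Dfin"
    unfolding op_closure_def mem_Collect_eq prod.case using cc
    by (intro conjI exI[of _ "\<lambda>n. (cut n f, cut n g)"] exI[of _ "\<lambda>n. (cut n u, cut n v)"]) simp_all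
qed

lemma densely_defined_Dfin: "densely_defined H1 Dfin"
  unfolding densely_defined_def
proof (intro ballI allI impI)
  fix x and e :: real assume x: "x \<in> carrier H1" and e: "0 < e"
  obtain f g where fg: "x = (f, g)" "f \<in> carrier (ell2 I)" "g \<in> carrier (ell2 J)" using x by (auto simp: hsum_simps)
  have cu: "cut n f \<in> carrier (ell2 I)" "cut n g \<in> carrier (ell2 J)" for n by (rule cut_carrier fg)+
  have "hlim H1 (\<lambda>n. (cut n f, cut n g)) (f, g)" by (intro hlim_sum cu fg hlim_cut; blast)
  from LIMSEQ_D[OF this[unfolded hlim_def] e] obtain n
    where "norm (hnorm H1 ((cut n f, cut n g) \<ominus>\<^bsub>H1\<^esub> (f, g)) - 0) < e" by blast
  hence n: "hnorm H1 ((cut n f, cut n g) \<ominus>\<^bsub>H1\<^esub> (f, g)) < e"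
    unfolding diff_zero real_norm_def by (rule le_less_trans[OF abs_ge_self])
  have eq: "hnorm H1 ((f, g) \<ominus>\<^bsub>H1\<^esub> (cut n f, cut n g)) = hnorm H1 ((cut n f, cut n g) \<ominus>\<^bsub>H1\<^esub> (f, g))"
    unfolding minus(2)[OF cu] minus(2)[OF fg(2,3)]
    using cu fg(2,3) by (simp add: hnorm_sum ell2_hnorm_diff ell2_minus ell2_hnorm ell2_diff_carrier n2_def norm_minus_commute)
  have mem: "((cut n f, cut n g), (wmul (cut n g), wmul (cut n f))) \<in> Dfin" using cu by (simp add: Dfin_iff cut_finite hsum_simps)
  show "\<exists>y\<in>Domain Dfin. hnorm H1 (x \<ominus>\<^bsub>H1\<^esub> y) < e"
  proof (rule bexI)
    show "hnorm H1 (x \<ominus>\<^bsub>H1\<^esub> (cut n f, cut n g)) < e" unfolding fg(1) eq by (rule n)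
    show "(cut n f, cut n g) \<in> Domain Dfin" using mem by (rule DomainI)
  qed
qed

lemma densely_defined_Dmax: "densely_defined H1 Dmax"
  using densely_defined_Dfin Domain_mono[OF Dfin_subset] unfolding densely_defined_def by blast

lemma ip_pair:
  assumes "(f, g) \<in> carrier H1"
  shows "ip H1 (f, g) (u, v) = ip2 f u + ip2 g v"
  using assms by (simp add: hsum_simps ell2_ip)

lemma ip2_wmul: "ip2 (wmul f) g = ip2 f (wmul g)"
  unfolding ip2_def wmul_def by (simp add: ac_simps)

lemma ip2_delta: "ip2 (\<lambda>j. if j = i then a else 0) f = cnj a * f i"
proof -
  have "ip2 (\<lambda>j. if j = i then a else 0) f = (\<Sum>\<^sub>\<infinity>j\<in>{i}. cnj a * f j)"
    unfolding ip2_def by (rule infsum_cong_neutral) auto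
  thus ?thesis by simp
qed

text \<open>Pairing with the basis vectors determines the adjoint in each coordinate. Where no basis
  vector is available, both sides of the coordinate equation are 0.\<close>

lemma self_adjoint_Dmax: "self_adjoint H1 Dmax"
  unfolding self_adjoint_def
proof (intro conjI densely_defined_Dmax)
  show "op_adjoint H1 Dmax = Dmax"
  proof (rule equalityI; clarify)
    fix f g u v assume A: "((f, g), (u, v)) \<in> op_adjoint H1 Dmax"
    hence ca: "(f, g) \<in> carrier H1" "(u, v) \<in> carrier H1"
      and ad: "\<And>x w. (x, w) \<in> Dmax \<Longrightarrow> ip H1 w (f, g) = ip H1 x (u, v)" by (auto simp: op_adjoint_def)
    define e where "e i = (\<lambda>j. if j = i then 1 else 0 :: complex)" for i :: 'i
    have we: "wmul (e i) = (\<lambda>j. if j = i then of_real (c i) else 0)" for i by (auto simp: wmul_def e_def)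
    have l2e: "l2 (\<lambda>j. if j = i then a else 0)" for i :: 'i and a by (rule l2_finite_support, rule finite_subset[of _ "{i}"]) auto
    have l2e': "l2 (e i)" "l2 (wmul (e i))" for i unfolding we using l2e by (simp_all add: e_def)
    have z: "wmul (\<lambda>i. 0) = (\<lambda>i. 0)" by (simp add: wmul_def)
    have ip0: "ip2 (\<lambda>i. 0) h = 0" for h :: "'i \<Rightarrow> complex" by (simp add: ip2_def)
    have "u i = wmul g i" for i
    proof (cases "i \<in> I")
      case True
      have x: "((e i, \<lambda>j. 0), (\<lambda>j. 0, wmul (e i))) \<in> Dmax"
        using True by (simp add: Dmax_iff carrier_pair z l2e') (auto simp: e_def)
      have y: "(e i, \<lambda>j. 0) \<in> carrier H1" "(\<lambda>j. 0, wmul (e i)) \<in> carrier H1" using x Dmax_carrier by auto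
      have "ip2 (wmul (e i)) g = ip2 (e i) u" using ad[OF x] by (simp add: ip_pair[OF y(1)] ip_pair[OF y(2)] ip0)
      thus ?thesis unfolding we unfolding e_def ip2_delta by (simp add: wmul_def)
    next
      case False
      thus ?thesis using ca wmul_zero(2)[of g i] by (simp add: carrier_pair)
    qed
    moreover have "v i = wmul f i" for i
    proof (cases "i \<in> J")
      case True
      have x: "((\<lambda>j. 0, e i), (wmul (e i), \<lambda>j. 0)) \<in> Dmax"
        using True by (simp add: Dmax_iff carrier_pair z l2e') (auto simp: e_def)
      have y: "(\<lambda>j. 0, e i) \<in> carrier H1" "(wmul (e i), \<lambda>j. 0) \<in> carrier H1" using x Dmax_carrier by auto
      have "ip2 (wmul (e i)) f = ip2 (e i) v" using ad[OF x] by (simp add: ip_pair[OF y(1)] ip_pair[OF y(2)] ip0)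
      thus ?thesis unfolding we unfolding e_def ip2_delta by (simp add: wmul_def)
    next
      case False
      thus ?thesis using ca wmul_zero(1)[of f i] by (simp add: carrier_pair)
    qed
    ultimately have "u = wmul g" "v = wmul f" by auto
    thus "((f, g), (u, v)) \<in> Dmax" using ca by (simp add: Dmax_iff carrier_pair)
  next
    fix f g u v assume D: "((f, g), (u, v)) \<in> Dmax"
    have "ip H1 w (f, g) = ip H1 x (u, v)" if xw: "(x, w) \<in> Dmax" for x w
    proof -
      obtain f' g' u' v' where e: "x = (f', g')" "w = (u', v')" by (cases x, cases w)
      have y: "(f', g') \<in> carrier H1" "(u', v') \<in> carrier H1" using xw Dmax_carrier e by auto
      have "u' = wmul g'" "v' = wmul f'" "u = wmul g" "v = wmul f" using xw D by (simp_all add: e Dmax_iff)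
      thus ?thesis unfolding e ip_pair[OF y(1)] ip_pair[OF y(2)] by (simp add: ip2_wmul)
    qed
    thus "((f, g), (u, v)) \<in> op_adjoint H1 Dmax" using D Dmax_carrier by (auto simp: op_adjoint_def)
  qed
qed

end

section \<open>Compactness of the resolvent\<close>

context offdiagonal begin

text \<open>An argument of Rellich type. Some subsequence converges in every coordinate; where
  \<open>c\<close> is large, the bound on \<open>wmul\<close> makes the remainder uniformly
  small.\<close>

lemma compact_ell2:
  assumes L: "L \<subseteq> I \<union> J" and X: "\<And>n. X n \<in> carrier (ell2 L)" "\<And>n. n2 (X n) \<le> C"
    and W: "\<And>n. l2 (wmul (X n))" "\<And>n. n2 (wmul (X n)) \<le> C"
  shows "\<exists>r x. strict_mono (r :: nat \<Rightarrow> nat) \<and> x \<in> carrier (ell2 L) \<and> hlim (ell2 L) (X \<circ> r) x"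
proof -
  interpret L: hilbert_space "ell2 L" by (rule hilbert_space_ell2)
  have l2X: "l2 (X n)" for n using X(1)[of n] by (simp add: ell2_simps)
  have U: "I \<union> J = (\<Union>n. {i \<in> I \<union> J. c i \<le> real n})" using real_arch_simple by auto
  have co: "countable (I \<union> J)"
    by (subst U) (intro countable_UN countableI_type countable_finite finite_sublevel)
  have bd: "cmod (X n i) \<le> sqrt C" for n i
    using cmod_sq_le_n2[OF l2X, of n i] X(2)[of n] by (intro real_le_rsqrt) linarith
  \<comment> \<open>A diagonal argument over the countable index set, possible because the norm
    bounds all coordinates uniformly.\<close>
  obtain r where r: "strict_mono r" "\<And>i. i \<in> I \<union> J \<Longrightarrow> \<exists>l. (\<lambda>n. X (r n) i) \<longlonglongrightarrow> l"
  proof (rule function_convergent_subsequence[OF co, of X "sqrt C"])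
    show "cmod (X n i) \<le> sqrt C" for n i by (rule bd)
  qed (rule that)
  define Y where "Y = X \<circ> r"
  have Y: "Y n \<in> carrier (ell2 L)" "l2 (Y n)" "l2 (wmul (Y n))" "n2 (wmul (Y n)) \<le> C" for n
    using X(1) l2X W by (simp_all add: Y_def)
  have dW: "wmul (\<lambda>i. Y m i - Y n i) = (\<lambda>i. wmul (Y m) i + (-1) * wmul (Y n) i)" for m n
    by (auto simp: wmul_def algebra_simps)
  have l2W: "l2 (wmul (\<lambda>i. Y m i - Y n i))" for m n
    unfolding dW by (rule l2_add(1)[OF Y(3) l2_scale[OF Y(3)]])
  have n2W: "n2 (wmul (\<lambda>i. Y m i - Y n i)) \<le> 4 * C" for m n
    unfolding dW using l2_add(2)[OF Y(3)[of m] l2_scale[OF Y(3)[of n], of "-1"]] n2_scale[of "-1" "wmul (Y n)"] Y(4)[of m] Y(4)[of n]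
    by simp
  have C0: "0 \<le> C" using X(2)[of 0] n2_nonneg[of "X 0"] by linarith
  have Cau: "\<exists>M. \<forall>m\<ge>M. \<forall>n\<ge>M. hnorm (ell2 L) (Y m \<ominus>\<^bsub>ell2 L\<^esub> Y n) < e" if e: "0 < e" for e
  proof -
    \<comment> \<open>For differences, the coordinates with \<open>c\<close> above \<open>R\<close>
      contribute at most 4C/R^2, and this choice keeps that below e^2/2.\<close>
    obtain R :: nat where R: "8 * C / e\<^sup>2 + 1 \<le> real R" using real_arch_simple by blast
    have R1: "1 \<le> real R" 
    proof -
      have "0 \<le> 8 * C / e\<^sup>2" using C0 by simp
      thus ?thesis using R by linarith
    qed
    have RR: "4 * C / (real R)\<^sup>2 \<le> e\<^sup>2 / 2"
    proof -
      have "8 * C / e\<^sup>2 \<le> real R" using R by linarith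
      also have "\<dots> \<le> (real R)\<^sup>2" using R1 by (simp add: power2_eq_square)
      finally show ?thesis using e R1 by (simp add: field_simps)
    qed
    define F where "F = {i \<in> I \<union> J. c i \<le> real R}"
    have fF: "finite F" unfolding F_def by (rule finite_sublevel)
    have cau: "Cauchy (\<lambda>n. Y n i)" if iF: "i \<in> F" for i
    proof -
      obtain l where "(\<lambda>n. X (r n) i) \<longlonglongrightarrow> l" using r(2)[of i] iF by (auto simp: F_def)
      thus ?thesis unfolding Y_def o_def by (rule LIMSEQ_imp_Cauchy)
    qed
    \<comment> \<open>The finitely many other coordinates share the second half of e^2. The added 1
      makes the final inequality strict and covers an empty \<open>F\<close>.\<close>
    define P where "P i M \<longleftrightarrow> (\<forall>m\<ge>M. \<forall>n\<ge>M. dist (Y m i) (Y n i) < sqrt (e\<^sup>2 / (2 * (real (card F) + 1))))" for i M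
    have "\<exists>M. P i M" if iF: "i \<in> F" for i
    proof -
      have "0 < sqrt (e\<^sup>2 / (2 * (real (card F) + 1)))" using e by simp
      from metric_CauchyD[OF cau[OF iF] this] show ?thesis unfolding P_def .
    qed
    hence "\<forall>i\<in>F. \<exists>M. P i M" by (intro ballI)
    from bchoice[OF this] obtain M where M: "\<forall>i\<in>F. P i (M i)" by (elim exE)
    define M0 where "M0 = Max (insert 0 (M ` F))"
    have M0: "M i \<le> M0" if "i \<in> F" for i unfolding M0_def using fF that by (intro Max_ge) auto
    have "hnorm (ell2 L) (Y m \<ominus>\<^bsub>ell2 L\<^esub> Y n) < e" if mn: "m \<ge> M0" "n \<ge> M0" for m n
    proof -
      define d where "d = (\<lambda>i. Y m i - Y n i)"
      have d0: "d i = 0" if "i \<notin> I \<union> J" for i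
      proof -
        have "i \<notin> L" using that L by blast
        thus ?thesis using Y(1)[of m] Y(1)[of n] by (simp add: d_def ell2_simps)
      qed
      have inF: "(cmod (d i))\<^sup>2 \<le> e\<^sup>2 / (2 * (real (card F) + 1))" if "i \<in> F" for i
      proof -
        have "cmod (d i) < sqrt (e\<^sup>2 / (2 * (real (card F) + 1)))"
          using bspec[OF M that] M0[OF that] mn by (auto simp: P_def d_def dist_norm)
        from power_mono[OF less_imp_le[OF this] norm_ge_zero, of 2] show ?thesis by simp
      qed
      have outF: "(cmod (d i))\<^sup>2 \<le> (cmod (wmul d i))\<^sup>2 / (real R)\<^sup>2" if "i \<notin> F" for i
      proof (cases "i \<in> I \<union> J")
        case True
        hence "real R \<le> c i" using that by (auto simp: F_def)
        hence "real R * cmod (d i) \<le> cmod (wmul d i)" using R1 by (simp add: wmul_def norm_mult mult_right_mono)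
        from power_mono[OF this, of 2] R1 show ?thesis by (simp add: field_simps power_mult_distrib)
      next
        case False
        thus ?thesis using d0[OF False] by (simp add: wmul_def)
      qed
      have "n2 d \<le> e\<^sup>2 / 2 * (real (card F) / (real (card F) + 1)) + e\<^sup>2 / 2"
      proof (rule l2I_finite_sums(2))
        fix G :: "'i set" assume G: "finite G"
        have "(\<Sum>i\<in>G. (cmod (d i))\<^sup>2) \<le> (\<Sum>i\<in>F. (cmod (d i))\<^sup>2) + (\<Sum>i\<in>G - F. (cmod (d i))\<^sup>2)"
        proof -
          have "(\<Sum>i\<in>G. (cmod (d i))\<^sup>2) \<le> (\<Sum>i\<in>F \<union> (G - F). (cmod (d i))\<^sup>2)" by (rule sum_mono2) (use G fF in auto)
          thus ?thesis using G fF by (subst (asm) sum.union_disjoint) auto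
        qed
        also have "(\<Sum>i\<in>F. (cmod (d i))\<^sup>2) \<le> (\<Sum>i\<in>F. e\<^sup>2 / (2 * (real (card F) + 1)))" by (rule sum_mono[OF inF])
        also have "\<dots> = e\<^sup>2 / 2 * (real (card F) / (real (card F) + 1))" by simp
        also have "(\<Sum>i\<in>G - F. (cmod (d i))\<^sup>2) \<le> (\<Sum>i\<in>G - F. (cmod (wmul d i))\<^sup>2 / (real R)\<^sup>2)" by (rule sum_mono) (simp add: outF)
        also have "\<dots> = (\<Sum>i\<in>G - F. (cmod (wmul d i))\<^sup>2) / (real R)\<^sup>2" by (simp add: sum_divide_distrib)
        also have "\<dots> \<le> 4 * C / (real R)\<^sup>2"
        proof (rule divide_right_mono)
          have "(\<Sum>i\<in>G - F. (cmod (wmul d i))\<^sup>2) \<le> n2 (wmul d)"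
            by (rule finite_sum_le_n2) (use G l2W in \<open>auto simp: d_def\<close>)
          thus "(\<Sum>i\<in>G - F. (cmod (wmul d i))\<^sup>2) \<le> 4 * C" using n2W[of m n] unfolding d_def by linarith
        qed simp
        also note RR
        finally show "(\<Sum>i\<in>G. (cmod (d i))\<^sup>2) \<le> e\<^sup>2 / 2 * (real (card F) / (real (card F) + 1)) + e\<^sup>2 / 2" by simp
      qed
      also have "\<dots> < e\<^sup>2"
      proof -
        have "real (card F) / (real (card F) + 1) < 1" by simp
        hence "e\<^sup>2 / 2 * (real (card F) / (real (card F) + 1)) < e\<^sup>2 / 2 * 1" using e by (intro mult_strict_left_mono) auto
        thus ?thesis by linarith
      qed
      finally have "sqrt (n2 d) < sqrt (e\<^sup>2)" by (rule real_sqrt_less_mono)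
      thus ?thesis using e by (simp add: ell2_hnorm_diff[OF Y(1) Y(1)] d_def)
    qed
    thus ?thesis by blast
  qed
  have "\<exists>x\<in>carrier (ell2 L). hlim (ell2 L) Y x" by (rule ell2_complete) (use Y(1) Cau in blast)+
  thus ?thesis using r(1) unfolding Y_def by blast
qed

text \<open>The cross terms of the two squares are opposite because \<open>c\<close> is real. Summed
  over the indices, the squared norm of (D - i)x is the sum of those of x and Dx, so a bound on (D -
  i)x controls both.\<close>

lemma resolvent_identity:
  assumes "u = wmul g" "v = wmul f"
  shows "(cmod (u i - \<i> * f i))\<^sup>2 + (cmod (v i - \<i> * g i))\<^sup>2
    = (cmod (f i))\<^sup>2 + (cmod (g i))\<^sup>2 + (cmod (wmul f i))\<^sup>2 + (cmod (wmul g i))\<^sup>2"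
  unfolding assms wmul_def cmod_power2 by (simp add: power2_eq_square algebra_simps)

lemma compact_resolvent_at_Dmax: "compact_resolvent_at H1 Dmax \<i>"
  unfolding compact_resolvent_at_def
proof (intro conjI ballI allI impI)
  fix w assume "w \<in> carrier H1"
  then obtain w1 w2 where w: "w = (w1, w2)" and wc: "(w1, w2) \<in> carrier H1" by (cases w) auto
  have wz: "l2 w1" "l2 w2" "\<And>i. i \<notin> I \<Longrightarrow> w1 i = 0" "\<And>i. i \<notin> J \<Longrightarrow> w2 i = 0" using wc by (simp_all add: carrier_pair)
  define k where "k i = complex_of_real (1 + (c i)\<^sup>2)" for i
  have k0: "k i \<noteq> 0" for i
  proof -
    have "1 + (c i)\<^sup>2 > 0" by (simp add: add_pos_nonneg)
    thus ?thesis unfolding k_def of_real_eq_0_iff by simp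
  qed
  \<comment> \<open>The inverse of D - i is (D + i)/(1 + D^2), and D^2 is multiplication by the
    square of \<open>c\<close>; \<open>F\<close> is its first component, and with exchanged
    arguments its second.\<close>
  define F where "F x y = (\<lambda>i. (of_real (c i) * y i + \<i> * x i) / k i)" for x y :: "'i \<Rightarrow> complex"
  have kn: "cmod (k i) = 1 + (c i)\<^sup>2" for i
    unfolding k_def norm_of_real by simp
  have b1: "cmod (complex_of_real (c i) / k i) \<le> 1" "cmod (\<i> / k i) \<le> 1" "cmod (complex_of_real (c i * c i) / k i) \<le> 1" for i
    using sum_squares_bound[of "\<bar>c i\<bar>" 1] unfolding norm_divide kn
    by (auto simp: divide_le_eq_1 add_pos_nonneg norm_mult power2_eq_square)
  have l2F: "l2 (F x y)" "l2 (wmul (F x y))" if xy: "l2 x" "l2 y" for x y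
  proof -
    have e1: "F x y = (\<lambda>i. of_real (c i) / k i * y i + \<i> / k i * x i)" by (auto simp: F_def add_divide_distrib)
    have a1: "l2 (\<lambda>i. of_real (c i) / k i * y i)"
      by (rule l2_dominated(1)[OF xy(2), of _ 1]) (simp only: norm_mult, rule mult_right_mono[OF b1(1)], simp)
    have a2: "l2 (\<lambda>i. \<i> / k i * x i)"
      by (rule l2_dominated(1)[OF xy(1), of _ 1]) (simp only: norm_mult, rule mult_right_mono[OF b1(2)], simp)
    show "l2 (F x y)" unfolding e1 by (rule l2_add(1)[OF a1 a2])
    have e2: "wmul (F x y) = (\<lambda>i. of_real (c i * c i) / k i * y i + \<i> * (of_real (c i) / k i * x i))"
      by (auto simp: F_def wmul_def add_divide_distrib algebra_simps)
    have a3: "l2 (\<lambda>i. of_real (c i * c i) / k i * y i)"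
      by (rule l2_dominated(1)[OF xy(2), of _ 1]) (simp only: norm_mult, rule mult_right_mono[OF b1(3)], simp)
    have a4: "l2 (\<lambda>i. \<i> * (of_real (c i) / k i * x i))"
      by (intro l2_scale l2_dominated(1)[OF xy(1), of _ 1]) (simp only: norm_mult, rule mult_right_mono[OF b1(1)], simp)
    show "l2 (wmul (F x y))" unfolding e2 by (rule l2_add(1)[OF a3 a4])
  qed
  have FI: "F w1 w2 i = 0" if "i \<notin> I" for i using that wz(3,4)[of i] c_J[of i] by (cases "i \<in> J") (auto simp: F_def)
  have FJ: "F w2 w1 i = 0" if "i \<notin> J" for i using that wz(3,4)[of i] c_I[of i] by (cases "i \<in> I") (auto simp: F_def)
  have cF: "(F w1 w2, F w2 w1) \<in> carrier H1" using FI FJ l2F wz by (simp add: carrier_pair)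
  have key: "of_real (c i) * F y x i = x i + \<i> * F x y i" for x y i
  proof -
    have "x i * k i + \<i> * (of_real (c i) * y i + \<i> * x i) = of_real (c i) * (of_real (c i) * x i + \<i> * y i)"
      by (simp add: k_def algebra_simps power2_eq_square)
    hence "(x i * k i + \<i> * (of_real (c i) * y i + \<i> * x i)) / k i = of_real (c i) * F y x i" by (simp add: F_def)
    moreover have "(x i * k i + \<i> * (of_real (c i) * y i + \<i> * x i)) / k i = x i + \<i> * (of_real (c i) * y i + \<i> * x i) / k i"
      using k0[of i] by (subst add_divide_distrib) simp
    ultimately show ?thesis by (simp add: F_def)
  qed
  have wF: "wmul (F w2 w1) = (\<lambda>i. w1 i + \<i> * F w1 w2 i)" "wmul (F w1 w2) = (\<lambda>i. w2 i + \<i> * F w2 w1 i)"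
    unfolding wmul_def key by auto
  have plus: "w \<oplus>\<^bsub>H1\<^esub> \<i> \<odot>\<^bsub>H1\<^esub> (f, g) = (\<lambda>i. w1 i + \<i> * f i, \<lambda>i. w2 i + \<i> * g i)" for f g
    by (simp add: w hsum_simps ell2_simps)
  show "\<exists>!x. (x, w \<oplus>\<^bsub>H1\<^esub> \<i> \<odot>\<^bsub>H1\<^esub> x) \<in> Dmax"
  proof (rule ex1I)
    show "((F w1 w2, F w2 w1), w \<oplus>\<^bsub>H1\<^esub> \<i> \<odot>\<^bsub>H1\<^esub> (F w1 w2, F w2 w1)) \<in> Dmax"
      unfolding plus Dmax_iff wF[symmetric] using cF l2F wz by simp
    fix x assume x: "(x, w \<oplus>\<^bsub>H1\<^esub> \<i> \<odot>\<^bsub>H1\<^esub> x) \<in> Dmax"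
    obtain f g where fg: "x = (f, g)" by (cases x)
    have e: "of_real (c i) * g i = w1 i + \<i> * f i" "of_real (c i) * f i = w2 i + \<i> * g i" for i
      using x unfolding fg plus Dmax_iff by (auto simp: wmul_def fun_eq_iff)
    have "f i * k i = of_real (c i) * w2 i + \<i> * w1 i \<and> g i * k i = of_real (c i) * w1 i + \<i> * w2 i" for i
    proof -
      have w12: "w1 i = of_real (c i) * g i - \<i> * f i" "w2 i = of_real (c i) * f i - \<i> * g i" using e[of i] by simp_all
      show ?thesis unfolding w12 k_def by (simp add: algebra_simps power2_eq_square)
    qed
    hence "f i = F w1 w2 i \<and> g i = F w2 w1 i" for i using k0[of i] by (simp add: F_def eq_divide_eq)
    thus "x = (F w1 w2, F w2 w1)" unfolding fg by auto
  qed
next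
  fix X Y :: "nat \<Rightarrow> ('i \<Rightarrow> complex) \<times> ('i \<Rightarrow> complex)"
  assume *: "(\<forall>n. (X n, Y n) \<in> Dmax) \<and> (\<exists>C. \<forall>n. hnorm H1 (Y n \<ominus>\<^bsub>H1\<^esub> \<i> \<odot>\<^bsub>H1\<^esub> X n) \<le> C)"
  then obtain C where C: "\<And>n. hnorm H1 (Y n \<ominus>\<^bsub>H1\<^esub> \<i> \<odot>\<^bsub>H1\<^esub> X n) \<le> C" by blast
  define f g u v where "f n = fst (X n)" and "g n = snd (X n)" and "u n = fst (Y n)" and "v n = snd (Y n)" for n
  have XE: "X n = (f n, g n)" "Y n = (u n, v n)" for n by (simp_all add: f_def g_def u_def v_def)
  have D: "((f n, g n), (u n, v n)) \<in> Dmax" for n using *[THEN conjunct1, rule_format, of n] unfolding XE .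
  have ca: "(f n, g n) \<in> carrier H1" "(u n, v n) \<in> carrier H1" for n using D Dmax_carrier by blast+
  have cb: "f n \<in> carrier (ell2 I)" "g n \<in> carrier (ell2 J)" "u n \<in> carrier (ell2 I)" "v n \<in> carrier (ell2 J)" for n
    using ca[of n] by (simp_all add: hsum_simps)
  have uv: "u n = wmul (g n)" "v n = wmul (f n)" for n using D[of n] by (simp_all add: Dmax_iff)
  have l2: "l2 (f n)" "l2 (g n)" "l2 (wmul (f n))" "l2 (wmul (g n))" for n
    using ca[of n] by (simp_all add: carrier_pair flip: uv)
  have sc: "(\<lambda>i. \<i> * f n i) \<in> carrier (ell2 I)" "(\<lambda>i. \<i> * g n i) \<in> carrier (ell2 J)" for n
    using cb[of n] by (auto simp: ell2_simps l2_scale)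
  have dc: "(\<lambda>i. u n i - \<i> * f n i) \<in> carrier (ell2 I)" "(\<lambda>i. v n i - \<i> * g n i) \<in> carrier (ell2 J)" for n
    using ell2_diff_carrier cb sc by blast+
  have dl: "l2 (\<lambda>i. u n i - \<i> * f n i)" "l2 (\<lambda>i. v n i - \<i> * g n i)" for n
    using dc[of n] by (simp_all add: ell2_simps)
  have m: "Y n \<ominus>\<^bsub>H1\<^esub> \<i> \<odot>\<^bsub>H1\<^esub> X n = (\<lambda>i. u n i - \<i> * f n i, \<lambda>i. v n i - \<i> * g n i)" for n
    using minus(2)[OF sc(1)[of n] sc(2)[of n], of "u n" "v n"] sc by (simp add: XE hsum_simps ell2_minus) (simp add: ell2_simps ell2_minus sc)
  have bound: "n2 (\<lambda>i. u n i - \<i> * f n i) + n2 (\<lambda>i. v n i - \<i> * g n i) \<le> C\<^sup>2" for n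
  proof -
    have "sqrt (n2 (\<lambda>i. u n i - \<i> * f n i) + n2 (\<lambda>i. v n i - \<i> * g n i)) \<le> C"
      using C[of n] unfolding m hnorm_sum[OF dc] ell2_hnorm[OF dc(1)] ell2_hnorm[OF dc(2)] by simp
    from power_mono[OF this, of 2] show ?thesis by simp
  qed
  have all: "n2 h \<le> C\<^sup>2" if "\<And>i. (cmod (h i))\<^sup>2 \<le> (cmod (u n i - \<i> * f n i))\<^sup>2 + (cmod (v n i - \<i> * g n i))\<^sup>2" for h :: "'i \<Rightarrow> complex" and n
  proof (rule l2I_finite_sums(2))
    fix G :: "'i set" assume G: "finite G"
    have "(\<Sum>i\<in>G. (cmod (h i))\<^sup>2) \<le> (\<Sum>i\<in>G. (cmod (u n i - \<i> * f n i))\<^sup>2) + (\<Sum>i\<in>G. (cmod (v n i - \<i> * g n i))\<^sup>2)"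
      unfolding sum.distrib[symmetric] by (rule sum_mono[OF that])
    also have "\<dots> \<le> C\<^sup>2" using finite_sum_le_n2[OF dl(1)[of n] G] finite_sum_le_n2[OF dl(2)[of n] G] bound[of n] by linarith
    finally show "(\<Sum>i\<in>G. (cmod (h i))\<^sup>2) \<le> C\<^sup>2" .
  qed
  have n2b: "n2 (f n) \<le> C\<^sup>2" "n2 (g n) \<le> C\<^sup>2" "n2 (wmul (f n)) \<le> C\<^sup>2" "n2 (wmul (g n)) \<le> C\<^sup>2" for n
    by (rule all[of _ n], unfold resolvent_identity[OF uv], simp)+
  obtain r x where r: "strict_mono r" "x \<in> carrier (ell2 I)" "hlim (ell2 I) (f \<circ> r) x"
    using compact_ell2[of I f, OF _ cb(1) n2b(1) l2(3) n2b(3)] by auto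
  obtain r' x' where r': "strict_mono r'" "x' \<in> carrier (ell2 J)" "hlim (ell2 J) ((g \<circ> r) \<circ> r') x'"
    using compact_ell2[of J "g \<circ> r" "C\<^sup>2"] cb(2) n2b(2,4) l2(4) by auto
  have "hlim H1 (\<lambda>n. ((f \<circ> r \<circ> r') n, (g \<circ> r \<circ> r') n)) (x, x')"
    by (rule hlim_sum[OF _ _ r(2) r'(2) hlim_subseq[OF r(3) r'(1)] r'(3)]) (simp_all add: cb)
  moreover have "(\<lambda>n. ((f \<circ> r \<circ> r') n, (g \<circ> r \<circ> r') n)) = X \<circ> (r \<circ> r')" by (auto simp: XE)
  ultimately show "\<exists>r x. strict_mono (r :: nat \<Rightarrow> nat) \<and> x \<in> carrier H1 \<and> hlim H1 (X \<circ> r) x"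
    using r r' strict_mono_o[OF r(1) r'(1)] by (intro exI[of _ "r \<circ> r'"] exI[of _ "(x, x')"]) (auto simp: hsum_simps)
qed

end

section \<open>Eigenvalues and eigenspaces of the model\<close>

context offdiagonal begin

lemma eigenspace_Dmax_iff:
  "(f, g) \<in> eigenspace H1 Dmax \<mu> \<longleftrightarrow>
    (f, g) \<in> carrier H1 \<and> (\<forall>i. of_real (c i) * g i = \<mu> * f i \<and> of_real (c i) * f i = \<mu> * g i)"
proof -
  have e: "\<mu> \<odot>\<^bsub>H1\<^esub> (f, g) = (\<lambda>i. \<mu> * f i, \<lambda>i. \<mu> * g i)" by (simp add: hsum_simps ell2_simps)
  have "l2 (\<lambda>i. \<mu> * f i) \<and> l2 (\<lambda>i. \<mu> * g i)" if "(f, g) \<in> carrier H1"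
    using that by (simp add: carrier_pair l2_scale)
  thus ?thesis unfolding eigenspace_def mem_Collect_eq e Dmax_iff by (auto simp: wmul_def fun_eq_iff)
qed

text \<open>Applying the eigenvalue equation twice shows that the square of \<open>c i\<close>
  equals that of the eigenvalue at every index where the vector does not vanish.\<close>

lemma eigenvector_level:
  assumes "(f, g) \<in> eigenspace H1 Dmax \<mu>" "f i \<noteq> 0 \<or> g i \<noteq> 0"
  shows "i \<in> I \<union> J" "c i = cmod \<mu>" "\<exists>s\<in>{1,-1}. \<mu> = complex_of_real (s * c i)"
proof -
  have e: "of_real (c i) * g i = \<mu> * f i" "of_real (c i) * f i = \<mu> * g i"
    using assms(1) by (simp_all add: eigenspace_Dmax_iff)
  show i: "i \<in> I \<union> J" using assms by (auto simp: eigenspace_Dmax_iff carrier_pair)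
  have "(of_real (c i))\<^sup>2 * f i = \<mu>\<^sup>2 * f i" 
  proof -
    have "(of_real (c i))\<^sup>2 * f i = of_real (c i) * (of_real (c i) * f i)" by (simp add: power2_eq_square)
    also have "\<dots> = \<mu> * (of_real (c i) * g i)" unfolding e(2) by simp
    finally show ?thesis unfolding e(1) by (simp add: power2_eq_square)
  qed
  moreover have "(of_real (c i))\<^sup>2 * g i = \<mu>\<^sup>2 * g i"
  proof -
    have "(of_real (c i))\<^sup>2 * g i = of_real (c i) * (of_real (c i) * g i)" by (simp add: power2_eq_square)
    also have "\<dots> = \<mu> * (of_real (c i) * f i)" unfolding e(1) by simp
    finally show ?thesis unfolding e(2) by (simp add: power2_eq_square)
  qed
  ultimately have "(complex_of_real (c i))\<^sup>2 = \<mu>\<^sup>2" using assms(2) by auto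
  hence "\<mu> = complex_of_real (c i) \<or> \<mu> = - complex_of_real (c i)" by (simp add: power2_eq_iff eq_commute)
  thus "c i = cmod \<mu>" "\<exists>s\<in>{1,-1}. \<mu> = complex_of_real (s * c i)" using c_nonneg[OF i] by auto
qed

text \<open>An eigenvector lives on a single level set of \<open>c\<close>, which is finite. So the
  closure has no eigenvectors outside the original domain.\<close>

lemma eigenspace_Dfin: "eigenspace H1 Dfin \<mu> = eigenspace H1 Dmax \<mu>"
proof
  show "eigenspace H1 Dfin \<mu> \<subseteq> eigenspace H1 Dmax \<mu>" using Dfin_subset by (auto simp: eigenspace_def)
  show "eigenspace H1 Dmax \<mu> \<subseteq> eigenspace H1 Dfin \<mu>"
  proof clarify
    fix f g assume e: "(f, g) \<in> eigenspace H1 Dmax \<mu>"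
    have s: "{i. f i \<noteq> 0 \<or> g i \<noteq> 0} \<subseteq> {i \<in> I \<union> J. c i \<le> cmod \<mu>}"
      using eigenvector_level(1,2)[OF e] by fastforce
    have fi: "finite {i. f i \<noteq> 0 \<or> g i \<noteq> 0}" by (rule finite_subset[OF s finite_sublevel])
    have "finite {i. f i \<noteq> 0}" "finite {i. g i \<noteq> 0}" by (rule finite_subset[OF _ fi], auto)+
    moreover obtain u v where uv: "\<mu> \<odot>\<^bsub>H1\<^esub> (f, g) = (u, v)" by (cases "\<mu> \<odot>\<^bsub>H1\<^esub> (f, g)")
    ultimately show "(f, g) \<in> eigenspace H1 Dfin \<mu>"
      using e unfolding eigenspace_def mem_Collect_eq uv Dfin_iff Dmax_iff by blast
  qed
qed

text \<open>If \<open>i\<close> lies in only one of the index sets, then only one component is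
  present. In that case \<open>c i = 0\<close>, and the vector belongs to the eigenvalue 0 for
  either sign \<open>s\<close>.\<close>

definition eigvec :: "real \<Rightarrow> 'i \<Rightarrow> ('i \<Rightarrow> complex) \<times> ('i \<Rightarrow> complex)" where
  "eigvec s i = (\<lambda>j. if j = i \<and> i \<in> I then 1 else 0, \<lambda>j. if j = i \<and> i \<in> J then of_real s else 0)"

lemma eigvec_carrier: "eigvec s i \<in> carrier H1"
proof -
  have "l2 (\<lambda>j. if j = i \<and> b then a else 0)" for a :: complex and b
    by (rule l2_finite_support, rule finite_subset[of _ "{i}"]) auto
  thus ?thesis by (auto simp: eigvec_def carrier_pair)
qed

lemma eigvec_eq:
  assumes "s \<in> {1,-1}"
  shows "of_real (c i) * snd (eigvec s i) j = of_real (s * c i) * fst (eigvec s i) j"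
    "of_real (c i) * fst (eigvec s i) j = of_real (s * c i) * snd (eigvec s i) j"
  using assms c_I[of i] c_J[of i] by (auto simp: eigvec_def)

lemma eigenvalues_Dmax:
  "eigenvalues H1 Dmax = {complex_of_real (s * c i) | s i. s \<in> {1,-1} \<and> i \<in> I \<union> J}"
proof (rule Set.set_eqI, rule iffI)
  fix \<mu> assume "\<mu> \<in> eigenvalues H1 Dmax"
  then obtain f g where e: "(f, g) \<in> eigenspace H1 Dmax \<mu>" "(f, g) \<noteq> \<zero>\<^bsub>H1\<^esub>" unfolding eigenvalues_def by auto
  hence "f \<noteq> (\<lambda>i. 0) \<or> g \<noteq> (\<lambda>i. 0)" by (auto simp: hsum_simps ell2_simps)
  then obtain i where "f i \<noteq> 0 \<or> g i \<noteq> 0" by blast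
  from eigenvector_level[OF e(1) this] show "\<mu> \<in> {complex_of_real (s * c i) | s i. s \<in> {1,-1} \<and> i \<in> I \<union> J}" by blast
next
  fix \<mu> assume "\<mu> \<in> {complex_of_real (s * c i) | s i. s \<in> {1,-1} \<and> i \<in> I \<union> J}"
  then obtain s i where si: "\<mu> = complex_of_real (s * c i)" "s \<in> {1,-1}" "i \<in> I \<union> J" by blast
  have f: "of_real (c i) * snd (eigvec s i) j = of_real (c j) * snd (eigvec s i) j"
    "of_real (c i) * fst (eigvec s i) j = of_real (c j) * fst (eigvec s i) j" for j by (auto simp: eigvec_def)
  have "(fst (eigvec s i), snd (eigvec s i)) \<in> eigenspace H1 Dmax \<mu>"
    unfolding eigenspace_Dmax_iff si(1) using eigvec_carrier eigvec_eq[OF si(2), of i, unfolded f] by simp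
  moreover have "eigvec s i \<noteq> \<zero>\<^bsub>H1\<^esub>"
  proof
    assume "eigvec s i = \<zero>\<^bsub>H1\<^esub>"
    hence "fst (eigvec s i) i = 0" "snd (eigvec s i) i = 0" by (simp_all add: hsum_simps ell2_simps)
    thus False using si by (auto simp: eigvec_def)
  qed
  ultimately show "\<mu> \<in> eigenvalues H1 Dmax" unfolding eigenvalues_def by auto
qed

lemma finsum_H1:
  fixes a :: "nat \<Rightarrow> complex"
  assumes "\<And>k. b k \<in> carrier H1"
  shows "(\<Oplus>\<^bsub>H1\<^esub>k\<in>{..<n}. a k \<odot>\<^bsub>H1\<^esub> b k) = (\<lambda>i. \<Sum>k<n. a k * fst (b k) i, \<lambda>i. \<Sum>k<n. a k * snd (b k) i)"
proof -
  interpret S: hilbert_space H1 by (rule hilbert_space_sum)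
  have m: "a k \<odot>\<^bsub>H1\<^esub> b k = (\<lambda>i. a k * fst (b k) i, \<lambda>i. a k * snd (b k) i)" for k
    by (cases "b k") (simp add: hsum_simps ell2_simps)
  have cl: "a k \<odot>\<^bsub>H1\<^esub> b k \<in> carrier H1" for k using S.smult_closed[of "a k" "b k"] assms by simp
  show ?thesis
  proof (induction n)
    case 0
    show ?case by (simp add: hsum_simps ell2_simps)
  next
    case (Suc n)
    have "(\<Oplus>\<^bsub>H1\<^esub>k\<in>insert n {..<n}. a k \<odot>\<^bsub>H1\<^esub> b k) = a n \<odot>\<^bsub>H1\<^esub> b n \<oplus>\<^bsub>H1\<^esub> (\<Oplus>\<^bsub>H1\<^esub>k\<in>{..<n}. a k \<odot>\<^bsub>H1\<^esub> b k)"
      by (rule S.finsum_insert) (use cl in auto)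
    thus ?case unfolding Suc.IH lessThan_Suc[symmetric] by (simp add: m hsum_simps ell2_simps add.commute)
  qed
qed

text \<open>One vector \<open>eigvec s i\<close> for each index of the level. The last hypothesis
  excludes an index of weight 0 common to \<open>I\<close> and \<open>J\<close>: its two components
  would be independent and count twice.\<close>

lemma has_dim_eigenspace:
  assumes h: "bij_betw h {..<n} {i \<in> I \<union> J. c i = r}" and s: "s \<in> {1,-1}" and r: "0 \<le> r"
    and z: "\<And>i. r = 0 \<Longrightarrow> i \<in> I \<Longrightarrow> i \<in> J \<Longrightarrow> c i \<noteq> 0"
  shows "has_dim H1 (eigenspace H1 Dmax (complex_of_real (s * r))) n"
proof -
  interpret S: hilbert_space H1 by (rule hilbert_space_sum)
  define b where "b k = eigvec s (h k)" for k
  have bc: "b k \<in> carrier H1" for k by (simp add: b_def eigvec_carrier)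
  have inj: "h k = h k' \<longleftrightarrow> k = k'" if "k < n" "k' < n" for k k'
    using h that by (auto simp: bij_betw_def inj_on_def)
  have hl: "h k \<in> I \<union> J" "c (h k) = r" if "k < n" for k using h that by (auto simp: bij_betw_def)
  have ss: "complex_of_real s * complex_of_real s = 1" using s by auto
  have at_h: "(\<Sum>k<n. a k * fst (b k) (h k0)) = (if h k0 \<in> I then a k0 else 0)"
    "(\<Sum>k<n. a k * snd (b k) (h k0)) = (if h k0 \<in> J then a k0 * of_real s else 0)" if k0: "k0 < n" for a :: "nat \<Rightarrow> complex" and k0
  proof -
    have "(\<Sum>k<n. a k * fst (b k) (h k0)) = (\<Sum>k<n. if k = k0 then (if h k0 \<in> I then a k0 else 0) else 0)"
      by (rule sum.cong) (use inj[OF k0] in \<open>auto simp: b_def eigvec_def\<close>)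
    thus "(\<Sum>k<n. a k * fst (b k) (h k0)) = (if h k0 \<in> I then a k0 else 0)" using k0 by simp
    have "(\<Sum>k<n. a k * snd (b k) (h k0)) = (\<Sum>k<n. if k = k0 then (if h k0 \<in> J then a k0 * of_real s else 0) else 0)"
      by (rule sum.cong) (use inj[OF k0] in \<open>auto simp: b_def eigvec_def\<close>)
    thus "(\<Sum>k<n. a k * snd (b k) (h k0)) = (if h k0 \<in> J then a k0 * of_real s else 0)" using k0 by simp
  qed
  have off_h: "(\<Sum>k<n. a k * fst (b k) i) = 0" "(\<Sum>k<n. a k * snd (b k) i) = 0" if "i \<notin> h ` {..<n}" for a :: "nat \<Rightarrow> complex" and i
    by (rule sum.neutral, use that in \<open>auto simp: b_def eigvec_def\<close>)+
  show ?thesis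
    unfolding has_dim_def
  proof (intro exI[of _ b] conjI allI impI ballI)
    fix a :: "nat \<Rightarrow> complex"
    have "(\<Oplus>\<^bsub>H1\<^esub>k\<in>{..<n}. a k \<odot>\<^bsub>H1\<^esub> b k) \<in> carrier H1"
      by (rule S.finsum_closed) (use S.smult_closed bc in auto)
    moreover have "of_real (c i) * (\<Sum>k<n. a k * snd (b k) i) = of_real (s * r) * (\<Sum>k<n. a k * fst (b k) i)"
      "of_real (c i) * (\<Sum>k<n. a k * fst (b k) i) = of_real (s * r) * (\<Sum>k<n. a k * snd (b k) i)" for i
    proof -
      have "of_real (c i) * (\<Sum>k<n. a k * snd (b k) i) = of_real (s * r) * (\<Sum>k<n. a k * fst (b k) i) \<and>
       of_real (c i) * (\<Sum>k<n. a k * fst (b k) i) = of_real (s * r) * (\<Sum>k<n. a k * snd (b k) i)"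
      proof (cases "i \<in> h ` {..<n}")
        case True
        then obtain k where k: "k < n" "i = h k" by auto
        show ?thesis unfolding k(2) at_h[OF k(1)] using hl[OF k(1)] s c_I[of "h k"] c_J[of "h k"] by auto
      next
        case False
        thus ?thesis by (simp add: off_h)
      qed
      thus "of_real (c i) * (\<Sum>k<n. a k * snd (b k) i) = of_real (s * r) * (\<Sum>k<n. a k * fst (b k) i)"
      "of_real (c i) * (\<Sum>k<n. a k * fst (b k) i) = of_real (s * r) * (\<Sum>k<n. a k * snd (b k) i)" by blast+
    qed
    ultimately show "(\<Oplus>\<^bsub>H1\<^esub>k\<in>{..<n}. a k \<odot>\<^bsub>H1\<^esub> b k) \<in> eigenspace H1 Dmax (complex_of_real (s * r))"
      unfolding finsum_H1[of b, OF bc] eigenspace_Dmax_iff by blast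
  next
    fix x assume x: "x \<in> eigenspace H1 Dmax (complex_of_real (s * r))"
    obtain f g where fg: "x = (f, g)" by (cases x)
    note e = x[unfolded fg]
    have zero: "f i = 0" "g i = 0" if "i \<notin> h ` {..<n}" for i
    proof -
      have "f i = 0 \<and> g i = 0"
      proof (rule ccontr)
        assume "\<not> (f i = 0 \<and> g i = 0)"
        hence "i \<in> I \<union> J" "c i = cmod (complex_of_real (s * r))" using eigenvector_level(1,2)[OF e, of i] by blast+
        hence "i \<in> {i \<in> I \<union> J. c i = r}" using s r by (auto simp: norm_mult)
        thus False using h that by (simp add: bij_betw_def)
      qed
      thus "f i = 0" "g i = 0" by blast+
    qed
    have car: "i \<notin> I \<Longrightarrow> f i = 0" "i \<notin> J \<Longrightarrow> g i = 0" for i using e by (simp_all add: eigenspace_Dmax_iff carrier_pair)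
    have gsf: "g (h k) = of_real s * f (h k)" if "k < n" "h k \<in> I" "h k \<in> J" for k
    proof -
      have "r \<noteq> 0" using z[of "h k"] hl[OF that(1)] that by auto
      have "of_real (c (h k)) * f (h k) = of_real (s * r) * g (h k)"
        using e by (simp add: eigenspace_Dmax_iff)
      hence "of_real r * f (h k) = of_real r * (of_real s * g (h k))" by (simp add: hl(2)[OF that(1)] ac_simps)
      hence "f (h k) = of_real s * g (h k)" using \<open>r \<noteq> 0\<close> unfolding mult_cancel_left by simp
      thus ?thesis using ss by (simp flip: mult.assoc)
    qed
    \<comment> \<open>The coefficient is read off in a component that exists; in the second one,
      multiplication by \<open>s\<close> undoes the sign put there by \<open>eigvec\<close>.\<close>
    define a where "a = (\<lambda>k\<in>{..<n}. if h k \<in> I then f (h k) else of_real s * g (h k))"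
    have "(\<lambda>i. \<Sum>k<n. a k * fst (b k) i, \<lambda>i. \<Sum>k<n. a k * snd (b k) i) = x"
    proof -
      have "(\<Sum>k<n. a k * fst (b k) i) = f i \<and> (\<Sum>k<n. a k * snd (b k) i) = g i" for i
      proof (cases "i \<in> h ` {..<n}")
        case True
        then obtain k where k: "k < n" "i = h k" by auto
        have "h k \<in> I \<or> h k \<in> J" using hl(1)[OF k(1)] by blast
        thus ?thesis unfolding k(2) at_h[OF k(1)] using k(1) gsf[OF k(1)] car[of "h k"] ss
          by (auto simp: a_def mult.commute simp flip: mult.assoc)
      next
        case False
        thus ?thesis by (simp add: off_h zero)
      qed
      thus ?thesis unfolding fg by auto
    qed
    hence ex: "x = (\<Oplus>\<^bsub>H1\<^esub>k\<in>{..<n}. a k \<odot>\<^bsub>H1\<^esub> b k)" unfolding finsum_H1[of b, OF bc] by simp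
    show "\<exists>!a. a \<in> {..<n} \<rightarrow>\<^sub>E UNIV \<and> x = (\<Oplus>\<^bsub>H1\<^esub>k\<in>{..<n}. a k \<odot>\<^bsub>H1\<^esub> b k)"
    proof (rule ex1I[of _ a], intro conjI ex)
      show "a \<in> {..<n} \<rightarrow>\<^sub>E UNIV" by (simp add: a_def)
      fix a' assume a': "a' \<in> {..<n} \<rightarrow>\<^sub>E UNIV \<and> x = (\<Oplus>\<^bsub>H1\<^esub>k\<in>{..<n}. a' k \<odot>\<^bsub>H1\<^esub> b k)"
      hence v: "f i = (\<Sum>k<n. a' k * fst (b k) i)" "g i = (\<Sum>k<n. a' k * snd (b k) i)" for i
        unfolding finsum_H1[of b, OF bc] fg by auto
      show "a' = a"
      proof
        fix k show "a' k = a k"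
        proof (cases "k < n")
          case True
          have "h k \<in> I \<or> h k \<in> J" using hl(1)[OF True] by blast
          thus ?thesis using v(1)[of "h k"] v(2)[of "h k"] ss unfolding at_h[OF True]
            using True by (auto simp: a_def mult.left_commute)
        next
          case False
          thus ?thesis using a' by (simp add: a_def PiE_def extensional_def)
        qed
      qed
    qed
  qed (rule bc)
qed

end

section \<open>The Dirac operator\<close>

definition lev :: "(real \<Rightarrow> real) \<Rightarrow> real \<times> real \<Rightarrow> real" where
  "lev c = (\<lambda>(l, m). c l)"

lemma Nats_minus_1: "x \<in> \<nat> \<Longrightarrow> x - 1 \<notin> \<nat> \<Longrightarrow> x = 0" for x :: real
  using Nats_pred by blast

lemma Nats_ge_0: "x \<in> \<nat> \<Longrightarrow> 0 \<le> x" for x :: real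
  by (auto elim: Nats_cases)

text \<open>A pair that satisfies the right-hand side but lies in neither index set would have l - N
  = 0 and l + N + 1 = 0, that is l = -1/2, in conflict with l + m and l - m being natural
  numbers.\<close>

lemma gidx_union:
  "(l, m) \<in> gidx N \<union> gidx (N + 1) \<longleftrightarrow> l - N \<in> \<nat> \<and> l + N + 1 \<in> \<nat> \<and> l + m \<in> \<nat> \<and> l - m \<in> \<nat>"
proof
  assume "(l, m) \<in> gidx N \<union> gidx (N + 1)"
  then consider "(l, m) \<in> gidx N" | "(l, m) \<in> gidx (N + 1)" by blast
  thus "l - N \<in> \<nat> \<and> l + N + 1 \<in> \<nat> \<and> l + m \<in> \<nat> \<and> l - m \<in> \<nat>"
  proof cases
    case 1
    hence "l - N \<in> \<nat>" "l + N \<in> \<nat>" "l + m \<in> \<nat>" "l - m \<in> \<nat>" by (simp_all add: gidx_def)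
    thus ?thesis using Nats_add[OF _ Nats_1, of "l + N"] by blast
  next
    case 2
    hence a: "l - (N + 1) \<in> \<nat>" "l + (N + 1) \<in> \<nat>" "l + m \<in> \<nat>" "l - m \<in> \<nat>" by (simp_all add: gidx_def)
    have "l - N = l - (N + 1) + 1" "l + N + 1 = l + (N + 1)" by simp_all
    thus ?thesis using a Nats_add[OF a(1) Nats_1] by metis
  qed
next
  assume a: "l - N \<in> \<nat> \<and> l + N + 1 \<in> \<nat> \<and> l + m \<in> \<nat> \<and> l - m \<in> \<nat>"
  have "l + N \<in> \<nat> \<or> l - (N + 1) \<in> \<nat>"
  proof (rule ccontr)
    assume n: "\<not> (l + N \<in> \<nat> \<or> l - (N + 1) \<in> \<nat>)"
    have e: "l + N + 1 - 1 = l + N" "l - N - 1 = l - (N + 1)" by simp_all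
    have "l + N + 1 = 0" using a n Nats_minus_1[of "l + N + 1"] unfolding e by blast
    moreover have "l - N = 0" using a n Nats_minus_1[of "l - N"] unfolding e by blast
    moreover have "0 \<le> l + m" "0 \<le> l - m" using a Nats_ge_0 by blast+
    ultimately show False by linarith
  qed
  moreover have "l + (N + 1) \<in> \<nat>" using a by (simp add: add.assoc)
  ultimately show "(l, m) \<in> gidx N \<union> gidx (N + 1)" using a unfolding gidx_def by blast
qed

text \<open>The condition on \<open>l - N\<close> is the decisive one for N >= 0, that on
  \<open>l + N + 1\<close> for N < 0. The other one follows because 2N+1, respectively -2N-1, is a
  natural number.\<close>

lemma dirac_levels_iff:
  assumes "2 * N \<in> \<int>"
  shows "l \<in> dirac_levels N \<longleftrightarrow> l - N \<in> \<nat> \<and> l + N + 1 \<in> \<nat>"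
proof -
  have nat: "x \<in> \<nat>" if xi: "x \<in> \<int>" and xp: "x > -1" for x :: real
  proof -
    obtain k where k: "x = of_int k" by (rule Ints_cases[OF xi])
    hence "0 \<le> k" using xp by simp
    thus ?thesis unfolding k by (metis of_nat_in_Nats of_int_of_nat_eq nonneg_int_cases)
  qed
  have sh: "l \<in> dirac_levels N \<longleftrightarrow> l - (if N \<ge> 0 then N else \<bar>N\<bar> - 1) \<in> \<nat>"
    unfolding dirac_levels_def Nats_def by (auto simp: algebra_simps)
  show ?thesis
  proof (cases "N \<ge> 0")
    case True
    have "2 * N + 1 \<in> \<nat>" using True assms by (intro nat) auto
    from Nats_add[of "l - N", OF _ this] True show ?thesis unfolding sh by (auto simp: algebra_simps)
  next
    case False
    have "- 2 * N - 1 \<in> \<nat>" using False assms Ints_minus[OF assms] by (intro nat) auto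
    from Nats_add[of "l + N + 1", OF _ this] False show ?thesis unfolding sh by (auto simp: algebra_simps)
  qed
qed

section \<open>The Dirac operator as an instance of the model, and its spectrum\<close>

context deformation begin

text \<open>From e^t >= 1 + t with t = - x ln q; the summand 1 absorbs q^x, which is at most
  1.\<close>

lemma br_ge_linear:
  obtains k where "0 < k" "\<And>x. 0 \<le> x \<Longrightarrow> k * x \<le> br x"
proof -
  define d where "d = 1/q - q"
  define L where "L = - ln q"
  have "1 < 1/q" using q_pos q_less_1 by simp
  hence d: "0 < d" using q_less_1 unfolding d_def by linarith
  have L: "0 < L" unfolding L_def using q_pos q_less_1 by simp
  show thesis
  proof (rule that[of "L / d"])
    fix x :: real assume x: "0 \<le> x"
    have "1 + x * L \<le> q powr (- x)" using exp_ge_add_one_self[of "x * L"] q_pos by (simp add: powr_def L_def)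
    moreover have "q powr x \<le> 1" using q_pos q_less_1 x by (simp add: powr_le1)
    ultimately have "x * L / d \<le> (q powr (- x) - q powr x) / d" using d by (intro divide_right_mono) auto
    also have "\<dots> = br x"
    proof -
      have "q - 1/q = - d" by (simp add: d_def)
      thus ?thesis unfolding qnum_def by (simp add: minus_divide_left)
    qed
    finally show "L / d * x \<le> br x" by (simp add: mult.commute)
  qed (use d L in simp)
qed

lemma offdiagonal_dirac:
  assumes N: "2 * N \<in> \<int>"
  shows "offdiagonal (idx N) (idx (N + 1)) (lev (cf N))"
proof
  note ie = idx_eq[OF N] idx_eq[OF half_Ints(3)[OF N]]
  fix i :: "real \<times> real"
  obtain l m where i: "i = (l, m)" by (cases i)
  { assume "i \<in> idx N" "i \<notin> idx (N + 1)"
    hence a: "l - N \<in> \<nat>" "l + N \<in> \<nat>" "l + m \<in> \<nat>" "l - m \<in> \<nat>" and n: "(l, m) \<notin> gidx (N + 1)" unfolding ie i by (auto simp: gidx_def)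
    have "l + N + 1 \<in> \<nat>" using Nats_add[OF a(2) Nats_1] .
    hence "l - N - 1 \<notin> \<nat>" using a n by (auto simp: gidx_def add.assoc diff_diff_eq)
    hence "l - N = 0" using Nats_minus_1 a by blast
    thus "lev (cf N) i = 0" by (simp add: lev_def i cf_def) }
  { assume "i \<in> idx (N + 1)" "i \<notin> idx N"
    hence a: "l - (N + 1) \<in> \<nat>" "l + N + 1 \<in> \<nat>" "l + m \<in> \<nat>" "l - m \<in> \<nat>" and n: "(l, m) \<notin> gidx N"
      unfolding ie i by (auto simp: gidx_def add.assoc)
    have "l - N \<in> \<nat>" using Nats_add[OF a(1) Nats_1] by simp
    hence "l + N + 1 - 1 \<notin> \<nat>" using a n by (auto simp: gidx_def)
    hence "l + N + 1 = 0" using Nats_minus_1 a by blast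
    thus "lev (cf N) i = 0" by (simp add: lev_def i cf_def) }
  { assume "i \<in> idx N \<union> idx (N + 1)"
    hence "l - N \<in> \<nat>" "l + N + 1 \<in> \<nat>" unfolding ie i gidx_union by auto
    hence "0 \<le> l - N" "0 \<le> l + N + 1" using Nats_ge_0 by blast+
    thus "0 \<le> lev (cf N) i" by (simp add: lev_def i cf_def) }
next
  note ie = idx_eq[OF N] idx_eq[OF half_Ints(3)[OF N]]
  fix R :: real
  obtain k where k: "0 < k" "\<And>x. 0 \<le> x \<Longrightarrow> k * x \<le> br x" using br_ge_linear by blast
  define S where "S = R\<^sup>2 / k\<^sup>2"
  \<comment> \<open>If l - N exceeds \<open>M\<close>, then l - N >= 1 and l + N + 1 = (l - N) + (2N
    + 1) >= 1 + S, so that the product of the two is larger than \<open>S\<close>. The bound on l so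
    obtained also bounds l - m, which is at most 2l.\<close>
  define M where "M = 1 + S + \<bar>2 * N + 1\<bar>"
  obtain n :: nat where n: "M \<le> real n" "2 * (\<bar>N\<bar> + M) \<le> real n"
    using real_arch_simple[of "max M (2 * (\<bar>N\<bar> + M))"] by auto
  have "{i \<in> idx N \<union> idx (N + 1). lev (cf N) i \<le> R} \<subseteq> (\<lambda>(a, b). (N + real a, N + real a - real b)) ` ({..n} \<times> {..n})"
  proof clarify
    fix l m assume lm: "(l, m) \<in> idx N \<union> idx (N + 1)" and R: "lev (cf N) (l, m) \<le> R"
    have a: "l - N \<in> \<nat>" "l + N + 1 \<in> \<nat>" "l + m \<in> \<nat>" "l - m \<in> \<nat>" using lm unfolding ie gidx_union by blast+
    have p: "0 \<le> l - N" "0 \<le> l + N + 1" "0 \<le> l + m" "0 \<le> l - m" using a Nats_ge_0 by blast+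
    have "0 \<le> cf N l" using p by (simp add: cf_def)
    hence "(cf N l)\<^sup>2 \<le> R\<^sup>2" using R by (intro power_mono) (simp_all add: lev_def)
    also have "(cf N l)\<^sup>2 = br (l - N) * br (l + N + 1)" using p by (simp add: cf_def power_mult_distrib)
    finally have R2: "br (l - N) * br (l + N + 1) \<le> R\<^sup>2" .
    have "(k * (l - N)) * (k * (l + N + 1)) \<le> br (l - N) * br (l + N + 1)"
      by (rule mult_mono[OF k(2)[OF p(1)] k(2)[OF p(2)]]) (use p k(1) in simp_all)
    hence "(k * (l - N)) * (k * (l + N + 1)) \<le> R\<^sup>2" using R2 by (rule order_trans)
    hence ab: "(l - N) * (l + N + 1) \<le> S" using k(1) by (simp add: S_def pos_le_divide_eq power2_eq_square ac_simps)
    have S0: "0 \<le> S" by (simp add: S_def)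
    have "l - N \<le> M"
    proof (rule ccontr)
      assume "\<not> l - N \<le> M"
      hence g: "1 + S + \<bar>2 * N + 1\<bar> < l - N" by (simp add: M_def)
      hence g1: "1 \<le> l - N" using S0 by linarith
      have g2: "1 + S \<le> l + N + 1" using g by linarith
      have "1 * (1 + S) \<le> (l - N) * (l + N + 1)" using g1 g2 S0 by (intro mult_mono) auto
      hence "1 * (1 + S) \<le> S" using ab by (rule order_trans)
      thus False by simp
    qed
    hence "l \<le> N + M" by simp
    obtain a where a': "l - N = real a" using a(1) by (auto elim: Nats_cases)
    obtain b where b': "l - m = real b" using a(4) by (auto elim: Nats_cases)
    have "real a \<le> real n" using \<open>l - N \<le> M\<close> n a' by linarith
    moreover have "real b \<le> real n" 
    proof -
      have "l - m \<le> 2 * l" using p(3) by simp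
      also have "\<dots> \<le> 2 * (\<bar>N\<bar> + M)" using \<open>l \<le> N + M\<close> abs_ge_self[of N] by simp
      finally show ?thesis using n(2) b' by simp
    qed
    ultimately show "(l, m) \<in> (\<lambda>(a, b). (N + real a, N + real a - real b)) ` ({..n} \<times> {..n})"
      using a' b' by (intro image_eqI[of _ _ "(a, b)"]) auto
  qed
  thus "finite {i \<in> idx N \<union> idx (N + 1). lev (cf N) i \<le> R}" by (rule finite_subset) simp
qed

text \<open>\<open>ket\<close> suppresses the coordinates off \<open>idx N\<close>, and by
  hypothesis the function they would carry is 0.\<close>

lemma lin_ext_diagonal:
  assumes "\<And>i. i \<notin> idx N \<Longrightarrow> complex_of_real (lev c i) * f i = 0"
  shows "lin_ext (\<lambda>(l, m) i. complex_of_real (c l) * ket N (l, m) i) f = mulc c f"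
proof
  fix i :: "real \<times> real"
  obtain l m where i: "i = (l, m)" by (cases i)
  have "lin_ext (\<lambda>(l, m) i. complex_of_real (c l) * ket N (l, m) i) f i
      = (\<Sum>\<^sub>\<infinity>j\<in>{i}. f j * (case j of (l, m) \<Rightarrow> complex_of_real (c l) * ket N (l, m) i))"
    unfolding lin_ext_def by (rule infsum_cong_neutral) (auto simp: ket_def split: prod.splits)
  also have "\<dots> = mulc c f i"
    using assms[of i] by (cases "i \<in> idx N") (auto simp: i mulc_def ket_def lev_def)
  finally show "lin_ext (\<lambda>(l, m) i. complex_of_real (c l) * ket N (l, m) i) f i = mulc c f i" .
qed

lemma offdiagonal_wmul:
  assumes N: "2 * N \<in> \<int>"
  shows "offdiagonal.wmul (lev (cf N)) = mulc (cf N)"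
  unfolding offdiagonal.wmul_def[OF offdiagonal_dirac[OF N]] by (intro ext) (auto simp: mulc_def lev_def)

abbreviation "Dclos N \<equiv> offdiagonal.Dmax (idx N) (idx (N + 1)) (lev (cf N))"

lemma dirac_eq:
  assumes N: "2 * N \<in> \<int>"
  shows "dirac q N = offdiagonal.Dfin (idx N) (idx (N + 1)) (lev (cf N))"
proof -
  interpret offdiagonal "idx N" "idx (N + 1)" "lev (cf N)" by (rule offdiagonal_dirac[OF N])
  have al: "f \<in> algspan L \<longleftrightarrow> f \<in> carrier (ell2 (idx L)) \<and> finite {i. f i \<noteq> 0}" for f L
    by (auto simp: algspan_def ell2_simps intro: l2_finite_support)
  have 1: "lin_ext (\<lambda>(l, m) i. complex_of_real (cf N l) * ket N (l, m) i) g = mulc (cf N) g" if "g \<in> carrier (ell2 (idx (N + 1)))" for g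
    by (rule lin_ext_diagonal) (use that c_J in \<open>force simp: ell2_simps\<close>)
  have 2: "lin_ext (\<lambda>(l, m) i. complex_of_real (cf N l) * ket (N + 1) (l, m) i) g = mulc (cf N) g" if "g \<in> carrier (ell2 (idx N))" for g
    by (rule lin_ext_diagonal) (use that c_I in \<open>force simp: ell2_simps\<close>)
  have "x \<in> dirac q N \<longleftrightarrow> x \<in> Dfin" for x
  proof -
    obtain f g u v where x: "x = ((f, g), (u, v))" by (metis prod.collapse)
    have "x \<in> dirac q N \<longleftrightarrow> f \<in> algspan N \<and> g \<in> algspan (N + 1)
       \<and> u = lin_ext (\<lambda>(l, m) i. complex_of_real (cf N l) * ket N (l, m) i) g
       \<and> v = lin_ext (\<lambda>(l, m) i. complex_of_real (cf N l) * ket (N + 1) (l, m) i) f"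
      unfolding x dirac_def Let_def cf_def by auto
    also have "\<dots> \<longleftrightarrow> x \<in> Dfin"
      unfolding x Dfin_iff al offdiagonal_wmul[OF N] using 1 2 by (auto simp: hsum_simps)
    finally show ?thesis .
  qed
  thus ?thesis by blast
qed

lemma hspace1_eq: "hspace1 N = hsum (ell2 (idx N)) (ell2 (idx (N + 1)))"
  by (simp add: hspace1_def hspace_def)

lemma op_closure_dirac: "2 * N \<in> \<int> \<Longrightarrow> op_closure (hspace1 N) (dirac q N) = Dclos N"
  unfolding hspace1_eq dirac_eq by (rule offdiagonal.op_closure_Dfin[OF offdiagonal_dirac])

text \<open>Both brackets increase and neither is negative. Hence different levels have different
  eigenvalues, and multiplicities of several levels never add up.\<close>

lemma cf_strict_mono:
  assumes "0 \<le> l - N" "0 \<le> l + N + 1" "l < l'"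
  shows "cf N l < cf N l'"
  unfolding cf_def real_sqrt_mult[symmetric]
  by (rule real_sqrt_less_mono, rule mult_strict_mono) (use assms in \<open>auto simp: br_less_iff\<close>)

text \<open>The case 2l + 1 = 0 arises only for N = -1/2, whose lowest level l = -1/2 carries no
  basis vector. On every other level the vector with m = l exists.\<close>

lemma eigenvalues_dirac:
  assumes N: "2 * N \<in> \<int>"
  shows "eigenvalues (hspace1 N) (Dclos N) =
         {complex_of_real (s * sqrt (qnum q (l - N) * qnum q (l + N + 1))) | s l.
            s \<in> {1, -1} \<and> l \<in> dirac_levels N \<and> 2 * l + 1 \<noteq> 0}"
proof -
  interpret offdiagonal "idx N" "idx (N + 1)" "lev (cf N)" by (rule offdiagonal_dirac[OF N])
  note ie = idx_eq[OF N] idx_eq[OF half_Ints(3)[OF N]]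
  have cs: "sqrt (qnum q (l - N) * qnum q (l + N + 1)) = cf N l" for l by (simp add: cf_def real_sqrt_mult)
  have "(\<exists>m. (l, m) \<in> idx N \<union> idx (N + 1)) \<longleftrightarrow> l \<in> dirac_levels N \<and> 2 * l + 1 \<noteq> 0" for l
  proof
    assume "\<exists>m. (l, m) \<in> idx N \<union> idx (N + 1)"
    then obtain m where m: "l - N \<in> \<nat> \<and> l + N + 1 \<in> \<nat> \<and> l + m \<in> \<nat> \<and> l - m \<in> \<nat>" unfolding ie gidx_union by blast
    hence "0 \<le> l + m" "0 \<le> l - m" using Nats_ge_0 by blast+
    thus "l \<in> dirac_levels N \<and> 2 * l + 1 \<noteq> 0" using m by (simp add: dirac_levels_iff[OF N])
  next
    assume l: "l \<in> dirac_levels N \<and> 2 * l + 1 \<noteq> 0"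
    hence a: "l - N \<in> \<nat>" "l + N + 1 \<in> \<nat>" by (simp_all add: dirac_levels_iff[OF N])
    have "2 * l + 1 \<in> \<nat>" using Nats_add[OF a] by (simp add: algebra_simps)
    hence "l + l \<in> \<nat>" using l Nats_minus_1[of "2 * l + 1"] by auto
    hence "(l, l) \<in> idx N \<union> idx (N + 1)" unfolding ie gidx_union using a by simp
    thus "\<exists>m. (l, m) \<in> idx N \<union> idx (N + 1)" by blast
  qed
  hence "{complex_of_real (s * cf N l) | s l. s \<in> {1, -1} \<and> l \<in> dirac_levels N \<and> 2 * l + 1 \<noteq> 0}
     = {complex_of_real (s * lev (cf N) i) | s i. s \<in> {1,-1} \<and> i \<in> idx N \<union> idx (N + 1)}"
    unfolding lev_def by (force simp del: Un_iff)
  thus ?thesis unfolding hspace1_eq eigenvalues_Dmax cs by simp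
qed

lemma multiplicity_dirac:
  assumes N: "2 * N \<in> \<int>" and l: "l \<in> dirac_levels N" and s: "s \<in> {1,-1}"
  shows "\<exists>n. real n = 2 * l + 1 \<and> has_dim (hspace1 N)
            (eigenspace (hspace1 N) (Dclos N)
               (complex_of_real (s * sqrt (qnum q (l - N) * qnum q (l + N + 1))))) n"
proof -
  interpret offdiagonal "idx N" "idx (N + 1)" "lev (cf N)" by (rule offdiagonal_dirac[OF N])
  note ie = idx_eq[OF N] idx_eq[OF half_Ints(3)[OF N]]
  have cs: "sqrt (qnum q (l - N) * qnum q (l + N + 1)) = cf N l" for l by (simp add: cf_def real_sqrt_mult)
  have a: "l - N \<in> \<nat>" "l + N + 1 \<in> \<nat>" using l by (simp_all add: dirac_levels_iff[OF N])
  hence p: "0 \<le> l - N" "0 \<le> l + N + 1" using Nats_ge_0 by blast+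
  have "2 * l + 1 \<in> \<nat>" using Nats_add[OF a] by (simp add: algebra_simps)
  then obtain n where n: "2 * l + 1 = real n" by (auto elim: Nats_cases)
  \<comment> \<open>\<open>m\<close> runs from -l to l in unit steps, which gives 2l + 1 values; for
    l = -1/2 there are none.\<close>
  define h where "h k = (l, - l + real k)" for k
  have level: "(l', m) \<in> idx N \<union> idx (N + 1) \<and> lev (cf N) (l', m) = cf N l \<longleftrightarrow> l' = l \<and> l + m \<in> \<nat> \<and> l - m \<in> \<nat>" for l' m
  proof
    assume *: "(l', m) \<in> idx N \<union> idx (N + 1) \<and> lev (cf N) (l', m) = cf N l"
    hence b: "l' - N \<in> \<nat>" "l' + N + 1 \<in> \<nat>" "l' + m \<in> \<nat>" "l' - m \<in> \<nat>" unfolding ie gidx_union by blast+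
    hence "0 \<le> l' - N" "0 \<le> l' + N + 1" using Nats_ge_0 by blast+
    moreover have ce: "cf N l' = cf N l" using * by (simp add: lev_def)
    ultimately have "\<not> l' < l" "\<not> l < l'" using cf_strict_mono[of l' N l] cf_strict_mono[OF p, of l'] by auto
    hence "l' = l" by simp
    thus "l' = l \<and> l + m \<in> \<nat> \<and> l - m \<in> \<nat>" using b by simp
  qed (auto simp: lev_def ie gidx_union a simp del: Un_iff)
  have "bij_betw h {..<n} {i \<in> idx N \<union> idx (N + 1). lev (cf N) i = cf N l}"
  proof (rule bij_betw_imageI)
    show "inj_on h {..<n}" by (auto simp: h_def inj_on_def)
    have "i \<in> h ` {..<n} \<longleftrightarrow> i \<in> {i \<in> idx N \<union> idx (N + 1). lev (cf N) i = cf N l}" for i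
    proof -
      obtain l' m where i: "i = (l', m)" by (cases i)
      have "(l', m) \<in> h ` {..<n} \<longleftrightarrow> l' = l \<and> l + m \<in> \<nat> \<and> l - m \<in> \<nat>"
      proof
        assume "(l', m) \<in> h ` {..<n}"
        then obtain k where k: "k < n" "l' = l" "m = - l + real k" by (auto simp: h_def)
        have "l - m = real (n - 1 - k)" using n k by (simp add: of_nat_diff)
        thus "l' = l \<and> l + m \<in> \<nat> \<and> l - m \<in> \<nat>" using k by simp
      next
        assume *: "l' = l \<and> l + m \<in> \<nat> \<and> l - m \<in> \<nat>"
        then obtain k where k: "l + m = real k" by (auto elim: Nats_cases)
        have "0 \<le> l - m" using * Nats_ge_0 by blast
        hence "real k < real n" using k n by linarith
        thus "(l', m) \<in> h ` {..<n}" using * k by (intro image_eqI[of _ _ k]) (auto simp: h_def)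
      qed
      thus ?thesis unfolding i mem_Collect_eq level .
    qed
    thus "h ` {..<n} = {i \<in> idx N \<union> idx (N + 1). lev (cf N) i = cf N l}" by blast
  qed
  moreover have "0 \<le> cf N l" using p by (simp add: cf_def)
  \<comment> \<open>An index common to both summands has l - N > 0 and l + N + 1 > 0. An index of
    weight 0 therefore belongs to one summand only, which keeps the multiplicity of the eigenvalue 0
    at 2l + 1.\<close>
  moreover have "lev (cf N) i \<noteq> 0" if "i \<in> idx N" "i \<in> idx (N + 1)" for i
  proof -
    obtain l' m where i: "i = (l', m)" by (cases i)
    have "0 < l' - N" "0 < l' + N + 1" using that gidxD[of l' m N] gidxD[of l' m "N + 1"] unfolding ie i by auto
    thus ?thesis by (simp add: i lev_def cf_def)
  qed
  ultimately have "has_dim H1 (eigenspace H1 Dmax (complex_of_real (s * cf N l))) n"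
    by (intro has_dim_eigenspace s) auto
  thus ?thesis unfolding cs hspace1_eq using n by auto
qed

end

section \<open>The even spectral triple for each \<open>N\<close>\<close>

context deformation begin

lemma two_hspaces: "two_hilbert_spaces (hspace N) (hspace M)"
  by (intro two_hilbert_spaces.intro plain_hilbert_space_hspace)

lemma hspace1_carrier:
  assumes N: "2 * N \<in> \<int>"
  shows "(f, g) \<in> carrier (hspace1 N) \<longleftrightarrow> supp N f \<and> l2 f \<and> supp (N + 1) g \<and> l2 g"
  by (auto simp: hspace1_def hsum_simps hspace_carrier[OF N] hspace_carrier[OF half_Ints(3)[OF N]])

lemma hspace1_simps:
  "add (hspace1 N) (f, g) (f', g') = (vadd f f', vadd g g')" "smult (hspace1 N) c (f, g) = (smul c f, smul c g)"
  by (simp_all add: hspace1_def hsum_simps hspace_simps)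

lemma hspace1_ip: "(f, g) \<in> carrier (hspace1 N) \<Longrightarrow> ip (hspace1 N) (f, g) (f', g') = ip2 f f' + ip2 g g'"
  by (simp add: hspace1_def hsum_simps hspace_ip)

lemma hspace1_hnorm: "(f, g) \<in> carrier (hspace1 N) \<Longrightarrow> (hnorm (hspace1 N) (f, g))\<^sup>2 = n2 f + n2 g"
proof -
  assume a: "(f, g) \<in> carrier (hspace1 N)"
  hence "f \<in> carrier (hspace N)" "g \<in> carrier (hspace (N + 1))" by (simp_all add: hspace1_def hsum_simps)
  thus ?thesis unfolding hspace1_def by (simp add: two_hilbert_spaces.hnorm_sum[OF two_hspaces] hspace_hnorm)
qed

lemma hspace1_minus:
  assumes "(f', g') \<in> carrier (hspace1 N)"
  shows "(f, g) \<ominus>\<^bsub>hspace1 N\<^esub> (f', g') = (\<lambda>i. f i - f' i, \<lambda>i. g i - g' i)"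
    "\<ominus>\<^bsub>hspace1 N\<^esub> (f', g') = (\<lambda>i. - f' i, \<lambda>i. - g' i)"
proof -
  have c: "f' \<in> carrier (hspace N)" "g' \<in> carrier (hspace (N + 1))" using assms by (simp_all add: hspace1_def hsum_simps)
  note c' = c[unfolded hspace_def]
  show "(f, g) \<ominus>\<^bsub>hspace1 N\<^esub> (f', g') = (\<lambda>i. f i - f' i, \<lambda>i. g i - g' i)"
    "\<ominus>\<^bsub>hspace1 N\<^esub> (f', g') = (\<lambda>i. - f' i, \<lambda>i. - g' i)"
    unfolding hspace1_def two_hilbert_spaces.minus[OF two_hspaces c]
    unfolding hspace_def ell2_minus[OF c'(1)] ell2_minus[OF c'(2)] by simp_all
qed

lemma plain_hilbert_space_hspace1: "plain_hilbert_space (hspace1 N)"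
  unfolding hspace1_def by (rule plain_hilbert_space.intro[OF two_hilbert_spaces.hilbert_space_sum[OF two_hspaces]])

lemma star_rep_hspace1:
  assumes N: "2 * N \<in> \<int>"
  shows "star_rep (podles q) (hspace1 N) (podles_rep1 q N)"
  unfolding hspace1_def podles_rep1_def
  by (rule two_hilbert_spaces.star_rep_sum[OF two_hspaces star_rep_hspace[OF N] star_rep_hspace[OF half_Ints(3)[OF N]]])

lemma podles_rep1_coset:
  assumes N: "2 * N \<in> \<int>" and "(f, g) \<in> carrier (hspace1 N)"
  shows "podles_rep1 q N (coset q x) (f, g) = (free_rep q N x f, free_rep q (N + 1) x g)"
  using assms podles_rep_coset[OF N] podles_rep_coset[OF half_Ints(3)[OF N]]
  by (simp add: podles_rep1_def rep_sum_def hspace1_carrier)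

lemma Dclos_iff:
  assumes N: "2 * N \<in> \<int>"
  shows "((f, g), (u, v)) \<in> Dclos N \<longleftrightarrow> (f, g) \<in> carrier (hspace1 N) \<and> u = mulc (cf N) g \<and> v = mulc (cf N) f \<and> l2 u \<and> l2 v"
  unfolding offdiagonal.Dmax_iff[OF offdiagonal_dirac[OF N]] offdiagonal_wmul[OF N] hspace1_eq by simp

lemma dirac_iff:
  assumes N: "2 * N \<in> \<int>"
  shows "((f, g), (u, v)) \<in> dirac q N \<longleftrightarrow> (f, g) \<in> carrier (hspace1 N) \<and> u = mulc (cf N) g \<and> v = mulc (cf N) f
    \<and> finite {i. f i \<noteq> 0} \<and> finite {i. g i \<noteq> 0}"
  unfolding dirac_eq[OF N] offdiagonal.Dfin_iff[OF offdiagonal_dirac[OF N]] offdiagonal_wmul[OF N] hspace1_eq by simp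

lemma dirac_subset: "2 * N \<in> \<int> \<Longrightarrow> dirac q N \<subseteq> Dclos N"
  unfolding dirac_eq by (rule offdiagonal.Dfin_subset[OF offdiagonal_dirac])

lemma Dclos_carrier: "2 * N \<in> \<int> \<Longrightarrow> Dclos N \<subseteq> carrier (hspace1 N) \<times> carrier (hspace1 N)"
  unfolding hspace1_eq by (rule offdiagonal.Dmax_carrier[OF offdiagonal_dirac])

lemma bounded_op_offdiagonal:
  assumes N: "2 * N \<in> \<int>" and Kr: "bop N (N + 1) Kr" and Kl: "bop (N + 1) N Kl"
  shows "bounded_op (hspace1 N) (\<lambda>(f, g). (Kl g, Kr f))"
proof -
  obtain C1 where C1: "0 \<le> C1" "\<And>f. supp N f \<Longrightarrow> l2 f \<Longrightarrow> n2 (Kr f) \<le> C1 * n2 f" using bop_bound[OF Kr] by blast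
  obtain C2 where C2: "0 \<le> C2" "\<And>f. supp (N + 1) f \<Longrightarrow> l2 f \<Longrightarrow> n2 (Kl f) \<le> C2 * n2 f" using bop_bound[OF Kl] by blast
  have c: "(Kl g, Kr f) \<in> carrier (hspace1 N)" if "(f, g) \<in> carrier (hspace1 N)" for f g
    using that bopD(1,5)[OF Kr, of f] bopD(1,5)[OF Kl, of g] by (simp add: hspace1_carrier[OF N])
  have "hnorm (hspace1 N) (Kl g, Kr f) \<le> sqrt (C1 + C2) * hnorm (hspace1 N) (f, g)" if fg: "(f, g) \<in> carrier (hspace1 N)" for f g
  proof -
    have s: "supp N f" "l2 f" "supp (N + 1) g" "l2 g" using fg by (simp_all add: hspace1_carrier[OF N])
    have "(hnorm (hspace1 N) (Kl g, Kr f))\<^sup>2 \<le> C2 * n2 g + C1 * n2 f"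
      unfolding hspace1_hnorm[OF c[OF fg]] by (intro add_mono C1 C2 s)
    also have "\<dots> \<le> (C1 + C2) * (n2 f + n2 g)"
      using mult_nonneg_nonneg[OF C1(1) n2_nonneg[of g]] mult_nonneg_nonneg[OF C2(1) n2_nonneg[of f]]
      by (simp add: algebra_simps)
    also have "\<dots> = (sqrt (C1 + C2) * hnorm (hspace1 N) (f, g))\<^sup>2"
      using C1(1) C2(1) by (simp add: power_mult_distrib hspace1_hnorm[OF fg])
    finally show ?thesis
    proof (rule power2_le_imp_le)
      have "0 \<le> hnorm (hspace1 N) (f, g)"
        using plain_hilbert_space_hspace1 fg unfolding plain_hilbert_space_def by (rule hilbert_space.hnorm_nonneg)
      thus "0 \<le> sqrt (C1 + C2) * hnorm (hspace1 N) (f, g)" using C1(1) C2(1) by simp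
    qed
  qed
  hence "\<exists>C. \<forall>x\<in>carrier (hspace1 N). hnorm (hspace1 N) (case x of (f, g) \<Rightarrow> (Kl g, Kr f)) \<le> C * hnorm (hspace1 N) x"
    by (intro exI[of _ "sqrt (C1 + C2)"] ballI) (auto split: prod.splits)
  moreover have "(\<lambda>(f, g). (Kl g, Kr f)) \<in> carrier (hspace1 N) \<rightarrow> carrier (hspace1 N)" using c by auto
  moreover have "(case x \<oplus>\<^bsub>hspace1 N\<^esub> y of (f, g) \<Rightarrow> (Kl g, Kr f)) = (case x of (f, g) \<Rightarrow> (Kl g, Kr f)) \<oplus>\<^bsub>hspace1 N\<^esub> (case y of (f, g) \<Rightarrow> (Kl g, Kr f))"
    if "x \<in> carrier (hspace1 N)" "y \<in> carrier (hspace1 N)" for x y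
  proof -
    obtain f g f' g' where xy: "x = (f, g)" "y = (f', g')" by (cases x, cases y)
    show ?thesis using that bopD(3)[OF Kr, of f f'] bopD(3)[OF Kl, of g g'] unfolding xy
      by (simp add: hspace1_carrier[OF N] hspace1_simps)
  qed
  moreover have "(case a \<odot>\<^bsub>hspace1 N\<^esub> x of (f, g) \<Rightarrow> (Kl g, Kr f)) = a \<odot>\<^bsub>hspace1 N\<^esub> (case x of (f, g) \<Rightarrow> (Kl g, Kr f))"
    if "x \<in> carrier (hspace1 N)" for a x
  proof -
    obtain f g where x: "x = (f, g)" by (cases x)
    show ?thesis using that bopD(2)[OF Kr, of f a] bopD(2)[OF Kl, of g a] unfolding x
      by (simp add: hspace1_carrier[OF N] hspace1_simps)
  qed
  ultimately show ?thesis unfolding bounded_op_def by blast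
qed

text \<open>Treats the operator on the algebraic span and its closure at once. The first domain is
  invariant because the representation preserves finite support. The second is invariant because D a
  x = a D x + K x is square-summable when the commutator \<open>K\<close> is bounded.\<close>

lemma is_commutator_dirac:
  assumes N: "2 * N \<in> \<int>" and Kr: "dcomm (cf N) N (N + 1) x Kr" and Kl: "dcomm (cf N) (N + 1) N x Kl"
    and D: "D \<in> {dirac q N, Dclos N}"
  shows "is_commutator (hspace1 N) D (podles_rep1 q N (coset q x)) (\<lambda>(f, g). (Kl g, Kr f))"
  unfolding is_commutator_def
proof (intro conjI)
  have b: "bop N (N + 1) Kr" "bop (N + 1) N Kl" using Kr Kl by (simp_all add: dcomm_def)
  show "bounded_op (hspace1 N) (\<lambda>(f, g). (Kl g, Kr f))" by (rule bounded_op_offdiagonal[OF N b])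
  note F = bop_free_rep[OF N, of x] bop_free_rep[OF half_Ints(3)[OF N], of x]
  show "\<forall>(y, w)\<in>D. \<exists>z. (podles_rep1 q N (coset q x) y, z) \<in> D \<and>
      (case y of (f, g) \<Rightarrow> (Kl g, Kr f)) = z \<ominus>\<^bsub>hspace1 N\<^esub> podles_rep1 q N (coset q x) w"
  proof clarify
    fix f g u v assume d: "((f, g), (u, v)) \<in> D"
    hence d': "((f, g), (u, v)) \<in> Dclos N" using D dirac_subset[OF N] by auto
    hence c: "(f, g) \<in> carrier (hspace1 N)" "(u, v) \<in> carrier (hspace1 N)" using Dclos_carrier[OF N] by auto
    have uv: "u = mulc (cf N) g" "v = mulc (cf N) f" using d' by (simp_all add: Dclos_iff[OF N])
    have s: "supp N f" "l2 f" "supp (N + 1) g" "l2 g" "supp N u" "l2 u" "supp (N + 1) v" "l2 v"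
      using c by (simp_all add: hspace1_carrier[OF N])
    define z1 where "z1 = mulc (cf N) (free_rep q (N + 1) x g)"
    define z2 where "z2 = mulc (cf N) (free_rep q N x f)"
    have z: "z1 = vadd (free_rep q N x u) (Kl g)" "z2 = vadd (free_rep q (N + 1) x v) (Kr f)"
      using Kr Kl s unfolding dcomm_def z1_def z2_def uv by blast+
    have cw: "(free_rep q N x u, free_rep q (N + 1) x v) \<in> carrier (hspace1 N)"
      using bopD(1,5)[OF F(1) s(5)] bopD(1,5)[OF F(2) s(7)] s by (simp add: hspace1_carrier[OF N])
    have cf': "(free_rep q N x f, free_rep q (N + 1) x g) \<in> carrier (hspace1 N)"
      using bopD(1,5)[OF F(1) s(1)] bopD(1,5)[OF F(2) s(3)] s by (simp add: hspace1_carrier[OF N])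
    have l: "l2 z1" "l2 z2" unfolding z vadd_def
      using l2_add(1) bopD(5)[OF F(1) s(5)] bopD(5)[OF F(2) s(7)] bopD(5)[OF b(1) s(1)] bopD(5)[OF b(2) s(3)] s by blast+
    have m: "((free_rep q N x f, free_rep q (N + 1) x g), (z1, z2)) \<in> D"
    proof (cases "D = Dclos N")
      case True
      show ?thesis unfolding True Dclos_iff[OF N] using cf' l by (simp add: z1_def z2_def)
    next
      case False
      hence D': "D = dirac q N" using D by blast
      have "finite {i. f i \<noteq> 0}" "finite {i. g i \<noteq> 0}" using d unfolding D' dirac_iff[OF N] by blast+
      thus ?thesis unfolding D' dirac_iff[OF N] using cf' bopD(4)[OF F(1) s(1)] bopD(4)[OF F(2) s(3)]
        by (simp add: z1_def z2_def)
    qed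
    show "\<exists>z. (podles_rep1 q N (coset q x) (f, g), z) \<in> D \<and> (Kl g, Kr f) = z \<ominus>\<^bsub>hspace1 N\<^esub> podles_rep1 q N (coset q x) (u, v)"
      unfolding podles_rep1_coset[OF N c(1)] podles_rep1_coset[OF N c(2)]
    proof (rule exI[of _ "(z1, z2)"], rule conjI[OF m])
      show "(Kl g, Kr f) = (z1, z2) \<ominus>\<^bsub>hspace1 N\<^esub> (free_rep q N x u, free_rep q (N + 1) x v)"
        unfolding hspace1_minus(1)[OF cw] unfolding z by (simp add: vadd_def)
    qed
  qed
qed

lemma bounded_commutator_dirac:
  assumes N: "2 * N \<in> \<int>" and D: "D \<in> {dirac q N, Dclos N}" and a: "a \<in> carrier (podles q)"
  shows "bounded_commutator (hspace1 N) D (podles_rep1 q N a)"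
proof -
  obtain x where x: "a = coset q x" using a by (auto simp: podles_simps)
  obtain Kr Kl where K: "dcomm (cf N) N (N + 1) x Kr" "dcomm (cf N) (N + 1) N x Kl"
    using dcomm_raise[OF N] dcomm_lower[OF N] by blast
  show ?thesis unfolding x
    by (rule bounded_commutatorI[OF is_commutator_dirac[OF N K D]])
      (use D Dclos_carrier[OF N] dirac_subset[OF N] in blast)
qed

lemma grading1_pair: "grading1 (f, g) = (f, smul (-1) g)"
  by (simp add: grading1_def smul_def)

lemma grading1_carrier: "2 * N \<in> \<int> \<Longrightarrow> (f, g) \<in> carrier (hspace1 N) \<Longrightarrow> (f, smul (-1) g) \<in> carrier (hspace1 N)"
  by (simp add: hspace1_carrier supp_smul) (simp add: smul_def l2_uminus)

lemma anticommutes_grading1: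
  assumes N: "2 * N \<in> \<int>" and D: "D \<in> {dirac q N, Dclos N}"
  shows "anticommutes (hspace1 N) D grading1"
  unfolding anticommutes_def
proof clarify
  fix f g u v assume d: "((f, g), (u, v)) \<in> D"
  hence d': "((f, g), (u, v)) \<in> Dclos N" using D dirac_subset[OF N] by auto
  hence c: "(f, g) \<in> carrier (hspace1 N)" "(u, v) \<in> carrier (hspace1 N)" using Dclos_carrier[OF N] by auto
  have uv: "u = mulc (cf N) g" "v = mulc (cf N) f" "l2 u" "l2 v" using d' unfolding Dclos_iff[OF N] by blast+
  have e: "\<ominus>\<^bsub>hspace1 N\<^esub> grading1 (u, v) = (smul (-1) u, v)"
    unfolding grading1_pair hspace1_minus(2)[OF grading1_carrier[OF N c(2)]] by (simp add: smul_def)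
  have "((f, smul (-1) g), (smul (-1) u, v)) \<in> D"
  proof (cases "D = Dclos N")
    case True
    have "l2 (smul (-1) u)" using uv(3) unfolding smul_def by (rule l2_scale)
    thus ?thesis unfolding True Dclos_iff[OF N] using grading1_carrier[OF N c(1)] uv by (simp add: mulc_smul)
  next
    case False
    hence D': "D = dirac q N" using D by blast
    have "finite {i. f i \<noteq> 0}" "finite {i. g i \<noteq> 0}" using d unfolding D' dirac_iff[OF N] by blast+
    thus ?thesis unfolding D' dirac_iff[OF N] using grading1_carrier[OF N c(1)] uv
      by (simp add: mulc_smul) (simp add: smul_def)
  qed
  thus "(grading1 (f, g), \<ominus>\<^bsub>hspace1 N\<^esub> grading1 (u, v)) \<in> D" unfolding e unfolding grading1_pair .
qed

lemma bounded_op_grading1: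
  assumes N: "2 * N \<in> \<int>"
  shows "bounded_op (hspace1 N) grading1"
proof -
  have "bounded_op (hspace1 N) (map_prod (\<lambda>f. f) (\<lambda>g. smul (-1) g))"
    unfolding hspace1_def
    by (rule two_hilbert_spaces.bounded_op_sum[OF two_hspaces bounded_op_bop[OF N bop_id] bounded_op_bop[OF half_Ints(3)[OF N] bop_smul[OF bop_id]]])
  moreover have "map_prod (\<lambda>f. f) (\<lambda>g. smul (-1) g) = grading1" by (auto simp: grading1_pair)
  ultimately show ?thesis by simp
qed

lemma even_spectral_triple_dirac:
  assumes N: "2 * N \<in> \<int>"
  shows "even_spectral_triple (podles q) (hspace1 N) (podles_rep1 q N) (Dclos N) grading1"
  unfolding even_spectral_triple_def spectral_triple_def
proof (intro conjI ballI)
  show "star_algebra (podles q)" using q_pos by (intro star_algebra_podles) simp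
  show "hilbert_space (hspace1 N)" using plain_hilbert_space_hspace1 unfolding plain_hilbert_space_def .
  show "star_rep (podles q) (hspace1 N) (podles_rep1 q N)" by (rule star_rep_hspace1[OF N])
  show "self_adjoint (hspace1 N) (Dclos N)" unfolding hspace1_eq by (rule offdiagonal.self_adjoint_Dmax[OF offdiagonal_dirac[OF N]])
  show "compact_resolvent (hspace1 N) (Dclos N)"
    unfolding hspace1_eq by (rule compact_resolventI[OF offdiagonal.compact_resolvent_at_Dmax[OF offdiagonal_dirac[OF N]]])
  show "bounded_commutator (hspace1 N) (Dclos N) (podles_rep1 q N a)" if "a \<in> carrier (podles q)" for a
    by (rule bounded_commutator_dirac[OF N _ that]) simp
  show "bounded_op (hspace1 N) grading1" by (rule bounded_op_grading1[OF N])
  show "anticommutes (hspace1 N) (Dclos N) grading1" by (rule anticommutes_grading1[OF N]) simp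
  show "grading1 (grading1 x) = x" if "x \<in> carrier (hspace1 N)" for x
    by (cases x) (simp add: grading1_def)
  show "ip (hspace1 N) (grading1 x) y = ip (hspace1 N) x (grading1 y)" if "x \<in> carrier (hspace1 N)" "y \<in> carrier (hspace1 N)" for x y
  proof -
    obtain f g f' g' where xy: "x = (f, g)" "y = (f', g')" by (cases x, cases y)
    have c: "(f, g) \<in> carrier (hspace1 N)" using that xy by simp
    have "ip2 (smul (-1) g) g' = ip2 g (smul (-1) g')" unfolding smul_def ip2_scale_left ip2_scale_right by simp
    thus ?thesis unfolding xy grading1_pair hspace1_ip[OF c] hspace1_ip[OF grading1_carrier[OF N c]] by simp
  qed
  show "grading1 (podles_rep1 q N a x) = podles_rep1 q N a (grading1 x)" if a: "a \<in> carrier (podles q)" and x: "x \<in> carrier (hspace1 N)" for a x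
  proof -
    obtain y where y: "a = coset q y" using a by (auto simp: podles_simps)
    obtain f g where fg: "x = (f, g)" by (cases x)
    have c: "(f, g) \<in> carrier (hspace1 N)" using x fg by simp
    have "supp (N + 1) g" using c by (simp add: hspace1_carrier[OF N])
    from bopD(2)[OF bop_free_rep[OF half_Ints(3)[OF N]] this, of y "-1"] show ?thesis
      unfolding fg y podles_rep1_coset[OF N c] grading1_pair podles_rep1_coset[OF N grading1_carrier[OF N c]] by simp
  qed
qed

end

section \<open>The real extension\<close>

text \<open>The second triple consists of V_(-N-1) and V_(-N) in this order, so \<open>jc\<close>
  maps the components of the first triple to it in reversed order. For this reason
  \<open>dirac_J\<close> anticommutes with the grading.\<close>

definition dirac_J :: "(vec \<times> vec) \<times> (vec \<times> vec) \<Rightarrow> (vec \<times> vec) \<times> (vec \<times> vec)" where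
  "dirac_J = (\<lambda>((f, g), (f', g')). ((jc g', jc f'), (jc g, jc f)))"

lemma dirac_J_simp: "dirac_J ((f, g), (f', g')) = ((jc g', jc f'), (jc g, jc f))"
  by (simp add: dirac_J_def)

lemma dirac_J_dirac_J: "dirac_J (dirac_J x) = x"
  by (auto simp: dirac_J_def split: prod.splits)

context deformation begin

abbreviation "HH N \<equiv> hsum (hspace1 N) (hspace1 (- N - 1))"
abbreviation "DD N \<equiv> op_sum (Dclos N) (Dclos (- N - 1))"
abbreviation "RR N \<equiv> rep_sum (podles_rep1 q N) (podles_rep1 q (- N - 1))"

lemma Ints_reflect: "2 * N \<in> \<int> \<Longrightarrow> 2 * (- N - 1) \<in> \<int>" for N :: real
proof -
  assume "2 * N \<in> \<int>"
  hence "- (2 * N) - 2 \<in> \<int>" by (intro Ints_diff Ints_minus) auto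
  thus ?thesis by (simp add: algebra_simps)
qed

lemma reflect_simps: "- N - 1 + 1 = - N" "- (N + 1) = - N - 1" "- (- N - 1) = N + 1" "- (- N) = N" for N :: real
  by simp_all

lemma HH_spaces: "two_hilbert_spaces (hspace1 N) (hspace1 (- N - 1))"
  by (intro two_hilbert_spaces.intro plain_hilbert_space_hspace1)

lemma HH_carrier:
  assumes N: "2 * N \<in> \<int>"
  shows "((f, g), (f', g')) \<in> carrier (HH N) \<longleftrightarrow> (supp N f \<and> l2 f \<and> supp (N + 1) g \<and> l2 g)
    \<and> (supp (- (N + 1)) f' \<and> l2 f' \<and> supp (- N) g' \<and> l2 g')"
  unfolding hsum_simps mem_Times_iff fst_conv snd_conv hspace1_carrier[OF N] hspace1_carrier[OF Ints_reflect[OF N]] reflect_simps ..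

lemma HH_simps:
  "add (HH N) ((f, g), (f', g')) ((h, k), (h', k')) = ((vadd f h, vadd g k), (vadd f' h', vadd g' k'))"
  "smult (HH N) a ((f, g), (f', g')) = ((smul a f, smul a g), (smul a f', smul a g'))"
  by (simp_all add: hsum_simps hspace1_simps)

lemma HH_ip:
  assumes "((f, g), (f', g')) \<in> carrier (HH N)"
  shows "ip (HH N) ((f, g), (f', g')) ((h, k), (h', k')) = ip2 f h + ip2 g k + (ip2 f' h' + ip2 g' k')"
  using assms by (simp add: hsum_simps hspace1_ip)

lemma dirac_J_carrier:
  assumes N: "2 * N \<in> \<int>" and x: "x \<in> carrier (HH N)"
  shows "dirac_J x \<in> carrier (HH N)"
proof -
  obtain f g f' g' where e: "x = ((f, g), (f', g'))" by (metis prod.collapse)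
  have "supp N f" "l2 f" "supp (N + 1) g" "l2 g" "supp (- (N + 1)) f'" "l2 f'" "supp (- N) g'" "l2 g'"
    using x unfolding e HH_carrier[OF N] by blast+
  thus ?thesis unfolding e dirac_J_simp HH_carrier[OF N] l2_jc
    using supp_jc[of N f] supp_jc[of "N + 1" g] supp_jc'[of N g'] supp_jc'[of "N + 1" f'] by blast
qed

lemma antiunitary_dirac_J:
  assumes N: "2 * N \<in> \<int>"
  shows "antiunitary (HH N) dirac_J"
  unfolding antiunitary_def
proof (intro conjI ballI allI)
  show "bij_betw dirac_J (carrier (HH N)) (carrier (HH N))"
    by (rule bij_betw_byWitness[where f'=dirac_J]) (use dirac_J_carrier[OF N] in \<open>auto simp: dirac_J_dirac_J\<close>)
  fix x y assume x: "x \<in> carrier (HH N)" and y: "y \<in> carrier (HH N)"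
  obtain f g f' g' where ex: "x = ((f, g), (f', g'))" by (metis prod.collapse)
  obtain h k h' k' where ey: "y = ((h, k), (h', k'))" by (metis prod.collapse)
  show "dirac_J (x \<oplus>\<^bsub>HH N\<^esub> y) = dirac_J x \<oplus>\<^bsub>HH N\<^esub> dirac_J y"
    unfolding ex ey HH_simps dirac_J_simp jc_vadd ..
  show "ip (HH N) (dirac_J x) (dirac_J y) = ip (HH N) y x"
    unfolding ex ey dirac_J_simp HH_ip[OF dirac_J_carrier[OF N x, unfolded ex dirac_J_simp]] HH_ip[OF y[unfolded ey]] ip2_jc
    by (simp add: ac_simps)
next
  fix a x assume x: "x \<in> carrier (HH N)"
  obtain f g f' g' where ex: "x = ((f, g), (f', g'))" by (metis prod.collapse)
  show "dirac_J (a \<odot>\<^bsub>HH N\<^esub> x) = cnj a \<odot>\<^bsub>HH N\<^esub> dirac_J x"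
    unfolding ex HH_simps dirac_J_simp jc_smul ..
qed

text \<open>The two roots trade places. This is what makes -N-1 the partner of \<open>N\<close> and
  lets \<open>dirac_J\<close> commute with the Dirac operator.\<close>

lemma cf_reflect: "cf (- N - 1) = cf N"
  by (simp add: cf_def fun_eq_iff algebra_simps)

lemma DD_iff:
  assumes N: "2 * N \<in> \<int>"
  shows "(((f, g), (f', g')), ((u, v), (u', v'))) \<in> DD N \<longleftrightarrow> ((f, g), (f', g')) \<in> carrier (HH N) \<and>
    (u = mulc (cf N) g \<and> v = mulc (cf N) f \<and> l2 u \<and> l2 v) \<and>
    (u' = mulc (cf N) g' \<and> v' = mulc (cf N) f' \<and> l2 u' \<and> l2 v')"
proof -
  have "(((f, g), (f', g')), ((u, v), (u', v'))) \<in> DD N \<longleftrightarrow>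
    ((f, g), (u, v)) \<in> Dclos N \<and> ((f', g'), (u', v')) \<in> Dclos (- N - 1)" by (auto simp: op_sum_def)
  moreover have "((f', g'), (u', v')) \<in> Dclos (- N - 1) \<longleftrightarrow> (f', g') \<in> carrier (hspace1 (- N - 1)) \<and>
    u' = mulc (cf N) g' \<and> v' = mulc (cf N) f' \<and> l2 u' \<and> l2 v'"
    unfolding Dclos_iff[OF Ints_reflect[OF N]] unfolding cf_reflect ..
  ultimately show ?thesis unfolding Dclos_iff[OF N] hsum_simps mem_Times_iff fst_conv snd_conv by blast
qed

lemma dirac_J_DD:
  assumes N: "2 * N \<in> \<int>"
  shows "map_prod dirac_J dirac_J ` DD N = DD N"
proof -
  have s: "(dirac_J x, dirac_J y) \<in> DD N" if xy: "(x, y) \<in> DD N" for x y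
  proof -
    obtain f g f' g' where ex: "x = ((f, g), (f', g'))" by (metis prod.collapse)
    obtain u v u' v' where ey: "y = ((u, v), (u', v'))" by (metis prod.collapse)
    have *: "((f, g), (f', g')) \<in> carrier (HH N)" "u = mulc (cf N) g" "v = mulc (cf N) f" "l2 u" "l2 v"
      "u' = mulc (cf N) g'" "v' = mulc (cf N) f'" "l2 u'" "l2 v'"
      using xy unfolding ex ey DD_iff[OF N] by blast+
    show ?thesis unfolding ex ey dirac_J_simp DD_iff[OF N] l2_jc supp_mulc_jc
      using * dirac_J_carrier[OF N *(1), unfolded dirac_J_simp] by blast
  qed
  have "p \<in> map_prod dirac_J dirac_J ` DD N" if "p \<in> DD N" for p
  proof -
    obtain x y where p: "p = (x, y)" by (cases p)
    show ?thesis unfolding p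
      by (rule image_eqI[of _ _ "(dirac_J x, dirac_J y)"]) (use s \<open>p \<in> DD N\<close> in \<open>simp_all add: p dirac_J_dirac_J\<close>)
  qed
  thus ?thesis using s by auto
qed

lemma DD_carriers: "2 * N \<in> \<int> \<Longrightarrow> Dclos N \<subseteq> carrier (hspace1 N) \<times> carrier (hspace1 N)"
  "2 * N \<in> \<int> \<Longrightarrow> Dclos (- N - 1) \<subseteq> carrier (hspace1 (- N - 1)) \<times> carrier (hspace1 (- N - 1))"
  by (rule Dclos_carrier Dclos_carrier[OF Ints_reflect], assumption)+

lemma RR_coset:
  assumes N: "2 * N \<in> \<int>" and x: "((f, g), (f', g')) \<in> carrier (HH N)"
  shows "RR N (coset q x) ((f, g), (f', g')) =
    ((free_rep q N x f, free_rep q (N + 1) x g), (free_rep q (- N - 1) x f', free_rep q (- N - 1 + 1) x g'))"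
proof -
  have "(f, g) \<in> carrier (hspace1 N)" "(f', g') \<in> carrier (hspace1 (- N - 1))" using x by (simp_all add: hsum_simps)
  thus ?thesis unfolding rep_sum_def map_prod_simp
    using podles_rep1_coset[OF N] podles_rep1_coset[OF Ints_reflect[OF N]] by simp
qed

text \<open>\<open>dirac_J\<close> is its own inverse, and its two exchanges of components undo each
  other; so the conjugated operator acts on each component by the right action of that
  component.\<close>

lemma conj_RR:
  assumes N: "2 * N \<in> \<int>" and x: "((f, g), (f', g')) \<in> carrier (HH N)"
  shows "conj_by (HH N) dirac_J (RR N (coset q x)) ((f, g), (f', g')) =
    ((rop N x f, rop (N + 1) x g), (rop (- N - 1) x f', rop (- N - 1 + 1) x g'))"
proof -
  have inj: "inj_on dirac_J (carrier (HH N))" by (rule inj_on_inverseI[of _ dirac_J]) (rule dirac_J_dirac_J)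
  have "inv_into (carrier (HH N)) dirac_J ((f, g), (f', g')) = inv_into (carrier (HH N)) dirac_J (dirac_J (dirac_J ((f, g), (f', g'))))"
    by (simp only: dirac_J_dirac_J)
  also have "\<dots> = dirac_J ((f, g), (f', g'))" by (rule inv_into_f_f[OF inj dirac_J_carrier[OF N x]])
  finally have i: "inv_into (carrier (HH N)) dirac_J ((f, g), (f', g')) = ((jc g', jc f'), (jc g, jc f))"
    unfolding dirac_J_simp .
  show ?thesis
    unfolding conj_by_def o_apply i RR_coset[OF N dirac_J_carrier[OF N x, unfolded dirac_J_simp]] dirac_J_simp rop_def reflect_simps ..
qed

lemma rop_carrier:
  assumes "2 * N \<in> \<int>" "supp N f"
  shows "supp N (rop N x f)" "l2 f \<Longrightarrow> l2 (rop N x f)"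
proof -
  have n: "2 * (- N) \<in> \<int>" using assms(1) by simp
  note b = bopD[OF bop_free_rep[OF n, of x] supp_jc[OF assms(2)]]
  show "supp N (rop N x f)" unfolding rop_def by (rule supp_jc'[OF b(1)])
  show "l2 f \<Longrightarrow> l2 (rop N x f)" unfolding rop_def l2_jc by (rule b(5)) simp
qed

text \<open>A single bounded operator \<open>K\<close> works for all \<open>y\<close>. Its entries
  are the commutators from \<open>dcomm\<close>, and they intertwine the right actions by
  \<open>inter_rop\<close>.\<close>

lemma HH_commutator:
  assumes N: "2 * N \<in> \<int>"
  shows "\<exists>K. is_commutator (HH N) (DD N) (RR N (coset q x)) K \<and>
     (\<forall>p\<in>carrier (HH N). \<forall>y. conj_by (HH N) dirac_J (RR N (coset q y)) (K p) = K (conj_by (HH N) dirac_J (RR N (coset q y)) p))"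
proof -
  note M = Ints_reflect[OF N]
  obtain Kr Kl where K: "dcomm (cf N) N (N + 1) x Kr" "dcomm (cf N) (N + 1) N x Kl"
    using dcomm_raise[OF N] dcomm_lower[OF N] by blast
  obtain Kr' Kl' where K': "dcomm (cf (- N - 1)) (- N - 1) (- N - 1 + 1) x Kr'" "dcomm (cf (- N - 1)) (- N - 1 + 1) (- N - 1) x Kl'"
    using dcomm_raise[OF M] dcomm_lower[OF M] by blast
  define P where "P = map_prod (\<lambda>(f, g). (Kl g, Kr f)) (\<lambda>(f, g). (Kl' g, Kr' f))"
  have bo: "bounded_op (hspace1 N) (podles_rep1 q N (coset q x))" "bounded_op (hspace1 (- N - 1)) (podles_rep1 q (- N - 1) (coset q x))"
    using star_rep_hspace1[OF N] star_rep_hspace1[OF M] unfolding star_rep_def by (auto simp: podles_simps)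
  have c: "is_commutator (HH N) (DD N) (RR N (coset q x)) P"
    unfolding P_def rep_sum_def
    by (rule two_hilbert_spaces.is_commutator_sum[OF HH_spaces is_commutator_dirac[OF N K] DD_carriers(1)[OF N] bo(1)
          is_commutator_dirac[OF M K'] DD_carriers(2)[OF N] bo(2)]) simp_all
  have Pc: "P p \<in> carrier (HH N)" if "p \<in> carrier (HH N)" for p
    using c that unfolding is_commutator_def bounded_op_def by blast
  have "conj_by (HH N) dirac_J (RR N (coset q y)) (P p) = P (conj_by (HH N) dirac_J (RR N (coset q y)) p)"
    if p: "p \<in> carrier (HH N)" for p y
  proof -
    obtain f g f' g' where e: "p = ((f, g), (f', g'))" by (metis prod.collapse)
    have s: "supp N f" "supp (N + 1) g" "supp (- N - 1) f'" "supp (- N - 1 + 1) g'"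
      using p unfolding e HH_carrier[OF N] reflect_simps by blast+
    have P: "P ((f, g), (f', g')) = ((Kl g, Kr f), (Kl' g', Kr' f'))" for f g f' g' by (simp add: P_def)
    have b: "bop N (N + 1) Kr" "intertwines N (N + 1) Kr" "bop (N + 1) N Kl" "intertwines (N + 1) N Kl"
      "bop (- N - 1) (- N - 1 + 1) Kr'" "intertwines (- N - 1) (- N - 1 + 1) Kr'"
      "bop (- N - 1 + 1) (- N - 1) Kl'" "intertwines (- N - 1 + 1) (- N - 1) Kl'"
      using K K' unfolding dcomm_def by blast+
    show ?thesis
      unfolding e P conj_RR[OF N Pc[OF p, unfolded e P]] conj_RR[OF N p[unfolded e]]
        inter_rop[OF N b(1,2) s(1)] inter_rop[OF half_Ints(3)[OF N] b(3,4) s(2)]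
        inter_rop[OF M b(5,6) s(3)] inter_rop[OF half_Ints(3)[OF M] b(7,8) s(4)] ..
  qed
  thus ?thesis using c by blast
qed

text \<open>The left action itself intertwines the right one, by \<open>inter_free_rep\<close> and
  \<open>inter_rop\<close> in each component.\<close>

lemma conj_RR_commute:
  assumes N: "2 * N \<in> \<int>" and p: "p \<in> carrier (HH N)"
  shows "conj_by (HH N) dirac_J (RR N (coset q x)) (RR N (coset q y) p) = RR N (coset q y) (conj_by (HH N) dirac_J (RR N (coset q x)) p)"
proof -
  note M = Ints_reflect[OF N] and N1 = half_Ints(3)[OF N] and M1 = half_Ints(3)[OF Ints_reflect[OF N]]
  obtain f g f' g' where e: "p = ((f, g), (f', g'))" by (metis prod.collapse)
  have s: "supp N f" "supp (N + 1) g" "supp (- N - 1) f'" "supp (- N - 1 + 1) g'" "l2 f" "l2 g" "l2 f'" "l2 g'"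
    using p unfolding e HH_carrier[OF N] reflect_simps by blast+
  have c1: "((free_rep q N y f, free_rep q (N + 1) y g), (free_rep q (- N - 1) y f', free_rep q (- N - 1 + 1) y g')) \<in> carrier (HH N)"
    unfolding HH_carrier[OF N]
    using bopD(1,5)[OF bop_free_rep[OF N, of y] s(1)] bopD(1,5)[OF bop_free_rep[OF N1, of y] s(2)]
      bopD(1,5)[OF bop_free_rep[OF M, of y] s(3)] bopD(1,5)[OF bop_free_rep[OF M1, of y] s(4)] s
    unfolding reflect_simps by blast
  have c2: "((rop N x f, rop (N + 1) x g), (rop (- N - 1) x f', rop (- N - 1 + 1) x g')) \<in> carrier (HH N)"
    unfolding HH_carrier[OF N]
    using rop_carrier[OF N s(1), of x] rop_carrier[OF N1 s(2), of x] rop_carrier[OF M s(3), of x] rop_carrier[OF M1 s(4), of x] s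
    unfolding reflect_simps by blast
  show ?thesis
    unfolding e RR_coset[OF N p[unfolded e]] conj_RR[OF N c1] conj_RR[OF N p[unfolded e]] RR_coset[OF N c2]
      inter_rop[OF N bop_free_rep[OF N] inter_free_rep[OF N] s(1)] inter_rop[OF N1 bop_free_rep[OF N1] inter_free_rep[OF N1] s(2)]
      inter_rop[OF M bop_free_rep[OF M] inter_free_rep[OF M] s(3)] inter_rop[OF M1 bop_free_rep[OF M1] inter_free_rep[OF M1] s(4)] ..
qed

lemma even_spectral_triple_HH:
  assumes N: "2 * N \<in> \<int>"
  shows "even_spectral_triple (podles q) (HH N) (RR N) (DD N) (map_prod grading1 grading1)"
proof -
  note M = Ints_reflect[OF N]
  have E: "even_spectral_triple (podles q) (hspace1 N) (podles_rep1 q N) (Dclos N) grading1"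
    "even_spectral_triple (podles q) (hspace1 (- N - 1)) (podles_rep1 q (- N - 1)) (Dclos (- N - 1)) grading1"
    by (rule even_spectral_triple_dirac[OF N] even_spectral_triple_dirac[OF M])+
  note E' = E[unfolded even_spectral_triple_def spectral_triple_def]
  interpret two_hilbert_spaces "hspace1 N" "hspace1 (- N - 1)" by (rule HH_spaces)
  have b: "bounded_op (hspace1 N) grading1" "bounded_op (hspace1 (- N - 1)) grading1" using E' by blast+
  \<comment> \<open>Both resolvents are taken at the same point, as
    \<open>compact_resolvent_at_sum\<close> requires.\<close>
  have co: "compact_resolvent_at (hspace1 L) (Dclos L) \<i>" if "2 * L \<in> \<int>" for L
    unfolding hspace1_eq by (rule offdiagonal.compact_resolvent_at_Dmax[OF offdiagonal_dirac[OF that]])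
  show ?thesis
    unfolding even_spectral_triple_def spectral_triple_def
  proof (intro conjI ballI)
    show "star_algebra (podles q)" using E' by blast
    show "hilbert_space (HH N)" by (rule hilbert_space_sum)
    show "star_rep (podles q) (HH N) (RR N)" by (rule star_rep_sum[OF star_rep_hspace1[OF N] star_rep_hspace1[OF M]])
    show "self_adjoint (HH N) (DD N)" using E' by (intro self_adjoint_sum) blast+
    show "compact_resolvent (HH N) (DD N)"
      by (rule compact_resolventI[OF compact_resolvent_at_sum[OF co[OF N] DD_carriers(1)[OF N] co[OF M] DD_carriers(2)[OF N]]])
    show "bounded_op (HH N) (map_prod grading1 grading1)" by (rule bounded_op_sum[OF b])
    show "anticommutes (HH N) (DD N) (map_prod grading1 grading1)"
      by (rule anticommutes_sum[OF _ DD_carriers(1)[OF N] b(1) _ DD_carriers(2)[OF N] b(2)]) (use E' in blast)+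
    show "bounded_commutator (HH N) (DD N) (RR N a)" if a: "a \<in> carrier (podles q)" for a
    proof -
      obtain x where x: "a = coset q x" using a by (auto simp: podles_simps)
      obtain K where K: "is_commutator (HH N) (DD N) (RR N (coset q x)) K" using HH_commutator[OF N] by blast
      have "Domain (DD N) \<subseteq> carrier (HH N)"
        using DD_carriers[OF N] by (force simp: op_sum_def hsum_simps)
      thus ?thesis unfolding x by (rule bounded_commutatorI[OF K])
    qed
  next
    fix x assume x: "x \<in> carrier (HH N)"
    show "map_prod grading1 grading1 (map_prod grading1 grading1 x) = x"
      by (cases x) (auto simp: grading1_def)
    obtain y z where e: "x = (y, z)" by (cases x)
    have yz: "y \<in> carrier (hspace1 N)" "z \<in> carrier (hspace1 (- N - 1))" using x by (simp_all add: e hsum_simps)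
    { fix x' assume x': "x' \<in> carrier (HH N)"
      obtain y' z' where e': "x' = (y', z')" by (cases x')
      have yz': "y' \<in> carrier (hspace1 N)" "z' \<in> carrier (hspace1 (- N - 1))" using x' by (simp_all add: e' hsum_simps)
      have "ip (hspace1 N) (grading1 y) y' = ip (hspace1 N) y (grading1 y')"
        "ip (hspace1 (- N - 1)) (grading1 z) z' = ip (hspace1 (- N - 1)) z (grading1 z')"
        using E' yz yz' by blast+
      thus "ip (HH N) (map_prod grading1 grading1 x) x' = ip (HH N) x (map_prod grading1 grading1 x')"
        unfolding e e' map_prod_simp hsum_simps by simp }
    { fix a assume a: "a \<in> carrier (podles q)"
      have "grading1 (podles_rep1 q N a y) = podles_rep1 q N a (grading1 y)"
        "grading1 (podles_rep1 q (- N - 1) a z) = podles_rep1 q (- N - 1) a (grading1 z)" using E' yz a by blast+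
      thus "map_prod grading1 grading1 (RR N a x) = RR N a (map_prod grading1 grading1 x)"
        unfolding e rep_sum_def map_prod_simp by simp }
  qed
qed

lemma satisfies_order_one_dirac:
  assumes N: "2 * N \<in> \<int>"
  shows "satisfies_order_one (podles q) (hspace1 N) (podles_rep1 q N) (Dclos N) grading1"
proof -
  have J1: "\<exists>\<epsilon>\<in>{1, -1}. \<forall>x\<in>carrier (HH N). dirac_J (dirac_J x) = \<epsilon> \<odot>\<^bsub>HH N\<^esub> x"
  proof (rule bexI[of _ 1], rule ballI)
    fix x :: "(vec \<times> vec) \<times> (vec \<times> vec)"
    obtain f g f' g' where e: "x = ((f, g), (f', g'))" by (metis prod.collapse)
    show "dirac_J (dirac_J x) = 1 \<odot>\<^bsub>HH N\<^esub> x" unfolding dirac_J_dirac_J e HH_simps by (simp add: smul_def)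
  qed simp
  have J2: "\<exists>\<epsilon>\<in>{1, -1}. \<forall>x\<in>carrier (HH N). dirac_J (map_prod grading1 grading1 x) = \<epsilon> \<odot>\<^bsub>HH N\<^esub> map_prod grading1 grading1 (dirac_J x)"
  proof (rule bexI[of _ "-1"], rule ballI)
    fix x :: "(vec \<times> vec) \<times> (vec \<times> vec)"
    obtain f g f' g' where e: "x = ((f, g), (f', g'))" by (metis prod.collapse)
    show "dirac_J (map_prod grading1 grading1 x) = (-1) \<odot>\<^bsub>HH N\<^esub> map_prod grading1 grading1 (dirac_J x)"
      unfolding e map_prod_simp grading1_pair dirac_J_simp HH_simps jc_smul smul_smul by (simp add: smul_def)
  qed simp
  have cm: "\<forall>a\<in>carrier (podles q). \<forall>b\<in>carrier (podles q). \<forall>x\<in>carrier (HH N).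
        conj_by (HH N) dirac_J (RR N a) (RR N b x) = RR N b (conj_by (HH N) dirac_J (RR N a) x)"
    unfolding podles_simps(1) by (intro ballI, elim imageE) (simp only: conj_RR_commute[OF N])
  have o1: "order_one_real (podles q) (HH N) (RR N) (DD N) dirac_J"
    unfolding order_one_real_def
  proof (intro ballI)
    fix a b assume "a \<in> carrier (podles q)" "b \<in> carrier (podles q)"
    then obtain x y where xy: "a = coset q x" "b = coset q y" by (auto simp: podles_simps)
    show "\<exists>K. is_commutator (HH N) (DD N) (RR N b) K \<and>
        (\<forall>x\<in>carrier (HH N). conj_by (HH N) dirac_J (RR N a) (K x) = K (conj_by (HH N) dirac_J (RR N a) x))"
      using HH_commutator[OF N, of y] unfolding xy by blast
  qed
  have "even_real_spectral_triple (podles q) (HH N) (RR N) (DD N) (map_prod grading1 grading1) dirac_J"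
    unfolding even_real_spectral_triple_def
    by (intro conjI even_spectral_triple_HH[OF N] antiunitary_dirac_J[OF N] J1 J2 cm dirac_J_DD[OF N])
  thus ?thesis unfolding satisfies_order_one_def
    using o1 even_spectral_triple_dirac[OF N] even_spectral_triple_dirac[OF Ints_reflect[OF N]] by blast
qed

end

theorem proposition2p4:
  fixes q N :: real
  assumes "0 < q" and "q < 1" and "2 * N \<in> \<int>"
  shows "densely_defined (hspace1 N) (dirac q N) \<and>
    anticommutes (hspace1 N) (dirac q N) grading1 \<and>
    (\<forall>a\<in>carrier (podles q).
       bounded_commutator (hspace1 N) (dirac q N) (podles_rep1 q N a)) \<and>
    satisfies_order_one (podles q) (hspace1 N) (podles_rep1 q N)
      (op_closure (hspace1 N) (dirac q N)) grading1 \<and>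
    (\<forall>D\<in>{dirac q N, op_closure (hspace1 N) (dirac q N)}.
       eigenvalues (hspace1 N) D =
         {complex_of_real (s * sqrt (qnum q (l - N) * qnum q (l + N + 1))) | s l.
            s \<in> {1, -1} \<and> l \<in> dirac_levels N \<and> 2 * l + 1 \<noteq> 0} \<and>
       (\<forall>l\<in>dirac_levels N. \<forall>s\<in>{1, -1}. \<exists>n. real n = 2 * l + 1 \<and>
          has_dim (hspace1 N)
            (eigenspace (hspace1 N) D
               (complex_of_real (s * sqrt (qnum q (l - N) * qnum q (l + N + 1))))) n))"
proof -
  interpret deformation q using assms(1,2) by (rule deformation.intro)
  note N = assms(3)
  \<comment> \<open>Every eigenvector of the closure is finitely supported, so the spectral
    statements have to be proved for the closure only.\<close>
  have es: "eigenspace (hspace1 N) D = eigenspace (hspace1 N) (Dclos N)"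
    if "D \<in> {dirac q N, op_closure (hspace1 N) (dirac q N)}" for D
  proof -
    have "eigenspace (hspace1 N) (dirac q N) = eigenspace (hspace1 N) (Dclos N)"
      by (rule ext) (simp only: dirac_eq[OF N] hspace1_eq offdiagonal.eigenspace_Dfin[OF offdiagonal_dirac[OF N]])
    thus ?thesis using that op_closure_dirac[OF N] by auto
  qed
  have ev: "eigenvalues (hspace1 N) D = eigenvalues (hspace1 N) (Dclos N)"
    if "D \<in> {dirac q N, op_closure (hspace1 N) (dirac q N)}" for D
    unfolding eigenvalues_def es[OF that] ..
  show ?thesis
  proof (intro conjI ballI)
    show "densely_defined (hspace1 N) (dirac q N)"
      unfolding dirac_eq[OF N] hspace1_eq by (rule offdiagonal.densely_defined_Dfin[OF offdiagonal_dirac[OF N]])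
    show "anticommutes (hspace1 N) (dirac q N) grading1" by (rule anticommutes_grading1[OF N]) simp
    show "bounded_commutator (hspace1 N) (dirac q N) (podles_rep1 q N a)" if "a \<in> carrier (podles q)" for a
      by (rule bounded_commutator_dirac[OF N _ that]) simp
    show "satisfies_order_one (podles q) (hspace1 N) (podles_rep1 q N) (op_closure (hspace1 N) (dirac q N)) grading1"
      unfolding op_closure_dirac[OF N] by (rule satisfies_order_one_dirac[OF N])
  next
    fix D assume D: "D \<in> {dirac q N, op_closure (hspace1 N) (dirac q N)}"
    show "eigenvalues (hspace1 N) D =
         {complex_of_real (s * sqrt (qnum q (l - N) * qnum q (l + N + 1))) | s l.
            s \<in> {1, -1} \<and> l \<in> dirac_levels N \<and> 2 * l + 1 \<noteq> 0}"
      unfolding ev[OF D] by (rule eigenvalues_dirac[OF N])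
    fix l s :: real assume "l \<in> dirac_levels N" "s \<in> {1, -1}"
    thus "\<exists>n. real n = 2 * l + 1 \<and> has_dim (hspace1 N)
            (eigenspace (hspace1 N) D
               (complex_of_real (s * sqrt (qnum q (l - N) * qnum q (l + N + 1))))) n"
      unfolding es[OF D] by (rule multiplicity_dirac[OF N])
  qed
qed

end
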